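(* Let $f\in L^2(\Gamma)$ with $\int_\Gamma f=0$ and let $u\in H^2(\Gamma)$ with $\int_\Gamma u=0$ be the solution of $-\Delta_\Gamma u=f$ on $\Gamma$, i.e. $a(u,v)=l(v)$ for all $v\in H^1(\Gamma)$ with $a(u,v)=(\nabla_\Gamma u,\nabla_\Gamma v)_\Gamma$, $l(v)=(f,v)_\Gamma$. Let $A_h=a_h+\tau s_h$ and $l_h$ be the discrete forms described in the context, and let $u_h\in V_{h,0}$ solve $A_h(u_h,v)=l_h(v)$ for all $v\in V_{h,0}$. Assume: (i) (Poincaré) $h^{-c}\|v\|_{\mathcal T_h}^2\lesssim\|v\|_{A_h}^2$ for all $v\in V_{h,0}$. (ii) (Interpolation) There is an interpolation operator $\pi_h$ assigning to $v\in H^2(\Gamma)$ a function $\pi_hv^e\in V_h$ with $\|v^e-\pi_hv^e\|_{\Gamma_h}+h\|v^e-\pi_hv^e\|_{A_h}\lesssim h^2\|v\|_{2,\Gamma}$. (iii) (Quadrature) For all $v\in V_h$, $|l_h(v)-l(v^l)|\lesssim h\|f\|_\Gamma\|v\|_{A_h}$ and $|a(u,v^l)-a_h(u^e,v)|\lesssim h\|u\|_{2,\Gamma}\|v\|_{A_h}$; and for all $\phi\in H^2(\Gamma)$ with $\phi_h=\pi_h\phi^e$, $|l_h(\phi_h)-l(\phi_h^l)|\lesssim h^2\|f\|_\Gamma\|\phi\|_{2,\Gamma}$ and $|a(u_h^l,\phi_h^l)-a_h(u_h,\phi_h)|\lesssim h^2\|u\|_{2,\Gamma}\|\phi\|_{2,\Gamma}$.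 (iv) (Weak consistency) $\|v^e\|_{s_h}\lesssim h\|v\|_{2,\Gamma}$ for all $v\in H^2(\Gamma)$. Then $$\|u^e-u_h\|_{A_h}\lesssim h\|f\|_\Gamma,\qquad \|u-u_h^l\|_{\Gamma}\lesssim h^2\|f\|_\Gamma .$$
   Context: Manifold: $\Gamma\subset\mathbb R^k$ is a smooth compact connected $d$-dimensional embedded submanifold without boundary, $c=k-d\ge1$. $\rho(x)=\mathrm{dist}(x,\Gamma)$, $U_\delta(\Gamma)=\{\rho<\delta\}$; $\delta_0>0$ is fixed so small that the closest point projection $p:U_{\delta_0}(\Gamma)\to\Gamma$ is well defined and smooth. $P_\Gamma(q)$ is the orthogonal projection onto $T_q\Gamma$; $\nabla_\Gamma u=P_\Gamma\nabla\bar u$ for any extension $\bar u$, $\Delta_\Gamma=\nabla_\Gamma\cdot\nabla_\Gamma$. Extension: $v^e=v\circ p$; $P_\Gamma^e=P_\Gamma\circ p$. $(\cdot,\cdot)_\Gamma$, $\|\cdot\|_\Gamma$: $L^2(\Gamma)$ inner product and norm; $\|\cdot\|_{2,\Gamma}$: $H^2(\Gamma)$ norm; $\|\cdot\|_{\Gamma_h}$: $L^2(\Gamma_h)$ norm. Discrete manifold: for $h\in(0,h_0]$, $\mathcal K_h$ is a conforming mesh without boundary of non-degenerate (not necessarily shape-regular) $d$-simplices, $\Gamma_h=\bigcup_{K\in\mathcal K_h}K$; $P_{\Gamma_h}$ is the piecewise constant orthogonal projection onto the linear space parallel to $K$. Standing assumptions: $\Gamma_h\subset U_{\delta_0}(\Gamma)$,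 $p:\Gamma_h\to\Gamma$ is a bijection, $\|\rho\|_{L^\infty(\Gamma_h)}\lesssim h^2$, $\|P_\Gamma^e-P_{\Gamma_h}\|_{L^\infty(\Gamma_h)}\lesssim h$. Lift: $w^l(p(x))=w(x)$ for $x\in\Gamma_h$. Background mesh: $\widetilde{\mathcal T}_h$ is a quasi-uniform mesh (mesh parameter $h$) of shape-regular closed $k$-simplices covering a bounded open set containing $U_{\delta_0}(\Gamma)$; active mesh $\mathcal T_h=\{T\in\widetilde{\mathcal T}_h:T\cap\Gamma_h\neq\emptyset\}$, $N_h=\bigcup_{T\in\mathcal T_h}T$, $\|\cdot\|_{\mathcal T_h}=\|\cdot\|_{L^2(N_h)}$. $V_h$: continuous functions on $N_h$, affine on each $T\in\mathcal T_h$. $V_{h,0}=\{v\in V_h:\int_{\Gamma_h}v=0\}$. Discrete forms: $a_h,s_h$ are symmetric positive semidefinite bilinear forms, defined on $V_h$ and on the extensions $v^e$ (and their sums), $l_h$ is a linear form on $V_h$, $\tau>0$ is a fixed parameter, $A_h=a_h+\tau s_h$, and $A_h(1,\cdot)=0$. $\|w\|_{s_h}^2=s_h(w,w)$, $\|w\|_{a_h}^2=a_h(w,w)$, $\|w\|_{A_h}^2=A_h(w,w)$, $\|v\|_a^2=a(v,v)$. It is assumed that $\|v\|_a\lesssim\|v^e\|_{A_h}$ for $v\in H^1(\Gamma)+V_h^l$ and $\|w^l\|_a\lesssim\|w\|_{A_h}$ for $w\in H^1(\Gamma)^e+V_h$, where $H^1(\Gamma)^e$ and $V_h^l$ are the spaces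 of extended, respectively lifted, functions. $a\lesssim b$ means $a\le Cb$ with $C>0$ independent of $h\in(0,h_0]$, $h_0$ sufficiently small, of the functions involved, and of the position of $\Gamma_h$ in the mesh. *)

theory Defs
  imports "HOL-Analysis.Analysis"
begin

section \<open>Smooth maps and surface measure\<close>

text \<open>Meant for open \<open>S\<close> only.\<close>

primrec C_k_on :: "nat \<Rightarrow> 'a::euclidean_space set \<Rightarrow> ('a \<Rightarrow> 'b::real_normed_vector) \<Rightarrow> bool" where
  "C_k_on 0 S f \<longleftrightarrow> continuous_on S f"
| "C_k_on (Suc n) S f \<longleftrightarrow>
     (\<forall>x\<in>S. f differentiable (at x)) \<and>
     (\<forall>b\<in>Basis. C_k_on n S (\<lambda>x. frechet_derivative f (at x) b))"

definition smooth_on :: "'a::euclidean_space set \<Rightarrow> ('a \<Rightarrow> 'b::real_normed_vector) \<Rightarrow> bool" where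
  "smooth_on S f \<longleftrightarrow> (\<forall>n. C_k_on n S f)"

definition injective_immersion :: "(real^'d) set \<Rightarrow> (real^'d \<Rightarrow> real^'k) \<Rightarrow> bool" where
  "injective_immersion V \<phi> \<longleftrightarrow>
     open V \<and> smooth_on V \<phi> \<and> inj_on \<phi> V \<and> (\<forall>y\<in>V. inj (frechet_derivative \<phi> (at y)))"

definition area_density :: "(real^'d \<Rightarrow> real^'k) \<Rightarrow> real^'d \<Rightarrow> real" where
  "area_density \<phi> y =
     (let J = matrix (frechet_derivative \<phi> (at y)) in sqrt (det (transpose J ** J)))"

text \<open>
  \<open>\<sigma>\<close> is a \<open>d\<close>-dimensional area measure on the Borel sets of the ambient space: it satisfies the
  area formula for all smooth injective immersions of open subsets of \<open>\<real>\<^sup>d\<close>. The \<open>d\<close>-dimensional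
  Hausdorff measure (normalised to agree with Lebesgue measure on \<open>\<real>\<^sup>d\<close>) has this property,
  and the property determines \<open>\<sigma>\<close> on every subset covered by countably many images of such maps,
  in particular on \<open>d\<close>-dimensional submanifolds (where it is the Riemannian measure) and on
  finite unions of \<open>d\<close>-simplices. The type argument only carries the dimension.
\<close>

definition area_measure :: "'d::finite itself \<Rightarrow> (real^'k) measure \<Rightarrow> bool" where
  "area_measure _ \<sigma> \<longleftrightarrow>
     sets \<sigma> = sets borel \<and>
     (\<forall>V (\<phi> :: real^'d \<Rightarrow> real^'k) B.
        injective_immersion V \<phi> \<and> B \<in> sets borel \<and> B \<subseteq> V \<longrightarrow>
        emeasure \<sigma> (\<phi> ` B) = (\<integral>\<^sup>+y\<in>B. ennreal (area_density \<phi> y) \<partial>lborel))"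

section \<open>Embedded submanifolds\<close>

text \<open>Embedded submanifold without boundary, given by local parametrisations that are
  homeomorphisms onto relatively open subsets.\<close>

definition embedded_submanifold :: "'d::finite itself \<Rightarrow> (real^'k) set \<Rightarrow> bool" where
  "embedded_submanifold _ \<Gamma> \<longleftrightarrow>
     (\<forall>x\<in>\<Gamma>. \<exists>V (\<phi> :: real^'d \<Rightarrow> real^'k) \<psi>.
        injective_immersion V \<phi> \<and> x \<in> \<phi> ` V \<and>
        openin (top_of_set \<Gamma>) (\<phi> ` V) \<and> homeomorphism V (\<phi> ` V) \<phi> \<psi>)"

definition tangent_space :: "(real^'k) set \<Rightarrow> real^'k \<Rightarrow> (real^'k) set" where
  "tangent_space \<Gamma> q =
     {w. \<exists>\<gamma>. (\<forall>t::real. \<gamma> t \<in> \<Gamma>) \<and> \<gamma> 0 = q \<and> (\<gamma> has_vector_derivative w) (at 0)}"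

definition orth_proj :: "(real^'k) set \<Rightarrow> real^'k \<Rightarrow> real^'k" where
  "orth_proj S x = (THE y. y \<in> S \<and> (\<forall>z\<in>S. orthogonal (x - y) z))"

abbreviation tangent_proj :: "(real^'k) set \<Rightarrow> real^'k \<Rightarrow> real^'k \<Rightarrow> real^'k" where
  "tangent_proj \<Gamma> q \<equiv> orth_proj (tangent_space \<Gamma> q)"

definition tubular :: "(real^'k) set \<Rightarrow> real \<Rightarrow> (real^'k) set" where
  "tubular \<Gamma> \<delta> = {x. infdist x \<Gamma> < \<delta>}"

definition smooth_closest_point :: "(real^'k) set \<Rightarrow> real \<Rightarrow> bool" where
  "smooth_closest_point \<Gamma> \<delta> \<longleftrightarrow>
     (\<forall>x\<in>tubular \<Gamma> \<delta>. \<exists>!q. q \<in> \<Gamma> \<and> dist x q = infdist x \<Gamma>) \<and>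
     smooth_on (tubular \<Gamma> \<delta>) (closest_point \<Gamma>)"

definition extension :: "(real^'k) set \<Rightarrow> (real^'k \<Rightarrow> real) \<Rightarrow> real^'k \<Rightarrow> real" where
  "extension \<Gamma> v = v \<circ> closest_point \<Gamma>"

definition lift :: "(real^'k) set \<Rightarrow> (real^'k) set \<Rightarrow> (real^'k \<Rightarrow> real) \<Rightarrow> real^'k \<Rightarrow> real" where
  "lift \<Gamma> \<Gamma>\<^sub>h w = w \<circ> inv_into \<Gamma>\<^sub>h (closest_point \<Gamma>)"

section \<open>Sobolev spaces on \<open>\<Gamma>\<close>\<close>

text \<open>Functions on \<open>\<Gamma>\<close> are represented by functions on the ambient space whose values
  off \<open>\<Gamma>\<close> are irrelevant; equivalence classes are represented by their members.\<close>

definition L2_fun :: "'a measure \<Rightarrow> ('a \<Rightarrow> 'b::euclidean_space) \<Rightarrow> bool" where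
  "L2_fun M f \<longleftrightarrow> f \<in> borel_measurable M \<and> integrable M (\<lambda>x. (norm (f x))\<^sup>2)"

definition L2_norm :: "'a measure \<Rightarrow> ('a \<Rightarrow> 'b::euclidean_space) \<Rightarrow> real" where
  "L2_norm M f = sqrt (\<integral>x. (norm (f x))\<^sup>2 \<partial>M)"

definition smooth_tangent_field :: "(real^'k) set \<Rightarrow> (real^'k \<Rightarrow> real^'k) \<Rightarrow> bool" where
  "smooth_tangent_field \<Gamma> X \<longleftrightarrow>
     (\<exists>U. open U \<and> \<Gamma> \<subseteq> U \<and> smooth_on U X) \<and> (\<forall>q\<in>\<Gamma>. X q \<in> tangent_space \<Gamma> q)"

text \<open>\<open>div\<^sub>\<Gamma> X = tr (DX P\<^sub>\<Gamma>)\<close>, which is \<open>\<nabla>\<^sub>\<Gamma> \<cdot> X\<close> for \<open>\<nabla>\<^sub>\<Gamma> = P\<^sub>\<Gamma> \<nabla>\<close> acting componentwise.\<close>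

definition surface_div :: "(real^'k) set \<Rightarrow> (real^'k \<Rightarrow> real^'k) \<Rightarrow> real^'k \<Rightarrow> real" where
  "surface_div \<Gamma> X q = trace (matrix (frechet_derivative X (at q) \<circ> tangent_proj \<Gamma> q))"

text \<open>\<open>g\<close> is the weak tangential gradient of \<open>v\<close>; the divergence theorem for tangent fields on a
  closed manifold has no curvature term.\<close>

definition weak_surface_grad ::
  "(real^'k) measure \<Rightarrow> (real^'k) set \<Rightarrow> (real^'k \<Rightarrow> real) \<Rightarrow> (real^'k \<Rightarrow> real^'k) \<Rightarrow> bool" where
  "weak_surface_grad \<sigma> \<Gamma> v g \<longleftrightarrow>
     L2_fun (restrict_space \<sigma> \<Gamma>) g \<and>
     (AE q in restrict_space \<sigma> \<Gamma>. g q \<in> tangent_space \<Gamma> q) \<and>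
     (\<forall>X. smooth_tangent_field \<Gamma> X \<longrightarrow>
        (\<integral>q. g q \<bullet> X q \<partial>restrict_space \<sigma> \<Gamma>) =
        - (\<integral>q. v q * surface_div \<Gamma> X q \<partial>restrict_space \<sigma> \<Gamma>))"

definition surface_grad ::
  "(real^'k) measure \<Rightarrow> (real^'k) set \<Rightarrow> (real^'k \<Rightarrow> real) \<Rightarrow> real^'k \<Rightarrow> real^'k" where
  "surface_grad \<sigma> \<Gamma> v = (SOME g. weak_surface_grad \<sigma> \<Gamma> v g)"

definition H1 :: "(real^'k) measure \<Rightarrow> (real^'k) set \<Rightarrow> (real^'k \<Rightarrow> real) set" where
  "H1 \<sigma> \<Gamma> = {v. L2_fun (restrict_space \<sigma> \<Gamma>) v \<and> (\<exists>g. weak_surface_grad \<sigma> \<Gamma> v g)}"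

definition H2 :: "(real^'k) measure \<Rightarrow> (real^'k) set \<Rightarrow> (real^'k \<Rightarrow> real) set" where
  "H2 \<sigma> \<Gamma> = {v \<in> H1 \<sigma> \<Gamma>. \<forall>i. (\<lambda>q. surface_grad \<sigma> \<Gamma> v q $ i) \<in> H1 \<sigma> \<Gamma>}"

definition H2_norm :: "(real^'k) measure \<Rightarrow> (real^'k) set \<Rightarrow> (real^'k \<Rightarrow> real) \<Rightarrow> real" where
  "H2_norm \<sigma> \<Gamma> v =
     sqrt ((L2_norm (restrict_space \<sigma> \<Gamma>) v)\<^sup>2 +
           (L2_norm (restrict_space \<sigma> \<Gamma>) (surface_grad \<sigma> \<Gamma> v))\<^sup>2 +
           (\<Sum>i\<in>UNIV. (L2_norm (restrict_space \<sigma> \<Gamma>)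
              (surface_grad \<sigma> \<Gamma> (\<lambda>q. surface_grad \<sigma> \<Gamma> v q $ i)))\<^sup>2))"

definition dirichlet_form ::
  "(real^'k) measure \<Rightarrow> (real^'k) set \<Rightarrow> (real^'k \<Rightarrow> real) \<Rightarrow> (real^'k \<Rightarrow> real) \<Rightarrow> real" where
  "dirichlet_form \<sigma> \<Gamma> u v =
     (\<integral>q. surface_grad \<sigma> \<Gamma> u q \<bullet> surface_grad \<sigma> \<Gamma> v q \<partial>restrict_space \<sigma> \<Gamma>)"

text \<open>Weak form of \<open>- \<Delta>\<^sub>\<Gamma> u = f\<close>, normalised by \<open>\<integral>\<^sub>\<Gamma> u = 0\<close>.\<close>

definition poisson_solution ::
  "(real^'k) measure \<Rightarrow> (real^'k) set \<Rightarrow> (real^'k \<Rightarrow> real) \<Rightarrow> (real^'k \<Rightarrow> real) \<Rightarrow> bool" where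
  "poisson_solution \<sigma> \<Gamma> f u \<longleftrightarrow>
     u \<in> H2 \<sigma> \<Gamma> \<and> (\<integral>q. u q \<partial>restrict_space \<sigma> \<Gamma>) = 0 \<and>
     (\<forall>v\<in>H1 \<sigma> \<Gamma>. dirichlet_form \<sigma> \<Gamma> u v = (\<integral>q. f q * v q \<partial>restrict_space \<sigma> \<Gamma>))"

section \<open>Discrete manifold, background mesh and discrete forms\<close>

text \<open>Throughout, one constant \<open>C\<close> serves for all \<open>\<lesssim>\<close> in the hypotheses; each of the bounds below
  is preserved when \<open>C\<close> is enlarged.\<close>

definition parallel_space :: "(real^'k) set \<Rightarrow> (real^'k) set" where
  "parallel_space K = {x - y | x y. x \<in> affine hull K \<and> y \<in> affine hull K}"

text \<open>The \<open>L\<^sup>\<infinity>\<close> bounds are stated pointwise; the functions concerned are continuous on each \<open>K\<close>.\<close>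

definition discrete_manifold ::
  "'d::finite itself \<Rightarrow> (real^'k) set \<Rightarrow> real \<Rightarrow> real \<Rightarrow> real \<Rightarrow> (real^'k) set set \<Rightarrow> bool" where
  "discrete_manifold _ \<Gamma> \<delta> C h \<K> \<longleftrightarrow>
     triangulation \<K> \<and> (\<forall>K\<in>\<K>. int CARD('d) simplex K) \<and>
     (\<forall>K\<in>\<K>. \<forall>F. F facet_of K \<longrightarrow> card {K'\<in>\<K>. F facet_of K'} = 2) \<and>
     \<Union>\<K> \<subseteq> tubular \<Gamma> \<delta> \<and>
     bij_betw (closest_point \<Gamma>) (\<Union>\<K>) \<Gamma> \<and>
     (\<forall>x\<in>\<Union>\<K>. infdist x \<Gamma> \<le> C * h\<^sup>2) \<and>
     (\<forall>K\<in>\<K>. \<forall>x\<in>K.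
        onorm (\<lambda>w. tangent_proj \<Gamma> (closest_point \<Gamma> x) w - orth_proj (parallel_space K) w) \<le> C * h)"

definition background_mesh ::
  "(real^'k) set \<Rightarrow> real \<Rightarrow> real \<Rightarrow> real \<Rightarrow> (real^'k) set set \<Rightarrow> bool" where
  "background_mesh \<Gamma> \<delta> C h \<T> \<longleftrightarrow>
     triangulation \<T> \<and> (\<forall>T\<in>\<T>. int CARD('k) simplex T) \<and>
     (\<exists>\<Omega>. open \<Omega> \<and> bounded \<Omega> \<and> tubular \<Gamma> \<delta> \<subseteq> \<Omega> \<and> \<Omega> \<subseteq> \<Union>\<T>) \<and>
     (\<forall>T\<in>\<T>. diameter T \<le> C * h \<and> h \<le> C * diameter T) \<and>
     (\<forall>T\<in>\<T>. \<exists>z. cball z (diameter T / C) \<subseteq> T)"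

definition active_mesh :: "(real^'k) set set \<Rightarrow> (real^'k) set \<Rightarrow> (real^'k) set set" where
  "active_mesh \<T> \<Gamma>\<^sub>h = {T\<in>\<T>. T \<inter> \<Gamma>\<^sub>h \<noteq> {}}"

text \<open>Values off the union of the mesh are unconstrained.\<close>

definition fe_space :: "(real^'k) set set \<Rightarrow> (real^'k \<Rightarrow> real) set" where
  "fe_space \<T> =
     {v. continuous_on (\<Union>\<T>) v \<and> (\<forall>T\<in>\<T>. \<exists>c b. \<forall>x\<in>T. v x = c \<bullet> x + b)}"

definition fe_space0 ::
  "(real^'k) measure \<Rightarrow> (real^'k) set \<Rightarrow> (real^'k) set set \<Rightarrow> (real^'k \<Rightarrow> real) set" where
  "fe_space0 \<sigma> \<Gamma>\<^sub>h \<T> = {v \<in> fe_space \<T>. (\<integral>x. v x \<partial>restrict_space \<sigma> \<Gamma>\<^sub>h) = 0}"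

definition sum_space ::
  "('a \<Rightarrow> real) set \<Rightarrow> ('a \<Rightarrow> real) set \<Rightarrow> ('a \<Rightarrow> real) set" where
  "sum_space V W = {\<lambda>x. v x + w x | v w. v \<in> V \<and> w \<in> W}"

definition linear_form_on :: "('a \<Rightarrow> real) set \<Rightarrow> (('a \<Rightarrow> real) \<Rightarrow> real) \<Rightarrow> bool" where
  "linear_form_on V l \<longleftrightarrow>
     (\<forall>v\<in>V. \<forall>w\<in>V. \<forall>r s. l (\<lambda>x. r * v x + s * w x) = r * l v + s * l w)"

definition psd_form_on ::
  "('a \<Rightarrow> real) set \<Rightarrow> (('a \<Rightarrow> real) \<Rightarrow> ('a \<Rightarrow> real) \<Rightarrow> real) \<Rightarrow> bool" where
  "psd_form_on V B \<longleftrightarrow>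
     (\<forall>v\<in>V. linear_form_on V (B v)) \<and> (\<forall>v\<in>V. \<forall>w\<in>V. B v w = B w v) \<and> (\<forall>v\<in>V. 0 \<le> B v v)"

definition form_norm :: "(('a \<Rightarrow> real) \<Rightarrow> ('a \<Rightarrow> real) \<Rightarrow> real) \<Rightarrow> ('a \<Rightarrow> real) \<Rightarrow> real" where
  "form_norm B v = sqrt (B v v)"

text \<open>Standing assumptions on the forms: they live on \<open>H\<^sup>1(\<Gamma>)\<^sup>e + V\<^sub>h\<close>, and
  \<open>A\<^sub>h = a\<^sub>h + \<tau> s\<^sub>h\<close> annihilates constants and controls the Dirichlet form.\<close>

definition discrete_forms ::
  "(real^'k) measure \<Rightarrow> (real^'k) set \<Rightarrow> (real^'k) set \<Rightarrow> (real^'k \<Rightarrow> real) set \<Rightarrow> real \<Rightarrow> real \<Rightarrow>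
   ((real^'k \<Rightarrow> real) \<Rightarrow> (real^'k \<Rightarrow> real) \<Rightarrow> real) \<Rightarrow>
   ((real^'k \<Rightarrow> real) \<Rightarrow> (real^'k \<Rightarrow> real) \<Rightarrow> real) \<Rightarrow> bool" where
  "discrete_forms \<sigma> \<Gamma> \<Gamma>\<^sub>h V\<^sub>h C \<tau> a\<^sub>h s\<^sub>h \<longleftrightarrow>
     (let A\<^sub>h = (\<lambda>v w. a\<^sub>h v w + \<tau> * s\<^sub>h v w);
          W = sum_space (extension \<Gamma> ` H1 \<sigma> \<Gamma>) V\<^sub>h
      in psd_form_on W a\<^sub>h \<and> psd_form_on W s\<^sub>h \<and>
         (\<forall>w\<in>W. A\<^sub>h (\<lambda>x. 1) w = 0) \<and>
         (\<forall>v\<in>sum_space (H1 \<sigma> \<Gamma>) (lift \<Gamma> \<Gamma>\<^sub>h ` V\<^sub>h).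
            form_norm (dirichlet_form \<sigma> \<Gamma>) v \<le> C * form_norm A\<^sub>h (extension \<Gamma> v)) \<and>
         (\<forall>w\<in>W. form_norm (dirichlet_form \<sigma> \<Gamma>) (lift \<Gamma> \<Gamma>\<^sub>h w) \<le> C * form_norm A\<^sub>h w))"

end

theory Submission
 imports Defs "HOL-Analysis.Analysis"
begin

text \<open>
  Gaussian averages over \<open>\<Gamma>\<close> with kernels \<open>exp (- \<mu> |x - y|\<^sup>2)\<close>, normalised by their mass, commute with tangential
  derivatives up to operators bounded on \<open>L\<^sup>2\<close>: derivatives of the kernel along the diagonal are dominated by wider
  Gaussians. Hence mollification converges in \<open>H\<^sup>1\<close>, weak gradients are unique, and mollified weak solutions of
  \<open>- \<Delta> u = f\<close> have bounded Laplacians; integration by parts and the commutators of the tangential derivatives turn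
  this into \<open>H\<^sup>2\<close> regularity. Existence follows from the Riesz theorem and a Poincare inequality proved on patches and
  propagated by connectedness. Lifted finite element functions are Lipschitz, so they lie in \<open>H\<^sup>1\<close>, and the areas on
  \<open>\<Gamma>\<^sub>h\<close> and \<open>\<Gamma>\<close> agree up to a factor \<open>1 + O(h\<^sup>2)\<close>. The energy estimate is the Strang lemma. For the \<open>L\<^sup>2\<close>
  estimate the dual problem is solved for the mean free part of \<open>u - u\<^sub>h\<^sup>l\<close>; the mean of \<open>u\<^sub>h\<^sup>l\<close> is \<open>O(h\<^sup>2)\<close> because
  \<open>u\<^sub>h\<close> has mean zero on \<open>\<Gamma>\<^sub>h\<close>. In the formal text \<open>Ga\<close>, \<open>sg\<close>, \<open>ph\<close> stand for \<open>\<Gamma>\<close>, \<open>\<sigma>\<close>, \<open>\<phi>\<close> and so on.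
\<close>

text \<open>Two definitions decide how much must be built. \<open>surface_grad\<close> is an
  arbitrary choice among weak gradients, so even the linearity of \<open>dirichlet_form\<close>
  rests on a.e. uniqueness; and the hypotheses offer neither a dual solution nor a bound of
  \<open>H2_norm\<close> by the data, so elliptic theory on \<Gamma> has to be developed. To avoid
  partitions of unity and Sobolev spaces in charts, smooth functions live on the tube and
  coordinates are replaced by the tangential fields \<open>fr i\<close>, the images of the unit
  vectors under the derivative of p: global, but linearly dependent and not commuting. The measure
  \<sigma> is accessible only through the area formula for injective immersions, so ball volumes,
  the divergence theorem and the comparison with the discrete manifold all become statements on
  Jacobians. The simplices may be arbitrarily thin, so nothing may depend on their shape: each is
  parametrised isometrically, and only the derivative of p on its plane is compared with the
  identity. Since h_0 and C' precede mesh, forms and data, the regularity constant \<open>K\<close>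
  and the area constant \<open>E\<close> are fixed first.\<close>

abbreviation (input) "FD f x \<equiv> frechet_derivative f (at x)"
abbreviation (input) "L2n \<equiv> L2_norm"
abbreviation (input) "adens \<equiv> area_density"
abbreviation (input) "em \<equiv> emeasure"
abbreviation (input) "enr \<equiv> ennreal"
abbreviation (input) "ind \<equiv> indicator"
abbreviation (input) "bmeas \<equiv> borel_measurable"
abbreviation (input) "cont \<equiv> continuous_on"
abbreviation (input) "NN \<equiv> nn_integral"
type_synonym 'k fn = "real^'k \<Rightarrow> real"
lemmas icong = Bochner_Integration.integral_cong[OF refl] and lmon = mult_left_mono and rmon = mult_right_mono and sq2 = power2_eq_square
notation LIMSEQ (infixr "---->" 60) and scaleR (infixr "*." 75) and inner (infix ".*" 70) and abs ("|_|")

section \<open>Calculus of smooth maps\<close>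

abbreviation pd :: "('a::euclidean_space => 'b::real_normed_vector) => 'a => 'a => 'b"
 where "pd f b \<equiv> %x. FD f x b"

lemma pdiff_eqI: "(f has_derivative f') (at x) ==> pd f b x = f' b"
 using frechet_derivative_at by metis

lemma C_k_on_subset: "C_k_on n S f ==> T <= S ==> C_k_on n T f"
 by (induction n arbitrary: f) (auto intro: continuous_on_subset)

lemma C_k_on_cong:
 assumes "open S" "!!x. x:S ==> f x = g x"
 shows "C_k_on n S f \<longleftrightarrow> C_k_on n S g"
 using assms(2)
proof (induction n arbitrary: f g)
 case 0 thus ?case by simp
next
 case (Suc n)
 have der: "(f has_derivative f') (at x) \<longleftrightarrow> (g has_derivative f') (at x)" if "x:S" for x f'
 using has_derivative_transform_within_open[OF _ \<open>open S\<close> that, of f f' UNIV g] has_derivative_transform_within_open[OF _ \<open>open S\<close> that, of g f' UNIV f] Suc.prems by auto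
 have "FD f x = FD g x" if "x:S" for x
 using der[OF that] by (simp add: frechet_derivative_def)
 thus ?case
 using der Suc.IH[of "pd f b" "pd g b" for b] by (auto simp: differentiable_def)
qed

lemma C_k_on_SucI:
 assumes "open S" "!!x. x:S ==> (f has_derivative f' x) (at x)"
 and "!!b. b:Basis ==> C_k_on n S (%x. f' x b)"
 shows "C_k_on (Suc n) S f"
proof -
 have "C_k_on n S (pd f b) \<longleftrightarrow> C_k_on n S (%x. f' x b)" for b
 by (rule C_k_on_cong[OF assms(1)]) (rule pdiff_eqI[OF assms(2)])
 thus ?thesis using assms(2,3) by (auto simp: differentiable_def)
qed

lemma C_k_on_Suc_imp: "C_k_on (Suc n) S f ==> C_k_on n S f"
proof (induction n arbitrary: f)
 case 0 thus ?case
 by (simp add: differentiable_at_withinI differentiable_imp_continuous_on differentiable_on_def)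
next
 case (Suc n) thus ?case by simp
qed

lemma C_k_on_const: "C_k_on n S (%x. c)"
 by (induction n arbitrary: c) auto

lemma C_k_on_bl:
 assumes "bounded_linear f" shows "C_k_on n S f"
proof (cases n)
 case 0 thus ?thesis using assms by (simp add: linear_continuous_on)
next
 case (Suc m)
 have "f differentiable (at x)" for x
 using assms bounded_linear_imp_differentiable by blast
 moreover have "pd f b = (%x. f b)" for b
 by (simp add: frechet_derivative_at[OF bounded_linear_imp_has_derivative[OF assms], symmetric])
 ultimately show ?thesis using Suc by (simp add: C_k_on_const)
qed

lemma C_k_on_has_der:
 "C_k_on (Suc n) S f ==> x:S ==> (f has_derivative FD f x) (at x)"
 by (simp add: frechet_derivative_works[symmetric])

lemma C_k_on_pdiff: "C_k_on (Suc n) S f ==> b:Basis ==> C_k_on n S (pd f b)"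
 by simp

lemma C_k_on_add:
 assumes "open S" "C_k_on n S f" "C_k_on n S g" shows "C_k_on n S (%x. f x+g x)"
 using assms(2,3)
proof (induction n arbitrary: f g)
 case 0 thus ?case by (simp add: continuous_on_add)
next
 case (Suc n)
 show ?case
 by (rule C_k_on_SucI[OF assms(1) has_derivative_add])
 (rule C_k_on_has_der[OF Suc.prems(1)] C_k_on_has_der[OF Suc.prems(2)]
 Suc.IH C_k_on_pdiff[OF Suc.prems(1)] C_k_on_pdiff[OF Suc.prems(2)] | assumption)+
qed

lemma (in bounded_bilinear) C_k_on_prod:
 fixes f :: "'e::euclidean_space => 'a"
 assumes "open S" "C_k_on n S f" "C_k_on n S g" shows "C_k_on n S (%x. prod (f x) (g x))"
 using assms(2,3)
proof (induction n arbitrary: f g)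
 case 0 thus ?case by (simp add: continuous_on)
next
 case (Suc n)
 have "C_k_on n S f" "C_k_on n S g" using Suc.prems C_k_on_Suc_imp by blast+
 thus ?case
 by (intro C_k_on_SucI[OF assms(1) FDERIV])
 (rule C_k_on_has_der[OF Suc.prems(1)] C_k_on_has_der[OF Suc.prems(2)]
 C_k_on_add[OF assms(1)] Suc.IH C_k_on_pdiff[OF Suc.prems(1)] C_k_on_pdiff[OF Suc.prems(2)]
 | assumption)+
qed

lemma C_k_on_sum:
 assumes "open S" "finite I" "!!i. i:I ==> C_k_on n S (f i)"
 shows "C_k_on n S (%x. SUM i:I. f i x)"
 using assms(2,3) by (induction I rule: finite_induct) (auto intro!: C_k_on_add[OF assms(1)] simp: C_k_on_const)

text \<open>\<open>C_k_on\<close> recurses through partial derivatives in basis directions, so the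
  chain rule is written as a sum over the basis; the induction hypothesis then applies to each
  factor \<open>pd g j (f x)\<close>.\<close>

lemma C_k_on_comp:
 fixes f :: "'a::euclidean_space => 'b::euclidean_space" and g :: "'b => 'c::real_normed_vector"
 assumes "open S" "open T" "f ` S <= T" "C_k_on n T g" "C_k_on n S f"
 shows "C_k_on n S (%x. g (f x))"
 using assms(4,5)
proof (induction n arbitrary: g)
 case 0 thus ?case using assms(3) by (auto intro: continuous_on_compose2)
next
 case (Suc n)
 have d: "((%x. g (f x)) has_derivative
 (%b. SUM j:Basis. (pd f b x.*j)*.pd g j (f x))) (at x)" if "x:S" for x
 proof -
 have g: "(g has_derivative FD g (f x)) (at (f x))"
 using Suc.prems(1) assms(3) that by (auto simp: frechet_derivative_works[symmetric])
 hence l: "linear (FD g (f x))"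
 by (simp add: bounded_linear.linear has_derivative_bounded_linear)
 have D: "((%x. g (f x)) has_derivative (%b. FD g (f x) (pd f b x))) (at x)"
 by (rule has_derivative_compose[OF C_k_on_has_der[OF Suc.prems(2) that] g])
 have "FD g (f x) v = (SUM j:Basis. (v.*j)*.pd g j (f x))" for v
 by (subst euclidean_representation[symmetric, of v])
 (simp only: linear_sum[OF l] linear_cmul[OF l])
 hence "(%b. FD g (f x) (pd f b x)) =
 (%b. SUM j:Basis. (pd f b x.*j)*.pd g j (f x))" by blast
 with D show ?thesis by simp
 qed
 have "C_k_on n S f" using Suc.prems C_k_on_Suc_imp by blast
 hence "C_k_on n S (%x. pd g j (f x))" if "j:Basis" for j
 using Suc.IH C_k_on_pdiff[OF Suc.prems(1) that] by blast
 thus ?case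
 by (intro C_k_on_SucI[OF assms(1) d] C_k_on_sum[OF assms(1)] C_k_on_const C_k_on_pdiff[OF Suc.prems(2)]
 bounded_bilinear.C_k_on_prod[OF bounded_bilinear_scaleR assms(1)]
 bounded_bilinear.C_k_on_prod[OF bounded_bilinear_inner assms(1)]) auto
qed

lemma sm_pdiff_iff:
 "smooth_on S f \<longleftrightarrow> (ALL x:S. f differentiable (at x)) & (ALL b:Basis. smooth_on S (pd f b))"
proof
 assume L: "smooth_on S f"
 hence "C_k_on (Suc n) S f" for n by (simp only: smooth_on_def)
 thus "(ALL x:S. f differentiable (at x)) & (ALL b:Basis. smooth_on S (pd f b))"
 by (auto simp: smooth_on_def)
next
 assume "(ALL x:S. f differentiable (at x)) & (ALL b:Basis. smooth_on S (pd f b))"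
 hence "C_k_on (Suc n) S f" for n by (auto simp: smooth_on_def)
 thus "smooth_on S f" using C_k_on_Suc_imp unfolding smooth_on_def by blast
qed

lemma sm_cont: "smooth_on S f ==> continuous_on S f"
 unfolding smooth_on_def using C_k_on.simps(1) by blast

lemma sm_der:
 "smooth_on S f ==> x:S ==> (f has_derivative FD f x) (at x)"
 by (meson frechet_derivative_works sm_pdiff_iff)

lemma sm_lin_der:
 "smooth_on S f ==> x:S ==> linear (FD f x)"
 using has_derivative_linear sm_der by blast

lemma sm_subset: "smooth_on S f ==> T <= S ==> smooth_on T f"
 unfolding smooth_on_def using C_k_on_subset by blast

lemma sm_cong: "open S ==> (!!x. x:S ==> f x = g x) ==> smooth_on S f \<longleftrightarrow> smooth_on S g"
 unfolding smooth_on_def using C_k_on_cong by blast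

lemma sm_const: "smooth_on S (%x. c)"
 unfolding smooth_on_def using C_k_on_const by blast

lemma sm_bl: "bounded_linear f ==> smooth_on S f"
 unfolding smooth_on_def using C_k_on_bl by blast

lemma sm_ident: "smooth_on S (%x. x)"
 by (rule sm_bl) (rule bounded_linear_ident)

lemma sm_add:
 "open S ==> smooth_on S f ==> smooth_on S g ==> smooth_on S (%x. f x+g x)"
 unfolding smooth_on_def using C_k_on_add by blast

lemma sm_sum:
 "open S ==> finite I ==> (!!i. i:I ==> smooth_on S (f i)) ==> smooth_on S (%x. SUM i:I. f i x)"
 unfolding smooth_on_def using C_k_on_sum by blast

lemma sm_bilin:
 "bounded_bilinear b ==> open S ==> smooth_on S f ==> smooth_on S g ==> smooth_on S (%x. b (f x) (g x))"
 unfolding smooth_on_def using bounded_bilinear.C_k_on_prod by blast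

lemmas sm_mult = sm_bilin[OF bounded_bilinear_mult]
 and sm_scaleR = sm_bilin[OF bounded_bilinear_scaleR]
 and sm_inner = sm_bilin[OF bounded_bilinear_inner]

lemma sm_comp:
 fixes f :: "'a::euclidean_space => 'b::euclidean_space"
 shows "open S ==> open T ==> f ` S <= T ==> smooth_on T g ==> smooth_on S f ==> smooth_on S (%x. g (f x))"
 unfolding smooth_on_def using C_k_on_comp by blast

lemma sm_lin_comp:
 fixes f :: "'a::euclidean_space => 'b::euclidean_space"
 assumes "open S" "bounded_linear g" "smooth_on S f" shows "smooth_on S (%x. g (f x))"
 using sm_comp[OF assms(1) open_UNIV _ sm_bl[OF assms(2)] assms(3)] by simp

lemma sm_minus:
 fixes f :: "'a::euclidean_space => 'b::euclidean_space"
 shows "open S ==> smooth_on S f ==> smooth_on S (%x. - f x)"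
 using sm_lin_comp bounded_linear_minus[OF bounded_linear_ident] by blast

lemma sm_diff:
 fixes f :: "'a::euclidean_space => 'b::euclidean_space"
 shows "open S ==> smooth_on S f ==> smooth_on S g ==> smooth_on S (%x. f x-g x)"
 using sm_add[of S f "%x. - g x"] sm_minus[of S g] by simp

lemma sm_exp: "smooth_on UNIV (exp :: real => real)"
proof -
 have "C_k_on n UNIV (exp :: real => real)" for n
 proof (induction n)
 case 0 thus ?case by (auto intro!: continuous_intros)
 next
 case (Suc n)
 show ?case
 by (rule C_k_on_SucI[OF open_UNIV DERIV_exp[unfolded has_field_derivative_def]]) (use Suc in simp)
 qed
 thus ?thesis by (simp add: smooth_on_def)
qed

lemma sm_inverse: "smooth_on (- {0}) (inverse :: real => real)"
proof -
 have o: "open (- {0::real})" by auto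
 have "C_k_on n (- {0}) (inverse :: real => real)" for n
 proof (induction n)
 case 0 thus ?case by (auto intro!: continuous_intros)
 next
 case (Suc n)
 have d: "(inverse has_derivative (%b. (- 1*b)*(inverse x*inverse x))) (at x)"
 if "x:- {0}" for x :: real
 using that has_derivative_inverse'[of x UNIV] by (simp add: mult_ac)
 show ?case
 by (rule C_k_on_SucI[OF o d])
 (intro bounded_bilinear.C_k_on_prod[OF bounded_bilinear_mult o] C_k_on_const Suc | assumption)+
 qed
 thus ?thesis by (simp add: smooth_on_def)
qed

lemma sm_pdiff_field:
 fixes f :: "'a::euclidean_space => 'b::euclidean_space"
 assumes "open S" "smooth_on S f" "smooth_on S w"
 shows "smooth_on S (%x. FD f x (w x))"
proof -
 have "FD f x (w x) = (SUM j:Basis. (w x.*j)*.pd f j x)" if "x:S" for x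
 by (subst euclidean_representation[symmetric, of "w x"])
 (simp only: linear_sum[OF sm_lin_der[OF assms(2) that]]
 linear_cmul[OF sm_lin_der[OF assms(2) that]])
 hence "smooth_on S (%x. FD f x (w x)) \<longleftrightarrow>
 smooth_on S (%x. SUM j:Basis. (w x.*j)*.pd f j x)"
 by (intro sm_cong assms(1))
 thus ?thesis
 using assms sm_pdiff_iff[of S f] by (auto intro!: sm_sum sm_scaleR sm_inner sm_const)
qed

text \<open>Two applications of the mean value theorem: in direction \<open>a\<close> to the
  increment in \<open>b\<close>, then in direction \<open>b\<close>. The left side is symmetric in
  \<open>a\<close> and \<open>b\<close>, which is what \<open>pdiff_commute\<close>
  exploits.\<close>

lemma second_difference_mvt:
 fixes f :: "'a::euclidean_space => real"
 assumes S: "open S" and f: "smooth_on S f" and t: "0 < t"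
 and sub': "ALL r:{0..t}. ALL s:{0..t}. x+r*.a+s*.b:S"
 shows "EX r s. 0 <= r & r <= t & 0 <= s & s <= t &
 f (x+t*.a+t*.b)-f (x+t*.a)-f (x+t*.b)+f x =
 t*(t*pd (pd f a) b (x+r*.a+s*.b))"
proof -
 have sub: "x+r*.a+s*.b:S" if "0 <= r" "r <= t" "0 <= s" "s <= t" for r s
 using sub' that by auto
 have fa: "smooth_on S (pd f a)"
 by (rule sm_pdiff_field[OF S f sm_const])
 have d1: "((%r. f (x+r*.a+s*.b)) has_derivative
 (%h. h*pd f a (x+r*.a+s*.b))) (at r)"
 if "0 <= r" "r <= t" "0 <= s" "s <= t" for r s
 proof -
 have "((%r. f (x+r*.a+s*.b)) has_derivative
 (%h. FD f (x+r*.a+s*.b) (h*.a))) (at r)"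
 by (rule has_derivative_compose[OF _ sm_der[OF f]])
 (use that sub in \<open>auto intro!: derivative_eq_intros\<close>)
 thus ?thesis
 using linear_cmul[OF sm_lin_der[OF f sub[OF that]]] by simp
 qed
 have d2: "((%s. pd f a (x+r*.a+s*.b)) has_derivative
 (%h. h*pd (pd f a) b (x+r*.a+s*.b))) (at s)"
 if "0 <= r" "r <= t" "0 <= s" "s <= t" for r s
 proof -
 have "((%s. pd f a (x+r*.a+s*.b)) has_derivative
 (%h. FD (pd f a) (x+r*.a+s*.b) (h*.b))) (at s)"
 by (rule has_derivative_compose[OF _ sm_der[OF fa]])
 (use that sub in \<open>auto intro!: derivative_eq_intros\<close>)
 thus ?thesis
 using linear_cmul[OF sm_lin_der[OF fa sub[OF that]]] by simp
 qed
 let ?g = "%r. f (x+r*.a+t*.b)-f (x+r*.a+0*.b)"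
 let ?h = "%r s. pd f a (x+r*.a+s*.b)"
 have "(?g has_derivative (%h. h*?h r t-h*?h r 0)) (at r within {0..t})" if "0 <= r" "r <= t" for r
 by (rule has_derivative_at_withinI[OF has_derivative_diff[OF d1[of r t] d1[of r 0]]]) (use that t in auto)
 from mvt_simple[OF t this] obtain r where r: "0 < r" "r < t" and
 1: "?g t-?g 0 = (t-0)*?h r t-(t-0)*?h r 0" by auto
 have "(?h r has_derivative (%h. h*pd (pd f a) b (x+r*.a+s*.b))) (at s within {0..t})"
 if "0 <= s" "s <= t" for s
 by (rule has_derivative_at_withinI[OF d2]) (use that r in auto)
 from mvt_simple[OF t this] obtain s where "0 < s" "s < t"
 "?h r t-?h r 0 = (t-0)*pd (pd f a) b (x+r*.a+s*.b)" by auto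
 moreover from this have "?g t-?g 0 = t*(t*pd (pd f a) b (x+r*.a+s*.b))"
 using 1 by (simp only: right_diff_distrib[symmetric] diff_zero)
 ultimately show ?thesis using r by (intro exI[of _ r] exI[of _ s]) simp
qed

lemma pdiff_commute:
 fixes f :: "'a::euclidean_space => real"
 assumes S: "open S" and f: "smooth_on S f" and x: "x:S"
 shows "pd (pd f a) b x = pd (pd f b) a x"
proof -
 obtain d where d: "d > 0" "ball x d <= S" using S x openE by blast
 define m where "m = 1+norm a+norm b"
 have m: "m > 0" by (simp add: m_def add_pos_nonneg)
 \<comment> \<open>Starting at 2 keeps \<open>t n*m\<close> strictly below \<open>d\<close>, so that
   the whole parallelogram stays in the ball already for \<open>n = 0\<close>.\<close>
 define t where "t n = d/m/real (Suc (Suc n))" for n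
 have tpos: "t n > 0" for n using d m by (simp add: t_def)
 have tlt: "t n*m < d" for n
 proof -
 have "t n*m = d/real (Suc (Suc n))" using m by (simp add: t_def)
 also have "... < d" using d by (simp add: divide_simps)
 finally show ?thesis .
 qed
 have small: "norm (r*.a+s*.b) <= t n*m" if "0 <= r" "r <= t n" "0 <= s" "s <= t n" for r s n
 proof -
 have "norm (r*.a+s*.b) <= r*norm a+s*norm b"
 using that norm_triangle_ineq[of "r*.a" "s*.b"] by simp
 also have "... <= t n*norm a+t n*norm b" using that by (intro add_mono rmon) auto
 also have "... <= t n*m" using tpos[of n] by (simp add: m_def algebra_simps)
 finally show ?thesis .
 qed
 have sub: "x+r*.a+s*.b:S" "x+s*.b+r*.a:S"
 if "0 <= r" "r <= t n" "0 <= s" "s <= t n" for r s n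
 using small[OF that] tlt[of n] d(2) by (auto simp: dist_norm norm_minus_commute add.assoc add.left_commute
 add.commute[of "s*.b"] subset_iff)
 have sub1: "ALL r:{0..t n}. ALL s:{0..t n}. x+r*.a+s*.b:S"
 and sub2: "ALL r:{0..t n}. ALL s:{0..t n}. x+r*.b+s*.a:S" for n
 using sub[of _ n] by auto
 have "EX z z'. norm (z-x) <= t n*m & norm (z'-x) <= t n*m &
 pd (pd f a) b z = pd (pd f b) a z'" for n
 proof -
 obtain r s where 1: "0 <= r" "r <= t n" "0 <= s" "s <= t n"
 "f (x+t n*.a+t n*.b)-f (x+t n*.a)-f (x+t n*.b)+f x =
 t n*(t n*pd (pd f a) b (x+r*.a+s*.b))"
 using second_difference_mvt[OF S f tpos[of n] sub1] by blast
 obtain r' s' where 2: "0 <= r'" "r' <= t n" "0 <= s'" "s' <= t n"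
 "f (x+t n*.b+t n*.a)-f (x+t n*.b)-f (x+t n*.a)+f x =
 t n*(t n*pd (pd f b) a (x+r'*.b+s'*.a))"
 using second_difference_mvt[OF S f tpos[of n] sub2] by blast
 have "x+t n*.b+t n*.a = x+t n*.a+t n*.b" by simp
 hence "t n*(t n*pd (pd f a) b (x+r*.a+s*.b)) =
 t n*(t n*pd (pd f b) a (x+r'*.b+s'*.a))"
 using 1(5) 2(5) by (simp add: algebra_simps)
 hence "pd (pd f a) b (x+r*.a+s*.b) = pd (pd f b) a (x+r'*.b+s'*.a)"
 using tpos[of n] by simp
 moreover have "norm (x+r*.a+s*.b-x) <= t n*m"
 using small[OF 1(1-4)] by simp
 moreover have "norm (x+r'*.b+s'*.a-x) <= t n*m"
 using small[OF 2(3,4,1,2)] by (simp add: algebra_simps)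
 ultimately show ?thesis by blast
 qed
 then obtain z z' where z: "!!n. norm (z n-x) <= t n*m" "!!n. norm (z' n-x) <= t n*m"
 "!!n. pd (pd f a) b (z n) = pd (pd f b) a (z' n)" by metis
 have t0: "(%n. t n*m) ----> 0"
 using m LIMSEQ_Suc[OF LIMSEQ_Suc[OF lim_const_over_n[of d]]] by (simp add: t_def)
 have "z ----> x" "z' ----> x"
 using z Lim_null_comparison[OF _ t0, of "%n. z n-x"] Lim_null_comparison[OF _ t0, of "%n. z' n-x"] by (auto simp: LIM_zero_iff)
 moreover have "isCont (pd (pd f a) b) x" "isCont (pd (pd f b) a) x"
 using sm_cont sm_pdiff_field[OF S _ sm_const] f x S continuous_on_eq_continuous_at by blast+
 ultimately have "(%n. pd (pd f a) b (z n)) ----> pd (pd f a) b x"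
 "(%n. pd (pd f b) a (z' n)) ----> pd (pd f b) a x"
 using isCont_tendsto_compose by blast+
 thus ?thesis using z(3) LIMSEQ_unique by simp
qed

section \<open>Integrals depending on a parameter\<close>

text \<open>Differentiation under the integral by dominated convergence: the mean value inequality
  on the ball bounds the remainder quotient by \<open>2*C\<close>, so \<open>2*C * |ph|\<close>
  dominates although \<open>ph\<close> is merely integrable.\<close>

lemma has_der_int_param:
 fixes k :: "'a::euclidean_space => 'b => real"
 assumes r: "0 < r" and ph: "integrable M ph"
 and k: "!!x. x:ball x0 r ==> k x:bmeas M"
 and kC: "!!x y. x:ball x0 r ==> y:space M ==> |k x y| <= C"
 and k': "!!w. (%y. k' x0 y w):bmeas M"
 and d: "!!x y. x:ball x0 r ==> y:space M ==> ((%x. k x y) has_derivative k' x y) (at x)"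
 and k'C: "!!x y w. x:ball x0 r ==> y:space M ==> |k' x y w| <= C*norm w"
 shows "((%x. LINT y|M. k x y*ph y) has_derivative (%w. LINT y|M. k' x0 y w*ph y)) (at x0)"
proof -
 have x0: "x0:ball x0 r" using r by simp
 have bd: "integrable M (%y. g y*ph y)" if "g:bmeas M" "!!y. y:space M ==> |g y| <= B" for g B
 proof (rule Bochner_Integration.integrable_bound[of _ "%y. B*ph y"])
 show "AE y in M. norm (g y*ph y) <= norm (B*ph y)"
 using that(2) by (intro AE_I2) (auto simp: abs_mult intro!: rmon, smt (verit))
 qed (use ph that(1) in auto)
 have ik: "integrable M (%y. k x y*ph y)" if "x:ball x0 r" for x
 using bd[OF k[OF that] kC[OF that]] .
 have ik': "integrable M (%y. k' x0 y w*ph y)" for w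
 using bd[OF k' k'C[OF x0]] .
 have lin: "linear (k' x0 y)" if "y:space M" for y
 using d[OF x0 that] has_derivative_linear by blast
 have "bounded_linear (%w. LINT y|M. k' x0 y w*ph y)"
 proof (intro linear_linear[THEN iffD2] linearI)
 fix v w c
 show "(LINT y|M. k' x0 y (v+w)*ph y) = (LINT y|M. k' x0 y v * ph y)+(LINT y|M. k' x0 y w*ph y)"
 by (subst Bochner_Integration.integral_add[OF ik' ik', symmetric], rule Bochner_Integration.integral_cong[OF refl])
 (simp add: linear_add[OF lin] algebra_simps)
 show "(LINT y|M. k' x0 y (c*.v)*ph y) = c*.(LINT y|M. k' x0 y v * ph y)"
 by (subst integral_scaleR_right[symmetric], rule Bochner_Integration.integral_cong[OF refl])
 (simp add: linear_cmul[OF lin])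
 qed
 moreover have "((%w. norm ((LINT y|M. k (x0+w) y*ph y)-(LINT y|M. k x0 y*ph y) -
 (LINT y|M. k' x0 y w*ph y))/norm w) \<longlongrightarrow> 0) (at 0)"
 unfolding tendsto_at_iff_sequentially
 proof (intro allI impI, unfold o_def)
 fix s :: "nat => 'a" assume s: "ALL i. s i:UNIV - {0}" "s ----> 0"
 hence "eventually (%i. dist (s i) 0 < r) sequentially" using r tendstoD by blast
 \<comment> \<open>The first members of the sequence may leave the ball, where nothing is known;
   everything below is shifted by \<open>N\<close>.\<close>
 then obtain N where N: "!!i. i >= N ==> x0+s i:ball x0 r"
 by (auto simp: eventually_sequentially dist_norm)
 define q where "q i y = (k (x0+s i) y-k x0 y-k' x0 y (s i))/norm (s i)" for i y
 have lip: "|k (x0+w) y-k x0 y| <= C*norm w" if "y:space M" "x0+w:ball x0 r" for w y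
 proof -
 have "onorm (k' x y) <= C" if "x:ball x0 r" for x
 by (rule onorm_le) (use k'C[OF that \<open>y : space M\<close>] in simp)
 moreover have "((%x. k x y) has_derivative k' x y) (at x within ball x0 r)" if "x:ball x0 r" for x
 by (rule has_derivative_at_withinI[OF d[OF that \<open>y : space M\<close>]])
 ultimately have "norm (k (x0+w) y-k x0 y) <= C*norm (x0+w-x0)"
 by (intro differentiable_bound[OF convex_ball _ _ that(2) x0, where f = "%x. k x y"])
 thus ?thesis by simp
 qed
 have "(%i. LINT y|M. q (i+N) y*ph y) ----> (LINT y|M. 0)"
 proof (rule integral_dominated_convergence[where w = "%y. 2*C * |ph y|"])
 show "(%y. q (i+N) y*ph y):bmeas M" for i
 unfolding q_def using k[OF N] k[OF x0] k' ph by simp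
 show "integrable M (%y. 2*C * |ph y| )" using ph by auto
 show "AE y in M. (%i. q (i+N) y*ph y) ----> 0"
 proof (rule AE_I2)
 fix y assume y: "y:space M"
 have "((%w. norm (k (x0+w) y-k x0 y-k' x0 y w)/norm w) \<longlongrightarrow> 0) (at 0)"
 using d[OF x0 y] by (simp add: has_derivative_at)
 hence "(%i. norm (k (x0+s i) y-k x0 y-k' x0 y (s i))/norm (s i)) ----> 0"
 using s by (auto simp: tendsto_at_iff_sequentially o_def)
 hence "(%i. |q i y| ) ----> 0" by (simp add: q_def)
 hence "(%i. q (i+N) y) ----> 0" using LIMSEQ_ignore_initial_segment tendsto_rabs_zero_iff by blast
 thus "(%i. q (i+N) y*ph y) ----> 0" using tendsto_mult_left_zero by blast
 qed
 show "AE y in M. norm (q (i+N) y*ph y) <= 2*C * |ph y|" for i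
 proof (rule AE_I2)
 fix y assume y: "y:space M"
 have "|k (x0+s (i+N)) y-k x0 y-k' x0 y (s (i+N))| <= 2*C*norm (s (i+N))"
 using lip[OF y N[of "i+N"]] k'C[OF x0 y, of "s (i+N)"] by simp
 hence "|q (i+N) y| <= 2*C" using s(1) by (simp add: q_def abs_divide divide_simps)
 thus "norm (q (i+N) y*ph y) <= 2*C * |ph y|" by (simp add: abs_mult rmon)
 qed
 qed simp
 hence "(%i. |LINT y|M. q (i+N) y*ph y| ) ----> 0" by (simp add: tendsto_rabs_zero)
 moreover have "|LINT y|M. q (i+N) y*ph y| = norm ((LINT y|M. k (x0+s (i+N)) y*ph y) -
 (LINT y|M. k x0 y*ph y)-(LINT y|M. k' x0 y (s (i+N))*ph y))/norm (s (i+N))" for i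
 proof -
 have "q (i+N) y*ph y = (k (x0+s (i+N)) y*ph y-k x0 y*ph y-k' x0 y (s (i+N))*ph y) /
 norm (s (i+N))" for y
 by (simp add: q_def algebra_simps)
 thus ?thesis
 using ik[OF N[of "i+N"]] ik[OF x0] ik'[of "s (i+N)"] by simp
 qed
 ultimately show "(%i. norm ((LINT y|M. k (x0+s i) y*ph y)-(LINT y|M. k x0 y*ph y) -
 (LINT y|M. k' x0 y (s i)*ph y))/norm (s i)) ----> 0"
 using LIMSEQ_offset[of "%i. norm ((LINT y|M. k (x0+s i) y*ph y)-(LINT y|M. k x0 y*ph y) -
 (LINT y|M. k' x0 y (s i)*ph y))/norm (s i)" N] by simp
 qed
 ultimately show ?thesis by (simp add: has_derivative_at)
qed

locale compact_measure = finite_measure M for M :: "'a::euclidean_space measure" +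
 fixes Ga :: "'a set"
 assumes compact_space: "compact Ga" and sets_M: "sets M = sets (restrict_space borel Ga)"
begin

lemma space_M: "space M = Ga"
 using sets_eq_imp_space_eq[OF sets_M] by (simp add: space_restrict_space)

lemma cont_meas: "cont Ga f ==> f:bmeas M"
 for f :: "'a => 'b::topological_space"
 using borel_measurable_continuous_on_restrict[of Ga f] measurable_cong_sets[OF sets_M refl] by blast

lemma cont_bdd:
 fixes f :: "'a => 'b::real_normed_vector"
 assumes "cont Ga f" shows "EX B>0. ALL y:Ga. norm (f y) <= B"
 using compact_imp_bounded[OF compact_continuous_image[OF assms compact_space]] by (auto simp: bounded_pos)

lemma cont_int:
 fixes f :: "'a => 'b::{second_countable_topology, banach}"
 assumes "cont Ga f" shows "integrable M f"
 using cont_bdd[OF assms] cont_meas[OF assms] by (metis integrable_const_bound AE_I2 space_M)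

lemma param_int_der:
 fixes k :: "'b::euclidean_space \<times> 'a => real"
 assumes S: "open S" and T: "Ga <= T" and k: "smooth_on (S \<times> T) k"
 and ph: "integrable M ph" and x0: "x0:S"
 shows "((%x. LINT y|M. k (x, y)*ph y) has_derivative
 (%w. LINT y|M. FD k (x0, y) (w, 0)*ph y)) (at x0)"
proof -
 obtain r where r: "r > 0" "cball x0 r <= S" using S x0 open_contains_cball by blast
 have cpt: "compact (cball x0 r \<times> Ga)" using compact_space by (simp add: compact_Times)
 have sub: "cball x0 r \<times> Ga <= S \<times> T" using r T by auto
 have bnd: "EX C. ALL x:cball x0 r. ALL y:Ga. |g (x, y)| <= C" if "smooth_on (S \<times> T) g" for g :: "'b \<times> 'a => real"
 using compact_imp_bounded[OF compact_continuous_image[OF continuous_on_subset[OF sm_cont[OF that] sub] cpt]] by (auto simp: bounded_iff)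
 have kb: "smooth_on (S \<times> T) (pd k (b, 0))" if "b:Basis" for b
 using k sm_pdiff_iff[of "S \<times> T" k] that by (auto simp: Basis_prod_def)
 obtain C0 where C0: "!!x y. x:cball x0 r ==> y:Ga ==> |k (x, y)| <= C0" using bnd[OF k] by blast
 obtain C where C: "!!b x y. b:Basis ==> x:cball x0 r ==> y:Ga ==> |pd k (b, 0) (x, y)| <= C b"
 using bnd[OF kb] by metis
 define B where "B = |C0| + (SUM b:(Basis :: 'b set). |C b| )"
 have exp: "FD k (x, y) (w, 0) = (SUM b:Basis. (w.*b)*pd k (b, 0) (x, y))"
 if "x:cball x0 r" "y:Ga" for x y w
 proof -
 have l: "linear (FD k (x, y))"
 using sm_lin_der[OF k] that sub by blast
 hence l': "linear (%w. FD k (x, y) (w, 0))"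
 by (intro linear_compose[OF _ l, unfolded o_def] linearI) auto
 show ?thesis
 by (subst euclidean_representation[symmetric, of w])
 (simp only: linear_sum[OF l'] linear_cmul[OF l'] real_scaleR_def)
 qed
 show ?thesis
 proof (rule has_der_int_param[where C = B and r = r
 and k = "%x y. k (x, y)" and k' = "%x y w. FD k (x, y) (w, 0)"])
 show "(%y. k (x, y)):bmeas M" if "x:ball x0 r" for x
 using that by (intro cont_meas continuous_on_compose2[OF
 continuous_on_subset[OF sm_cont[OF k] sub]] continuous_intros) auto
 show "|k (x, y)| <= B" if "x:ball x0 r" "y:space M" for x y
 proof -
 have "0 <= (SUM b:(Basis :: 'b set). |C b| )" by simp
 hence "C0 <= B" unfolding B_def by linarith
 thus ?thesis using C0[of x y] that space_M by simp
 qed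
 show "(%y. FD k (x0, y) (w, 0)):bmeas M" for w
 proof -
 have "(%y. SUM b:Basis. (w.*b)*pd k (b, 0) (x0, y)):bmeas M"
 using r by (intro cont_meas continuous_on_sum continuous_on_mult_left continuous_on_compose2[OF
 continuous_on_subset[OF sm_cont[OF kb] sub]] continuous_intros) auto
 thus ?thesis using exp[of x0] r space_M by (subst measurable_cong[where g = "%y. SUM b:Basis. (w.*b)*pd k (b, 0) (x0, y)"]) auto
 qed
 show "((%x. k (x, y)) has_derivative (%w. FD k (x, y) (w, 0))) (at x)"
 if "x:ball x0 r" "y:space M" for x y
 proof (rule has_derivative_compose[of "%x. (x, y)"])
 show "((%x. (x, y)) has_derivative (%w. (w, 0))) (at x)"
 by (intro has_derivative_Pair has_derivative_ident has_derivative_const)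
 have "(x, y):S \<times> T" using that r(2) T space_M by auto
 thus "(k has_derivative FD k (x, y)) (at (x, y))"
 using sm_der[OF k] by blast
 qed
 show "|frechet_derivative k (at (x, y)) (w, 0)| <= B*norm w" if "x:ball x0 r" "y:space M" for x y w
 proof -
 have "|frechet_derivative k (at (x, y)) (w, 0)| <= (SUM b:Basis. |(w.*b)*pd k (b, 0) (x, y)| )"
 using that space_M by (subst exp) auto
 also have "... <= (SUM b:Basis. norm w * |C b| )"
 proof (intro sum_mono)
 fix b :: 'b assume "b:Basis"
 thus "|(w.*b)*pd k (b, 0) (x, y)| <= norm w * |C b|"
 using C[of b x y] that space_M Basis_le_norm[of b w] by (auto simp: abs_mult intro!: mult_mono)
 qed
 also have "... <= B*norm w" by (simp add: B_def sum_distrib_left algebra_simps)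
 finally show ?thesis .
 qed
 qed (use r ph in auto)
qed

text \<open>The derivative in \<open>x\<close> is an integral of the same kind with kernel
  \<open>pd k (b, 0)\<close>, so the induction runs over all kernels at once.\<close>

lemma sm_param_int:
 fixes k :: "'b::euclidean_space \<times> 'a => real"
 assumes S: "open S" and T: "open T" "Ga <= T" and k: "smooth_on (S \<times> T) k" and ph: "integrable M ph"
 shows "smooth_on S (%x. LINT y|M. k (x, y)*ph y)"
proof -
 have diff: "(%x. LINT y|M. k (x, y)*ph y) differentiable (at x)"
 if "smooth_on (S \<times> T) k" "x:S" for k x
 using param_int_der[OF S T(2) that(1) ph that(2)] differentiableI by blast
 have "C_k_on n S (%x. LINT y|M. k (x, y)*ph y)" for n
 using k
 proof (induction n arbitrary: k)
 case 0 thus ?case using diff by (simp add: differentiable_at_withinI differentiable_imp_continuous_on differentiable_on_def)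
 next
 case (Suc n)
 have "C_k_on n S (pd (%x. LINT y|M. k (x, y)*ph y) b)" if "b:Basis" for b
 proof -
 have "smooth_on (S \<times> T) (pd k (b, 0))"
 using Suc.prems sm_pdiff_iff[of "S \<times> T" k] that by (auto simp: Basis_prod_def)
 from Suc.IH[OF this] show ?thesis
 by (subst C_k_on_cong[OF S]) (use frechet_derivative_at[OF param_int_der[OF S T(2) Suc.prems ph]] in
 \<open>auto simp: fun_eq_iff\<close>)
 qed
 thus ?case using diff[OF Suc.prems] by auto
 qed
 thus ?thesis by (simp add: smooth_on_def)
qed

end

section \<open>Square integrable functions\<close>

lemma discriminant:
 fixes a b c :: real
 assumes "!!t. 0 <= a+2*t*b+t^2*c" "0 <= c" shows "b^2 <= a*c"
proof (cases "c = 0")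
 case True
 have "b = 0"
 proof (rule ccontr)
 assume "b ~= 0"
 \<comment> \<open>With \<open>c = 0\<close> the expression is affine in \<open>t\<close>, and this
   \<open>t\<close> gives it the value -1.\<close>
 thus False using assms(1)[of "- (a+1)/(2*b)"] True by (simp add: field_simps)
 qed
 thus ?thesis using True by simp
next
 case False
 hence "c > 0" using assms(2) by simp
 hence "a+2*(- b/c)*b+(- b/c)^2*c = (a*c-b^2)/c"
 by (simp add: field_simps sq2)
 thus ?thesis using assms(1)[of "- b/c"] \<open>c > 0\<close> by (simp add: zero_le_divide_iff)
qed

lemma norm_lincomb2:
 fixes x y :: "'a::real_inner"
 shows "(norm (r*.x+s*.y))^2 = r^2*(norm x)^2+2*r * s*(x.*y)+s^2*(norm y)^2"
 by (simp only: power2_norm_eq_inner)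
 (simp add: inner_add inner_commute sq2 algebra_simps)

lemma L2n_nonneg: "0 <= L2n M f"
 by (simp add: L2_norm_def)

lemma L2n_power2: "(L2n M f)^2 = (LINT x|M. (norm (f x))^2)"
 by (simp add: L2_norm_def)

lemma L2_funD: "L2_fun M f ==> f:bmeas M"
 "L2_fun M f ==> integrable M (%x. (norm (f x))^2)"
 by (auto simp: L2_fun_def)

lemma L2_bound:
 assumes "L2_fun M g" "f:bmeas M" "AE x in M. norm (f x) <= C*norm (g x)"
 shows "L2_fun M f"
 unfolding L2_fun_def
proof
 show "integrable M (%x. (norm (f x))^2)"
 proof (rule Bochner_Integration.integrable_bound[where f = "%x. C^2*(norm (g x))^2"])
 show "AE x in M. norm ((norm (f x))^2) <= norm (C^2*(norm (g x))^2)"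
 using assms(3) by eventually_elim
 (auto simp: power_mult_distrib[symmetric] intro: power_mono)
 qed (use assms L2_funD[OF assms(1)] in auto)
qed (use assms in auto)

lemma L2n_bound:
 assumes "L2_fun M g" "f:bmeas M" "AE x in M. norm (f x) <= C*norm (g x)" "0 <= C"
 shows "L2n M f <= C*L2n M g"
proof -
 have "(LINT x|M. (norm (f x))^2) <= (LINT x|M. C^2*(norm (g x))^2)"
 proof (rule integral_mono_AE)
 show "AE x in M. (norm (f x))^2 <= C^2*(norm (g x))^2"
 using assms(3) by eventually_elim
 (auto simp: power_mult_distrib[symmetric] intro: power_mono)
 qed (use L2_funD[OF assms(1)] L2_funD[OF L2_bound[OF assms(1-3)]] in auto)
 hence "(L2n M f)^2 <= (C*L2n M g)^2"
 by (simp add: L2n_power2 power_mult_distrib)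
 thus ?thesis by (rule power2_le_imp_le) (use assms(4) L2n_nonneg[of M g] in simp)
qed

lemma L2n_cong_AE:
 assumes "f:bmeas M" "g:bmeas M" "AE x in M. f x = g x"
 shows "L2n M f = L2n M g"
 unfolding L2_norm_def using assms by (intro arg_cong[of _ _ sqrt] integral_cong_AE) auto

lemma L2_int_inner:
 assumes "L2_fun M f" "L2_fun M g" shows "integrable M (%x. f x.*g x)"
proof (rule Bochner_Integration.integrable_bound[where f = "%x. (norm (f x))^2+(norm (g x))^2"])
 have "norm (f x.*g x) <= norm ((norm (f x))^2+(norm (g x))^2)" for x
 proof -
 have "|f x.*g x| <= norm (f x)*norm (g x)" by (rule Cauchy_Schwarz_ineq2)
 also have "... <= (norm (f x))^2+(norm (g x))^2"
 using sum_squares_bound[of "norm (f x)" "norm (g x)"] mult_nonneg_nonneg[OF norm_ge_zero norm_ge_zero, of "f x" "g x"] by linarith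
 finally show ?thesis by simp
 qed
 thus "AE x in M. norm (f x.*g x) <= norm ((norm (f x))^2+(norm (g x))^2)" by simp
qed (use L2_funD[OF assms(1)] L2_funD[OF assms(2)] in auto)

lemma L2_int_mult:
 fixes f g :: "'a => real"
 shows "L2_fun M f ==> L2_fun M g ==> integrable M (%x. f x*g x)"
 using L2_int_inner[of M f g] by simp

lemma L2_lincomb:
 fixes f g :: "'a => 'b::euclidean_space"
 assumes f: "L2_fun M f" and g: "L2_fun M g"
 shows "L2_fun M (%x. r*.f x+s*.g x)"
 unfolding L2_fun_def
proof
 note [measurable] = L2_funD(1)[OF f] L2_funD(1)[OF g]
 show "(%x. r*.f x+s*.g x):bmeas M" by simp
 show "integrable M (%x. (norm (r*.f x+s*.g x))^2)"
 using L2_funD(2)[OF f] L2_funD(2)[OF g] L2_int_inner[OF f g] by (simp add: norm_lincomb2)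
qed

lemma L2_add: "L2_fun M f ==> L2_fun M g ==> L2_fun M (%x. f x+g x)"
 for f g :: "'a => 'b::euclidean_space"
 using L2_lincomb[of M f g 1 1] by simp

lemma L2_diff: "L2_fun M f ==> L2_fun M g ==> L2_fun M (%x. f x-g x)"
 for f g :: "'a => 'b::euclidean_space"
 using L2_lincomb[of M f g 1 "-1"] by simp

lemma L2_scaleR: "L2_fun M f ==> L2_fun M (%x. r*.f x)"
 for f :: "'a => 'b::euclidean_space"
 using L2_lincomb[of M f f r 0] by simp

lemma L2_zero: "L2_fun M (%x. 0)"
 by (simp add: L2_fun_def)

lemma L2_CS:
 fixes f g :: "'a => 'b::euclidean_space"
 assumes f: "L2_fun M f" and g: "L2_fun M g"
 shows "|LINT x|M. f x.*g x| <= L2n M f*L2n M g"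
proof -
 have "(LINT x|M. f x.*g x)^2 <= (L2n M f)^2*(L2n M g)^2"
 proof (rule discriminant)
 fix t
 have "0 <= (LINT x|M. (norm (f x+t*.g x))^2)" by simp
 also have "... = (LINT x|M. (norm (f x))^2+2*t*(f x.*g x)+t^2*(norm (g x))^2)"
 by (simp add: norm_lincomb2[of 1 _ t, simplified])
 also have "... = (L2n M f)^2+2*t*(LINT x|M. f x.*g x)+t^2*(L2n M g)^2"
 using L2_funD(2)[OF f] L2_funD(2)[OF g] L2_int_inner[OF f g] by (simp add: L2n_power2)
 finally show "0 <= (L2n M f)^2+2*t*(LINT x|M. f x.*g x)+t^2*(L2n M g)^2" .
 qed simp
 hence "|LINT x|M. f x.*g x|\<^sup>2 <= (L2n M f*L2n M g)^2" by (simp add: power_mult_distrib)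
 thus ?thesis by (rule power2_le_imp_le) (use L2n_nonneg[of M f] L2n_nonneg[of M g] in simp)
qed

lemma L2_CS_mult:
 fixes f g :: "'a => real"
 shows "L2_fun M f ==> L2_fun M g ==> |LINT x|M. f x*g x| <= L2n M f*L2n M g"
 using L2_CS[of M f g] by simp

lemma L2n_add:
 fixes f g :: "'a => 'b::euclidean_space"
 assumes f: "L2_fun M f" and g: "L2_fun M g"
 shows "L2n M (%x. f x+g x) <= L2n M f+L2n M g"
proof -
 have "(L2n M (%x. f x+g x))^2 = (LINT x|M. (norm (f x))^2+2*(f x.*g x)+(norm (g x))^2)"
 unfolding L2n_power2 by (simp add: norm_lincomb2[of 1 _ 1, simplified])
 also have "... = (L2n M f)^2+2*(LINT x|M. f x.*g x)+(L2n M g)^2"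
 using L2_funD(2)[OF f] L2_funD(2)[OF g] L2_int_inner[OF f g] by (simp add: L2n_power2)
 also have "... <= (L2n M f+L2n M g)^2"
 using L2_CS[OF f g] by (simp add: power2_sum)
 finally show ?thesis by (rule power2_le_imp_le) (use L2n_nonneg[of M f] L2n_nonneg[of M g] in simp)
qed

lemma L2n_scaleR:
 fixes f :: "'a => 'b::euclidean_space"
 shows "L2n M (%x. r*.f x) = |r|*L2n M f"
 by (simp add: L2_norm_def power_mult_distrib real_sqrt_mult)

lemma L2n_cmult: "L2n M (%x. r*f x) = |r|*L2n M f" for f :: "'a => real"
 using L2n_scaleR[of M r f] by simp

lemma L2n_minus_commute: "L2n M (%x. f x-g x) = L2n M (%x. g x-f x)"
 by (simp add: L2_norm_def norm_minus_commute)

lemma L2n_diff: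
 fixes f g :: "'a => 'b::euclidean_space"
 assumes f: "L2_fun M f" and g: "L2_fun M g"
 shows "L2n M (%x. f x-g x) <= L2n M f+L2n M g"
 using L2n_add[OF f L2_scaleR[OF g, of "-1"]] L2n_scaleR[of M "-1" g] by simp

lemma L2n_diff_triangle:
 fixes f g h :: "'a => 'b::euclidean_space"
 assumes "L2_fun M f" "L2_fun M g" "L2_fun M h"
 shows "L2n M (%x. f x-h x) <= L2n M (%x. f x-g x)+L2n M (%x. g x-h x)"
 using L2n_add[OF L2_diff[OF assms(1,2)] L2_diff[OF assms(2,3)]] by simp

lemma L2n_abs_diff:
 fixes f g :: "'a => 'b::euclidean_space"
 assumes f: "L2_fun M f" and g: "L2_fun M g"
 shows "|L2n M f-L2n M g| <= L2n M (%x. f x-g x)"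
 using L2n_add[OF L2_diff[OF f g] g] L2n_add[OF L2_diff[OF g f] f] L2n_minus_commute[of M f g] by simp

lemma L2n_lim:
 fixes f :: "nat => 'a => 'b::euclidean_space"
 assumes "!!n. L2_fun M (f n)" "L2_fun M g" "(%n. L2n M (%x. f n x-g x)) ----> 0"
 shows "(%n. L2n M (f n)) ----> L2n M g"
proof -
 have "(%n. L2n M (f n)-L2n M g) ----> 0"
 by (rule Lim_null_comparison[OF always_eventually[OF allI] assms(3)]) (simp add: L2n_abs_diff assms)
 thus ?thesis by (rule LIM_zero_cancel)
qed

lemma L2_inner_lim:
 fixes f :: "nat => 'a => 'b::euclidean_space"
 assumes f: "!!n. L2_fun M (f n)" and g: "L2_fun M g" and h: "L2_fun M h"
 and lim: "(%n. L2n M (%x. f n x-g x)) ----> 0"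
 shows "(%n. LINT x|M. f n x.*h x) ----> (LINT x|M. g x.*h x)"
proof -
 have "norm ((LINT x|M. f n x.*h x)-(LINT x|M. g x.*h x)) <= L2n M (%x. f n x-g x)*L2n M h" for n
 using L2_CS[OF L2_diff[OF f g] h] Bochner_Integration.integral_diff[OF L2_int_inner[OF f h] L2_int_inner[OF g h]] by (simp add: inner_diff_left)
 hence "(%n. (LINT x|M. f n x.*h x)-(LINT x|M. g x.*h x)) ----> 0"
 by (rule Lim_null_comparison[OF always_eventually[OF allI] tendsto_mult_left_zero[OF lim]])
 thus ?thesis by (rule LIM_zero_cancel)
qed

lemma (in finite_measure) L2_bounded:
 assumes "f:bmeas M" "AE x in M. norm (f x) <= B"
 shows "L2_fun M f" "L2n M f <= |B| * sqrt (measure M (space M))"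
proof -
 have one: "L2_fun M (%x. 1 :: real)" by (simp add: L2_fun_def)
 have n: "AE x in M. norm (f x) <= |B|*norm (1 :: real)"
 using assms(2) by auto
 show "L2_fun M f" by (rule L2_bound[OF one assms(1) n])
 show "L2n M f <= |B| * sqrt (measure M (space M))"
 using L2n_bound[OF one assms(1) n] by (simp add: L2_norm_def)
qed

lemma (in finite_measure) L2_int:
 fixes f :: "'a => 'b::euclidean_space"
 assumes "L2_fun M f" shows "integrable M f"
proof (rule Bochner_Integration.integrable_bound[where f = "%x. 1+(norm (f x))^2"])
 have "norm (f x) <= norm (1+(norm (f x))^2)" for x
 using sum_squares_bound[of 1 "norm (f x)"] norm_ge_zero[of "f x"]
 unfolding real_norm_def power_one by linarith
 thus "AE x in M. norm (f x) <= norm (1+(norm (f x))^2)" by simp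
qed (use L2_funD[OF assms] in auto)

lemma (in finite_measure) L1_le_L2:
 fixes f :: "'a => 'b::euclidean_space"
 assumes "L2_fun M f"
 shows "(LINT x|M. norm (f x)) <= L2n M f * sqrt (measure M (space M))"
proof -
 have 1: "L2_fun M (%x. 1 :: real)" by (simp add: L2_fun_def)
 have 2: "L2_fun M (%x. norm (f x))" using L2_funD[OF assms] by (auto simp: L2_fun_def)
 show ?thesis using L2_CS[OF 2 1] by (simp add: L2_norm_def)
qed

text \<open>Riesz-Fischer: a subsequence with summable increments converges almost everywhere, and
  Fatou's lemma carries the Cauchy estimate over to the limit.\<close>

lemma (in finite_measure) L2_complete:
 fixes f :: "nat => 'a => 'b::euclidean_space"
 assumes f: "!!n. L2_fun M (f n)"
 and cauchy: "!!e. e > 0 ==> EX N. ALL m>=N. ALL n>=N. L2n M (%x. f m x-f n x) < e"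
 shows "EX g. L2_fun M g & (%n. L2n M (%x. f n x-g x)) ----> 0"
proof -
 note [measurable] = L2_funD(1)[OF f]
 obtain N where N: "!!k m n. m >= N k ==> n >= N k ==> L2_norm M (%x. f m x-f n x) < (1/2)^k"
 using cauchy[of "(1/2)^k" for k] by auto metis
 \<comment> \<open>A sum in place of a maximum: it dominates every \<open>N i\<close> with
   \<open>i <= k\<close>, which makes all later terms of the subsequence admissible.\<close>
 define r where "r k = (SUM i<=k. N i)" for k
 have rN: "r k >= N k" for k by (simp add: r_def member_le_sum)
 have rS: "r (Suc k) >= N k" for k using rN[of k] by (simp add: r_def)
 have rmono: "N k <= r j" if "k <= j" for k j
 using rN[of k] that by (simp add: r_def) (meson atMost_iff finite_atMost le0 le_trans member_le_sum order_refl)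
 define d where "d k x = norm (f (r (Suc k)) x-f (r k) x)" for k x
 have [measurable]: "d k:bmeas M" for k unfolding d_def by simp
 have "(NN M (%x. enr (d k x))) <= enr ((1/2)^k * sqrt (measure M (space M)))" for k
 proof -
 have dd: "L2_fun M (%x. f (r (Suc k)) x-f (r k) x)" by (intro L2_diff f)
 have "(LINT x|M. d k x) <= L2n M (%x. f (r (Suc k)) x-f (r k) x) * sqrt (measure M (space M))"
 using L1_le_L2[OF dd] by (simp add: d_def)
 also have "... <= (1/2)^k * sqrt (measure M (space M))"
 using N[OF rS rN, of k] by (intro rmon) auto
 finally have "enr (LINT x|M. d k x) <= enr ((1/2)^k * sqrt (measure M (space M)))"
 by simp
 moreover have "integrable M (d k)" unfolding d_def by (intro integrable_norm L2_int dd)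
 hence "(NN M (%x. enr (d k x))) = enr (LINT x|M. d k x)"
 by (rule nn_integral_eq_integral) (simp add: d_def)
 ultimately show ?thesis by simp
 qed
 hence "(NN M (%x. (\<Sum>k. enr (d k x)))) <= (\<Sum>k. enr ((1/2)^k * sqrt (measure M (space M))))"
 by (subst nn_integral_suminf) (auto intro!: suminf_le)
 also have "... < \<infinity>"
 by (subst suminf_ennreal2) (auto intro!: summable_mult2)
 finally have "AE x in M. (\<Sum>k. enr (d k x)) ~= \<infinity>"
 by (intro nn_integral_PInf_AE) auto
 hence conv: "AE x in M. convergent (%k. f (r k) x)"
 proof eventually_elim
 case (elim x)
 hence "summable (%k. norm (f (r (Suc k)) x-f (r k) x))"
 using summable_suminf_not_top[of "%k. d k x"] by (simp add: d_def)
 hence "summable (%k. f (r (Suc k)) x-f (r k) x)" by (rule summable_norm_cancel)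
 hence "convergent (%n. (SUM k<n. f (r (Suc k)) x-f (r k) x))" by (simp add: summable_iff_convergent)
 hence "convergent (%n. f (r n) x-f (r 0) x)"
 by (simp add: sum_lessThan_telescope[of "%k. f (r k) x"])
 thus ?case by (simp add: convergent_diff_const_right_iff)
 qed
 define g where "g x = lim (%k. f (r k) x)" for x
 have gm [measurable]: "g:bmeas M" unfolding g_def by simp
 have glim: "AE x in M. (%k. f (r k) x) ----> g x"
 using conv by eventually_elim (simp add: g_def convergent_LIMSEQ_iff)
 have bound: "(NN M (%x. enr ((norm (f n x-g x))^2))) <= enr (((1/2)^k)^2)" if "n >= N k" for n k
 proof -
 have "(NN M (%x. enr ((norm (f n x-g x))^2))) =
 (NN M (%x. liminf (%j. enr ((norm (f n x-f (r j) x))^2))))"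
 proof (rule nn_integral_cong_AE, use glim in eventually_elim)
 case (elim x)
 have "(%j. enr ((norm (f n x-f (r j) x))^2)) ----> enr ((norm (f n x-g x))^2)"
 by (intro tendsto_ennrealI tendsto_power tendsto_norm tendsto_diff tendsto_const elim)
 thus ?case using lim_imp_Liminf[OF sequentially_bot] by metis
 qed
 also have "... <= liminf (%j. NN M (%x. enr ((norm (f n x-f (r j) x))^2)))"
 by (rule nn_integral_liminf) simp
 also have "... <= enr (((1/2)^k)^2)"
 proof (rule order_trans[OF Liminf_le_Limsup[OF sequentially_bot] Limsup_bounded], rule eventually_sequentiallyI[of k])
 fix j assume "k <= j"
 have L: "L2_fun M (%x. f n x-f (r j) x)" by (intro L2_diff f)
 have "(NN M (%x. enr ((norm (f n x-f (r j) x))^2))) = enr ((L2n M (%x. f n x-f (r j) x))^2)"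
 unfolding L2n_power2 by (rule nn_integral_eq_integral) (use L2_funD[OF L] in auto)
 also have "... <= enr (((1/2)^k)^2)"
 using N[OF that rmono[OF \<open>k <= j\<close>]] L2n_nonneg by (intro ennreal_leI power_mono) auto
 finally show "(NN M (%x. enr ((norm (f n x-f (r j) x))^2))) <= enr (((1/2)^k)^2)" .
 qed
 finally show ?thesis .
 qed
 have L: "L2_fun M (%x. f n x-g x)" if "n >= N k" for n k
 proof -
 have "(NN M (%x. enr (norm ((norm (f n x-g x))^2)))) < \<infinity>"
 using bound[OF that] by (auto simp: less_top[symmetric] top_unique)
 thus ?thesis by (auto simp: L2_fun_def integrable_iff_bounded)
 qed
 have "L2_fun M (%x. f (N 0) x-(f (N 0) x-g x))" by (intro L2_diff f L[of 0]) simp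
 hence g2: "L2_fun M g" by simp
 have small: "L2n M (%x. f n x-g x) <= (1/2)^k" if "n >= N k" for n k
 proof -
 have "enr ((L2n M (%x. f n x-g x))^2) = (NN M (%x. enr ((norm (f n x-g x))^2)))"
 unfolding L2n_power2 by (rule nn_integral_eq_integral[symmetric]) (use L2_funD[OF L[OF that]] in auto)
 hence "enr ((L2n M (%x. f n x-g x))^2) <= enr (((1/2)^k)^2)"
 using bound[OF that] by simp
 hence "(L2n M (%x. f n x-g x))^2 <= ((1/2)^k)^2"
 by simp
 thus ?thesis by (rule power2_le_imp_le) simp
 qed
 have "(%n. L2n M (%x. f n x-g x)) ----> 0"
 proof (rule LIMSEQ_I)
 fix e :: real assume "e > 0"
 then obtain k where "(1/2 :: real)^k < e" using real_arch_pow_inv[of e "1/2"] by auto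
 hence "ALL n>=N k. norm (L2n M (%x. f n x-g x)-0) < e"
 using small[of k] by (auto simp: abs_of_nonneg[OF L2n_nonneg] intro: le_less_trans)
 thus "EX n0. ALL n>=n0. norm (L2n M (%x. f n x-g x)-0) < e" by blast
 qed
 thus ?thesis using g2 by blast
qed

text \<open>The minimising sequence of \<open>B v v - 2 F v\<close>; a complete ambient space turns it into a
 representer of \<open>F\<close>.\<close>

lemma riesz_sequence:
 fixes S :: "('a => 'b::real_vector) set" and B :: "('a => 'b) => ('a => 'b) => real"
 assumes z: "(%x. 0):S"
 and comb: "!!v w r s. v:S ==> w:S ==> (%x. r*.v x+s*.w x):S"
 and B: "!!v w z r s. v:S ==> w:S ==> z:S ==> B (%x. r*.v x+s*.w x) z = r*B v z+s*B w z"
 and sym: "!!v w. v:S ==> w:S ==> B v w = B w v"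
 and pos: "!!v. v:S ==> 0 <= B v v"
 and F: "!!v w r s. v:S ==> w:S ==> F (%x. r*.v x+s*.w x) = r*F v+s*F w"
 and bd: "!!v. v:S ==> |F v| <= C * sqrt (B v v)"
 shows "EX v. (ALL n. v n:S) &
 (ALL e>0. EX N. ALL m>=N. ALL n>=N. B (%x. v m x-v n x) (%x. v m x-v n x) < e) &
 (ALL w:S. (%n. B (v n) w) ----> F w)"
proof -
 define J where "J v = B v v-2*F v" for v
 have quad: "B (%x. r*.v x+s*.w x) (%x. r*.v x+s*.w x) =
 r^2*B v v+2*r * s*B v w+s^2*B w w" if "v:S" "w:S" for r s v w
 using that comb[OF that, of r s] by (simp add: B sym[of _ "%x. r*.v x+s*.w x"] sym[of w v]
 sq2 algebra_simps)
 have lower: "- C\<^sup>2 <= J v" if "v:S" for v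
 proof -
 have "2*F v <= 2*(C * sqrt (B v v))" using bd[OF that] by simp
 also have "... <= C^2+B v v" using sum_squares_bound[of C "sqrt (B v v)"] pos[OF that] by simp
 finally show ?thesis by (simp add: J_def)
 qed
 define I where "I = Inf (J ` S)"
 have bb: "bdd_below (J ` S)" using lower by (auto intro!: bdd_belowI)
 have I: "I <= J v" if "v:S" for v unfolding I_def using bb that by (auto intro: cInf_lower)
 have "EX v:S. J v < I+1/Suc n" for n
 proof -
 have "Inf (J ` S) < I+1/Suc n" by (simp add: I_def)
 thus ?thesis using cInf_lessD[of "J ` S"] z by auto
 qed
 then obtain v where v: "!!n. v n:S" "!!n. J (v n) < I+1/Suc n" by metis
 \<comment> \<open>Parallelogram identity: the distance of two nearly minimising elements is
   controlled because \<open>J\<close> of their midpoint is at least \<open>I\<close>.\<close>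
 have cau: "B (%x. v m x-v n x) (%x. v m x-v n x) <= 2/Suc m+2/Suc n" for m n
 proof -
 let ?mid = "%x. (1/2)*.v m x+(1/2)*.v n x"
 have "B (%x. 1*.v m x+(- 1)*.v n x) (%x. 1*.v m x+(- 1)*.v n x) =
 2*J (v m)+2*J (v n)-4*J ?mid"
 unfolding J_def quad[OF v(1) v(1)] F[OF v(1) v(1)] by (simp add: sq2)
 also have "... <= 2/Suc m+2/Suc n"
 using v(2)[of m] v(2)[of n] I[OF comb[OF v(1) v(1), of "1/2" m "1/2" n]] by simp
 finally show ?thesis by simp
 qed
 have "(%n. B (v n) w) ----> F w" if w: "w:S" for w
 proof -
 \<comment> \<open>Perturbing \<open>v n\<close> by \<open>s*w\<close> can lower \<open>J\<close> by
   at most \<open>1/Suc n\<close>. Taking \<open>s\<close> equal to plus and minus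
   \<open>1/sqrt (Suc n)\<close> balances this against the quadratic term and bounds the residual in
   the direction \<open>w\<close>.\<close>
 have bnd: "norm (B (v n) w-F w) <= (B w w+1)*inverse (sqrt (real (Suc n)))" for n
 proof -
 define t where "t = inverse (sqrt (real (Suc n)))"
 have t: "t > 0" "t^2 = 1/Suc n" by (auto simp: t_def power_inverse divide_inverse)
 define D where "D = B (v n) w-F w"
 have "- (2 * s*D) <= t^2*(B w w+1)" if "s^2 = t^2" for s
 proof -
 have "I <= J (%x. 1*.v n x+s*.w x)" by (rule I[OF comb[OF v(1) w]])
 also have "... = J (v n)+2 * s*D+t^2*B w w"
 unfolding J_def quad[OF v(1) w] F[OF v(1) w] that by (simp add: D_def algebra_simps)
 finally show ?thesis using v(2)[of n] unfolding t(2)[symmetric] distrib_left by simp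
 qed
 from this[of t] this[of "- t"] have "2*t * |D| <= t^2*(B w w+1)"
 by simp
 hence "t*(2 * |D| ) <= t*(t*(B w w+1))"
 by (simp add: sq2)
 hence "2 * |D| <= t*(B w w+1)" using t(1) by simp
 hence "|D| <= (B w w+1)*t" by (simp add: mult.commute)
 thus ?thesis unfolding t_def D_def real_norm_def .
 qed
 have lim: "(%n. (B w w+1)*inverse (sqrt (real (Suc n)))) ----> 0"
 by (intro tendsto_mult_right_zero tendsto_inverse_0_at_top filterlim_compose[OF sqrt_at_top]
 filterlim_compose[OF filterlim_real_sequentially filterlim_Suc])
 have "(%n. B (v n) w-F w) ----> 0"
 by (rule Lim_null_comparison[OF always_eventually[OF allI[OF bnd]] lim])
 thus ?thesis by (rule LIM_zero_cancel)
 qed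
 moreover have "EX N. ALL m>=N. ALL n>=N. B (%x. v m x-v n x) (%x. v m x-v n x) < e" if e: "e > 0" for e
 proof -
 obtain N where N: "inverse (real (Suc N)) < e/4"
 using reals_Archimedean[OF divide_pos_pos[OF e zero_less_numeral]] by blast
 have le: "2/real (Suc m) <= 2*inverse (real (Suc N))" if "m >= N" for m
 using that by (simp add: field_simps)
 have "ALL m>=N. ALL n>=N. B (%x. v m x-v n x) (%x. v m x-v n x) < e"
 proof (intro allI impI)
 fix m n assume "m >= N" "n >= N"
 thus "B (%x. v m x-v n x) (%x. v m x-v n x) < e"
 using cau[of m n] N le[of m] le[of n] by simp
 qed
 thus ?thesis by blast
 qed
 ultimately show ?thesis using v(1) by blast
qed

text \<open>\<open>S\<close> need not be closed: the minimising sequence converges in L2, and its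
  limit, possibly outside \<open>S\<close>, represents \<open>F\<close>. The norm bound follows by
  inserting the sequence itself and passing to the limit.\<close>

lemma (in finite_measure) L2_riesz:
 fixes S :: "('a => 'b::euclidean_space) set"
 assumes z: "(%x. 0):S"
 and comb: "!!v w r s. v:S ==> w:S ==> (%x. r*.v x+s*.w x):S"
 and L2: "!!v. v:S ==> L2_fun M v"
 and F: "!!v w r s. v:S ==> w:S ==> F (%x. r*.v x+s*.w x) = r*F v+s*F w"
 and bd: "!!v. v:S ==> |F v| <= C*L2n M v"
 shows "EX g. L2_fun M g & L2n M g <= |C| & (ALL v:S. F v = (LINT x|M. g x.*v x))"
proof -
 have sq: "sqrt (LINT x|M. v x.*v x) = L2n M v" for v :: "'a => 'b"
 by (simp add: L2_norm_def power2_norm_eq_inner)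
 let ?B = "%v w. LINT x|M. v x.*w x"
 have "EX v. (ALL n. v n:S) &
 (ALL e>0. EX N. ALL m>=N. ALL n>=N. ?B (%x. v m x-v n x) (%x. v m x-v n x) < e) &
 (ALL w:S. (%n. ?B (v n) w) ----> F w)"
 proof (rule riesz_sequence[where B = ?B])
 show "?B (%x. r*.v x+s*.w x) z = r*?B v z+s*?B w z"
 if "v:S" "w:S" "z:S" for v w z r s
 using that by (simp add: inner_add_left L2_int_inner L2)
 show "|F v| <= C * sqrt (?B v v)" if "v:S" for v
 using bd[OF that] by (simp add: sq)
 qed (fact z, erule comb, simp_all add: inner_commute F)
 then obtain v where v: "!!n. v n:S"
 "!!e. e > 0 ==> EX N. ALL m>=N. ALL n>=N. ?B (%x. v m x-v n x) (%x. v m x-v n x) < e"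
 "!!w. w:S ==> (%n. ?B (v n) w) ----> F w" by blast
 have "EX g. L2_fun M g & (%n. L2n M (%x. v n x-g x)) ----> 0"
 proof (rule L2_complete[OF L2[OF v(1)]])
 fix e :: real assume "e > 0"
 then obtain N where N: "!!m n. m >= N ==> n >= N ==> (LINT x|M. (v m x-v n x).*(v m x-v n x)) < e^2"
 using v(2)[of "e^2"] by auto
 hence "L2n M (%x. v m x-v n x) < e" if "m >= N" "n >= N" for m n
 using N[OF that] \<open>e > 0\<close> by (simp add: sq[symmetric] real_less_lsqrt)
 thus "EX N. ALL m>=N. ALL n>=N. L2n M (%x. v m x-v n x) < e" by blast
 qed
 then obtain g where g: "L2_fun M g" "(%n. L2n M (%x. v n x-g x)) ----> 0" by blast
 have rep: "F w = (LINT x|M. g x.*w x)" if "w:S" for w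
 using LIMSEQ_unique[OF v(3)[OF that] L2_inner_lim[OF L2[OF v(1)] g(1) L2[OF that] g(2)]] .
 have lim1: "(%n. LINT x|M. v n x.*g x) ----> (L2n M g)^2"
 using L2_inner_lim[OF L2[OF v(1)] g(1) g(1) g(2)] by (simp add: L2n_power2 power2_norm_eq_inner)
 have "(L2n M g)^2 <= |C|*L2n M g"
 proof (rule LIMSEQ_le[OF lim1 tendsto_mult_left[OF L2n_lim[OF L2[OF v(1)] g]]])
 have "(LINT x|M. v n x.*g x) <= |C|*L2n M (v n)" for n
 using rep[OF v(1)] bd[OF v(1)[of n]] rmon[OF abs_ge_self[of C] L2n_nonneg[of M "v n"]] by (simp add: inner_commute)
 thus "EX N. ALL n>=N. (LINT x|M. v n x.*g x) <= |C|*L2n M (v n)" by blast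
 qed
 hence "L2n M g <= |C|"
 using L2n_nonneg[of M g] by (cases "L2n M g = 0") (auto simp: sq2)
 thus ?thesis using g rep by blast
qed

lemma (in compact_measure) L2_cont:
 fixes f :: "'a => 'b::euclidean_space"
 assumes "cont Ga f" shows "L2_fun M f"
proof -
 obtain B where "ALL y:Ga. norm (f y) <= B" using cont_bdd[OF assms] by blast
 hence "AE x in M. norm (f x) <= B" using space_M by auto
 thus ?thesis by (rule L2_bounded(1)[OF cont_meas[OF assms]])
qed

text \<open>Open sets \<open>U\<close> around the set and \<open>V\<close> around its complement
  cover everything and overlap in small measure; a Urysohn function separating the two closed
  complements differs from the indicator only on the overlap.\<close>

lemma (in compact_measure) L2_indicator_approx:
 assumes A: "A:sets M" and e: "0 < e"
 shows "EX g::'a => real. cont Ga g & L2n M (%x. ind A x-g x) < e"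
proof -
 \<comment> \<open>Outer regularity speaks of measures on the Borel sets of the whole space, hence
   the push-forward under the inclusion.\<close>
 define N where "N = distr M borel (%x. x)"
 have m: "(%x. x):M \<rightarrow>\<^sub>M borel" by (intro cont_meas continuous_on_id)
 interpret N: finite_measure N unfolding N_def by (rule finite_measure_distr[OF m])
 have sN: "sets N = sets borel" by (simp add: N_def)
 have "A:sets (restrict_space borel Ga)" using A sets_M by simp
 then obtain B where B: "B:sets borel" "A = B Int Ga"
 using compact_imp_closed[OF compact_space] by (auto simp: sets_restrict_space_iff)
 define d where "d = e^2/3"
 have d: "d > 0" using e by (simp add: d_def)
 have reg: "EX U. open U & C <= U & measure N U < measure N C+d" if C: "C:sets borel" for C
 proof -
 have "em N C = (INF U\<in> {U. C <= U & open U}. em N U)"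
 by (rule outer_regular) (use sN N.emeasure_finite C in auto)
 moreover have "em N C < em N C+enr d"
 using d by simp
 ultimately have "(INF U\<in> {U. C <= U & open U}. em N U) < em N C+enr d" by simp
 then obtain U where U: "C <= U" "open U" "em N U < em N C+enr d"
 by (auto simp: INF_less_iff)
 hence "measure N U < measure N C+d"
 using d by (simp add: N.emeasure_eq_measure ennreal_less_iff flip: ennreal_plus)
 thus ?thesis using U by blast
 qed
 obtain U where U: "open U" "B <= U" "measure N U < measure N B+d" using reg[OF B(1)] by blast
 obtain V where V: "open V" "- B <= V" "measure N V < measure N (- B)+d" using reg[of "- B"] B(1) by auto
 have "measure N U+measure N V = measure N (U Un V)+measure N (U Int V)"
 using U V sN by (subst measure_Un3) (auto simp: N.fmeasurable_eq_sets)
 moreover have "U Un V = UNIV" using U V by auto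
 moreover have "measure N B+measure N (- B) = measure N UNIV"
 using N.finite_measure_compl[of B] B(1) sN by (simp add: N_def Compl_eq_Diff_UNIV)
 ultimately have UV: "measure N (U Int V) < 2*d" using U(3) V(3) by simp
 have "closed (- V)" "closed (- U)" "- V Int-U = {}" using U V by auto
 then obtain g :: "'a => real" where g: "cont UNIV g" "!!x. g x:closed_segment 1 0"
 "!!x. x:- V ==> g x = 1" "!!x. x:- U ==> g x = 0"
 using Urysohn[of "- V" "- U" 1 0] by metis
 have g01: "0 <= g x" "g x <= 1" for x using g(2)[of x] by (auto simp: closed_segment_eq_real_ivl)
 have gc: "cont Ga g" using g(1) continuous_on_subset by blast
 have pt: "(ind A x-g x)^2 <= ind (U Int V) x" if "x:Ga" for x
 proof (cases "x:U Int V")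
 case True
 have "|ind A x-g x| <= 1" using g01[of x] by (auto simp: indicator_def)
 thus ?thesis using True by (simp add: abs_square_le_1)
 next
 case False
 thus ?thesis using that g(3)[of x] g(4)[of x] B(2) U(2) V(2) by (auto simp: indicator_def)
 qed
 have f2: "L2_fun M (%x. ind A x-g x)"
 using A by (intro L2_diff L2_cont[OF gc] L2_bounded(1)[where B = 1]) (auto simp: indicator_def)
 have "(L2n M (%x. ind A x-g x))^2 <= (LINT x|M. ind (U Int V) x)"
 unfolding L2n_power2
 proof (rule integral_mono)
 show "integrable M (ind (U Int V) :: 'a => real)"
 using measurable_sets[OF m, of "U Int V"] U V by (subst integrable_indicator_iff) (auto simp: Int_commute less_top[symmetric])
 qed (use L2_funD[OF f2] pt space_M in auto)
 also have "... = measure N (U Int V)"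
 using U V by (simp add: N_def measure_distr[OF m])
 finally have "(L2n M (%x. ind A x-g x))^2 < e^2" using UV zero_less_power[OF e, of 2] unfolding d_def by linarith
 hence "L2n M (%x. ind A x-g x) < e" using e by (simp add: power2_less_imp_less)
 thus ?thesis using gc by blast
qed

lemma (in compact_measure) L2_cont_dense:
 fixes f :: "'a => real"
 assumes f: "L2_fun M f" and e: "0 < e"
 shows "EX g. cont Ga g & L2n M (%x. f x-g x) < e"
proof -
 define D where "D h \<longleftrightarrow> L2_fun M h & (ALL e>0. EX g. cont Ga g & L2n M (%x. h x-g x) < e)" for h :: "'a => real"
 have D0: "D (%x. 0)" unfolding D_def
 by (auto simp: L2_zero L2_norm_def intro!: exI[of _ "%x. 0"])
 have Dadd: "D (%x. h x+k x)" if hD: "D h" and kD: "D k" for h k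
 unfolding D_def
 proof (intro conjI allI impI)
 show "L2_fun M (%x. h x+k x)" using hD kD by (auto simp: D_def intro: L2_add)
 fix e :: real assume "e > 0"
 hence e2: "e/2 > 0" by simp
 obtain g where g1: "cont Ga g" "L2n M (%x. h x-g x) < e/2"
 using hD e2 unfolding D_def by blast
 obtain g' where g2: "cont Ga g'" "L2n M (%x. k x-g' x) < e/2"
 using kD e2 unfolding D_def by blast
 note g = g1 g2
 have "L2_fun M (%x. h x-g x)" "L2_fun M (%x. k x-g' x)"
 using hD kD L2_cont[OF g(1)] L2_cont[OF g(3)] by (auto simp: D_def intro!: L2_diff)
 hence "L2n M (%x. (h x-g x)+(k x-g' x)) < e"
 using L2n_add[of M "%x. h x-g x" "%x. k x-g' x"] g(2,4) by simp
 hence "L2n M (%x. (h x+k x)-(g x+g' x)) < e" by (simp add: algebra_simps)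
 thus "EX g. cont Ga g & L2n M (%x. h x+k x-g x) < e"
 using g by (intro exI[of _ "%x. g x+g' x"]) (auto intro: continuous_on_add)
 qed
 have Dind: "D (%x. c*ind A x)" if A: "A:sets M" for A c
 unfolding D_def
 proof (intro conjI allI impI)
 show "L2_fun M (%x. c*ind A x)"
 using A by (intro L2_bounded(1)[where B = "|c|"]) (auto simp: indicator_def)
 fix e :: real assume "e > 0"
 hence "0 < e/( |c| + 1)" by simp
 then obtain g :: "'a => real" where g: "cont Ga g"
 "L2n M (%x. ind A x-g x) < e/( |c| + 1)"
 using L2_indicator_approx[OF A, of "e/( |c| + 1)"] by metis
 have "L2n M (%x. c*(ind A x-g x)) <= ( |c| + 1)*L2n M (%x. ind A x-g x)"
 unfolding L2n_cmult by (intro rmon L2n_nonneg) simp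
 also have "... < e" using g(2) by (simp add: pos_less_divide_eq mult.commute add_nonneg_pos)
 finally show "EX g. cont Ga g & L2n M (%x. c*ind A x-g x) < e"
 using g(1) by (intro exI[of _ "%x. c*g x"]) (auto intro: continuous_on_mult_left simp: right_diff_distrib)
 qed
 have Dsum: "D (%x. SUM i:I. h i x)" if "finite I" "!!i. i:I ==> D (h i)" for I and h :: "real => 'a => real"
 using that by (induction I rule: finite_induct) (auto intro: Dadd simp: D0)
 have Dsimple: "EX g. cont Ga g & L2n M (%x. s x-g x) < e" if s: "simple_function M s" and e: "e > 0" for s :: "'a => real" and e :: real
 proof -
 have "D (%x. SUM y:s ` space M. y*ind (s -` {y} Int space M) x)"
 using s by (intro Dsum Dind) (auto simp: simple_function_def)
 then obtain g where g: "cont Ga g"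
 "L2n M (%x. (SUM y:s ` space M. y*ind (s -` {y} Int space M) x)-g x) < e"
 using e unfolding D_def by blast
 have "L2n M (%x. (SUM y:s ` space M. y*ind (s -` {y} Int space M) x)-g x) = L2n M (%x. s x-g x)"
 unfolding L2_norm_def
 by (intro arg_cong[of _ _ sqrt] icong)
 (subst simple_function_indicator_representation_banach[OF s], auto simp: mult.commute)
 thus ?thesis using g by auto
 qed
 obtain s where s: "!!i. simple_function M (s i)" "!!x. x:space M ==> (%i. s i x) ----> f x"
 "!!i x. x:space M ==> norm (s i x) <= 2*norm (f x)"
 using borel_measurable_implies_sequence_metric[OF L2_funD(1)[OF f], of 0] unfolding norm_conv_dist by metis
 have sm: "s i:bmeas M" for i using s(1) by (rule borel_measurable_simple_function)
 have sL: "L2_fun M (s i)" for i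
 by (rule L2_bound[OF f sm, of i 2]) (use s(3) in auto)
 have "(%i. LINT x|M. (norm (f x-s i x))^2) ----> (LINT x|M. 0)"
 proof (rule integral_dominated_convergence[where w = "%x. 9*(norm (f x))^2"])
 show "AE x in M. (%i. (norm (f x-s i x))^2) ----> 0"
 proof (rule AE_I2)
 fix x assume "x:space M"
 hence "(%i. (norm (f x-s i x))^2) ----> (norm (f x-f x))^2"
 by (intro tendsto_intros s(2))
 thus "(%i. (norm (f x-s i x))^2) ----> 0" by simp
 qed
 show "AE x in M. norm ((norm (f x-s i x))^2) <= 9*(norm (f x))^2" for i
 proof (rule AE_I2)
 fix x assume "x:space M"
 hence "norm (f x-s i x) <= 3*norm (f x)"
 using s(3)[of x i] by simp
 hence "(norm (f x-s i x))^2 <= (3*norm (f x))^2" by (rule power_mono) simp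
 thus "norm ((norm (f x-s i x))^2) <= 9*(norm (f x))^2" by simp
 qed
 qed (use L2_funD[OF f] sm in auto)
 hence "eventually (%i. (LINT x|M. (norm (f x-s i x))^2) < (e/2)^2) sequentially"
 by (rule order_tendstoD) (use e in simp)
 then obtain i where "(L2n M (%x. f x-s i x))^2 < (e/2)^2"
 unfolding L2n_power2 eventually_sequentially by auto
 hence i: "L2n M (%x. f x-s i x) < e/2" by (rule power2_less_imp_less) (use e in simp)
 obtain g where g: "cont Ga g" "L2n M (%x. s i x-g x) < e/2"
 using Dsimple[OF s(1)] e half_gt_zero by blast
 have "L2n M (%x. f x-g x) < e"
 using L2n_diff_triangle[OF f sL[of i] L2_cont[OF g(1)]] i g(2) by simp
 thus ?thesis using g(1) by blast
qed

section \<open>Closest point projection and tangent spaces\<close>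

locale closest_point_tube =
 fixes Ga :: "(real^'k) set" and de :: real
 assumes compact: "compact Ga" and nonempty: "Ga ~= {}" and de: "0 < de"
 and smooth_cp: "smooth_closest_point Ga de"
begin

abbreviation cp :: "real^'k => real^'k" where "cp \<equiv> closest_point Ga"

abbreviation tube :: "(real^'k) set" where "tube \<equiv> tubular Ga de"
abbreviation (input) "TS \<equiv> tangent_space Ga"
abbreviation (input) "dv \<equiv> surface_div Ga"
abbreviation (input) "tf \<equiv> smooth_tangent_field Ga"
abbreviation (input) "smT \<equiv> smooth_on tube"

text \<open>On \<open>Ga\<close> this is the orthogonal projection onto the tangent space
  (\<open>tangent_proj_eq\<close>). The derivative of p extends that projection smoothly to the
  tube; idempotency is claimed on \<open>Ga\<close> only.\<close>

definition dcp :: "real^'k => real^'k => real^'k" where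
 "dcp x = FD cp x"

lemma closed: "closed Ga"
 by (rule compact_imp_closed[OF compact])

lemma op_tube: "open tube"
proof -
 have "tube = (%x. infdist x Ga) -` {..<de}" by (auto simp: tubular_def)
 thus ?thesis
 by (simp only:) (intro open_vimage continuous_on_infdist continuous_on_id open_lessThan)
qed

lemma sub_tb: "Ga <= tube"
 using de by (auto simp: tubular_def)

lemma cp_in: "cp x:Ga"
 by (rule closest_point_in_set[OF closed nonempty])

lemma cp_self: "x:Ga ==> cp x = x"
 by (rule closest_point_self)

lemma cp_le: "y:Ga ==> dist x (cp x) <= dist x y"
 by (rule closest_point_le[OF closed])

lemma sm_cp: "smT cp"
 using smooth_cp by (simp add: smooth_closest_point_def)

lemma cp_der: "x:tube ==> (cp has_derivative dcp x) (at x)"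
 unfolding dcp_def by (rule sm_der[OF sm_cp])

lemma lin_dcp: "x:tube ==> linear (dcp x)"
 using cp_der has_derivative_linear by blast

lemma cp_line_der:
 assumes "q:Ga" shows "((%t. cp (q+t*.w)) has_vector_derivative dcp q w) (at 0)"
proof -
 have q: "q+0*.w:tube" using assms sub_tb by auto
 have "((%t::real. q+t*.w) has_derivative (%t. t*.w)) (at 0)"
 by (auto intro!: derivative_eq_intros)
 from has_derivative_compose[OF this cp_der[OF q]]
 have "((%t. cp (q+t*.w)) has_derivative (%t. dcp q (t*.w))) (at 0)" by simp
 moreover have "dcp q (t*.w) = t*.dcp q w" for t
 using linear_cmul[OF lin_dcp] assms sub_tb by blast
 ultimately show ?thesis by (simp add: has_vector_derivative_def)
qed

lemma dcp_in_tsp: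
 assumes "q:Ga" shows "dcp q w:TS q"
 unfolding tangent_space_def using cp_line_der[OF assms, of w] cp_in cp_self[OF assms] by (auto intro!: exI[of _ "%t. cp (q+t*.w)"])

text \<open>Both sides are the derivative of one and the same function of \<open>t\<close> along a
  curve in \<open>Ga\<close>. So tangential derivatives depend only on the values on
  \<open>Ga\<close>.\<close>

lemma der_on_tangent:
 fixes f g :: "real^'k => 'b::real_normed_vector"
 assumes "w:TS q" "(f has_derivative f') (at q)" "(g has_derivative g') (at q)"
 and "!!x. x:Ga ==> f x = g x"
 shows "f' w = g' w"
proof -
 obtain ga where ga: "!!t::real. ga t:Ga" "ga 0 = q" "(ga has_vector_derivative w) (at 0)"
 using assms(1) by (auto simp: tangent_space_def)
 have der: "((%t. h (ga t)) has_vector_derivative h' w) (at 0)" if "(h has_derivative h') (at q)"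
 for h :: "real^'k => 'b" and h'
 proof -
 have "((%t. h (ga t)) has_derivative (%t. h' (t*.w))) (at 0)"
 by (rule has_derivative_compose[OF ga(3)[unfolded has_vector_derivative_def]]) (use that ga(2) in simp)
 thus ?thesis
 using linear_cmul[OF has_derivative_linear[OF that]] by (simp add: has_vector_derivative_def)
 qed
 have "(%t. f (ga t)) = (%t. g (ga t))" using assms(4) ga(1) by auto
 thus ?thesis using der[OF assms(2)] der[OF assms(3)] vector_derivative_unique_at by metis
qed

lemma dcp_tangent:
 assumes "q:Ga" "w:TS q" shows "dcp q w = w"
 using der_on_tangent[OF assms(2) cp_der has_derivative_ident] assms(1) sub_tb cp_self by blast

lemma dcp_idem: "q:Ga ==> dcp q (dcp q w) = dcp q w"
 using dcp_tangent dcp_in_tsp by blast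

lemma tsp_iff: "q:Ga ==> w:TS q \<longleftrightarrow> dcp q w = w"
 using dcp_tangent dcp_in_tsp by metis

text \<open>The point \<open>q\<close> competes with p in the closest point problem for
  \<open>q + t w\<close>, so the distance to the projection is at most \<open>|t|\<close> times the
  norm of \<open>w\<close>; divide by \<open>t\<close> and let it tend to 0.\<close>

lemma norm_diff_dcp:
 assumes "q:Ga" shows "norm (w-dcp q w) <= norm w"
proof -
 let ?F = "%t. (q+t*.w)-cp (q+t*.w)"
 have "(?F has_vector_derivative w-dcp q w) (at 0)"
 by (intro has_vector_derivative_diff cp_line_der[OF assms]) (auto intro!: derivative_eq_intros)
 hence "((%t. norm (?F (0+t)-?F 0-t*.(w-dcp q w))/norm t) \<longlongrightarrow> 0) (at 0)"
 unfolding has_vector_derivative_def has_derivative_at by blast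
 moreover have "eventually (%t. norm (w-dcp q w)-norm w <=
 norm (?F (0+t)-?F 0-t*.(w-dcp q w))/norm t) (at 0)"
 proof (rule eventually_at_filter[THEN iffD2], rule always_eventually, intro allI impI)
 fix t :: real assume t: "t ~= 0"
 have "norm (?F t) <= |t|*norm w"
 using cp_le[OF assms, of "q+t*.w"] by (simp add: dist_norm)
 hence "|t|*norm (w-dcp q w)-|t|*norm w <= norm (?F t-t*.(w-dcp q w))"
 using norm_triangle_ineq3[of "?F t" "t*.(w-dcp q w)"] unfolding norm_scaleR by simp
 hence "|t|*(norm (w-dcp q w)-norm w) <= norm (?F t-t*.(w-dcp q w))"
 by (simp add: right_diff_distrib)
 thus "norm (w-dcp q w)-norm w <= norm (?F (0+t)-?F 0-t*.(w-dcp q w))/norm t"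
 using t cp_self[OF assms] by (simp add: pos_le_divide_eq mult.commute)
 qed
 ultimately have "norm (w-dcp q w)-norm w <= 0" by (rule tendsto_lowerbound) simp
 thus ?thesis by simp
qed

text \<open>An idempotent map P with |w - P w| <= |w| is an orthogonal projection: for
  \<open>n\<close> in the kernel and \<open>a\<close> in the range, applying the inequality to
  \<open>n + t a\<close> gives |n| <= |n + t a| for all \<open>t\<close>, which forces
  \<open>n\<close> and \<open>a\<close> to be orthogonal.\<close>

lemma dcp_orthogonal:
 assumes q: "q:Ga" shows "(w-dcp q w).*dcp q v = 0"
proof -
 have qt: "q:tube" using q sub_tb by blast
 define n where "n = w-dcp q w"
 define a where "a = dcp q v"
 have n0: "dcp q n = 0" by (simp add: n_def linear_diff[OF lin_dcp[OF qt]] dcp_idem[OF q])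
 have aa: "dcp q a = a" by (simp add: a_def dcp_idem[OF q])
 have "0 <= 0+2*t*(n.*a)+t^2*(norm a)^2" for t
 proof -
 have "dcp q (n+t*.a) = t*.a"
 using n0 aa by (simp add: linear_add[OF lin_dcp[OF qt]] linear_cmul[OF lin_dcp[OF qt]])
 hence "norm n <= norm (n+t*.a)" using norm_diff_dcp[OF q, of "n+t*.a"] by simp
 hence "(norm n)^2 <= (norm (n+t*.a))^2" by simp
 thus ?thesis by (simp add: norm_lincomb2[of 1 n t, simplified])
 qed
 hence "(n.*a)^2 <= 0*(norm a)^2" by (rule discriminant) simp
 thus ?thesis by (simp add: n_def a_def)
qed

lemma dcp_sym:
 assumes q: "q:Ga" shows "dcp q v.*w = v.*dcp q w"
 using dcp_orthogonal[OF q, of w v] dcp_orthogonal[OF q, of v w] by (simp add: inner_diff_left inner_commute[of "dcp q v"] inner_commute[of v])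

lemma tangent_proj_eq:
 assumes q: "q:Ga" shows "tangent_proj Ga q = dcp q"
proof
 fix w
 show "tangent_proj Ga q w = dcp q w"
 unfolding orth_proj_def
 proof (rule the_equality)
 show "dcp q w:TS q & (ALL z:TS q. orthogonal (w-dcp q w) z)"
 using dcp_in_tsp[OF q] dcp_orthogonal[OF q, of w] dcp_tangent[OF q] by (auto simp: orthogonal_def) metis
 fix y assume y: "y:TS q & (ALL z:TS q. orthogonal (w-y) z)"
 hence yy: "dcp q y = y" using dcp_tangent[OF q] by blast
 have "dcp q w-y = dcp q (w-y)"
 using yy linear_diff[OF lin_dcp] q sub_tb by auto
 hence t: "dcp q w-y:TS q" using dcp_in_tsp[OF q] by metis
 have "(w-y).*(dcp q w-y) = 0" using y t by (auto simp: orthogonal_def)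
 moreover have "(w-dcp q w).*(dcp q w-y) = 0"
 using dcp_orthogonal[OF q, of w "dcp q w-y"] dcp_tangent[OF q t] by simp
 ultimately have "(dcp q w-y).*(dcp q w-y) = 0"
 by (simp add: inner_diff_left)
 thus "y = dcp q w" by simp
 qed
qed

subsection \<open>Tangential derivatives\<close>

text \<open>The projected coordinate vectors, a global redundant frame of the tangent spaces.
  Derivatives along them are the Cartesian components of the tangential gradient, so charts are
  avoided in all differential identities.\<close>

definition fr :: "'k => real^'k => real^'k" where
 "fr i x = dcp x (axis i 1)"

definition td :: "'k => (real^'k => real) => 'k fn" where
 "td i f x = FD f x (fr i x)"

definition tg :: "(real^'k => real) => real^'k => real^'k" where
 "tg f x = (\<chi> i. td i f x)"

lemma sm_fr: "smT (fr i)"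
proof -
 have "fr i = pd cp (axis i 1)" by (simp add: fun_eq_iff fr_def dcp_def)
 thus ?thesis using sm_pdiff_field[OF op_tube sm_cp sm_const] by metis
qed

lemma sm_td:
 assumes "smT f" shows "smT (td i f)"
proof -
 have "td i f = (%x. FD f x (fr i x))" by (simp add: fun_eq_iff td_def)
 thus ?thesis using sm_pdiff_field[OF op_tube assms sm_fr] by metis
qed

lemma frame_tangent: "q:Ga ==> fr i q:TS q"
 by (simp add: fr_def dcp_in_tsp)

lemma dcp_frame: "q:Ga ==> dcp q (fr i q) = fr i q"
 using frame_tangent dcp_tangent by blast

lemma dcp_expand:
 assumes "q:tube" shows "dcp q w = (SUM i:UNIV. (w $ i)*.fr i q)"
proof -
 have "dcp q w = dcp q (SUM i:UNIV. (w $ i)*.axis i 1)"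
 by (simp add: basis_expansion[of w, unfolded scalar_mult_eq_scaleR])
 thus ?thesis by (simp only: linear_sum[OF lin_dcp[OF assms]] linear_cmul[OF lin_dcp[OF assms]] fr_def)
qed

lemma inner_frame: "q:Ga ==> w.*fr i q = dcp q w $ i"
 by (simp add: fr_def dcp_sym[symmetric] inner_axis)

lemma tgrad_inner:
 assumes f: "smT f" and q: "q:Ga"
 shows "tg f q.*w = FD f q (dcp q w)"
proof -
 have qt: "q:tube" using q sub_tb by blast
 show ?thesis
 unfolding dcp_expand[OF qt]
 by (simp add: tg_def td_def inner_vec_def linear_sum[OF sm_lin_der[OF f qt]]
 linear_cmul[OF sm_lin_der[OF f qt]] mult.commute)
qed

lemma tgrad_tangent:
 assumes f: "smT f" and q: "q:Ga" shows "dcp q (tg f q) = tg f q"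
proof -
 have "(dcp q (tg f q)-tg f q).*w = 0" for w
 using tgrad_inner[OF f q, of w] tgrad_inner[OF f q, of "dcp q w"] dcp_idem[OF q] by (simp add: inner_diff_left dcp_sym[OF q])
 thus ?thesis by (metis inner_eq_zero_iff eq_iff_diff_eq_0)
qed

lemma tder_cong:
 assumes "smT f" "smT g" "!!x. x:Ga ==> f x = g x" "q:Ga"
 shows "td i f q = td i g q"
 unfolding td_def
 by (rule der_on_tangent[OF frame_tangent[OF assms(4)] sm_der[OF assms(1)]
 sm_der[OF assms(2)]]) (use assms(3,4) sub_tb in auto)

lemma tder_add:
 "smT f ==> smT g ==> x:tube ==> td i (%x. f x+g x) x = td i f x+td i g x"
 unfolding td_def by (rule pdiff_eqI[OF has_derivative_add]) (rule sm_der, assumption+)+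

lemma tder_mult:
 "smT f ==> smT g ==> x:tube ==>
 td i (%x. f x*g x) x = f x*td i g x+td i f x*g x"
 unfolding td_def by (rule pdiff_eqI[OF has_derivative_mult]) (rule sm_der, assumption+)+

lemma tder_const: "td i (%x. c) x = 0"
 unfolding td_def by simp

lemma sdiv_eq:
 assumes "q:Ga"
 shows "dv X q = (SUM j:UNIV. FD X q (fr j q) $ j)"
 by (simp add: surface_div_def tangent_proj_eq[OF assms] trace_def matrix_def fr_def)

lemma sdiv_scaleR:
 assumes f: "smT f" and X: "smooth_on S X" and q: "q:Ga" "q:S"
 and tan: "X q:TS q"
 shows "dv (%x. f x*.X x) q = f q * dv X q+frechet_derivative f (at q) (X q)"
proof -
 have qt: "q:tube" using q(1) sub_tb by blast
 have "pd (%x. f x*.X x) w q = f q*.pd X w q+pd f w q*.X q" for w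
 by (rule pdiff_eqI[OF has_derivative_scaleR[OF sm_der[OF f qt] sm_der[OF X q(2)]]])
 hence "dv (%x. f x*.X x) q =
 f q * dv X q+(SUM j:UNIV. pd f (fr j q) q*X q $ j)"
 by (simp add: sdiv_eq[OF q(1)] sum.distrib sum_distrib_left)
 also have "(SUM j:UNIV. pd f (fr j q) q*X q $ j) = tg f q.*X q"
 by (simp add: tg_def td_def inner_vec_def)
 also have "... = FD f q (X q)"
 using tgrad_inner[OF f q(1)] dcp_tangent[OF q(1) tan] by simp
 finally show ?thesis .
qed

text \<open>That \<open>[X\<^sub>i, X\<^sub>j]\<close> is tangential is seen by applying it to the components of
 \<open>x - p(x)\<close>, which vanish on \<open>Ga\<close>.\<close>

lemma tder_commutator:
 obtains Z where "!!i j q. q:Ga ==> Z i j q:TS q"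
 and "!!i j. cont Ga (Z i j)"
 and "!!i j f q. smT f ==> q:Ga ==>
 td i (td j f) q-td j (td i f) q = FD f q (Z i j q)"
proof
 \<comment> \<open>The Lie bracket of \<open>fr i\<close> and \<open>fr j\<close>. The second order
   terms of the two iterated derivatives cancel by symmetry of second derivatives, leaving a first
   order operator.\<close>
 define Z where "Z i j q = FD (fr j) q (fr i q)-frechet_derivative (fr i) (at q) (fr j q)" for i j q
 have expand: "td i (td j f) q = (SUM a:Basis. SUM b:Basis. (fr i q.*b)*(fr j q.*a)*pd (pd f a) b q)
 + FD f q (FD (fr j) q (fr i q))"
 if f: "smT f" and q: "q:tube" for i j f q
 proof -
 have lin: "pd g w x = (SUM a:Basis. (w.*a)*pd g a x)" if "smT g" "x:tube" for g :: "'k fn" and w x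
 proof -
 have "pd g w x = pd g (SUM a:Basis. (w.*a)*.a) x" by (simp add: euclidean_representation)
 thus ?thesis by (simp only: linear_sum[OF sm_lin_der[OF that]]
 linear_cmul[OF sm_lin_der[OF that]] real_scaleR_def)
 qed
 have fa: "smT (pd f a)" for a by (rule sm_pdiff_field[OF op_tube f sm_const])
 have d1: "((%x. fr j x.*a) has_derivative (%w. FD (fr j) q w.*a)) (at q)" for a
 by (intro has_derivative_inner_left sm_der[OF sm_fr q])
 have "((%x. SUM a:Basis. (fr j x.*a)*pd f a x) has_derivative
 (%w. SUM a:Basis. (fr j q.*a)*pd (pd f a) w q +
 (FD (fr j) q w.*a)*pd f a q)) (at q)"
 by (intro has_derivative_sum has_derivative_mult[OF d1 sm_der[OF fa q]])
 hence "(td j f has_derivative (%w. SUM a:Basis. (fr j q.*a)*pd (pd f a) w q +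
 (FD (fr j) q w.*a)*pd f a q)) (at q)"
 by (rule has_derivative_transform_within_open[OF _ op_tube q]) (simp add: td_def lin[OF f])
 hence "td i (td j f) q = (SUM a:Basis. (fr j q.*a)*pd (pd f a) (fr i q) q +
 (FD (fr j) q (fr i q).*a)*pd f a q)"
 unfolding td_def[of i] by (rule pdiff_eqI)
 also have "... = (SUM a:Basis. (fr j q.*a)*(SUM b:Basis. (fr i q.*b)*pd (pd f a) b q)) +
 FD f q (FD (fr j) q (fr i q))"
 by (simp only: sum.distrib lin[OF fa q, of _ "fr i q"] lin[OF f q, of "FD (fr j) q (fr i q)"])
 finally show ?thesis by (simp add: sum_distrib_left mult_ac)
 qed
 show com: "td i (td j f) q-td j (td i f) q = FD f q (Z i j q)"
 if f: "smT f" and q: "q:Ga" for i j f q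
 proof -
 have qt: "q:tube" using q sub_tb by blast
 have "(SUM a:Basis. SUM b:Basis. (fr i q.*b)*(fr j q.*a)*pd (pd f a) b q) =
 (SUM b:Basis. SUM a:Basis. (fr j q.*a)*(fr i q.*b)*pd (pd f b) a q)"
 by (subst sum.swap) (simp add: pdiff_commute[OF op_tube f qt] mult_ac)
 thus ?thesis
 unfolding expand[OF f qt, of i j] expand[OF f qt, of j i] Z_def
 by (simp add: linear_diff[OF sm_lin_der[OF f qt]])
 qed
 show "cont Ga (Z i j)" for i j
 unfolding Z_def
 by (intro continuous_on_diff continuous_on_subset[OF sm_cont sub_tb]
 sm_pdiff_field[OF op_tube] sm_fr)
 show "Z i j q:TS q" if q: "q:Ga" for i j q
 proof -
 have qt: "q:tube" using q sub_tb by blast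
 have "dcp q (Z i j q) $ l = Z i j q $ l" for l
 proof -
 define f where "f x = (x-cp x) $ l" for x
 have f: "smT f" unfolding f_def
 by (intro sm_lin_comp[OF op_tube bounded_linear_vec_nth]
 sm_diff[OF op_tube sm_ident sm_cp])
 have 0: "td i (td j f) q = 0" for i j
 proof -
 have "td j f x = 0" if "x:Ga" for x j
 using tder_cong[OF f sm_const[of _ 0] _ that, of j] cp_self by (auto simp: f_def tder_const)
 hence "td i (td j f) q = td i (%x. 0) q"
 by (intro tder_cong[OF sm_td[OF f] sm_const _ q])
 thus ?thesis by (simp add: tder_const)
 qed
 have "(f has_derivative (%w. (w-dcp q w) $ l)) (at q)" unfolding f_def
 by (intro bounded_linear.has_derivative[OF bounded_linear_vec_nth] has_derivative_diff
 has_derivative_ident cp_der[OF qt])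
 hence "FD f q (Z i j q) = (Z i j q-dcp q (Z i j q)) $ l"
 by (rule pdiff_eqI)
 thus ?thesis using com[OF f q, of i j] 0 by simp
 qed
 thus ?thesis using tsp_iff[OF q] by (simp add: vec_eq_iff)
 qed
qed

end

section \<open>Determinants near the identity and Gram determinants\<close>

lemma prod_near_one:
 fixes a :: "'i => real"
 assumes "finite I" "0 <= e" "e <= 1" "!!i. i:I ==> |a i| <= e"
 shows "|(PROD i:I. 1+a i)-1-(SUM i:I. a i)| <= 3^card I*e^2"
 using assms(1,4)
proof (induction I rule: finite_induct)
 case empty thus ?case by simp
next
 case (insert j I)
 define r where "r = (PROD i:I. 1+a i)-1-(SUM i:I. a i)"
 define S where "S = (SUM i:I. a i)"
 have r: "|r| <= 3^card I*e^2" using insert by (simp add: r_def)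
 have S: "|S| <= real (card I)*e"
 unfolding S_def using sum_norm_le[of I a "%_. e"] insert.prems by simp
 have aj: "|a j| <= e" using insert.prems by simp
 have "|S*a j| <= (real (card I)*e)*e"
 unfolding abs_mult by (rule mult_mono[OF S aj]) (use assms(2) in auto)
 moreover have "|r*(1+a j)| <= (3^card I*e^2)*2"
 unfolding abs_mult by (rule mult_mono[OF r]) (use aj assms(3) in auto)
 \<comment> \<open>With this the two error terms, \<open>card I\<close> and twice
   \<open>3^card I\<close>, add up to the next power of 3.\<close>
 moreover have "real (card I)*e^2 <= 3^card I*e^2"
 proof (rule rmon)
 have "card I < 3^card I" by (induction "card I") (auto intro: less_exp[THEN less_le_trans])
 thus "real (card I) <= 3^card I" by simp
 qed simp
 moreover have "(PROD i:insert j I. 1+a i)-1-(SUM i:insert j I. a i) = S*a j+r*(1+a j)"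
 using insert.hyps by (simp add: r_def S_def algebra_simps)
 ultimately show ?case using insert.hyps by (simp add: sq2)
qed

text \<open>In the Leibniz formula every permutation other than the identity moves at least two
  indices and therefore contributes two off-diagonal factors of size \<open>e\<close>; the identity
  is treated by \<open>prod_near_one\<close>.\<close>

lemma det_near_identity:
 "EX C>=0. ALL (N :: real^'n^'n) e. 0 <= e --> e <= 1 --> (ALL i j. |N $ i $ j| <= e) -->
 |det (mat 1+N)-1-trace N| <= C*e^2"
proof -
 let ?P = "{p. p permutes (UNIV :: 'n set)}"
 define C where "C = (3^CARD('n)+real (card ?P)*2^CARD('n) :: real)"
 have fin: "finite ?P" by simp
 have "|det (mat 1+N)-1-trace N| <= C*e^2"
 if e: "0 <= e" "e <= 1" and N: "!!i j. |N $ i $ j| <= e" for N :: "real^'n^'n" and e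
 proof -
 let ?A = "mat 1+N"
 let ?t = "%p. of_int (sign p)*(PROD i:UNIV. ?A $ i $ p i) :: real"
 have other: "|?t p| <= 2^CARD('n)*e^2" if p: "p : ?P" "p ~= id" for p
 proof -
 obtain i where i: "p i ~= i" using p(2) by (auto simp: fun_eq_iff)
 define j where "j = p i"
 have ij: "i ~= j" "p j ~= j"
 using i p(1) by (auto simp: j_def dest: permutes_inj[THEN injD])
 have off: "|?A $ l $ p l| <= e" if "p l ~= l" for l
 using N[of l "p l"] that by (simp add: mat_def)
 have two: "|?A $ l $ p l| <= 2" for l
 using N[of l "p l"] e by (auto simp: mat_def)
 have "(PROD l:UNIV. ?A $ l $ p l) = (?A $ i $ p i)*((?A $ j $ p j)*(PROD l:UNIV - {i} - {j}. ?A $ l $ p l))"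
 using ij by (subst prod.remove[of _ i], simp, simp, subst prod.remove[of _ j]) auto
 hence "|?t p| = |?A $ i $ p i|*( |?A $ j $ p j|*(PROD l:UNIV - {i} - {j}. |?A $ l $ p l| ))"
 by (simp add: abs_mult abs_prod sign_def)
 also have "... <= e*(e*(PROD l:UNIV - {i} - {j}. 2))"
 by (intro mult_mono prod_mono mult_nonneg_nonneg prod_nonneg) (use off[OF i] off[OF ij(2)] two e in auto)
 also have "... = 2^card (UNIV - {i} - {j})*e^2" by (simp add: sq2)
 also have "... <= 2^CARD('n)*e^2"
 by (intro rmon power_increasing card_mono) auto
 finally show ?thesis .
 qed
 have idin: "id : ?P" by simp
 have "det ?A = ?t id+(SUM p:?P - {id}. ?t p)"
 unfolding det_def using fin idin by (rule sum.remove)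
 moreover have "?t id = (PROD i:UNIV. 1+N $ i $ i)" by (simp add: mat_def)
 ultimately have "det ?A-1-trace N =
 ((PROD i:UNIV. 1+N $ i $ i)-1-(SUM i:UNIV. N $ i $ i))+(SUM p:?P - {id}. ?t p)"
 by (simp add: trace_def)
 also have "|...| <= |(PROD i:UNIV. 1+N $ i $ i)-1-(SUM i:UNIV. N $ i $ i)| + |SUM p:?P - {id}. ?t p|"
 by simp
 also have "... <= 3^CARD('n)*e^2+real (card ?P)*(2^CARD('n)*e^2)"
 proof (rule add_mono)
 show "|(PROD i:UNIV. 1+N $ i $ i)-1-(SUM i:UNIV. N $ i $ i)| <= 3^CARD('n)*e^2"
 by (rule prod_near_one) (use e N in auto)
 have "|SUM p:?P - {id}. ?t p| <= (SUM p:?P - {id}. |?t p| )" by simp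
 also have "... <= real (card (?P - {id}))*(2^CARD('n)*e^2)"
 by (rule sum_bounded_above) (use other in auto)
 also have "... <= real (card ?P)*(2^CARD('n)*e^2)"
 by (intro rmon) (use fin in \<open>auto intro: card_mono\<close>)
 finally show "|SUM p:?P - {id}. ?t p| <= real (card ?P)*(2^CARD('n)*e^2)" .
 qed
 also have "... = C*e^2" by (simp add: C_def algebra_simps)
 finally show ?thesis .
 qed
 moreover have "C >= 0" by (simp add: C_def)
 ultimately show ?thesis by blast
qed

definition gram :: "(real^'d => real^'k) => real" where
 "gram f = det (transpose (matrix f) ** matrix f)"

lemma adens_gram: "adens ph y = sqrt (gram (FD ph y))"
 by (simp add: area_density_def gram_def Let_def)

lemma gram_matrix_nth: "(transpose (matrix f) ** matrix f) $ i $ j = f (axis i 1).*f (axis j 1)"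
 for f :: "real^'d => real^'k"
 by (simp add: matrix_matrix_mult_def transpose_def matrix_def inner_vec_def)

lemma gram_comp:
 fixes f :: "real^'d => real^'k" and R :: "real^'d => real^'d"
 assumes "linear f" "linear R" shows "gram (f \<circ> R) = gram f*(det (matrix R))^2"
proof -
 have "transpose (matrix (f \<circ> R)) ** matrix (f \<circ> R) =
 (transpose (matrix R) ** (transpose (matrix f) ** matrix f)) ** matrix R"
 by (simp add: matrix_compose[OF assms(2,1)] matrix_transpose_mul matrix_mul_assoc)
 thus ?thesis by (simp add: gram_def det_mul sq2)
qed

lemma lin_isom_inner:
 assumes "linear U" "!!x. norm (U x) = norm x" shows "U x.*U y = x.*y"
proof -
 have "(norm (U (x+y)))^2 = (norm (x+y))^2" by (simp add: assms(2))
 hence "(U x+U y).*(U x+U y) = (x+y).*(x+y)"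
 by (simp add: power2_norm_eq_inner linear_add[OF assms(1)])
 moreover have "U x.*U x = x.*x" "U y.*U y = y.*y"
 using assms(2)[of x] assms(2)[of y] by (simp_all flip: power2_norm_eq_inner)
 ultimately show ?thesis by (simp add: inner_add inner_commute)
qed

text \<open>Splitting an injective linear map into an isometry onto its range and an endomorphism
  reduces its Gram determinant to the square of an ordinary determinant.\<close>

lemma lin_inj_factor_isom:
 fixes f :: "real^'d => real^'k"
 assumes f: "linear f" "inj f"
 obtains U :: "real^'d => real^'k" and R :: "real^'d => real^'d" where
 "linear U" "!!x. norm (U x) = norm x" "range U = range f" "linear R" "f = U \<circ> R" "det (matrix R) ~= 0"
proof -
 have "subspace (range f)" using f(1) subspace_UNIV by (rule linear_subspace_image)
 moreover have "dim (UNIV :: (real^'d) set) = dim (range f)"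
 using dim_image_eq[OF f(1), of UNIV] f(2) by simp
 ultimately obtain U :: "real^'d => real^'k" and g :: "real^'k => real^'d" where U: "linear U" "linear g" "U ` UNIV = range f" "g ` range f = UNIV"
 "!!x. x:UNIV ==> norm (U x) = norm x" "!!x. x:range f ==> norm (g x) = norm x"
 "!!x. x:UNIV ==> g (U x) = x" "!!x. x:range f ==> U (g x) = x"
 by (rule isometries_subspaces[OF subspace_UNIV]) (rule that)
 have R: "linear (g \<circ> f)" using f(1) U(2) by (rule linear_compose)
 moreover have "f = U \<circ> (g \<circ> f)" using U(8) by auto
 moreover have "inj (g \<circ> f)" using f(2) U(8) by (metis (no_types, lifting) comp_apply injD injI rangeI)
 moreover have "(*v) (matrix (g \<circ> f)) = g \<circ> f" by (rule matrix_vector_mul(2)[OF R])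
 ultimately have "invertible (matrix (g \<circ> f))" and fU: "f = U \<circ> (g \<circ> f)"
 by (simp_all add: matrix_left_invertible_injective invertible_left_inverse)
 hence "det (matrix (g \<circ> f)) ~= 0" by (simp add: invertible_det_nz)
 thus ?thesis using that[of U "g \<circ> f"] U R fU by auto
qed

lemma gram_isom:
 fixes U :: "real^'d => real^'k"
 assumes "linear U" "!!x. norm (U x) = norm x" shows "gram U = 1"
proof -
 have "transpose (matrix U) ** matrix U = mat 1"
 by (simp add: vec_eq_iff gram_matrix_nth lin_isom_inner[OF assms] mat_def inner_axis_axis)
 thus ?thesis by (simp add: gram_def)
qed

lemma gram_pos:
 fixes f :: "real^'d => real^'k"
 assumes "linear f" "inj f" shows "gram f > 0"
proof -
 obtain U :: "real^'d => real^'k" and R :: "real^'d => real^'d" where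
 U: "linear U" "!!x. norm (U x) = norm x" "linear R" "f = U \<circ> R" "det (matrix R) ~= 0"
 using lin_inj_factor_isom[OF assms] by metis
 show ?thesis using U gram_comp[OF U(1,3)] gram_isom[OF U(1,2)] by simp
qed

text \<open>The area distortion of \<open>L\<close> on the plane \<open>range f\<close> is its Gram
  determinant in an orthonormal basis of that plane, whatever parametrisation \<open>f\<close> is
  used.\<close>

lemma gram_comp_frame:
 fixes f :: "real^'d => real^'k" and L :: "real^'k => real^'k"
 assumes f: "linear f" "inj f" and L: "linear L"
 obtains u :: "'d => real^'k" where "!!i. u i:range f" "!!i j. u i.*u j = (if i = j then 1 else 0)"
 "span (range u) = range f"
 "gram (L \<circ> f) = det (\<chi> i j. L (u i).*L (u j))*gram f"
proof -
 obtain U :: "real^'d => real^'k" and R :: "real^'d => real^'d" where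
 U: "linear U" "!!x. norm (U x) = norm x" "range U = range f" "linear R" "f = U \<circ> R" "det (matrix R) ~= 0"
 using lin_inj_factor_isom[OF f] by metis
 define u where "u i = U (axis i 1)" for i
 have LU: "linear (L \<circ> U)" using U(1) L by (rule linear_compose)
 have gf: "gram f = (det (matrix R))^2"
 using gram_comp[OF U(1,4)] U(5) gram_isom[OF U(1,2)] by simp
 have "gram (L \<circ> f) = gram ((L \<circ> U) \<circ> R)" using U(5) by (simp add: o_assoc)
 also have "... = gram (L \<circ> U)*gram f" using gram_comp[OF LU U(4)] gf by simp
 also have "gram (L \<circ> U) = det (\<chi> i j. L (u i).*L (u j))"
 unfolding gram_def u_def by (rule arg_cong[where f = det]) (simp add: vec_eq_iff gram_matrix_nth)
 finally have "gram (L \<circ> f) = det (\<chi> i j. L (u i).*L (u j))*gram f" .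
 moreover have "range u = U ` Basis"
 by (auto simp: u_def Basis_vec_def)
 hence "span (range u) = range f"
 using linear_span_image[OF U(1), of Basis] U(3) by simp
 moreover have "u i:range f" for i unfolding u_def U(3)[symmetric] by simp
 moreover have "u i.*u j = (if i = j then 1 else 0)" for i j
 by (simp add: u_def lin_isom_inner[OF U(1,2)] inner_axis_axis)
 ultimately show ?thesis using that[of u] by blast
qed

text \<open>\<open>Q\<close> is the orthogonal projection onto the span of the frame. The identity
  turns the coordinate formula of the surface divergence into a trace over an orthonormal tangent
  basis.\<close>

lemma trace_on_frame:
 fixes L :: "real^'k => real^'k" and u :: "'d::finite => real^'k"
 assumes L: "linear L" and u: "!!i j. u i.*u j = (if i = j then 1 else 0)"
 and Q: "!!v. Q v = (SUM i:UNIV. (v.*u i)*.u i)"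
 shows "(SUM j:UNIV. L (Q (axis j 1)) $ j) = (SUM i:UNIV. u i.*L (u i))"
proof -
 have "(SUM j:UNIV. L (Q (axis j 1)) $ j) = (SUM j:UNIV. SUM i:UNIV. u i $ j*L (u i) $ j)"
 by (simp add: Q linear_sum[OF L] linear_cmul[OF L] inner_axis inner_commute[of "axis _ _"])
 also have "... = (SUM i:UNIV. u i.*L (u i))" by (subst sum.swap) (simp add: inner_vec_def)
 finally show ?thesis .
qed

lemma on_frame_expand:
 fixes u :: "'d::finite => real^'k"
 assumes u: "!!i j. u i.*u j = (if i = j then 1 else 0)" and v: "v:span (range u)"
 shows "v = (SUM i:UNIV. (v.*u i)*.u i)"
 using v
proof (induction rule: span_induct_alt)
 case base thus ?case by simp
next
 case (step c x y)
 then obtain k where k: "x = u k" by auto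
 have "c*.x = (SUM i:UNIV. ((c*.x).*u i)*.u i)"
 by (simp add: k u if_distrib[of "%d. (c*d)*._"] cong: if_cong)
 hence "c*.x+y = (SUM i:UNIV. ((c*.x).*u i)*.u i)+(SUM i:UNIV. (y.*u i)*.u i)"
 using step(2) by (rule arg_cong2[where f = "(+)"])
 thus ?case unfolding inner_add_left scaleR_add_left sum.distrib .
qed

text \<open>After squaring the defect is (1+a) a^2 (3-a) / 4, which is nonnegative up to a = 3;
  beyond that the left side is nonpositive.\<close>

lemma sqrt_lower_bound:
 fixes a :: real
 assumes a: "- 1 <= a" shows "1+a/2-a^2/2 <= sqrt (1+a)"
proof (cases "a <= 3")
 case True
 show ?thesis
 proof (rule real_le_rsqrt)
 have "(1+a/2-a^2/2)^2 = (1+a)-(1+a)*(a^2*(3-a))/4"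
 by (simp add: sq2 field_simps)
 moreover have "0 <= (1+a)*(a^2*(3-a))" using a True by simp
 ultimately show "(1+a/2-a^2/2)^2 <= 1+a" by simp
 qed
next
 case False
 hence "3*a <= a*a" by simp
 hence "1+a/2-a^2/2 <= 0" using False unfolding sq2 by linarith
 thus ?thesis using a real_sqrt_ge_zero[of "1+a"] by linarith
qed

section \<open>Charts and the surface measure\<close>

lemma lin_norm_le_sum_Basis:
 fixes A :: "'a::euclidean_space => 'b::real_normed_vector"
 assumes "linear A" shows "norm (A w) <= (SUM b:Basis. norm (A b))*norm w"
proof -
 have "A w = (SUM b:Basis. (w.*b)*.A b)"
 by (subst euclidean_representation[symmetric, of w]) (simp only: linear_sum[OF assms] linear_cmul[OF assms])
 also have "norm ... <= (SUM b:Basis. norm (A b)*norm w)"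
 by (rule sum_norm_le) (simp add: mult.commute[of "norm (A _)"] rmon Basis_le_norm)
 finally show ?thesis by (simp add: sum_distrib_right)
qed

lemma borel_image_homeo:
 fixes f :: "'a::euclidean_space => 'b::euclidean_space"
 assumes h: "homeomorphism S T f g" and T: "T:sets borel" and B: "B:sets borel" "B <= S"
 shows "f ` B:sets borel"
proof -
 have "f ` B = g -` B Int T"
 using h B(2) by (auto simp: homeomorphism_def)
 moreover have "g:bmeas (restrict_space borel T)"
 using h by (intro borel_measurable_continuous_on_restrict) (simp add: homeomorphism_def)
 hence "g -` B Int space (restrict_space borel T):sets (restrict_space borel T)"
 using B(1) by simp
 ultimately show ?thesis using T by (auto simp: sets_restrict_space_iff space_restrict_space)
qed

lemma cont_det_inner:
 fixes f :: "'i::finite => 'a::topological_space => 'b::real_inner"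
 assumes "!!i. cont S (f i)"
 shows "cont S (%x. det (\<chi> i j. f i x.*f j x))"
 unfolding det_def by (auto intro!: continuous_intros assms)

lemma adens_eq_det:
 "adens ph y = sqrt (det (\<chi> i j. pd ph (axis i 1) y.*pd ph (axis j 1) y))"
 unfolding adens_gram gram_def
 by (intro arg_cong[where f = sqrt] arg_cong[where f = det]) (simp add: vec_eq_iff gram_matrix_nth)

lemma cont_adens:
 assumes "open V" "smooth_on V ph" shows "cont V (adens ph)"
proof -
 have "cont V (%y. sqrt (det (\<chi> i j. pd ph (axis i 1) y.*pd ph (axis j 1) y)))"
 by (intro continuous_on_real_sqrt cont_det_inner sm_cont
 sm_pdiff_field[OF assms] sm_const)
 thus ?thesis by (simp add: adens_eq_det)
qed

lemma immD:
 assumes "injective_immersion V ph"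
 shows "open V" "smooth_on V ph" "inj_on ph V" "!!y. y:V ==> inj (FD ph y)"
 "!!y. y:V ==> linear (FD ph y)" "!!y. y:V ==> 0 < adens ph y"
proof -
 show 1: "open V" "smooth_on V ph" "inj_on ph V" "!!y. y:V ==> inj (FD ph y)"
 using assms by (auto simp: injective_immersion_def)
 show 2: "linear (FD ph y)" if "y:V" for y
 using sm_lin_der[OF 1(2) that] .
 show "0 < adens ph y" if "y:V" for y
 using gram_pos[OF 2[OF that] 1(4)[OF that]] by (simp add: adens_gram)
qed

text \<open>On a small ball the derivative deviates from that at \<open>y0\<close> by at most c/2,
  half its lower bound c there. So \<open>ph\<close> minus its linearisation is (c/2)-Lipschitz and
  both inequalities follow from the linear ones.\<close>

lemma immersion_bilip:
 fixes ph :: "real^'d => real^'k"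
 assumes im: "injective_immersion V ph" and y0: "y0:V"
 shows "EX r>0. EX C>=1. cball y0 r <= V &
 (ALL y:cball y0 r. ALL z:cball y0 r. norm (ph y-ph z) <= C*norm (y-z) & norm (y-z) <= C*norm (ph y-ph z)) &
 (ALL y:cball y0 r. adens ph y <= C & 1 <= C*adens ph y &
 (ALL w. norm (FD ph y w) <= C*norm w))"
proof -
 note im = immD[OF im]
 let ?D = "%y. FD ph y"
 obtain c where c: "c > 0" "!!w. c*norm w <= norm (?D y0 w)"
 using linear_inj_bounded_below_pos[OF im(5)[OF y0] im(4)[OF y0]] by blast
 obtain K0 where K0: "!!w. norm (?D y0 w) <= K0*norm w"
 using lin_norm_le_sum_Basis[OF im(5)[OF y0]] by blast
 define s where "s y = (SUM b:Basis. norm (?D y b-?D y0 b))" for y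
 have sc: "cont V s" unfolding s_def
 by (intro continuous_on_sum continuous_on_norm continuous_on_diff continuous_on_const
 sm_cont sm_pdiff_field[OF im(1,2)] sm_const)
 have "open {y:V. s y < c/2}"
 using continuous_open_preimage[OF sc im(1) open_lessThan[of "c/2"]] by (simp add: vimage_def Int_def)
 moreover have "y0:{y:V. s y < c/2}" using y0 c by (simp add: s_def)
 ultimately obtain r where r: "r > 0" "cball y0 r <= {y:V. s y < c/2}"
 using open_contains_cball by blast
 have sub: "cball y0 r <= V" using r(2) by blast
 have close: "norm (?D y w-?D y0 w) <= (c/2)*norm w" if "y:cball y0 r" for y w
 proof -
 have "linear (%w. ?D y w-?D y0 w)"
 using im(5) sub that y0 by (intro linear_compose_sub) auto
 from lin_norm_le_sum_Basis[OF this, of w]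
 have "norm (?D y w-?D y0 w) <= s y*norm w" by (simp add: s_def)
 also have "... <= (c/2)*norm w" using r(2) that by (intro rmon) auto
 finally show ?thesis .
 qed
 have diff: "norm ((ph y-?D y0 y)-(ph z-?D y0 z)) <= (c/2)*norm (y-z)"
 if "y:cball y0 r" "z:cball y0 r" for y z
 proof (rule differentiable_bound[OF convex_cball _ _ that, where f = "%y. ph y-?D y0 y"])
 fix x assume x: "x:cball y0 r"
 show "((%y. ph y-?D y0 y) has_derivative (%w. ?D x w-?D y0 w)) (at x within cball y0 r)"
 using x sub by (intro has_derivative_at_withinI[OF has_derivative_diff[OF
 sm_der[OF im(2)] linear_imp_has_derivative[OF im(5)[OF y0]]]]) blast
 show "onorm (%w. ?D x w-?D y0 w) <= c/2" by (rule onorm_le) (rule close[OF x])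
 qed
 have lin: "?D y0 y-?D y0 z = ?D y0 (y-z)" for y z by (simp add: linear_diff[OF im(5)[OF y0]])
 have up: "norm (ph y-ph z) <= (K0+c/2)*norm (y-z)"
 and low: "(c/2)*norm (y-z) <= norm (ph y-ph z)"
 if "y:cball y0 r" "z:cball y0 r" for y z
 proof -
 have *: "(ph y-?D y0 y)-(ph z-?D y0 z) = (ph y-ph z)-?D y0 (y-z)"
 by (simp add: lin[symmetric])
 have "norm (ph y-ph z) <= norm ((ph y-ph z)-?D y0 (y-z))+norm (?D y0 (y-z))"
 using norm_triangle_sub[of "ph y-ph z" "?D y0 (y-z)"] by simp
 thus "norm (ph y-ph z) <= (K0+c/2)*norm (y-z)"
 using diff[OF that] K0[of "y-z"] unfolding * by (simp add: distrib_right)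
 have "norm (?D y0 (y-z)) <= norm (ph y-ph z)+norm ((ph y-ph z)-?D y0 (y-z))"
 using norm_triangle_sub[of "?D y0 (y-z)" "ph y-ph z"] by (simp add: norm_minus_commute)
 thus "(c/2)*norm (y-z) <= norm (ph y-ph z)"
 using diff[OF that] c(2)[of "y-z"] unfolding * by simp
 qed
 have Dup: "norm (?D y w) <= (K0+c/2)*norm w" if "y:cball y0 r" for y w
 using close[OF that, of w] K0[of w] norm_triangle_sub[of "?D y w" "?D y0 w"] by (simp add: distrib_right)
 have adc: "cont (cball y0 r) (adens ph)"
 using cont_adens[OF im(1,2)] sub continuous_on_subset by blast
 obtain y1 where y1: "y1:cball y0 r" "!!y. y:cball y0 r ==> area_density ph y1 <= adens ph y"
 using continuous_attains_inf[OF compact_cball _ adc] r(1) by auto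
 obtain y2 where y2: "y2:cball y0 r" "!!y. y:cball y0 r ==> area_density ph y <= adens ph y2"
 using continuous_attains_sup[OF compact_cball _ adc] r(1) by auto
 have pos1: "adens ph y1 > 0" using im(6) y1(1) sub by blast
 define C where "C = Max {1, K0+c/2, 2/c, adens ph y2, 1/adens ph y1}"
 have C: "1 <= C" "K0+c/2 <= C" "2/c <= C" "adens ph y2 <= C" "1/adens ph y1 <= C"
 by (auto simp: C_def)
 have "cball y0 r <= V &
 (ALL y:cball y0 r. ALL z:cball y0 r. norm (ph y-ph z) <= C*norm (y-z) & norm (y-z) <= C*norm (ph y-ph z)) &
 (ALL y:cball y0 r. adens ph y <= C & 1 <= C*adens ph y & (ALL w. norm (?D y w) <= C*norm w))"
 proof (intro conjI ballI allI)
 fix y z assume yz: "y:cball y0 r" "z:cball y0 r"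
 show "norm (ph y-ph z) <= C*norm (y-z)"
 using up[OF yz] rmon[OF C(2) norm_ge_zero[of "y-z"]] by simp
 have "norm (y-z) <= (2/c)*norm (ph y-ph z)" using low[OF yz] c(1) by (simp add: field_simps)
 thus "norm (y-z) <= C*norm (ph y-ph z)"
 using rmon[OF C(3) norm_ge_zero[of "ph y-ph z"]] by simp
 next
 fix y w assume y: "y:cball y0 r"
 show "norm (?D y w) <= C*norm w"
 using Dup[OF y, of w] rmon[OF C(2) norm_ge_zero[of w]] by simp
 show "adens ph y <= C" using y2(2)[OF y] C(4) by simp
 have "1 = (1/adens ph y1)*adens ph y1" using pos1 by simp
 also have "... <= C*adens ph y" using C(1,5) y1(2)[OF y] pos1 by (intro mult_mono) auto
 finally show "1 <= C*adens ph y" .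
 qed (use sub in auto)
 thus ?thesis using r(1) C(1) by blast
qed

section \<open>Charts, patches and finite atlases\<close>

locale submfd = closest_point_tube Ga de
 for Ga :: "(real^'k) set" and de :: real +
 fixes sg :: "(real^'k) measure" and d :: "'d::finite itself"
 assumes area: "area_measure d sg" and embedded: "embedded_submanifold d Ga" and connected: "connected Ga"
begin

definition chart :: "(real^'d) set => (real^'d => real^'k) => bool" where
 "chart V ph \<longleftrightarrow> injective_immersion V ph & openin (top_of_set Ga) (ph ` V) &
 (EX ps. homeomorphism V (ph ` V) ph ps)"

lemma chart_exists: "q:Ga ==> EX V ph. chart V ph & q:ph ` V"
 using embedded unfolding embedded_submanifold_def chart_def by metis

lemma sets_sg: "sets sg = sets borel"
 using area by (simp add: area_measure_def)

lemma space_sg: "space sg = UNIV"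
 using sets_eq_imp_space_eq[OF sets_sg] by simp

lemma area_formula:
 fixes ph :: "real^'d => real^'k"
 shows "injective_immersion V ph ==> B:sets borel ==> B <= V ==>
 em sg (ph ` B) = (NN lborel (%y. (enr (adens ph y))*ind B y))"
 using area unfolding area_measure_def by blast

lemma chartD:
 assumes "chart V ph"
 shows "injective_immersion V ph" "ph ` V <= Ga" "ph ` V:sets borel" "open V"
 "!!B. B:sets borel ==> B <= V ==> ph ` B:sets borel"
 "!!B. open B ==> B <= V ==> openin (top_of_set Ga) (ph ` B)"
proof -
 obtain ps where ps: "homeomorphism V (ph ` V) ph ps" using assms by (auto simp: chart_def)
 have op: "openin (top_of_set Ga) (ph ` V)" using assms by (simp add: chart_def)
 show "injective_immersion V ph" using assms by (simp add: chart_def)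
 thus V: "open V" by (simp add: injective_immersion_def)
 show "ph ` V <= Ga" using openin_imp_subset[OF op] .
 obtain T where "open T" "ph ` V = Ga Int T" using op by (auto simp: openin_open)
 thus bV: "ph ` V:sets borel" using closed by simp
 show "ph ` B:sets borel" if "B:sets borel" "B <= V" for B
 by (rule borel_image_homeo[OF ps bV that])
 show "openin (top_of_set Ga) (ph ` B)" if "open B" "B <= V" for B
 proof -
 have "openin (top_of_set V) B" using that by (simp add: openin_open_eq V)
 hence "openin (top_of_set (ph ` V)) (ph ` B)" by (rule homeomorphism_imp_open_map[OF ps])
 thus ?thesis using op openin_trans by blast
 qed
qed

text \<open>The area formula speaks of measures of images only. It says that the density on
  \<open>V\<close>, pushed forward by \<open>ph\<close>, and \<sigma> restricted to the image
  coincide as measures, which yields the formula for integrals.\<close>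

lemma chart_nn_int:
 assumes ch: "chart V ph" and B: "B:sets borel" "B <= V" and F: "F:bmeas borel"
 shows "(NN sg (%x. (F x)*ind (ph ` B) x)) = (NN lborel (%y. (F (ph y)*enr (adens ph y))*ind B y))"
proof -
 note c = chartD[OF ch]
 note im = immD[OF c(1)]
 let ?R = "restrict_space lborel V"
 let ?a = "%y. enr (adens ph y)"
 have sR: "sets ?R = sets (restrict_space borel V)" by (rule sets_restrict_space_cong) simp
 have phim: "ph : ?R \<rightarrow>\<^sub>M borel"
 using borel_measurable_continuous_on_restrict[OF sm_cont[OF im(2)]] measurable_cong_sets[OF sR refl] by blast
 have "adens ph : ?R \<rightarrow>\<^sub>M borel"
 using borel_measurable_continuous_on_restrict[OF cont_adens[OF im(1,2)]] measurable_cong_sets[OF sR refl] by blast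
 hence am: "?a:bmeas ?R" by simp
 have V: "V Int space lborel:sets lborel" using im(1) by simp
 have mB: "B:sets ?R" using B im(1) by (simp add: sR sets_restrict_space_iff)
 define nu where "nu = distr (density ?R ?a) borel ph"
 have phim': "ph:density ?R ?a \<rightarrow>\<^sub>M borel" using phim by simp
 have eq: "nu = density sg (ind (ph ` V))"
 proof (rule measure_eqI)
 show "sets nu = sets (density sg (ind (ph ` V)))" by (simp add: nu_def sets_sg)
 fix A assume "A:sets nu"
 hence A: "A:sets borel" by (simp add: nu_def)
 have pre: "ph -` A Int V:sets ?R"
 using measurable_sets[OF phim A] by (simp add: space_restrict_space)
 hence preb: "ph -` A Int V:sets borel" using im(1) by (simp add: sR sets_restrict_space_iff)
 have "em nu A = em (density ?R ?a) (ph -` A Int V)"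
 unfolding nu_def using A by (subst emeasure_distr[OF phim']) (auto simp: space_restrict_space)
 also have "... = (NN ?R (%y. ?a y*ind (ph -` A Int V) y))"
 by (rule emeasure_density[OF am pre])
 also have "... = (NN lborel (%y. ?a y*ind (ph -` A Int V) y*ind V y))"
 by (rule nn_integral_restrict_space[OF V])
 also have "... = (NN lborel (%y. (?a y)*ind (ph -` A Int V) y))"
 by (rule nn_integral_cong) (auto simp: indicator_def)
 also have "... = em sg (ph ` (ph -` A Int V))"
 by (rule area_formula[OF c(1) preb, symmetric]) auto
 also have "ph ` (ph -` A Int V) = ph ` V Int A" by auto
 also have "em sg (ph ` V Int A) = em (density sg (ind (ph ` V))) A"
 proof -
 have "(ind (ph ` V) :: _ => ennreal):bmeas sg" by (intro borel_measurable_indicator) (simp add: sets_sg c(3))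
 thus ?thesis using A c(3) by (subst emeasure_density) (auto simp: sets_sg indicator_inter_arith[symmetric])
 qed
 finally show "em nu A = em (density sg (ind (ph ` V))) A" .
 qed
 have bB: "ph ` B:sets borel" using c(5) B by blast
 have Fm: "F:bmeas sg" using F measurable_cong_sets[OF sets_sg refl] by blast
 let ?G = "%x. F x*ind (ph ` B) x"
 have G: "?G:bmeas borel" using F bB by simp
 have "(NN sg (%x. (F x)*ind (ph ` B) x)) = (NN sg (%x. ind (ph ` V) x*?G x))"
 using B(2) by (intro nn_integral_cong) (auto simp: indicator_def)
 also have "... = integral\<^sup>N nu ?G"
 proof -
 have "(ind (ph ` V) :: _ => ennreal):bmeas sg" by (intro borel_measurable_indicator) (simp add: sets_sg c(3))
 moreover have "?G:bmeas sg" using G measurable_cong_sets[OF sets_sg refl] by blast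
 ultimately show ?thesis unfolding eq by (rule nn_integral_density[symmetric])
 qed
 also have "... = (NN (density ?R ?a) (%y. ?G (ph y)))"
 unfolding nu_def by (rule nn_integral_distr[OF phim']) (use G in simp)
 also have "... = (NN ?R (%y. ?a y*?G (ph y)))"
 by (rule nn_integral_density[OF am measurable_compose[OF phim G]])
 also have "... = (NN lborel (%y. ?a y*?G (ph y)*ind V y))"
 by (rule nn_integral_restrict_space[OF V])
 also have "... = (NN lborel (%y. (F (ph y)*?a y)*ind B y))"
 using B(2) im(3) by (intro nn_integral_cong) (auto simp: indicator_def inj_on_def mult.commute)
 finally show ?thesis .
qed

text \<open>A closed coordinate ball on which the chart is bi-Lipschitz with area density between
  1/C and C. Only \<open>C\<close> enters estimates, and it may be enlarged
  (\<open>patch_mono\<close>), so finitely many patches share one constant.\<close>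

definition patch :: "real => (real^'d => real^'k) => real^'d => real => bool" where
 "patch C ph y0 r \<longleftrightarrow> 0 < r & (EX V. chart V ph & cball y0 r <= V) &
 (ALL y:cball y0 r. ALL z:cball y0 r. norm (ph y-ph z) <= C*norm (y-z) & norm (y-z) <= C*norm (ph y-ph z)) &
 (ALL y:cball y0 r. adens ph y <= C & 1 <= C*adens ph y &
 (ALL w. norm (FD ph y w) <= C*norm w))"

lemma patch_mono:
 assumes "patch C ph y0 r" "C <= C'" shows "patch C' ph y0 r"
proof -
 have *: "a <= C*b ==> 0 <= b ==> a <= C'*b" for a b :: real
 using assms(2) rmon[of C C' b] by simp
 have pos: "0 <= adens ph y" if "y:cball y0 r" for y
 using that assms(1) immD(6) chartD(1) unfolding patch_def by (meson less_imp_le subsetD)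
 show ?thesis using assms pos unfolding patch_def by (auto intro!: *)
qed

lemma patch_exists:
 assumes "q:Ga" shows "EX a. (%(C, ph, y0, r). 1 <= C & patch C ph y0 r & ph y0 = q) a"
proof -
 obtain V ph y0 where ch: "chart V ph" and y0: "y0:V" "q = ph y0" using chart_exists[OF assms] by auto
 obtain r C where "r > 0" "C >= 1" "cball y0 r <= V"
 "ALL y:cball y0 r. ALL z:cball y0 r. norm (ph y-ph z) <= C*norm (y-z) & norm (y-z) <= C*norm (ph y-ph z)"
 "ALL y:cball y0 r. adens ph y <= C & 1 <= C*adens ph y &
 (ALL w. norm (FD ph y w) <= C*norm w)"
 using immersion_bilip[OF chartD(1)[OF ch] y0(1)] by blast
 hence "patch C ph y0 r" using ch unfolding patch_def by blast
 hence "1 <= C & patch C ph y0 r & ph y0 = q" using \<open>C >= 1\<close> y0(2) by simp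
 thus ?thesis by auto
qed

text \<open>Half balls already cover \<open>Ga\<close>, so that around each covered point a ball of
  radius r/2 is left in the patch; the lower volume bound of balls uses this room.\<close>

lemma atlas:
 obtains C :: real and I :: "((real^'d => real^'k) \<times> (real^'d) \<times> real) set" where
 "1 <= C" "finite I" "!!ph y0 r. (ph, y0, r):I ==> patch C ph y0 r"
 "Ga = (\<Union>(ph, y0, r)\<in>I. ph ` ball y0 (r/2))"
proof -
 let ?P = "%q (C, ph, y0, r). 1 <= C & patch C ph y0 r & ph y0 = q"
 have "ALL q:Ga. EX a. ?P q a" by (rule ballI) (rule patch_exists)
 from bchoice[OF this] obtain a where a: "ALL q:Ga. ?P q (a q)" ..
 define C where "C q = fst (a q)" for q
 define ph where "ph q = fst (snd (a q))" for q
 define y0 where "y0 q = fst (snd (snd (a q)))" for q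
 define r where "r q = snd (snd (snd (a q)))" for q
 have P: "1 <= C q & patch (C q) (ph q) (y0 q) (r q) & ph q (y0 q) = q" if "q:Ga" for q
 using a that by (auto simp: C_def ph_def y0_def r_def split_beta)
 define O' where "O' q = ph q ` ball (y0 q) (r q/2)" for q
 have ope: "openin (top_of_set Ga) (O' q)" and self: "q:O' q" if q: "q:Ga" for q
 proof -
 obtain V where V: "chart V (ph q)" "cball (y0 q) (r q) <= V" and r: "r q > 0"
 using P[OF q] unfolding patch_def by blast
 have "ball (y0 q) (r q/2) <= V" using V(2) r by auto
 thus "openin (top_of_set Ga) (O' q)" unfolding O'_def using chartD(6)[OF V(1)] by blast
 show "q:O' q" unfolding O'_def using P[OF q] r by (auto intro!: image_eqI[of _ _ "y0 q"])
 qed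
 obtain Q where Q: "finite Q" "Q <= Ga" "Ga <= (UN q:Q. O' q)"
 proof -
 have "EX T. open T & O' q = Ga Int T" if "q:Ga" for q using ope[OF that] by (simp add: openin_open)
 then obtain T where T: "!!q. q:Ga ==> open (T q) & O' q = Ga Int T q" by metis
 have "Ga <= (UN q:Ga. T q)" using T self by blast
 with compactE_image[OF compact] T obtain Q where "Q <= Ga" "finite Q" "Ga <= (UN q:Q. T q)" by metis
 moreover have "(UN q:Q. T q) Int Ga <= (UN q:Q. O' q)" using T \<open>Q <= Ga\<close> by blast
 ultimately show ?thesis by (intro that[of Q]) auto
 qed
 define C0 where "C0 = Max (insert 1 (C ` Q))"
 define I where "I = (%q. (ph q, y0 q, r q)) ` Q"
 have C0: "1 <= C0" "!!q. q:Q ==> C q <= C0" using Q(1) by (auto simp: C0_def)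
 show ?thesis
 proof
 show "finite I" using Q(1) by (simp add: I_def)
 show "patch C0 ph' y0' r'" if i: "(ph', y0', r'):I" for ph' y0' r'
 proof -
 obtain q where q: "q:Q" "ph' = ph q" "y0' = y0 q" "r' = r q" using i by (auto simp: I_def)
 thus ?thesis using patch_mono[OF _ C0(2)[OF q(1)]] P Q(2) by blast
 qed
 have "(\<Union>(ph, y0, r)\<in>I. ph ` ball y0 (r/2)) = (UN q:Q. O' q)" by (simp add: I_def O'_def)
 moreover have "O' q <= Ga" if "q:Q" for q using ope Q(2) that openin_imp_subset by blast
 ultimately show "Ga = (\<Union>(ph, y0, r)\<in>I. ph ` ball y0 (r/2))" using Q(3) by auto
 qed (rule C0(1))
qed

lemma patchD:
 assumes "patch C ph y0 r"
 shows "0 < r" "!!y z. y:cball y0 r ==> z:cball y0 r ==> norm (ph y-ph z) <= C*norm (y-z)"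
 "!!y z. y:cball y0 r ==> z:cball y0 r ==> norm (y-z) <= C*norm (ph y-ph z)"
 "!!y. y:cball y0 r ==> area_density ph y <= C" "!!y. y:cball y0 r ==> 1 <= C*adens ph y"
 "!!y w. y:cball y0 r ==> norm (FD ph y w) <= C*norm w"
 using assms unfolding patch_def by blast+

lemma patch_chart: "patch C ph y0 r ==> EX V. chart V ph & cball y0 r <= V"
 unfolding patch_def by blast

lemma patch_measure_le:
 assumes p: "patch C ph y0 r" and B: "B:sets borel" "B <= cball y0 r"
 shows "em sg (ph ` B) <= enr C*em lborel B"
proof -
 obtain V where V: "chart V ph" "cball y0 r <= V" using patch_chart[OF p] by blast
 have "em sg (ph ` B) = (NN lborel (%y. (enr (adens ph y))*ind B y))"
 using area_formula[OF chartD(1)[OF V(1)] B(1)] B(2) V(2) by blast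
 also have "... <= (NN lborel (%y. enr C*ind B y))"
 using patchD(4)[OF p] B(2) by (intro nn_integral_mono) (auto simp: indicator_def intro!: ennreal_leI)
 also have "... = enr C*em lborel B" using B(1) by (simp add: nn_integral_cmult_indicator)
 finally show ?thesis .
qed

lemma patch_measure_ge:
 assumes p: "patch C ph y0 r" and B: "B:sets borel" "B <= cball y0 r"
 shows "em lborel B <= enr C*em sg (ph ` B)"
proof -
 obtain V where V: "chart V ph" "cball y0 r <= V" using patch_chart[OF p] by blast
 note im = immD[OF chartD(1)[OF V(1)]]
 have m: "(%y. enr (adens ph y)*ind B y):bmeas lborel"
 proof -
 have "(%y. ind B y*.area_density ph y):bmeas borel"
 by (rule borel_measurable_continuous_on_indicator[OF B(1)
 continuous_on_subset[OF cont_adens[OF im(1,2)]]]) (use B(2) V(2) in blast)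
 hence "(%y. enr (ind B y*.area_density ph y)):bmeas lborel" by simp
 moreover have "enr (ind B y*.area_density ph y) = enr (adens ph y)*ind B y" for y
 by (simp add: indicator_def)
 ultimately show ?thesis by simp
 qed
 have C0: "0 <= C"
 proof -
 have y0: "y0:cball y0 r" using patchD(1)[OF p] by simp
 hence "0 < adens ph y0" using im(6) V(2) by blast
 thus ?thesis using patchD(4)[OF p y0] by simp
 qed
 have "em lborel B = (NN lborel (%y. ind B y))" using B(1) by simp
 also have "... <= (NN lborel (%y. enr C*(enr (adens ph y)*ind B y)))"
 proof (rule nn_integral_mono)
 fix y
 show "(ind B y :: ennreal) <= enr C*(enr (adens ph y)*ind B y)"
 proof (cases "y:B")
 case True
 have "enr 1 <= enr (C*adens ph y)" using patchD(5)[OF p] B(2) True by auto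
 also have "enr (C*adens ph y) = enr C*enr (adens ph y)"
 by (rule ennreal_mult'[OF C0])
 finally show ?thesis using True by simp
 qed simp
 qed
 also have "... = enr C*(NN lborel (%y. (enr (adens ph y))*ind B y))"
 by (rule nn_integral_cmult[OF m])
 also have "(NN lborel (%y. (enr (adens ph y))*ind B y)) = em sg (ph ` B)"
 using area_formula[OF chartD(1)[OF V(1)] B(1)] B(2) V(2) by auto
 finally show ?thesis .
qed

end

section \<open>Finite area, and tangent spaces read off in charts\<close>

context submfd
begin

abbreviation M :: "(real^'k) measure" where "M \<equiv> restrict_space sg Ga"
abbreviation (input) "nm \<equiv> L2n M"
abbreviation (input) "LL \<equiv> L2_fun M"
abbreviation (input) "wg \<equiv> weak_surface_grad sg Ga"
abbreviation (input) "Dir \<equiv> dirichlet_form sg Ga"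
abbreviation (input) "sgr \<equiv> surface_grad sg Ga"
abbreviation (input) "HA \<equiv> H1 sg Ga"
abbreviation (input) "HB \<equiv> H2 sg Ga"
abbreviation (input) "nB \<equiv> H2_norm sg Ga"

lemma Ga_sets: "Ga Int space sg:sets sg"
 using closed by (simp add: sets_sg space_sg)

lemma emeasure_M: "A <= Ga ==> emeasure M A = em sg A"
 by (rule emeasure_restrict_space[OF Ga_sets])

lemma patch_image_sets:
 assumes p: "patch C ph y0 r" and B: "B:sets borel" "B <= cball y0 r"
 shows "ph ` B:sets borel" "ph ` B <= Ga"
proof -
 obtain V where V: "chart V ph" "cball y0 r <= V" using patch_chart[OF p] by blast
 show "ph ` B:sets borel" using chartD(5)[OF V(1) B(1)] B(2) V(2) by blast
 show "ph ` B <= Ga" using chartD(2)[OF V(1)] B(2) V(2) by blast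
qed

lemma finite_measure_Ga: "em sg Ga < \<infinity>"
proof -
 obtain C I where A: "1 <= C" "finite I" "!!ph y0 r. (ph, y0, r):I ==> patch C ph y0 r"
 "Ga = (\<Union>(ph, y0, r)\<in>I. ph ` ball y0 (r/2))" by (rule atlas) blast
 let ?P = "%(ph, y0, r). ph ` ball y0 (r/2) :: (real^'k) set"
 have sub: "ball y0 (r/2) <= cball y0 r" if "(ph, y0, r):I" for ph and y0 :: "real^'d" and r
 using patchD(1)[OF A(3)[OF that]] by auto
 have s: "?P i:sets sg" if "i:I" for i
 using that patch_image_sets(1)[OF A(3) _ sub] by (cases i) (auto simp: sets_sg)
 have fin: "em sg (?P i) < \<infinity>" if "i:I" for i
 proof (cases i)
 case (fields ph y0 r)
 hence i: "(ph, y0, r):I" using that by simp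
 have "em sg (ph ` ball y0 (r/2)) <= enr C*em lborel (ball y0 (r/2))"
 by (rule patch_measure_le[OF A(3)[OF i] _ sub[OF i]]) simp
 also have "... < \<infinity>" using emeasure_lborel_ball_finite[of y0 "r/2"] by (simp add: ennreal_mult_less_top)
 finally show ?thesis by (simp add: fields)
 qed
 have "em sg (UN i:I. ?P i) <= (SUM i:I. em sg (?P i))"
 using s by (intro emeasure_subadditive_finite A(2)) auto
 also have "... < \<infinity>" using fin A(2) by simp
 finally show ?thesis using A(4) by simp
qed

sublocale compact_measure M Ga
proof (intro compact_measure.intro finite_measureI compact_measure_axioms.intro)
 show "em M (space M) ~= \<infinity>"
 using emeasure_M[OF subset_refl] finite_measure_Ga by (simp add: space_restrict_space space_sg)
 show "Topological_Spaces.compact Ga" by (rule compact)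
 show "sets M = sets (restrict_space borel Ga)" by (rule sets_restrict_space_cong[OF sets_sg])
qed

lemma sets_M_iff: "A:sets M \<longleftrightarrow> A:sets borel & A <= Ga"
 using closed by (auto simp: sets_M sets_restrict_space_iff)

lemma borel_extension:
 fixes f :: "real^'k => 'b::{topological_space, real_normed_vector}"
 assumes "f:bmeas M"
 shows "(%x. ind Ga x*.f x):bmeas borel"
 using assms borel_measurable_restrict_space_iff[of Ga borel f] closed measurable_cong_sets[OF sets_M refl] by auto

text \<open>Differentiating p o ph = ph shows that the range is tangential. Conversely the velocity
  of a curve is the limit of the derivative applied to difference quotients of its chart
  coordinates; these are controlled by the bi-Lipschitz bound alone, without differentiating the
  inverse chart, and the range is closed.\<close>

lemma range_chart_der:
 assumes ch: "chart V ph" and y: "y:V"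
 shows "range (FD ph y) = TS (ph y)"
proof -
 note im = immD[OF chartD(1)[OF ch]]
 let ?D = "FD ph y"
 have q: "ph y:Ga" using chartD(2)[OF ch] y by blast
 have "?D w:TS (ph y)" for w
 proof -
 have "((%y. cp (ph y)) has_derivative (%w. dcp (ph y) (?D w))) (at y)"
 using q sub_tb by (intro has_derivative_compose[OF sm_der[OF im(2) y] cp_der]) blast
 hence "(ph has_derivative (%w. dcp (ph y) (?D w))) (at y)"
 by (rule has_derivative_transform_within_open[OF _ im(1) y]) (use chartD(2)[OF ch] cp_self in blast)
 hence "?D w = dcp (ph y) (?D w)" by (rule pdiff_eqI)
 thus ?thesis using tsp_iff[OF q] by metis
 qed
 moreover have "w:range ?D" if w: "w:TS (ph y)" for w
 proof -
 obtain ga where ga: "!!t::real. ga t:Ga" "ga 0 = ph y" "(ga has_vector_derivative w) (at 0)"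
 using w by (auto simp: tangent_space_def)
 obtain ps where ps: "homeomorphism V (ph ` V) ph ps" using ch by (auto simp: chart_def)
 obtain T where T: "open T" "ph ` V = Ga Int T" using ch by (auto simp: chart_def openin_open)
 obtain r C where rC: "r > 0" "C >= 1" "cball y r <= V"
 "!!x z. x:cball y r ==> z:cball y r ==> norm (x-z) <= C*norm (ph x-ph z)"
 using immersion_bilip[OF chartD(1)[OF ch] y] by metis
 define t where "t n = inverse (real (Suc n))" for n
 have t0: "t ----> 0" unfolding t_def by (rule LIMSEQ_inverse_real_of_nat)
 have tpos: "t n > 0" for n by (simp add: t_def)
 have gac: "isCont ga 0" using ga(3) has_vector_derivative_continuous by blast
 hence g0: "(%n. ga (t n)) ----> ph y" using isCont_tendsto_compose[OF gac t0] ga(2) by simp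
 define z where "z n = ps (ga (t n))" for n
 have evT: "eventually (%n. ga (t n):ph ` V) sequentially"
 using topological_tendstoD[OF g0 T(1)] y T(2) ga(1) by auto
 have "cont (ph ` V) ps" using ps by (simp add: homeomorphism_def)
 hence "(%n. ps (ga (t n))) ----> ps (ph y)"
 by (rule continuous_on_tendsto_compose[OF _ g0 _ evT]) (use y in blast)
 moreover have "z = (%n. ps (ga (t n)))" by (simp add: fun_eq_iff z_def)
 ultimately have z: "z ----> y" using ps y by (simp add: homeomorphism_def)
 have evz: "eventually (%n. z n:ball y r) sequentially"
 using topological_tendstoD[OF z open_ball, of y r] rC(1) by simp
 have phiz: "eventually (%n. ph (z n) = ga (t n)) sequentially"
 using evT by eventually_elim (use ps in \<open>auto simp: z_def homeomorphism_def\<close>)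
 define q where "q n = (ga (t n)-ga 0) /\<^sub>R t n" for n
 have q: "q ----> w"
 proof -
 have "((%h. norm (ga (0+h)-ga 0-h*.w)/norm h) \<longlongrightarrow> 0) (at 0)"
 using ga(3) unfolding has_vector_derivative_def has_derivative_at by blast
 hence "(%n. norm (ga (0+t n)-ga 0-t n*.w)/norm (t n)) ----> 0"
 by (rule filterlim_compose[OF _ filterlim_atI[OF t0]]) (use tpos in \<open>simp add: less_imp_neq[symmetric]\<close>)
 moreover have "norm (ga (0+t n)-ga 0-t n*.w)/norm (t n) = norm (q n-w)" for n
 proof -
 have "q n-w = (ga (0+t n)-ga 0-t n*.w) /\<^sub>R t n"
 using tpos[of n] by (simp add: q_def scaleR_diff_right)
 thus ?thesis by (simp add: divide_inverse mult.commute)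
 qed
 ultimately have "(%n. norm (q n-w)) ----> 0" by simp
 hence "(%n. q n-w) ----> 0" by (rule tendsto_norm_zero_cancel)
 thus ?thesis by (rule LIM_zero_cancel)
 qed
 define e where "e n = norm (ph (z n)-ph y-?D (z n-y))/norm (z n-y)" for n
 have e: "e ----> 0"
 proof -
 have 1: "((%h. norm (ph (y+h)-ph y-?D h)/norm h) \<longlongrightarrow> 0) (at 0)"
 using sm_der[OF im(2) y] unfolding has_derivative_at by blast
 define E where "E = (%h. norm (ph (y+h)-ph y-?D h)/norm h)"
 have "E 0 = 0" by (simp add: E_def)
 hence "isCont E 0" using 1 unfolding isCont_def by (simp only: E_def)
 moreover have "(%n. z n-y) ----> 0" using z by (simp add: LIM_zero)
 ultimately have "(%n. E (z n-y)) ----> E 0" using isCont_tendsto_compose by blast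
 moreover have "(%n. E (z n-y)) = e" by (simp add: fun_eq_iff E_def e_def)
 ultimately show ?thesis using \<open>E 0 = 0\<close> by simp
 qed
 \<comment> \<open>The linearisation error is \<open>e n\<close> times the norm of
   \<open>z n-y\<close>, and the lower Lipschitz bound makes the latter at most \<open>C\<close>
   times \<open>t n\<close> times the norm of \<open>q n\<close>. Dividing by \<open>t n\<close>
   leaves a null sequence.\<close>
 have main: "eventually (%n. norm (?D ((z n-y) /\<^sub>R t n)-q n) <= e n*(C*norm (q n))) sequentially"
 using evz phiz
 proof eventually_elim
 case (elim n)
 have "norm (z n-y) <= C*norm (ph (z n)-ph y)" using rC(1,4) elim(1) by auto
 also have "... = C*(t n*norm (q n))" using elim(2) ga(2) tpos[of n] by (simp add: q_def)
 finally have zn: "norm (z n-y) <= C*(t n*norm (q n))" .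
 have "?D ((z n-y) /\<^sub>R t n) = ?D (z n-y) /\<^sub>R t n" by (rule linear_cmul[OF im(5)[OF y]])
 hence "?D ((z n-y) /\<^sub>R t n)-q n = - ((ph (z n)-ph y-?D (z n-y)) /\<^sub>R t n)"
 using elim(2) ga(2) by (simp only: q_def scaleR_diff_right) simp
 hence "norm (?D ((z n-y) /\<^sub>R t n)-q n) = norm (ph (z n)-ph y-?D (z n-y))/t n"
 using tpos[of n] by (simp add: divide_inverse mult.commute)
 also have "... = e n*norm (z n-y)/t n" by (auto simp: e_def linear_0[OF im(5)[OF y]])
 also have "... <= e n*(C*(t n*norm (q n)))/t n"
 using zn tpos[of n] by (intro divide_right_mono lmon) (auto simp: e_def)
 also have "... = e n*(C*norm (q n))" using tpos[of n] by simp
 finally show ?case .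
 qed
 have "(%n. e n*(C*norm (q n))) ----> 0*(C*norm w)" by (intro tendsto_intros e q)
 hence "(%n. ?D ((z n-y) /\<^sub>R t n)-q n) ----> 0" using Lim_null_comparison[OF main] by simp
 hence "(%n. ?D ((z n-y) /\<^sub>R t n)-q n+q n) ----> 0+w" by (rule tendsto_add[OF _ q])
 hence lim: "(%n. ?D ((z n-y) /\<^sub>R t n)) ----> w" by simp
 have "closed (range ?D)"
 using linear_subspace_image[OF im(5)[OF y] subspace_UNIV] by (rule closed_subspace)
 from closed_sequentially[OF this _ lim] show ?thesis by simp
 qed
 ultimately show ?thesis by blast
qed

end

section \<open>The divergence theorem\<close>

lemma positive_lower_bound:
 fixes t0 :: "'i::finite => real"
 assumes "!!i. 0 < t0 i" obtains t1 where "0 < t1" "t1 <= 1" "!!i. t1 <= t0 i"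
proof -
 have "0 < Min (insert 1 (range t0))" using assms by (subst Min_gr_iff) auto
 moreover have "Min (insert 1 (range t0)) <= 1" "Min (insert 1 (range t0)) <= t0 i" for i
 by (rule Min_le; simp)+
 ultimately show ?thesis using that by blast
qed

lemma cpt_bound:
 fixes f :: "'a::topological_space => 'b::real_normed_vector"
 assumes "compact K" "cont K f" obtains B where "0 <= B" "!!x. x:K ==> norm (f x) <= B"
proof -
 have "bounded (f ` K)" by (intro compact_imp_bounded compact_continuous_image assms)
 then obtain B where "0 < B" "!!x. x:f ` K ==> norm x <= B" by (auto simp: bounded_pos)
 thus ?thesis using that[of B] by auto
qed

lemma finite_uniform_bound:
 fixes f :: "'i::finite => 'a::topological_space => 'b::real_normed_vector"
 assumes "compact K" "!!i. cont K (f i)" obtains B where "0 <= B" "!!i x. x:K ==> norm (f i x) <= B"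
proof -
 have "EX B>=0. ALL x:K. norm (f i x) <= B" for i using cpt_bound[OF assms] by metis
 then obtain b where b: "!!i. 0 <= b i" "!!i x. x:K ==> norm (f i x) <= b i" by metis
 have "b i <= sum b UNIV" for i using b(1) by (intro member_le_sum) auto
 thus ?thesis using b by (intro that[of "sum b UNIV"] sum_nonneg) (blast intro: order_trans)+
qed

text \<open>Compactness of \<open>K\<close> gives a time interval common to all \<open>q\<close>,
  and a bound on the second time derivative there; integrating it twice through mean value
  inequalities keeps the remainder uniform in \<open>q\<close>.\<close>

lemma taylor_in_time:
 fixes G :: "real \<times> 'a::euclidean_space => 'b::euclidean_space"
 assumes W: "open W" and G: "smooth_on W G" and K: "compact K" and sub: "{0} \<times> K <= W"
 obtains t0 C where "0 < t0" "0 <= C" "{- t0..t0} \<times> K <= W"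
 "!!t q. q:K ==> |t| <= t0 ==> norm (G (t, q)-G (0, q)-t*.pd G (1, 0) (0, q)) <= C*t^2"
 "!!q. q:K ==> norm (pd G (1, 0) (0, q)) <= C"
proof -
 have "compact ({0 :: real} \<times> K)" using K by (intro compact_Times) auto
 then obtain e where e: "e > 0" "(UN x:{0 :: real} \<times> K. ball x e) <= W"
 using compact_subset_open_imp_ball_epsilon_subset[OF _ W sub] by metis
 define t0 where "t0 = e/2"
 have t0: "t0 > 0" using e by (simp add: t0_def)
 have inW: "(t, q):W" if "q:K" "|t| <= t0" for t q
 proof -
 have "(t, q):ball (0, q) e" using that e by (simp add: dist_Pair_Pair t0_def dist_real_def)
 thus ?thesis using e(2) that(1) by blast
 qed
 let ?G1 = "pd G (1, 0)"
 let ?G2 = "pd ?G1 (1, 0)"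
 have G1: "smooth_on W ?G1" by (rule sm_pdiff_field[OF W G sm_const])
 have G2: "smooth_on W ?G2" by (rule sm_pdiff_field[OF W G1 sm_const])
 have cK: "compact ({- t0..t0} \<times> K)" using K by (intro compact_Times) auto
 have sW: "{- t0..t0} \<times> K <= W" using inW by auto
 obtain B1 B2 where B12: "0 <= B1" "0 <= B2" "!!z. z:{- t0..t0} \<times> K ==> norm (?G1 z) <= B1"
 "!!z. z:{- t0..t0} \<times> K ==> norm (?G2 z) <= B2"
 using cpt_bound[OF cK continuous_on_subset[OF sm_cont[OF G1] sW]]
 cpt_bound[OF cK continuous_on_subset[OF sm_cont[OF G2] sW]] by metis
 define B where "B = B1+B2"
 have B: "norm (?G2 z) <= B" "norm (?G1 z) <= B" "0 <= B" if "z:{- t0..t0} \<times> K" for z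
 using B12(1,2) B12(3,4)[OF that] by (auto simp: B_def)
 have B0: "0 <= B" using B12(1,2) by (simp add: B_def)
 have der: "((%t. H (t, q)) has_derivative (%h. h*.pd H (1, 0) (t, q))) (at t)"
 if H: "smooth_on W H" and tq: "(t, q):W" for H :: "real \<times> 'a => 'b" and t q
 proof -
 have p: "((%t. (t, q)) has_derivative (%h. (h, 0))) (at t)"
 by (rule has_derivative_Pair[OF has_derivative_ident has_derivative_const])
 have "(h, 0) = h*.(1, 0 :: 'a)" for h :: real by simp
 hence "FD H (t, q) (h, 0) = h*.pd H (1, 0) (t, q)" for h :: real
 using linear_cmul[OF sm_lin_der[OF H tq], of h "(1, 0)"] by simp
 hence eq: "(%h. FD H (t, q) (h, 0)) = (%h. h*.pd H (1, 0) (t, q))"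
 by (rule ext)
 from has_derivative_compose[OF p sm_der[OF H tq]] show ?thesis unfolding eq .
 qed
 have step1: "norm (?G1 (t, q)-?G1 (0, q)) <= B * |t|" if q: "q:K" and t: "|t| <= t0" for t q
 proof -
 have d: "((%t. ?G1 (t, q)) has_derivative (%h. h*.?G2 (s, q))) (at s within {- t0..t0})"
 if "s:{- t0..t0}" for s
 by (rule has_derivative_at_withinI[OF der[OF G1 inW[OF q]]]) (use that in auto)
 have "norm (?G1 (t, q)-?G1 (0, q)) <= B*norm (t-0)"
 proof (rule differentiable_bound[OF _ d])
 fix s assume s: "s:{- t0..t0}"
 show "onorm (%h. h*.?G2 (s, q)) <= B"
 proof (rule onorm_le)
 fix h :: real
 show "norm (h*.?G2 (s, q)) <= B*norm h"
 using rmon[OF B(1)[of "(s, q)"] abs_ge_zero[of h]] s q by (simp add: mult.commute)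
 qed
 qed (use t in auto)
 thus ?thesis by simp
 qed
 have "norm (G (t, q)-G (0, q)-t*.?G1 (0, q)) <= B*t^2" if q: "q:K" and t: "|t| <= t0" for t q
 proof -
 let ?g = "%s. G (s, q)-s*.?G1 (0, q)"
 let ?S = "{- |t|..|t|}"
 have d: "(?g has_derivative (%h. h*.?G1 (s, q)-h*.?G1 (0, q))) (at s within ?S)"
 if "s : ?S" for s
 proof (rule has_derivative_at_withinI, rule has_derivative_diff)
 show "((%s. G (s, q)) has_derivative (%h. h*.?G1 (s, q))) (at s)"
 by (rule der[OF G inW[OF q]]) (use that t in auto)
 show "((%s. s*.?G1 (0, q)) has_derivative (%h. h*.?G1 (0, q))) (at s)"
 by (rule has_derivative_scaleR_left[OF has_derivative_ident])
 qed
 have "norm (?g t-?g 0) <= (B * |t| )*norm (t-0)"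
 proof (rule differentiable_bound[OF _ d])
 fix s assume s: "s : ?S"
 show "onorm (%h. h*.?G1 (s, q)-h*.?G1 (0, q)) <= B * |t|"
 proof (rule onorm_le)
 fix h :: real
 have "norm (?G1 (s, q)-?G1 (0, q)) <= B * |s|" using step1[OF q, of s] s t by auto
 also have "... <= B * |t|" using s B0 by (intro lmon) auto
 finally show "norm (h*.?G1 (s, q)-h*.?G1 (0, q)) <= B * |t|*norm h"
 unfolding scaleR_diff_right[symmetric] norm_scaleR
 by (subst mult.commute) (auto intro: rmon)
 qed
 qed auto
 thus ?thesis by (simp add: sq2 algebra_simps)
 qed
 thus ?thesis using B(2) t0 by (intro that[OF t0 B0 sW]) auto
qed

text \<open>With \<open>f\<close> subadditive and \<open>g\<close> superadditive on disjoint sets, a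
  local inequality survives cutting \<open>A\<close> along the cover. It is applied to a measure
  with density and to the area of images under an injective map.\<close>

lemma finite_cover_le:
 fixes f g :: "'a::topological_space set => ennreal"
 assumes "finite I" "!!i. i:I ==> P i:sets borel" "A:sets borel" "A <= (UN i:I. P i)" "A <= D"
 and "!!i B. i:I ==> B:sets borel ==> B <= P i ==> B <= D ==> f B <= g B"
 and "f {} = 0"
 and "!!B E. B:sets borel ==> E:sets borel ==> B <= D ==> E <= D ==> B Int E = {} ==> f (B Un E) <= f B+f E"
 and "!!B E. B:sets borel ==> E:sets borel ==> B <= D ==> E <= D ==> B Int E = {} ==> g B+g E <= g (B Un E)"
 shows "f A <= g A"
 using assms(1-6)
proof (induction I arbitrary: A rule: finite_induct)
 case empty
 hence "A = {}" by auto
 thus ?case using assms(7) by simp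
next
 case (insert i I)
 have Pi: "P i:sets borel" using insert.prems(1) by simp
 have 1: "A Int P i:sets borel" "A-P i:sets borel" using Pi insert.prems(2) by auto
 have "f (A-P i) <= g (A-P i)"
 proof (rule insert.IH)
 show "f B <= g B" if "j:I" "B:sets borel" "B <= P j" "B <= D" for j B
 using insert.prems(5)[of j B] that by simp
 qed (use insert.prems 1 in auto)
 moreover have "f (A Int P i) <= g (A Int P i)"
 by (rule insert.prems(5)[of i]) (use insert.prems 1 in auto)
 moreover have "f A <= f (A Int P i)+f (A-P i)"
 using assms(8)[OF 1] insert.prems(4) by (simp add: Int_Diff_Un le_infI1 Diff_subset[THEN subset_trans] Int_Diff_disjoint)
 moreover have "g (A Int P i)+g (A-P i) <= g A"
 using assms(9)[OF 1] insert.prems(4) by (simp add: Int_Diff_Un le_infI1 Diff_subset[THEN subset_trans] Int_Diff_disjoint)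
 ultimately show ?case by (meson add_mono order_trans)
qed

lemma lin_axis_expand:
 fixes A :: "real^'k => 'b::real_normed_vector"
 assumes "linear A" shows "(SUM l:UNIV. w $ l*.A (axis l 1)) = A w"
proof -
 have "A w = A (SUM l:UNIV. w $ l*.axis l 1)" by (simp add: basis_expansion[of w, unfolded scalar_mult_eq_scaleR])
 thus ?thesis by (simp only: linear_sum[OF assms] linear_cmul[OF assms])
qed

lemma lin_norm_le_sum_axis:
 fixes A :: "real^'k => 'b::real_normed_vector"
 assumes "linear A" shows "norm (A w) <= (SUM i:UNIV. norm (A (axis i 1)))*norm w"
proof -
 have "A w = (SUM i:UNIV. (w $ i)*.A (axis i 1))" by (rule lin_axis_expand[OF assms, symmetric])
 also have "norm ... <= (SUM i:UNIV. norm (A (axis i 1))*norm w)"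
 by (rule sum_norm_le) (simp add: mult.commute[of "norm (A _)"] rmon component_le_norm_cart)
 finally show ?thesis by (simp add: sum_distrib_right)
qed

lemma (in submfd) chart_preimage:
 assumes ch: "chart V ph" and A: "A:sets borel" and B: "B:sets borel" "B <= V"
 shows "ph -` A Int B:sets borel"
proof -
 note im = immD[OF chartD(1)[OF ch]]
 have "ph:bmeas (restrict_space borel B)"
 by (intro borel_measurable_continuous_on_restrict continuous_on_subset[OF sm_cont[OF im(2)] B(2)])
 from measurable_sets[OF this A] show ?thesis
 using B(1) by (auto simp: space_restrict_space sets_restrict_space_iff)
qed

section \<open>Moving the manifold along a tangential field\<close>

locale tfield = closest_point_tube Ga de
 for Ga :: "(real^'k) set" and de :: real +
 fixes X :: "real^'k => real^'k" and Om :: "(real^'k) set"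
 assumes Om: "open Om" "Ga <= Om" "Om <= tube" and X: "smooth_on Om X"
 and tan: "!!q. q:Ga ==> X q:tangent_space Ga q"
begin

definition flow_dom :: "(real \<times> (real^'k)) set" where
 "flow_dom = {z:UNIV \<times> Om. snd z+fst z*.X (snd z):tube}"

text \<open>An Euler step followed by the projection replaces the flow of \<open>X\<close>: only the
  first order in \<open>t\<close> matters for the divergence theorem, so no differential equation
  has to be solved.\<close>

definition push :: "real => real^'k => real^'k" where
 "push t x = cp (x+t*.X x)"

definition dpush :: "real => real^'k => real^'k => real^'k" where
 "dpush t x b = dcp (x+t*.X x) (b+t*.frechet_derivative X (at x) b)"

lemma sm_move: "smooth_on (UNIV \<times> Om) (%z. snd z+fst z*.X (snd z))"
proof -
 have o: "open (UNIV \<times> Om :: (real \<times> (real^'k)) set)" using Om by (simp add: open_Times)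
 have "smooth_on (UNIV \<times> Om :: (real \<times> (real^'k)) set) (%z. X (snd z))"
 by (rule sm_comp[OF o Om(1) _ X sm_bl[OF bounded_linear_snd]]) auto
 thus ?thesis
 by (rule sm_add[OF o sm_bl[OF bounded_linear_snd]
 sm_scaleR[OF o sm_bl[OF bounded_linear_fst]]])
qed

lemma open_flow_dom: "open flow_dom"
proof -
 have o: "open (UNIV \<times> Om :: (real \<times> (real^'k)) set)" using Om by (simp add: open_Times)
 have "flow_dom = (UNIV \<times> Om) Int (%z. snd z+fst z*.X (snd z)) -` tube"
 by (auto simp: flow_dom_def)
 thus ?thesis
 using continuous_open_preimage[OF sm_cont[OF sm_move] o op_tube] by simp
qed

lemma flow_domD: "(t, x):flow_dom ==> x:Om" "(t, x):flow_dom ==> x+t*.X x:tube"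
 by (auto simp: flow_dom_def)

lemma push_der: "(t, x):flow_dom ==> (push t has_derivative dpush t x) (at x)"
proof -
 assume z: "(t, x):flow_dom"
 have "((%x. x+t*.X x) has_derivative (%b. b+t*.frechet_derivative X (at x) b)) (at x)"
 by (rule has_derivative_add[OF has_derivative_ident
 has_derivative_scaleR_right[OF sm_der[OF X flow_domD(1)[OF z]]]])
 from has_derivative_compose[OF this cp_der[OF flow_domD(2)[OF z]]]
 show ?thesis by (simp add: push_def[abs_def] dpush_def[abs_def])
qed

lemma lin_dpush: "(t, x):flow_dom ==> linear (dpush t x)"
 using push_der has_derivative_linear by blast

text \<open>The direction \<open>b\<close> is made a third variable, so that the Taylor expansion of
  \<open>dpush\<close> in time is uniform over directions in the unit ball.\<close>

definition push_dom :: "(real \<times> (real^'k) \<times> (real^'k)) set" where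
 "push_dom = (%z. (fst z, fst (snd z))) -` flow_dom"

lemma sm_dpush: "open push_dom" "smooth_on push_dom (%z. dpush (fst z) (fst (snd z)) (snd (snd z)))"
proof -
 let ?p = "%z :: real \<times> (real^'k) \<times> (real^'k). (fst z, fst (snd z))"
 show o: "open push_dom" unfolding push_dom_def by (intro open_vimage open_flow_dom continuous_intros)
 have bl: "bounded_linear ?p"
 by (intro bounded_linear_Pair bounded_linear_fst bounded_linear_compose[OF bounded_linear_fst bounded_linear_snd])
 have c: "smooth_on push_dom (%z. g (?p z))" if "smooth_on flow_dom g" for g :: "real \<times> (real^'k) => real^'k"
 by (rule sm_comp[OF o open_flow_dom _ that sm_bl[OF bl]]) (auto simp: push_dom_def)
 have sub: "flow_dom <= UNIV \<times> Om" by (auto simp: flow_dom_def)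
 have "smooth_on flow_dom (%z. pd X (axis l 1) (snd z))" for l
 by (rule sm_comp[OF open_flow_dom Om(1) _ sm_pdiff_field[OF Om(1) X sm_const]
 sm_bl[OF bounded_linear_snd]]) (use sub in auto)
 note s = c[OF this]
 have "smooth_on flow_dom (%z. fr m (snd z+fst z*.X (snd z)))" for m
 by (rule sm_comp[OF open_flow_dom op_tube _ sm_fr sm_subset[OF sm_move sub]])
 (auto simp: flow_dom_def)
 note m = c[OF this]
 have "smooth_on push_dom (%z. SUM m:UNIV. ((snd (snd z)+fst z*.(SUM l:UNIV. snd (snd z) $ l*.pd X (axis l 1) (snd (?p z)))) $ m) *.
 fr m (snd (?p z)+fst (?p z)*.X (snd (?p z))))"
 by (intro sm_sum[OF o] sm_scaleR[OF o] m s sm_lin_comp[OF o bounded_linear_vec_nth] sm_add[OF o]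
 sm_bl bounded_linear_fst bounded_linear_compose[OF bounded_linear_snd bounded_linear_snd] o) simp_all
 thus "smooth_on push_dom (%z. dpush (fst z) (fst (snd z)) (snd (snd z)))"
 proof (rule sm_cong[OF o, THEN iffD1, rotated])
 fix z assume "z:push_dom"
 hence z: "fst (snd z):Om" "fst (snd z)+fst z*.X (fst (snd z)):tube" by (auto simp: push_dom_def flow_dom_def)
 show "(SUM m:UNIV. ((snd (snd z)+fst z*.(SUM l:UNIV. snd (snd z) $ l*.pd X (axis l 1) (snd (?p z)))) $ m) *.
 fr m (snd (?p z)+fst (?p z)*.X (snd (?p z)))) = dpush (fst z) (fst (snd z)) (snd (snd z))"
 using lin_axis_expand[OF sm_lin_der[OF X z(1)], of "snd (snd z)"] z(2) by (simp add: dpush_def dcp_expand)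
 qed
qed

lemma dpush_zero: "dpush 0 x b = dcp x b"
 by (simp add: dpush_def)

lemma dpush_time_der:
 assumes q: "q:Ga"
 shows "((%t. dpush t q b) has_derivative (%h. h*.(dcp q (FD X q b) +
 (SUM m:UNIV. (b $ m)*.frechet_derivative (fr m) (at q) (X q))))) (at 0)"
proof -
 have qt: "q:tube" using q sub_tb by blast
 let ?DX = "FD X q b"
 have fm: "((%t. fr m (q+t*.X q)) has_derivative (%h. h*.frechet_derivative (fr m) (at q) (X q))) (at 0)" for m
 proof -
 have "((%t. q+t*.X q) has_derivative (%h. h*.X q)) (at 0)"
 by (auto intro!: derivative_eq_intros)
 moreover have "(fr m has_derivative FD (fr m) q) (at (q+0*.X q))"
 using sm_der[OF sm_fr qt] by simp
 ultimately have "((%t. fr m (q+t*.X q)) has_derivative (%h. FD (fr m) q (h*.X q))) (at 0)"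
 by (rule has_derivative_compose)
 thus ?thesis by (simp only: linear_cmul[OF sm_lin_der[OF sm_fr qt]])
 qed
 have cm: "((%t. (b+t*.?DX) $ m) has_derivative (%h. h*?DX $ m)) (at 0)" for m
 by (auto intro!: derivative_eq_intros)
 let ?a = "dcp q ?DX+(SUM m:UNIV. (b $ m)*.frechet_derivative (fr m) (at q) (X q))"
 have "((%t. SUM m:UNIV. ((b+t*.?DX) $ m)*.fr m (q+t*.X q)) has_derivative
 (%h. SUM m:UNIV. ((b+0*.?DX) $ m)*.(h*.frechet_derivative (fr m) (at q) (X q)) +
 (h*?DX $ m)*.fr m (q+0*.X q))) (at 0)"
 by (intro has_derivative_sum has_derivative_scaleR[OF cm fm])
 moreover have "(SUM m:UNIV. ((b+0*.?DX) $ m)*.(h*.frechet_derivative (fr m) (at q) (X q))+(h*?DX $ m)*.fr m (q+0*.X q)) = h*.?a" for h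
 by (simp add: dcp_expand[OF qt] sum.distrib scaleR_sum_right scaleR_add_right add.commute mult.commute)
 ultimately have d: "((%t. SUM m:UNIV. ((b+t*.?DX) $ m)*.fr m (q+t*.X q)) has_derivative (%h. h*.?a)) (at 0)"
 by (simp only:)
 have o: "open ((%t::real. q+t*.X q) -` tube)" "0:(%t::real. q+t*.X q) -` tube"
 using qt by (auto intro!: open_vimage op_tube continuous_intros)
 show ?thesis by (rule has_derivative_transform_within_open[OF d o]) (simp add: dpush_def dcp_expand)
qed

text \<open>Differentiating \<open>P P = P\<close> along \<open>X\<close> gives \<open>P P' P = 0\<close>.\<close>

lemma frame_der_normal:
 assumes q: "q:Ga" and u: "u:tangent_space Ga q"
 shows "u.*(SUM m:UNIV. (u $ m)*.frechet_derivative (fr m) (at q) (X q)) = 0"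
proof -
 have qt: "q:tube" using q sub_tb by blast
 let ?w = "X q"
 let ?D = "%w. SUM m:UNIV. (u $ m)*.frechet_derivative (fr m) (at q) w"
 have fd: "(fr m has_derivative FD (fr m) q) (at q)" for m
 by (rule sm_der[OF sm_fr qt])
 have g: "((%x. SUM m:UNIV. (u $ m)*.fr m x) has_derivative ?D) (at q)"
 by (intro has_derivative_sum has_derivative_scaleR_right fd)
 have f: "((%x. SUM l:UNIV. ((SUM m:UNIV. (u $ m)*.fr m x) $ l)*.fr l x) has_derivative
 (%w. SUM l:UNIV. ((SUM m:UNIV. (u $ m)*.fr m q) $ l)*.frechet_derivative (fr l) (at q) w +
 (?D w $ l)*.fr l q)) (at q)"
 by (intro has_derivative_sum has_derivative_scaleR fd bounded_linear.has_derivative[OF bounded_linear_vec_nth g])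
 have eq: "(SUM l:UNIV. ((SUM m:UNIV. (u $ m)*.fr m x) $ l)*.fr l x) = (SUM m:UNIV. (u $ m)*.fr m x)"
 if "x:Ga" for x
 proof -
 have "x:tube" using that sub_tb by blast
 from dcp_idem[OF that, of u] show ?thesis by (simp only: dcp_expand[OF \<open>x : tube\<close>])
 qed
 have "(SUM m:UNIV. (u $ m)*.fr m q) = u"
 using dcp_expand[OF qt, of u] dcp_tangent[OF q u] by simp
 hence "?D ?w+dcp q (?D ?w) = ?D ?w"
 using der_on_tangent[OF tan[OF q] f g eq] dcp_expand[OF qt, of "?D ?w"] by (simp add: sum.distrib)
 hence "dcp q (?D ?w) = 0" by simp
 thus ?thesis using dcp_sym[OF q, of u "?D ?w"] dcp_tangent[OF q u] by simp
qed

end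

context tfield
begin

lemma dpush_near:
 assumes K: "compact K" "K <= Om"
 obtains t1 A where "0 < t1" "t1 <= 1" "0 <= A"
 "!!x t. x:K ==> |t| <= t1 ==> (t, x):flow_dom"
 "!!x t b. x:K ==> |t| <= t1 ==> norm (dpush t x b-dcp x b) <= A * |t|*norm b"
proof -
 let ?K = "K \<times> (cball 0 1 :: (real^'k) set)"
 let ?G = "%z. dpush (fst z) (fst (snd z)) (snd (snd z))"
 have K': "compact ?K" "{0} \<times> ?K <= push_dom" using K Om by (auto intro!: compact_Times simp: push_dom_def flow_dom_def)
 obtain t0 C where C: "0 < t0" "0 <= C" "{- t0..t0} \<times> ?K <= push_dom"
 "!!t q. q : ?K ==> |t| <= t0 ==> norm (?G (t, q)-?G (0, q)-t*.pd ?G (1, 0) (0, q)) <= C*t^2"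
 "!!q. q : ?K ==> norm (pd ?G (1, 0) (0, q)) <= C"
 by (rule taylor_in_time[OF sm_dpush K']) blast
 define t1 where "t1 = min t0 1"
 have t1: "0 < t1" "t1 <= 1" "t1 <= t0" using C(1) by (auto simp: t1_def)
 have dom: "(t, x):flow_dom" if "x:K" "|t| <= t1" for x t
 proof -
 have "(t, x, 0):{- t0..t0} \<times> ?K" using that t1(3) by (auto simp: abs_le_iff)
 with C(3) have "(t, x, 0):push_dom" by blast
 thus ?thesis by (simp add: push_dom_def)
 qed
 show ?thesis
 proof (rule that[OF t1(1,2) _ dom, of "2*C"])
 fix x t b assume x: "x:K" and t: "|t| <= t1"
 have unit: "norm (dpush t x b-dcp x b) <= 2*C * |t|" if "norm b <= 1" for b
 proof -
 let ?d = "pd ?G (1, 0) (0, x, b)"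
 have "norm (dpush t x b-dcp x b-t*.?d) <= C*t^2"
 using C(4)[of "(x, b)" t] x t t1(3) that by (simp add: dpush_zero)
 moreover have "C*t^2 <= C * |t|"
 using t t1(2) C(2) lmon[of "|t|" 1 "|t|"] by (intro lmon) (auto simp: sq2)
 moreover have "norm (t*.?d) <= C * |t|"
 using lmon[OF C(5)[of "(x, b)"] abs_ge_zero[of t]] x that by (simp add: mult.commute)
 ultimately show ?thesis using norm_triangle_sub[of "dpush t x b-dcp x b" "t*.?d"] by simp
 qed
 have l: "linear (%b. dpush t x b-dcp x b)"
 using lin_dpush[OF dom[OF x t]] lin_dcp x K(2) Om(3) by (intro linear_compose_sub) auto
 show "norm (dpush t x b-dcp x b) <= 2*C * |t|*norm b"
 proof (cases "b = 0")
 case False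
 have "norm (dpush t x b-dcp x b)/norm b <= 2*C * |t|"
 using unit[of "b /\<^sub>R norm b"] False unfolding linear_cmul[OF l] by (simp add: divide_inverse mult.commute)
 thus ?thesis using False by (simp add: pos_divide_le_eq)
 qed (simp add: linear_0[OF l])
 qed (use C(2) in auto)
qed

text \<open>Near each point of \<open>Ga\<close> the difference of \<open>push t\<close> and p has a
  small Lipschitz constant, and p is the identity on \<open>Ga\<close>, so the map is injective at
  distances below \<open>e\<close>. Points farther apart cannot collide, since no point moves by
  more than e/4.\<close>

lemma push_inj:
 obtains t1 where "0 < t1" "!!t. |t| <= t1 ==> inj_on (push t) Ga"
proof -
 obtain e where e: "e > 0" "(UN x:Ga. cball x e) <= Om"
 using compact_subset_open_imp_cball_epsilon_subset[OF compact Om(1,2)] by metis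
 define K where "K = {x+y | x y. x:Ga & y:cball 0 e}"
 have K: "compact K" unfolding K_def by (rule compact_sums[OF compact compact_cball])
 have Kc: "cball x e <= K" if "x:Ga" for x
 proof
 fix z assume "z:cball x e"
 hence "z = x+(z-x)" "z-x:cball 0 e" by (auto simp: dist_norm norm_minus_commute)
 thus "z:K" using that unfolding K_def by blast
 qed
 have "K <= Om"
 proof
 fix z assume "z:K"
 then obtain x y where "z = x+y" "x:Ga" "norm y <= e" by (auto simp: K_def)
 hence "z:cball x e" by (simp add: dist_norm)
 thus "z:Om" using e(2) \<open>x : Ga\<close> by blast
 qed
 then obtain t1 A where A: "0 < t1" "t1 <= 1" "0 <= A"
 "!!x t. x:K ==> |t| <= t1 ==> (t, x):flow_dom"
 "!!x t b. x:K ==> |t| <= t1 ==> norm (dpush t x b-dcp x b) <= A * |t|*norm b"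
 using dpush_near[OF K] by metis
 obtain B0 where B0: "0 <= B0" "!!x. x:Ga ==> norm (X x) <= B0"
 by (rule cpt_bound[OF compact continuous_on_subset[OF sm_cont[OF X] Om(2)]]) blast
 define B where "B = B0+1"
 have B: "0 < B" "!!x. x:Ga ==> norm (X x) <= B" using B0 by (auto simp: B_def intro: add_increasing2)
 \<comment> \<open>The second bound makes the Lipschitz constant \<open>A * |t|\<close> at most 1/2,
   the third makes the displacement at most e/4.\<close>
 define t2 where "t2 = min t1 (min (1/(2*(A+1))) (e/(8*B)))"
 have t2: "0 < t2" "t2 <= t1" "t2 <= 1/(2*(A+1))" "t2 <= e/(8*B)"
 using A(1,3) B(1) e(1) by (auto simp: t2_def)
 show ?thesis
 proof (rule that[OF t2(1)], rule inj_onI)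
 fix t x y assume t: "|t| <= t2" and xy: "x:Ga" "y:Ga" and eq: "push t x = push t y"
 have tB: "|t|*B <= e/8"
 proof -
 have "|t|*B <= (e/(8*B))*B" using t t2(4) B(1) e(1) by (intro mult_mono) auto
 also have "... = e/8" using B(1) by simp
 finally show ?thesis .
 qed
 have near: "dist x (push t x) <= e/4" if "x:Ga" for x
 proof -
 have "dist (x+t*.X x) (push t x) <= dist (x+t*.X x) x" unfolding push_def by (rule cp_le[OF that])
 moreover have "dist (x+t*.X x) x <= e/8"
 using lmon[OF B(2)[OF that] abs_ge_zero[of t]] tB by (simp add: dist_norm)
 ultimately show ?thesis using dist_triangle2[of x "push t x" "x+t*.X x"] by (simp add: dist_commute)
 qed
 have close: "dist x y <= e/2"
 using near[OF xy(1)] near[OF xy(2)] eq dist_triangle2[of x y "push t x"] by (simp add: dist_commute)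
 have der: "((%z. push t z-cp z) has_derivative (%b. dpush t z b-dcp z b)) (at z within cball x e)"
 if "z:cball x e" for z
 proof (rule has_derivative_at_withinI, rule has_derivative_diff)
 have "z:K" using Kc xy(1) that by blast
 thus "(push t has_derivative dpush t z) (at z)" using push_der[OF A(4)] t t2(2) by auto
 show "(cp has_derivative dcp z) (at z)"
 by (rule cp_der) (use that e(2) xy(1) Om(3) in blast)
 qed
 have on: "onorm (%b. dpush t z b-dcp z b) <= A * |t|" if "z:cball x e" for z
 proof (rule onorm_le)
 fix b
 have "z:K" using Kc[OF xy(1)] that by blast
 thus "norm (dpush t z b-dcp z b) <= A * |t|*norm b" by (rule A(5)) (use t t2(2) in simp)
 qed
 have "norm ((push t y-cp y)-(push t x-cp x)) <= (A * |t| )*norm (y-x)"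
 using close e(1) by (intro differentiable_bound[OF convex_cball der on]) (auto simp: dist_commute)
 hence "norm (y-x) <= (A * |t| )*norm (y-x)"
 using eq cp_self xy by (simp add: norm_minus_commute)
 also have "... <= (1/2)*norm (y-x)"
 proof (rule rmon)
 have "A * |t| <= (A+1)*(1/(2*(A+1)))" using t t2(3) A(3) by (intro mult_mono) auto
 also have "... = 1/2" using A(3) by simp
 finally show "A * |t| <= 1/2" .
 qed simp
 finally show "x = y" by simp
 qed
qed

lemma push_in: "push t x:Ga"
 unfolding push_def by (rule cp_in)

text \<open>First variation of length. The derivative of the frame along \<open>X\<close> is normal
  by \<open>frame_der_normal\<close>, so only the derivative of \<open>X\<close>
  contributes.\<close>

lemma dpush_inner_der:
 assumes q: "q:Ga" and v: "v:tangent_space Ga q"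
 shows "((%t. dpush t q v.*dpush t q v) has_derivative (%h. h*(2*(v.*frechet_derivative X (at q) v)))) (at 0)"
proof -
 let ?DX = "FD X q v"
 let ?a = "dcp q ?DX+(SUM m:UNIV. (v $ m)*.frechet_derivative (fr m) (at q) (X q))"
 have "v.*?a = v.*?DX"
 using dcp_sym[OF q, of v ?DX] by (simp add: dcp_tangent[OF q v] inner_add_right frame_der_normal[OF q v])
 hence "(%h. dpush 0 q v.*(h*.?a)+(h*.?a).*dpush 0 q v) = (%h. h*(2*(v.*?DX)))"
 by (simp add: fun_eq_iff dpush_zero dcp_tangent[OF q v] inner_commute)
 thus ?thesis using has_derivative_inner[OF dpush_time_der[OF q] dpush_time_der[OF q], of v v] by simp
qed

lemma sdiv_frame_sum:
 fixes u :: "'i::finite => real^'k"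
 assumes q: "q:Ga" and u: "!!i j. u i.*u j = (if i = j then 1 else 0)"
 and sp: "span (range u) = tangent_space Ga q"
 shows "surface_div Ga X q = (SUM i:UNIV. u i.*frechet_derivative X (at q) (u i))"
proof -
 have tanu: "u i:tangent_space Ga q" for i unfolding sp[symmetric] by (simp add: span_base)
 have Q: "dcp q v = (SUM i:UNIV. (v.*u i)*.u i)" for v
 proof -
 have "dcp q v:span (range u)" unfolding sp by (rule dcp_in_tsp[OF q])
 from on_frame_expand[OF u this] show ?thesis
 by (simp add: dcp_sym[OF q] dcp_tangent[OF q tanu])
 qed
 show ?thesis using trace_on_frame[OF sm_lin_der[OF X] u Q] q Om(2) by (auto simp: sdiv_eq[OF q] fr_def)
qed

text \<open>In an orthonormal tangent basis the Gram matrix of \<open>dpush t q\<close> is the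
  identity plus \<open>t\<close> times a matrix of trace 2 div X plus O(t^2). The determinant is
  expanded by \<open>det_near_identity\<close> and its root by
  \<open>sqrt_lower_bound\<close>.\<close>

lemma push_gram_lower:
 fixes d :: "'d::finite itself"
 obtains t1 C where "0 < t1" "0 <= C" "!!t q. q:Ga ==> |t| <= t1 ==> (t, q):flow_dom"
 "!!t q (f :: real^'d => real^'k). q:Ga ==> |t| <= t1 ==> linear f ==> inj f ==> range f = tangent_space Ga q ==>
 (1+t * surface_div Ga X q-C*t^2) * sqrt (gram f) <= sqrt (gram (dpush t q \<circ> f))"
proof -
 \<comment> \<open>Pairs of vectors in the unit ball are variables here, so that one Taylor
   remainder serves all entries of the Gram matrix, off-diagonal ones included.\<close>
 let ?K = "Ga \<times> (cball 0 1 :: (real^'k) set) \<times> (cball 0 1 :: (real^'k) set)"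
 let ?F = "%z. dpush (fst z) (fst (snd z)) (snd (snd z))"
 let ?l = "%z :: real \<times> (real^'k) \<times> (real^'k) \<times> (real^'k). (fst z, fst (snd z), fst (snd (snd z)))"
 let ?r = "%z :: real \<times> (real^'k) \<times> (real^'k) \<times> (real^'k). (fst z, fst (snd z), snd (snd (snd z)))"
 let ?G = "%z. ?F (?l z).*?F (?r z)"
 let ?W = "?l -` push_dom"
 have oW: "open ?W" by (intro open_vimage sm_dpush(1) continuous_intros)
 have bl: "bounded_linear ?l" "bounded_linear ?r"
 by (intro bounded_linear_Pair bounded_linear_fst bounded_linear_snd bounded_linear_compose[OF bounded_linear_fst] bounded_linear_compose[OF bounded_linear_snd])+
 have sG: "smooth_on ?W ?G"
 by (rule sm_inner[OF oW sm_comp[OF oW sm_dpush(1) _ sm_dpush(2) sm_bl[OF bl(1)]]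
 sm_comp[OF oW sm_dpush(1) _ sm_dpush(2) sm_bl[OF bl(2)]]]) (auto simp: push_dom_def)
 have K: "compact ?K" "{0} \<times> ?K <= ?W" using compact Om by (auto intro!: compact_Times simp: push_dom_def flow_dom_def)
 obtain t0' B where B: "0 < t0'" "0 <= B" "{- t0'..t0'} \<times> ?K <= ?W"
 "!!t q. q : ?K ==> |t| <= t0' ==> norm (?G (t, q)-?G (0, q)-t*.pd ?G (1, 0) (0, q)) <= B*t^2"
 "!!q. q : ?K ==> norm (pd ?G (1, 0) (0, q)) <= B"
 by (rule taylor_in_time[OF oW sG K]) blast
 define t0 where "t0 = min t0' 1"
 have t0: "0 < t0" "t0 <= 1" "t0 <= t0'" using B(1) by (auto simp: t0_def)
 obtain Cd where Cd: "Cd >= 0" "!!(N :: real^'d^'d) e. 0 <= e ==> e <= 1 ==> (!!i j. |N $ i $ j| <= e) ==>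
 |det (mat 1+N)-1-trace N| <= Cd*e^2"
 using det_near_identity[where 'n = 'd] by blast
 define n where "n = real CARD('d)"
 define E where "E = n*B+Cd*(B+B)^2"
 define Dv where "Dv = n*B"
 have E: "0 <= E" "0 <= Dv" using B(2) Cd(1) by (auto simp: E_def n_def Dv_def)
 define C where "C = E/2+(Dv+E)^2/2"
 have C: "0 <= C" using E by (simp add: C_def)
 \<comment> \<open>The second bound keeps the entries of \<open>N\<close> below 1, as
   \<open>det_near_identity\<close> demands; the third keeps \<open>|a|\<close> below 1 for the
   square root.\<close>
 define t1 where "t1 = min t0 (min (1/(B+B+1)) (1/(Dv+E+1)))"
 have t1: "0 < t1" "t1 <= t0" "t1 <= 1/(B+B+1)" "t1 <= 1/(Dv+E+1)"
 using t0 B(2) E by (auto simp: t1_def)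
 have dom: "(t, q):flow_dom" if "q:Ga" "|t| <= t1" for t q
 proof -
 have "(t, q, 0, 0):{- t0'..t0'} \<times> ?K" using that t0(3) t1(2) by (auto simp: abs_le_iff)
 with B(3) have "(t, q, 0, 0) : ?W" by blast
 thus ?thesis by (simp add: push_dom_def)
 qed
 show ?thesis
 proof (rule that[OF t1(1) C dom])
 fix t q and f :: "real^'d => real^'k"
 assume q: "q:Ga" and t: "|t| <= t1" and f: "linear f" "inj f" and rf: "range f = tangent_space Ga q"
 have qt: "q:tube" using q sub_tb by blast
 have L: "linear (dpush t q)" by (rule lin_dpush[OF dom[OF q t]])
 obtain u :: "'d => real^'k" where u: "!!i. u i:range f" "!!i j. u i.*u j = (if i = j then 1 else 0)"
 "span (range u) = range f" "gram (dpush t q \<circ> f) = det (\<chi> i j. dpush t q (u i).*dpush t q (u j))*gram f"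
 by (rule gram_comp_frame[OF f L]) blast
 have uK: "(q, u i, u j) : ?K" for i j using q u(2)[of i i] u(2)[of j j] by (simp add: norm_eq_sqrt_inner)
 have ut: "u i:tangent_space Ga q" for i using u(1) rf by blast
 define s where "s i j = pd ?G (1, 0) (0, q, u i, u j)" for i j
 define r where "r i j = ?G (t, q, u i, u j)-?G (0, q, u i, u j)-t * s i j" for i j
 have sb: "|s i j| <= B" for i j using B(5)[OF uK, of i j] by (simp add: s_def)
 have rb: "|r i j| <= B*t^2" for i j using B(4)[OF uK, of t i j] t t0(3) t1(2) by (simp add: r_def s_def)
 have ssum: "(SUM i:UNIV. s i i) = 2 * surface_div Ga X q"
 proof -
 have "s i i = 2*(u i.*frechet_derivative X (at q) (u i))" for i
 proof -
 have p: "((%t. (t, q, u i, u i)) has_derivative (%h. (h, 0))) (at 0)"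
 by (rule has_derivative_Pair[OF has_derivative_ident has_derivative_const])
 have "(0, q, u i, u i) : ?W" using K(2) uK by blast
 from has_derivative_compose[OF p sm_der[OF sG this]]
 have "((%t. dpush t q (u i).*dpush t q (u i)) has_derivative (%h. FD ?G (0, q, u i, u i) (h, 0))) (at 0)" by simp
 from fun_cong[OF has_derivative_unique[OF this dpush_inner_der[OF q ut]], of 1] show ?thesis by (simp add: s_def)
 qed
 thus ?thesis using sdiv_frame_sum[OF q u(2) u(3)[unfolded rf]] by (simp add: sum_distrib_left)
 qed
 define N where "N = (\<chi> i j. t * s i j+r i j)"
 have mat: "(\<chi> i j. dpush t q (u i).*dpush t q (u j)) = mat 1+N"
 by (simp add: vec_eq_iff N_def mat_def r_def dpush_zero dcp_tangent[OF q ut] u(2))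
 define e where "e = (B+B) * |t|"
 have tt: "t^2 <= |t|"
 using t t1(2) t0(2) lmon[of "|t|" 1 "|t|"] by (simp add: sq2)
 have Ne: "|N $ i $ j| <= e" for i j
 proof -
 have "|t * s i j| <= |t|*B" unfolding abs_mult by (rule lmon[OF sb]) simp
 moreover have "B*t^2 <= B * |t|" by (rule lmon[OF tt B(2)])
 ultimately show ?thesis using rb[of i j] abs_triangle_ineq[of "t * s i j" "r i j"]
 by (simp add: N_def e_def algebra_simps)
 qed
 have e1: "0 <= e" "e <= 1"
 proof -
 show "0 <= e" using B(2) by (simp add: e_def)
 have "e <= (B+B+1)*(1/(B+B+1))" unfolding e_def using t t1(3) B(2) by (intro mult_mono) auto
 thus "e <= 1" using B(2) by simp
 qed
 have tr: "trace N = 2*t * surface_div Ga X q+(SUM i:UNIV. r i i)"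
 proof -
 have "trace N = t*(SUM i:UNIV. s i i)+(SUM i:UNIV. r i i)"
 by (simp add: trace_def N_def sum.distrib sum_distrib_left)
 thus ?thesis by (simp add: ssum)
 qed
 have rsum: "|SUM i:UNIV. r i i| <= n*(B*t^2)"
 unfolding n_def using sum_norm_bound[of UNIV "%i. r i i" "B*t^2"] rb by simp
 have div: "|2 * surface_div Ga X q| <= Dv"
 using sum_norm_bound[of UNIV "%i. s i i" B] sb by (simp add: ssum Dv_def n_def)
 define a where "a = 2*t * surface_div Ga X q-E*t^2"
 have "|det (mat 1+N)-1-trace N| <= Cd*e^2" by (rule Cd(2)[OF e1 Ne])
 moreover have "Cd*e^2 = (Cd*(B+B)^2)*t^2" by (simp add: e_def power_mult_distrib)
 ultimately have det: "1+a <= det (mat 1+N)"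
 using rsum tr unfolding a_def E_def by (simp add: algebra_simps)
 have aabs: "|a| <= (Dv+E) * |t|"
 proof -
 have "|2*t * surface_div Ga X q| <= Dv * |t|"
 using rmon[OF div abs_ge_zero[of t]] by (simp add: abs_mult mult_ac)
 moreover have "E*t^2 <= E * |t|" "0 <= E*t^2" using E(1) tt by (auto intro: lmon)
 ultimately show ?thesis unfolding a_def distrib_right by linarith
 qed
 have "(Dv+E) * |t| <= (Dv+E+1)*(1/(Dv+E+1))" using t t1(4) E by (intro mult_mono) auto
 hence a1: "|a| <= 1" using aabs E by simp
 have "a^2 <= ((Dv+E) * |t| )^2" using aabs by (metis abs_ge_zero power2_abs power_mono)
 hence a2: "a^2 <= (Dv+E)^2*t^2" by (simp add: power_mult_distrib)
 have "C*t^2 = E*t^2/2+(Dv+E)^2*t^2/2" by (simp add: C_def field_simps)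
 moreover have "a/2 = t * surface_div Ga X q-E*t^2/2" by (simp add: a_def field_simps)
 ultimately have "1+t * surface_div Ga X q-C*t^2 <= 1+a/2-a^2/2"
 using a2 by linarith
 also have "... <= sqrt (1+a)" by (rule sqrt_lower_bound) (use a1 in linarith)
 also have "... <= sqrt (det (mat 1+N))" using det by simp
 finally have "(1+t * surface_div Ga X q-C*t^2) * sqrt (gram f) <= sqrt (det (mat 1+N)) * sqrt (gram f)"
 using gram_pos[OF f] by (intro rmon) auto
 thus "(1+t * surface_div Ga X q-C*t^2) * sqrt (gram f) <= sqrt (gram (dpush t q \<circ> f))"
 by (simp add: u(4) mat real_sqrt_mult)
 qed
qed

end

locale sfield = submfd Ga de sg d + tfield Ga de X Om
 for Ga :: "(real^'k) set" and de sg and d :: "'d::finite itself" and X Om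
begin

lemma cont_dv0: "cont Ga (surface_div Ga X)"
proof -
 have "cont Ga (%q. SUM j:UNIV. FD X q (fr j q) $ j)"
 by (intro continuous_on_sum continuous_on_component continuous_on_subset[OF sm_cont[OF
 sm_pdiff_field[OF Om(1) X sm_subset[OF sm_fr Om(3)]]] Om(2)])
 thus ?thesis by (subst continuous_on_cong[OF refl sdiv_eq])
qed

text \<open>The maps \<open>q \<mapsto> p(q + t X(q))\<close> are injective self-maps of \<open>Ga\<close> with area distortion at least
 \<open>1 + t div X - C t\<^sup>2\<close>. Since their images have at most the area of \<open>Ga\<close>, no matter whether they are
 onto, the first order term must vanish.\<close>

theorem int_sdiv: "(LINT q|M. surface_div Ga X q) = 0"
proof -
 let ?div = "surface_div Ga X"
 obtain t1 C where G: "0 < t1" "0 <= C" "!!t q. q:Ga ==> |t| <= t1 ==> (t, q):flow_dom"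
 "!!t q (f :: real^'d => real^'k). q:Ga ==> |t| <= t1 ==> linear f ==> inj f ==> range f = tangent_space Ga q ==>
 (1+t*?div q-C*t^2) * sqrt (gram f) <= sqrt (gram (dpush t q \<circ> f))"
 by (rule push_gram_lower) blast
 obtain t2 where t2: "0 < t2" "!!t. |t| <= t2 ==> inj_on (push t) Ga" by (rule push_inj) blast
 obtain t3 A where t3: "0 < t3" "0 <= A"
 "!!x t b. x:Ga ==> |t| <= t3 ==> norm (dpush t x b-dcp x b) <= A * |t|*norm b"
 by (rule dpush_near[OF compact Om(2)]) blast
 obtain Dv where Dv: "0 <= Dv" "!!q. q:Ga ==> |?div q| <= Dv"
 by (rule cpt_bound[OF compact cont_dv0]) auto
 define T where "T = min (min 1 t1) (min (min t2 t3) (min (1/(2*(A+1))) (1/(Dv+C+1))))"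
 have T: "0 < T" "T <= 1" "T <= t1" "T <= t2" "T <= t3" "T <= 1/(2*(A+1))" "T <= 1/(Dv+C+1)"
 using G(1,2) t2(1) t3(1,2) Dv(1) by (auto simp: T_def)
 define m where "m = measure M Ga"
 \<comment> \<open>The estimate is available for both signs of \<open>t\<close>; dividing by
   \<open>t\<close> and letting it tend to 0 bounds the integral from above and from below by
   0.\<close>
 have main: "t*(LINT q|M. ?div q) <= C*t^2*m" if t: "|t| <= T" for t
 proof -
 have dom: "(t, q):flow_dom" if "q:Ga" for q using G(3) that t T(3) by auto
 have inj: "inj_on (push t) Ga" using t2(2) t T(4) by auto
 define h where "h q = 1+t*?div q-C*t^2" for q
 define j where "j q = ind Ga q*.h q" for q
 have hc: "cont Ga h" unfolding h_def by (intro continuous_intros cont_dv0)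
 have jm: "j:bmeas borel"
 unfolding j_def by (rule borel_extension[OF cont_meas[OF hc]])
 have h0: "0 <= h q" if "q:Ga" for q
 proof -
 have "|t*?div q| <= |t|*Dv" unfolding abs_mult by (rule lmon[OF Dv(2)[OF that]]) simp
 moreover have "C*t^2 <= C * |t|"
 using t T(2) G(2) lmon[of "|t|" 1 "|t|"] by (intro lmon) (auto simp: sq2)
 moreover have "|t|*Dv+C * |t| = |t|*(Dv+C)" by (simp add: algebra_simps)
 moreover have "|t|*(Dv+C) <= (1/(Dv+C+1))*(Dv+C+1)"
 using t T(7) Dv(1) G(2) by (intro mult_mono) auto
 moreover have "(1/(Dv+C+1))*(Dv+C+1) = 1" using Dv(1) G(2) by simp
 ultimately show ?thesis unfolding h_def by simp
 qed
 have pc: "cont Ga (push t)"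
 using push_der[OF dom] has_derivative_continuous continuous_at_imp_continuous_on by blast
 obtain g where hom: "homeomorphism Ga (push t ` Ga) (push t) g"
 using homeomorphism_compact[OF compact pc refl inj] by blast
 have pb: "push t ` Ga:sets borel"
 by (intro borel_closed compact_imp_closed compact_continuous_image[OF pc compact])
 have pB: "push t ` B:sets sg" if "B:sets borel" "B <= Ga" for B
 using borel_image_homeo[OF hom pb that] by (simp add: sets_sg)
 obtain C0 I where at: "1 <= C0" "finite I" "!!ph y0 r. (ph, y0, r):I ==> patch C0 ph y0 r"
 "Ga = (\<Union>(ph, y0, r)\<in>I. ph ` ball y0 (r/2))" by (rule atlas) blast
 let ?P = "%(ph, y0, r). ph ` ball y0 (r/2) :: (real^'k) set"
 let ?j = "%x. enr (j x)"
 have jb: "?j:bmeas borel" using jm by simp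
 have jsg: "?j:bmeas sg" using jb measurable_cong_sets[OF sets_sg refl] by blast
 have sub: "ball y0 (r/2) <= cball y0 r" if "(ph, y0, r):I" for ph and y0 :: "real^'d" and r
 using patchD(1)[OF at(3)[OF that]] by auto
 have le: "em (density sg ?j) Ga <= em sg (push t ` Ga)"
 \<comment> \<open>On each patch the set is the image of a coordinate set, and moving it gives
   another injective immersion, so both areas are integrals over the same coordinates and the
   densities can be compared.\<close>
 proof (rule finite_cover_le[OF at(2), where P = ?P and D = Ga and g = "%B. em sg (push t ` B)"])
 show "?P i:sets borel" if "i:I" for i
 using that patch_image_sets(1)[OF at(3) _ sub] by (cases i) auto
 show "Ga:sets borel" using closed by auto
 show "Ga <= (UN i:I. ?P i)" using at(4) by simp
 show "em (density sg ?j) (B Un E) <= em (density sg ?j) B+em (density sg ?j) E"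
 if "B:sets borel" "E:sets borel" for B E
 using that by (intro emeasure_subadditive) (auto simp: sets_sg)
 show "em sg (push t ` B)+em sg (push t ` E) <= em sg (push t ` (B Un E))"
 if "B:sets borel" "E:sets borel" "B <= Ga" "E <= Ga" "B Int E = {}" for B E
 proof -
 have "push t ` B Int push t ` E = {}" using inj_on_image_Int[OF inj that(3,4)] that(5) by simp
 thus ?thesis using plus_emeasure[OF pB[OF that(1,3)] pB[OF that(2,4)]] by (simp add: image_Un)
 qed
 fix i B assume i: "i:I" and B: "B:sets borel" "B <= ?P i"
 obtain ph y0 r where ii: "i = (ph, y0, r)" by (cases i)
 have p: "patch C0 ph y0 r" using at(3) i ii by blast
 obtain V where V: "chart V ph" "cball y0 r <= V" using patch_chart[OF p] by blast
 note im = immD[OF chartD(1)[OF V(1)]]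
 have q: "ph y:Ga" if "y:V" for y using chartD(2)[OF V(1)] that by blast
 let ?b = "ball y0 (r/2)"
 have bV: "?b <= V" using sub[of ph y0 r] i ii V(2) by blast
 define B0 where "B0 = ph -` B Int ?b"
 have B0: "B0:sets borel" "B0 <= V" "ph ` B0 = B"
 using chart_preimage[OF V(1) B(1) _ bV] bV B(2) ii by (auto simp: B0_def)
 have comp: "((%y. push t (ph y)) has_derivative (%w. dpush t (ph y) (FD ph y w))) (at y)"
 if "y:V" for y
 by (rule has_derivative_compose[OF sm_der[OF im(2) that] push_der[OF dom[OF q[OF that]]]])
 have fd: "FD (push t \<circ> ph) y = dpush t (ph y) \<circ> FD ph y" if "y:V" for y
 using frechet_derivative_at[OF comp[OF that]] by (simp add: o_def)
 have imm: "injective_immersion V (push t \<circ> ph)"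
 unfolding injective_immersion_def
 proof (intro conjI ballI)
 have "smooth_on V (%y. X (ph y))"
 by (rule sm_comp[OF im(1) Om(1) _ X im(2)]) (use q Om(2) in blast)
 hence sm: "smooth_on V (%y. ph y+t*.X (ph y))"
 by (intro sm_add[OF im(1,2)] sm_scaleR[OF im(1) sm_const])
 have "smooth_on V (%y. cp (ph y+t*.X (ph y)))"
 by (rule sm_comp[OF im(1) op_tube _ sm_cp sm]) (use flow_domD(2)[OF dom[OF q]] in blast)
 thus "smooth_on V (push t \<circ> ph)" by (simp add: push_def o_def)
 show "inj_on (push t \<circ> ph) V" using im(3) inj_on_subset[OF inj chartD(2)[OF V(1)]] by (rule comp_inj_on)
 fix y assume y: "y:V"
 have "dpush t (ph y) (FD ph y w) = 0 ==> w = 0" for w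
 proof -
 let ?w = "FD ph y w"
 assume 0: "dpush t (ph y) ?w = 0"
 have "dcp (ph y) ?w = ?w" using range_chart_der[OF V(1) y] dcp_tangent[OF q[OF y]] by blast
 hence "norm ?w <= A * |t|*norm ?w" using t3(3)[OF q[OF y], of t ?w] 0 t T(5) by simp
 also have "... <= (1/2)*norm ?w"
 proof (rule rmon)
 have "A * |t| <= (A+1)*(1/(2*(A+1)))" using t T(6) t3(2) by (intro mult_mono) auto
 also have "... = 1/2" using t3(2) by simp
 finally show "A * |t| <= 1/2" .
 qed simp
 finally have "?w = 0" by simp
 thus "w = 0" using im(4)[OF y] linear_0[OF im(5)[OF y]] by (metis injD)
 qed
 moreover have "linear (dpush t (ph y) \<circ> FD ph y)"
 by (rule linear_compose[OF im(5)[OF y] lin_dpush[OF dom[OF q[OF y]]]])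
 ultimately show "inj (FD (push t \<circ> ph) y)"
 unfolding fd[OF y] by (simp add: linear_injective_0)
 qed (rule im(1))
 have "em (density sg ?j) B = (NN sg (%x. (?j x)*ind (ph ` B0) x))"
 unfolding B0(3) by (rule emeasure_density[OF jsg]) (use B(1) in \<open>simp add: sets_sg\<close>)
 also have "... = (NN lborel (%y. (?j (ph y)*enr (adens ph y))*ind B0 y))"
 by (rule chart_nn_int[OF V(1) B0(1,2) jb])
 also have "... <= (NN lborel (%y. (enr (adens (push t \<circ> ph) y))*ind B0 y))"
 proof (rule nn_integral_mono)
 fix y
 show "?j (ph y)*enr (adens ph y)*ind B0 y <=
 enr (adens (push t \<circ> ph) y)*ind B0 y"
 proof (cases "y:B0")
 case True
 hence y: "y:V" using B0(2) by blast
 have "j (ph y)*adens ph y <= adens (push t \<circ> ph) y"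
 using G(4)[OF q[OF y] _ im(5)[OF y] im(4)[OF y] range_chart_der[OF V(1) y], of t] t T(3) q[OF y] by (simp add: adens_gram fd[OF y] j_def h_def)
 hence "enr (j (ph y)*adens ph y) <= enr (adens (push t \<circ> ph) y)"
 by (rule ennreal_leI)
 thus ?thesis using True im(6)[OF y] by (simp add: ennreal_mult'')
 qed simp
 qed
 also have "... = em sg ((push t \<circ> ph) ` B0)" by (rule area_formula[OF imm B0(1,2), symmetric])
 also have "(push t \<circ> ph) ` B0 = push t ` B" using B0(3) by auto
 finally show "em (density sg ?j) B <= em sg (push t ` B)" .
 qed (auto)
 have "push t ` Ga <= Ga" using push_in by blast
 hence "em sg (push t ` Ga) <= em sg Ga" using closed by (intro emeasure_mono) (auto simp: sets_sg)
 with le have "em (density sg ?j) Ga <= em sg Ga" by simp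
 also have "em sg Ga = enr m"
 unfolding m_def emeasure_M[OF subset_refl, symmetric] by (rule emeasure_eq_measure)
 also have "em (density sg ?j) Ga = (NN M (%x. enr (h x)))"
 proof -
 have "em (density sg ?j) Ga = (NN sg (%x. ?j x*ind Ga x))"
 by (rule emeasure_density[OF jsg]) (use closed in \<open>auto simp: sets_sg\<close>)
 also have "... = (NN sg (%x. enr (h x)*ind Ga x))"
 by (rule nn_integral_cong) (simp add: j_def indicator_def)
 finally show ?thesis using nn_integral_restrict_space[OF Ga_sets] by simp
 qed
 also have "(NN M (%x. enr (h x))) = enr (LINT x|M. h x)"
 by (rule nn_integral_eq_integral[OF cont_int[OF hc]]) (use h0 space_M in auto)
 finally have "(LINT x|M. h x) <= m" by (simp add: m_def)
 moreover have "(LINT x|M. h x) = m+t*(LINT x|M. ?div x)-C*t^2*m"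
 unfolding h_def using cont_int[OF cont_dv0] space_M by (simp add: m_def)
 ultimately show ?thesis by simp
 qed
 have m: "0 <= m" by (simp add: m_def)
 let ?I = "LINT q|M. ?div q"
 have "|?I| <= (C*m)*t" if "0 < t" "t <= T" for t
 proof -
 have "t*?I <= t*((C*m)*t)" using main[of t] that by (simp add: sq2 mult_ac)
 hence 1: "?I <= (C*m)*t" using that by simp
 have "t*(- ?I) <= t*((C*m)*t)" using main[of "- t"] that by (simp add: sq2 mult_ac)
 hence "- ?I <= (C*m)*t" using that(1) by (simp only: mult_le_cancel_left_pos)
 with 1 show ?thesis by simp
 qed
 hence ev: "eventually (%t. |?I| <= (C*m)*t) (at_right 0)"
 using T(1) by (auto simp: eventually_at_right_field intro!: exI[of _ T])
 have "((%t. (C*m)*t) \<longlongrightarrow> (C*m)*0) (at_right 0)" by (intro tendsto_intros)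
 hence "|?I| <= (C*m)*0" using ev by (rule tendsto_lowerbound) simp
 thus ?thesis by simp
qed

end

section \<open>Integration by parts and weak gradients\<close>

lemma meas_vec_nth:
 fixes f :: "'a => real^'k"
 assumes [measurable]: "f:bmeas M" shows "(%x. f x $ i):bmeas M"
proof -
 have "(%x. f x.*axis i 1):bmeas M" by simp
 thus ?thesis by (simp add: inner_axis)
qed

lemma wgrad_cong:
 assumes "!!x. x:Ga ==> v x = w x" "sets sg = sets borel"
 shows "weak_surface_grad sg Ga v g \<longleftrightarrow> weak_surface_grad sg Ga w g"
proof -
 have "space (restrict_space sg Ga) = Ga"
 using sets_eq_imp_space_eq[OF assms(2)] by (simp add: space_restrict_space)
 hence "(LINT q|restrict_space sg Ga. v q * surface_div Ga X q) =
 (LINT q|restrict_space sg Ga. w q * surface_div Ga X q)" for X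
 using assms(1) by (intro Bochner_Integration.integral_cong) auto
 thus ?thesis by (simp add: weak_surface_grad_def)
qed

lemma lip_from_local:
 fixes f :: "real^'k => 'b::euclidean_space"
 assumes e: "0 < e" and B: "0 < B" and F: "!!x. x:S ==> norm (f x) <= F"
 and loc: "!!x y. x:S ==> y:S ==> dist x y <= e ==> norm (f x-f y) <= B*dist x y"
 obtains L where "0 < L" "!!x y. x:S ==> y:S ==> norm (f x-f y) <= L*dist x y"
proof (rule that[of "B+2 * |F|/e"])
 show "0 < B+2 * |F|/e" using B e by (intro add_pos_nonneg) auto
 fix x y assume xy: "x:S" "y:S"
 show "norm (f x-f y) <= (B+2 * |F|/e)*dist x y"
 proof (cases "dist x y <= e")
 case True
 have "0 <= 2 * |F|/e*dist x y" using e by simp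
 thus ?thesis using loc[OF xy True] by (simp add: distrib_right)
 next
 case False
 have "norm (f x-f y) <= 2 * |F|"
 using norm_triangle_ineq4[of "f x" "f y"] F[OF xy(1)] F[OF xy(2)] by simp
 also have "... = (2 * |F|/e)*e" using e by simp
 also have "... <= (2 * |F|/e)*dist x y" using False e by (intro lmon) auto
 also have "... <= (B+2 * |F|/e)*dist x y" using B by (intro rmon) auto
 finally show ?thesis .
 qed
qed

context submfd
begin

lemma smooth_tfieldE:
 assumes "tf X"
 obtains Om where "sfield Ga de sg d X Om"
proof -
 obtain U where U: "open U" "Ga <= U" "smooth_on U X" "ALL q:Ga. X q:TS q"
 using assms by (auto simp: smooth_tangent_field_def)
 have "tfield Ga de X (tube Int U)"
 by unfold_locales (use U op_tube sub_tb in \<open>auto intro: sm_subset\<close>)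
 hence "sfield Ga de sg d X (tube Int U)"
 by (intro sfield.intro submfd_axioms)
 thus ?thesis by (rule that)
qed

lemma cont_dv: "tf X ==> continuous_on Ga (dv X)"
 using smooth_tfieldE sfield.cont_dv0 by metis

lemma cont_tfield: "tf X ==> continuous_on Ga X"
 unfolding smooth_tangent_field_def using sm_cont continuous_on_subset by blast

lemma stf_scaleR:
 assumes f: "smT f" and X: "tf X"
 shows "tf (%x. f x*.X x)"
 "!!q. q:Ga ==> dv (%x. f x*.X x) q = f q * dv X q+tg f q.*X q"
proof -
 obtain U where U: "open U" "Ga <= U" "smooth_on U X" "!!q. q:Ga ==> X q:TS q"
 using X by (auto simp: smooth_tangent_field_def)
 have o: "open (tube Int U)" using U(1) op_tube by auto
 have "smooth_on (tube Int U) (%x. f x*.X x)"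
 by (rule sm_scaleR[OF o sm_subset[OF f] sm_subset[OF U(3)]]) auto
 moreover have "f q*.X q:TS q" if "q:Ga" for q
 using U(4)[OF that] that sub_tb by (simp add: tsp_iff linear_cmul[OF lin_dcp] subset_iff)
 ultimately show "tf (%x. f x*.X x)"
 unfolding smooth_tangent_field_def using o U(2) sub_tb by blast
 fix q assume q: "q:Ga"
 show "dv (%x. f x*.X x) q = f q * dv X q+tg f q.*X q"
 using sdiv_scaleR[OF f U(3) q _ U(4)[OF q]] U(2) q tgrad_inner[OF f q, of "X q"] dcp_tangent[OF q U(4)[OF q]] by auto
qed

lemma cont_tgrad:
 assumes "smT f" shows "cont Ga (tg f)"
 unfolding tg_def[abs_def]
 by (intro continuous_on_vec_lambda continuous_on_subset[OF sm_cont[OF sm_td[OF assms]] sub_tb])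

lemma smt_cont: "smT f ==> continuous_on Ga f"
 by (rule continuous_on_subset[OF sm_cont sub_tb])

lemma int_tgrad:
 assumes f: "smT f" and X: "tf X"
 shows "(LINT q|M. tg f q.*X q) = - (LINT q|M. f q * dv X q)"
proof -
 obtain Om where "sfield Ga de sg d (%x. f x*.X x) Om"
 by (rule smooth_tfieldE[OF stf_scaleR(1)[OF f X]])
 hence "0 = (LINT q|M. dv (%x. f x*.X x) q)"
 by (simp add: sfield.int_sdiv)
 also have "... = (LINT q|M. f q * dv X q+tg f q.*X q)"
 by (intro icong) (simp add: space_M stf_scaleR(2)[OF f X])
 also have "... = (LINT q|M. f q * dv X q)+(LINT q|M. tg f q.*X q)"
 by (intro Bochner_Integration.integral_add cont_int continuous_intros smt_cont[OF f]
 cont_dv[OF X] cont_tfield[OF X] cont_tgrad[OF f])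
 finally show ?thesis by simp
qed

lemma wgrad_smooth:
 assumes f: "smT f" shows "wg f (tg f)"
 unfolding weak_surface_grad_def
 using L2_cont[OF cont_tgrad[OF f]] int_tgrad[OF f] tgrad_tangent[OF f] tsp_iff by (auto simp: space_M)

lemma smooth_H1: "smT f ==> f:HA"
 unfolding H1_def using wgrad_smooth L2_cont[OF smt_cont] by blast

text \<open>The divergence of \<open>fr i\<close> on \<open>Ga\<close>, that is, up to sign the i-th
  component of the mean curvature vector. It is the zero order term in integration by parts for
  \<open>td i\<close>.\<close>

definition kap :: "'k => 'k fn" where
 "kap i x = (SUM j:UNIV. FD (fr i) x (fr j x) $ j)"

lemma sm_kap: "smT (kap i)"
 unfolding kap_def[abs_def]
 by (intro sm_sum[OF op_tube] sm_lin_comp[OF op_tube bounded_linear_vec_nth]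
 sm_pdiff_field[OF op_tube sm_fr sm_fr]) simp

lemma sdiv_frame: "q:Ga ==> dv (fr i) q = kap i q"
 by (simp add: sdiv_eq kap_def)

lemma stf_frame: "tf (fr i)"
 unfolding smooth_tangent_field_def using op_tube sub_tb sm_fr frame_tangent by blast

lemma tgrad_frame: "smT f ==> q:Ga ==> tg f q.*fr i q = td i f q"
 by (simp add: tgrad_inner td_def dcp_frame)

text \<open>The weak gradient is tangential, so pairing it with the admissible field
  \<open>f*fr i\<close> isolates its i-th Cartesian component.\<close>

lemma weak_grad_comp:
 assumes G: "wg v G" and f: "smT f"
 shows "(LINT q|M. f q*(G q $ i)) = - (LINT q|M. (td i f q+f q*kap i q) * v q)"
proof -
 have "(LINT q|M. f q*(G q $ i)) = (LINT q|M. G q.*(f q*.fr i q))"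
 proof (rule integral_cong_AE)
 have Gm: "G:bmeas M" and t: "AE q in M. G q:TS q"
 using G by (auto simp: weak_surface_grad_def L2_fun_def)
 note [measurable] = Gm cont_meas[OF smt_cont[OF f]]
 cont_meas[OF cont_tfield[OF stf_frame], of i]
 show "(%q. f q*(G q $ i)):bmeas M"
 by (intro borel_measurable_times meas_vec_nth) measurable
 show "(%q. G q.*(f q*.fr i q)):bmeas M" by simp
 show "AE q in M. f q*(G q $ i) = G q.*(f q*.fr i q)"
 using t AE_space by eventually_elim (simp add: space_M inner_frame dcp_tangent)
 qed
 also have "... = - (LINT q|M. v q * dv (%q. f q*.fr i q) q)"
 using G stf_scaleR(1)[OF f stf_frame] unfolding weak_surface_grad_def by blast
 also have "(LINT q|M. v q * dv (%q. f q*.fr i q) q) = (LINT q|M. (td i f q+f q*kap i q) * v q)"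
 by (intro icong)
 (simp add: space_M stf_scaleR(2)[OF f stf_frame] tgrad_frame[OF f]
 sdiv_frame algebra_simps)
 finally show ?thesis .
qed

lemma int_tder:
 assumes f: "smT f" and g: "smT g"
 shows "(LINT q|M. td i f q*g q) = - (LINT q|M. f q*td i g q+kap i q*f q*g q)"
proof -
 have "(LINT q|M. td i f q*g q) = (LINT q|M. g q*(tg f q $ i))"
 by (simp add: tg_def mult.commute)
 also have "... = - (LINT q|M. (td i g q+g q*kap i q)*f q)"
 by (rule weak_grad_comp[OF wgrad_smooth[OF f] g])
 finally show ?thesis by (simp add: algebra_simps)
qed

text \<open>\<open>Ga\<close> is not convex, so the mean value inequality is used on balls around
  its points; these lie in one compact subset of the tube, which makes the constant uniform.\<close>

lemma smooth_lip_local: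
 fixes f :: "real^'k => 'b::euclidean_space"
 assumes f: "smT f"
 obtains e L where "0 < e" "0 < L" "!!q. q:Ga ==> cball q e <= tube"
 "!!q x y. q:Ga ==> x:cball q e ==> y:cball q e ==> norm (f x-f y) <= L*dist x y"
proof -
 obtain e where e: "e > 0" "(UN x:Ga. cball x e) <= tube"
 using compact_subset_open_imp_cball_epsilon_subset[OF compact op_tube sub_tb] by metis
 define K where "K = {x+y | x y. x:Ga & y:cball 0 e}"
 have K: "compact K" unfolding K_def by (rule compact_sums[OF compact compact_cball])
 have Kc: "cball x e <= K" if "x:Ga" for x
 proof
 fix z assume "z:cball x e"
 hence "z = x+(z-x)" "z-x:cball 0 e" by (auto simp: dist_norm)
 thus "z:K" using that unfolding K_def by blast
 qed
 have Kt: "K <= tube"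
 proof
 fix z assume "z:K"
 then obtain x y where "z = x+y" "x:Ga" "norm y <= e" by (auto simp: K_def)
 hence "z:cball x e" by (simp add: dist_norm)
 thus "z:tube" using e(2) \<open>x : Ga\<close> by blast
 qed
 have "cont K (%x. SUM b:Basis. norm (pd f b x))"
 by (intro continuous_on_sum continuous_on_norm continuous_on_subset[OF sm_cont[OF
 sm_pdiff_field[OF op_tube f sm_const]] Kt])
 then obtain B where B: "0 <= B" "!!x. x:K ==> norm (SUM b:Basis. norm (pd f b x)) <= B"
 by (rule cpt_bound[OF K]) blast
 show ?thesis
 proof (rule that[of e "B+1"])
 fix q x y assume q: "q:Ga" and xy: "x:cball q e" "y:cball q e"
 have der: "(f has_derivative FD f z) (at z within cball q e)" if "z:cball q e" for z
 by (rule has_derivative_at_withinI[OF sm_der[OF f]]) (use that Kc[OF q] Kt in blast)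
 have on: "onorm (FD f z) <= B" if "z:cball q e" for z
 proof (rule onorm_le)
 fix w
 have zK: "z:K" "z:tube" using that Kc[OF q] Kt by auto
 have "norm (FD f z w) <= (SUM b:Basis. norm (pd f b z))*norm w"
 by (rule lin_norm_le_sum_Basis[OF sm_lin_der[OF f zK(2)]])
 also have "... <= B*norm w" using B(2)[OF zK(1)] by (intro rmon) (auto simp: abs_le_iff)
 finally show "norm (FD f z w) <= B*norm w" .
 qed
 have "norm (f x-f y) <= B*norm (x-y)"
 by (rule differentiable_bound[OF convex_cball der on]) (use xy in auto)
 also have "... <= (B+1)*dist x y" by (simp add: dist_norm rmon)
 finally show "norm (f x-f y) <= (B+1)*dist x y" .
 qed (use e B in auto)
qed

lemma smooth_lip:
 fixes f :: "real^'k => 'b::euclidean_space"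
 assumes f: "smT f"
 obtains L where "0 < L" "!!x y. x:Ga ==> y:Ga ==> norm (f x-f y) <= L*dist x y"
proof -
 obtain e B where e: "0 < e" and B: "0 < B" "!!q x y. q:Ga ==> x:cball q e ==> y:cball q e ==> norm (f x-f y) <= B*dist x y"
 using smooth_lip_local[OF f] by metis
 obtain F where F: "0 <= F" "!!x. x:Ga ==> norm (f x) <= F"
 by (rule cpt_bound[OF compact sm_cont[OF f, THEN continuous_on_subset[OF _ sub_tb]]]) blast
 show ?thesis
 using lip_from_local[where S = Ga and f = f, OF e B(1) F(2)] B(2) e that by auto
qed

end

section \<open>Gaussian kernels on \<open>Ga\<close>\<close>

context submfd
begin

text \<open>In a patch the coordinates of points of the ball differ by at most
  \<open>2*C*rh\<close>, so their volume is of order \<open>rh\<close> to the power d; there are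
  finitely many patches. The centre may be any point of the ambient space.\<close>

lemma measure_ball_le:
 obtains C where "0 < C" "!!x rh. 0 <= rh ==> measure M (Ga Int ball x rh) <= C*rh^CARD('d)"
proof -
 obtain C I where A: "1 <= C" "finite I" "!!ph y0 r. (ph, y0, r):I ==> patch C ph y0 r"
 "Ga = (\<Union>(ph, y0, r)\<in>I. ph ` ball y0 (r/2))" by (rule atlas) blast
 define v where "v = C*(unit_ball_vol (real CARD('d))*(2*C)^CARD('d))"
 have v: "0 <= v" using A(1) by (simp add: v_def)
 define S where "S x rh = (%(ph, y0 :: real^'d, r). ph ` (ph -` ball x rh Int ball y0 (r/2)) :: (real^'k) set)" for x rh
 have one: "S x rh i:sets M & measure M (S x rh i) <= v * rh^CARD('d)" if rh: "0 <= rh" and i: "i:I" for x rh i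
 proof -
 obtain ph y0 r where ii: "i = (ph, y0, r)" by (cases i)
 have p: "patch C ph y0 r" using A(3) i ii by blast
 obtain V where V: "chart V ph" "cball y0 r <= V" using patch_chart[OF p] by blast
 have bs: "ball y0 (r/2) <= cball y0 r" using patchD(1)[OF p] by auto
 define B where "B = ph -` ball x rh Int ball y0 (r/2)"
 have B: "B:sets borel" "B <= cball y0 r"
 using chart_preimage[OF V(1), of "ball x rh" "ball y0 (r/2)"] bs V(2) by (auto simp: B_def)
 have Seq: "S x rh i = ph ` B" by (simp add: S_def ii B_def)
 have sM: "ph ` B:sets M" using patch_image_sets[OF p B] by (simp add: sets_M_iff)
 have "em lborel B <= enr (unit_ball_vol (real CARD('d))*(2*C*rh)^CARD('d))"
 proof (cases "B = {}")
 case True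
 thus ?thesis by simp
 next
 case False
 then obtain z1 where z1: "z1:B" by blast
 have "B <= cball z1 (2*C*rh)"
 proof
 fix z assume z: "z:B"
 have "norm (z1-z) <= C*norm (ph z1-ph z)" using patchD(3)[OF p] z z1 B(2) by blast
 also have "norm (ph z1-ph z) <= 2*rh"
 using z z1 dist_triangle2[of "ph z1" "ph z" x] by (auto simp: B_def dist_norm[symmetric] dist_commute)
 finally show "z:cball z1 (2*C*rh)" using A(1) by (simp add: dist_norm lmon mult_ac)
 qed
 hence "em lborel B <= em lborel (cball z1 (2*C*rh))"
 by (intro emeasure_mono) auto
 thus ?thesis using A(1) rh by (simp add: emeasure_cball)
 qed
 hence "enr C*em lborel B <= enr (v * rh^CARD('d))"
 using A(1) lmon[of "em lborel B" _ "enr C"] by (simp add: v_def power_mult_distrib mult.assoc ennreal_mult')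
 hence "em M (ph ` B) <= enr (v * rh^CARD('d))"
 using patch_measure_le[OF p B] patch_image_sets(2)[OF p B] by (simp add: emeasure_M)
 hence "measure M (ph ` B) <= v * rh^CARD('d)"
 using v rh by (simp add: emeasure_eq_measure)
 thus ?thesis using sM Seq by simp
 qed
 show ?thesis
 proof (rule that[of "real (card I) * v+1"])
 show "0 < real (card I) * v+1" using v by (simp add: add_nonneg_pos)
 fix x and rh :: real assume rh: "0 <= rh"
 have "Ga Int ball x rh = (UN i:I. S x rh i)"
 by (subst A(4)) (fastforce simp: S_def)
 hence "measure M (Ga Int ball x rh) <= (SUM i:I. measure M (S x rh i))"
 using one[OF rh] by (simp add: finite_measure_subadditive_finite[OF A(2)] image_subset_iff)
 also have "... <= real (card I)*(v * rh^CARD('d))"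
 by (rule sum_bounded_above) (use one[OF rh] in blast)
 also have "... <= (real (card I) * v+1)*rh^CARD('d)" using rh by (simp add: distrib_right)
 finally show "measure M (Ga Int ball x rh) <= (real (card I) * v+1)*rh^CARD('d)" .
 qed
qed

lemma measure_ball_ge:
 obtains c where "0 < c" "!!y rh. y:Ga ==> 0 < rh ==> rh <= 1 ==> c*rh^CARD('d) <= measure M (Ga Int ball y rh)"
proof -
 obtain C I where A: "1 <= C" "finite I" "!!ph y0 r. (ph, y0, r):I ==> patch C ph y0 r"
 "Ga = (\<Union>(ph, y0, r)\<in>I. ph ` ball y0 (r/2))" by (rule atlas) blast
 define a where "a = Min (insert 1 ((%(ph, y0, r). r/2) ` I))"
 have a: "0 < a" "a <= 1" "!!ph y0 r. (ph, y0, r):I ==> a <= r/2"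
 proof -
 show "0 < a" unfolding a_def using A(2) patchD(1)[OF A(3)] by auto
 show "a <= 1" unfolding a_def using A(2) by simp
 show "a <= r/2" if "(ph, y0, r):I" for ph y0 r
 unfolding a_def using A(2) that by (intro Min_le) force+
 qed
 define c where "c = unit_ball_vol (real CARD('d))*(a/C)^CARD('d)/C"
 show ?thesis
 proof (rule that[of c])
 show "0 < c" using a(1) A(1) by (simp add: c_def)
 fix y and rh :: real assume y: "y:Ga" and rh: "0 < rh" "rh <= 1"
 obtain ph y0 r z0 where i: "(ph, y0, r):I" and z0: "z0:ball y0 (r/2)" "y = ph z0"
 using y A(4) by auto
 have p: "patch C ph y0 r" by (rule A(3)[OF i])
 \<comment> \<open>Small enough for the coordinate ball of radius \<open>s\<close> to stay in the
   patch and for its image to stay in the ball of radius \<open>rh\<close>, yet proportional to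
   \<open>rh\<close>.\<close>
 define s where "s = a*rh/C"
 have s: "0 < s" "s <= r/2" "C * s <= rh"
 proof -
 show "0 < s" using a(1) rh(1) A(1) by (simp add: s_def)
 have "s <= a*1/1" unfolding s_def using a(1) rh A(1) by (intro frac_le lmon) auto
 thus "s <= r/2" using a(3)[OF i] by simp
 show "C * s <= rh" using a(1,2) rh(1) A(1) rmon[of a 1 rh] by (simp add: s_def)
 qed
 have sub: "ball z0 s <= cball y0 r"
 proof
 fix z assume "z:ball z0 s"
 thus "z:cball y0 r" using z0(1) s(2) dist_triangle[of y0 z z0] by simp
 qed
 have im: "ph ` ball z0 s <= Ga Int ball y rh"
 proof
 fix x assume "x:ph ` ball z0 s"
 then obtain z where z: "z:ball z0 s" "x = ph z" by blast
 have z00: "z0:ball z0 s" using s(1) by simp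
 have "norm (ph z0-ph z) <= C*norm (z0-z)" using patchD(2)[OF p] sub z(1) z00 by blast
 also have "... < C * s" using z(1) A(1) by (simp add: dist_norm)
 finally show "x:Ga Int ball y rh"
 using s(3) z(2) z0(2) patch_image_sets(2)[OF p _ sub] z(1) by (auto simp: dist_norm)
 qed
 have "enr (unit_ball_vol (real CARD('d)) * s^CARD('d)) = em lborel (ball z0 s)"
 using s(1) by (simp add: emeasure_ball)
 also have "... <= enr C*em sg (ph ` ball z0 s)"
 by (rule patch_measure_ge[OF p _ sub]) simp
 also have "em sg (ph ` ball z0 s) = em M (ph ` ball z0 s)"
 using im by (intro emeasure_M[symmetric]) blast
 also have "enr C * ... <= enr C*em M (Ga Int ball y rh)"
 using closed by (intro lmon emeasure_mono[OF im]) (auto simp: sets_M_iff)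
 also have "... = enr (C*measure M (Ga Int ball y rh))"
 using A(1) by (simp add: emeasure_eq_measure ennreal_mult')
 finally have "unit_ball_vol (real CARD('d)) * s^CARD('d) <= C*measure M (Ga Int ball y rh)"
 using A(1) by simp
 moreover have "c*rh^CARD('d)*C = unit_ball_vol (real CARD('d)) * s^CARD('d)"
 by (simp add: c_def s_def power_mult_distrib power_divide)
 ultimately have "(c*rh^CARD('d))*C <= measure M (Ga Int ball y rh)*C" by (simp add: mult.commute)
 thus "c*rh^CARD('d) <= measure M (Ga Int ball y rh)" using A(1) by simp
 qed
qed

definition gs :: "real => real^'k => 'k fn" where
 "gs mu x y = exp (- mu*(dist x y)^2)"

text \<open>Dividing by this actual mass instead of a power of \<open>mu\<close> makes averages of
  constants exact. The price is that derivatives of the mass have to be controlled as well.\<close>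

definition gms :: "real => 'k fn" where
 "gms mu x = (LINT y|M. gs mu x y)"

lemma gauss_pos: "0 < gs mu x y"
 by (simp add: gs_def)

lemma gauss_le1: "0 <= mu ==> gs mu x y <= 1"
 by (simp add: gs_def)

lemma gauss_commute: "gs mu x y = gs mu y x"
 by (simp add: gs_def dist_commute)

lemma cont_gauss: "cont S (%y. gs mu x y)"
 unfolding gs_def by (intro continuous_intros)

lemma gauss_int: "integrable M (gs mu x)"
 by (rule cont_int[OF cont_gauss])

text \<open>Scaling argument: outside the ball of radius R/sqrt mu the kernel is at most exp(-3/4
  R^2) times the kernel for mu/4. With \<open>R\<close> large this factor beats the 2^d lost by
  rescaling, and the bound propagates from \<open>mu <= 4\<close> to all \<open>mu\<close> by powers
  of 4.\<close>

lemma gauss_upper: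
 obtains A where "0 < A" "!!mu x. 0 < mu ==> gms mu x * sqrt mu^CARD('d) <= A"
proof -
 let ?d = "CARD('d)"
 obtain C where C: "0 < C" "!!x rh. 0 <= rh ==> measure M (Ga Int ball x rh) <= C*rh^?d"
 by (rule measure_ball_le) blast
 have "filterlim (%R::real. exp (- 3/4*R)) (nhds 0) at_top"
 by (intro filterlim_compose[OF exp_at_bot] filterlim_tendsto_neg_mult_at_bot[OF tendsto_const] filterlim_ident) auto
 hence "eventually (%R::real. exp (- 3/4*R) < 1/(2*2^?d)) at_top"
 by (rule order_tendstoD) simp
 then obtain R0 :: real where R0: "!!R. R >= R0 ==> exp (- 3/4*R) < 1/(2*2^?d)"
 by (auto simp: eventually_at_top_linorder)
 define R where "R = max 1 R0"
 have R: "1 <= R" "exp (- 3/4*R^2)*2^?d <= 1/2"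
 proof -
 show R1: "1 <= R" by (simp add: R_def)
 have "R <= R^2" using R1 lmon[of 1 R R] by (simp add: sq2)
 hence "R^2 >= R0" by (simp add: R_def)
 from R0[OF this] show "exp (- 3/4*R^2)*2^?d <= 1/2" by (simp add: field_simps)
 qed
 define m where "m = measure M Ga"
 \<comment> \<open>The first entry makes the ball contribute at most A/2 in the step from mu/4 to
   \<open>mu\<close>, the second covers the start of the induction.\<close>
 define A where "A = max (2*C*R^?d) (m*2^?d)+1"
 have A: "0 < A" "2*C*R^?d <= A" "m*2^?d <= A"
 using C(1) R(1) by (auto simp: A_def add_nonneg_pos le_max_iff_disj)
 have base: "gms mu x * sqrt mu^?d <= A" if l: "0 < mu" "mu <= 4" for mu x
 proof -
 have "gms mu x <= (LINT y|M. 1)" unfolding gms_def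
 using l by (intro integral_mono gauss_int gauss_le1) auto
 hence "gms mu x <= m" by (simp add: m_def space_M)
 moreover have "sqrt mu <= 2" using l real_sqrt_le_mono[of mu 4] by simp
 hence "sqrt mu^?d <= 2^?d" using l by simp
 ultimately have "gms mu x * sqrt mu^?d <= m*2^?d"
 using l by (intro mult_mono) (auto simp: m_def)
 thus ?thesis using A(3) by simp
 qed
 have step: "gms mu x * sqrt mu^?d <= A" if "0 < mu" "mu <= 4^n" for mu x n
 using that
 proof (induction n arbitrary: mu)
 case 0
 thus ?case by (intro base) auto
 next
 case (Suc n)
 show ?case
 proof (cases "mu <= 4")
 case True
 thus ?thesis using Suc.prems by (intro base) auto
 next
 case False
 define rh where "rh = R/sqrt mu"
 have l0: "0 < sqrt mu" using Suc.prems by simp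
 have rh: "0 <= rh" using R(1) l0 by (simp add: rh_def)
 have pt: "gs mu x y <= ind (Ga Int ball x rh) y+exp (- 3/4*R^2)*gs (mu/4) x y" if "y:Ga" for y
 proof (cases "dist x y < rh")
 case True
 thus ?thesis using that gauss_le1[of mu x y] gauss_pos[of "mu/4" x y] Suc.prems by (simp add: add_increasing2)
 next
 case False
 hence "rh^2 <= (dist x y)^2" using rh by simp
 hence "mu*rh^2 <= mu*(dist x y)^2" using Suc.prems by simp
 moreover have "mu*rh^2 = R^2" using Suc.prems by (simp add: rh_def power_divide)
 ultimately have "R^2 <= mu*(dist x y)^2" by simp
 hence "- mu*(dist x y)^2 <= - 3/4*R^2 + - (mu/4)*(dist x y)^2" by simp
 hence "gs mu x y <= exp (- 3/4*R^2)*gs (mu/4) x y"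
 unfolding gs_def exp_add[symmetric] by simp
 thus ?thesis by (simp add: add_increasing)
 qed
 have bs: "Ga Int ball x rh:sets M" using closed by (auto simp: sets_M_iff)
 have "gms mu x <= (LINT y|M. ind (Ga Int ball x rh) y+exp (- 3/4*R^2)*gs (mu/4) x y)"
 unfolding gms_def using bs pt space_M by (intro integral_mono gauss_int Bochner_Integration.integrable_add integrable_mult_right)
 (auto simp: less_top[symmetric])
 also have "... = measure M (Ga Int ball x rh)+exp (- 3/4*R^2)*gms (mu/4) x"
 unfolding gms_def using bs by (subst Bochner_Integration.integral_add) (auto simp: less_top[symmetric] gauss_int)
 finally have "gms mu x * sqrt mu^?d <=
 (C*rh^?d+exp (- 3/4*R^2)*gms (mu/4) x) * sqrt mu^?d"
 using C(2)[OF rh, of x] l0 by simp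
 also have "... = C*R^?d+(exp (- 3/4*R^2)*2^?d)*(gms (mu/4) x * sqrt (mu/4)^?d)"
 proof -
 have e: "sqrt (mu/4) = sqrt mu/2" by (simp add: real_sqrt_divide)
 show ?thesis unfolding e using l0 by (simp add: rh_def power_divide distrib_right)
 qed
 also have "... <= A/2+(1/2)*A"
 proof (rule add_mono)
 have "gms (mu/4) x * sqrt (mu/4)^?d <= A" using Suc.prems by (intro Suc.IH) auto
 thus "(exp (- 3/4*R^2)*2^?d)*(gms (mu/4) x * sqrt (mu/4)^?d) <= (1/2)*A"
 using R(2) Suc.prems by (intro mult_mono) (auto simp: gms_def gs_def intro!: mult_nonneg_nonneg integral_nonneg_AE)
 qed (use A(2) in simp)
 finally show ?thesis by simp
 qed
 qed
 have "gms mu x * sqrt mu^?d <= A" if "0 < mu" for mu x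
 proof -
 obtain n where "mu < 4^n" using real_arch_pow[of 4 mu] by auto
 thus ?thesis using step[of mu n x] \<open>0 < mu\<close> by simp
 qed
 thus ?thesis using that A(1) by blast
qed

lemma gmass_lower:
 obtains c where "0 < c" "!!mu y. y:Ga ==> 1 <= mu ==> c <= gms mu y * sqrt mu^CARD('d)"
proof -
 let ?d = "CARD('d)"
 obtain c where c: "0 < c" "!!y rh. y:Ga ==> 0 < rh ==> rh <= 1 ==> c*rh^?d <= measure M (Ga Int ball y rh)"
 by (rule measure_ball_ge) blast
 have "exp (- 1)*c <= gms mu y * sqrt mu^?d" if y: "y:Ga" and l: "1 <= mu" for mu y
 proof -
 define rh where "rh = 1/sqrt mu"
 have rh: "0 < rh" "rh <= 1" using l by (auto simp: rh_def)
 have bs: "Ga Int ball y rh:sets M" using closed by (auto simp: sets_M_iff)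
 have pt: "exp (- 1)*ind (Ga Int ball y rh) z <= gs mu y z" for z
 proof (cases "z:Ga Int ball y rh")
 case True
 hence "(dist y z)^2 <= rh^2" by (intro power_mono) auto
 hence "mu*(dist y z)^2 <= mu*rh^2" using l by simp
 also have "mu*rh^2 = 1" using l by (simp add: rh_def power_divide)
 finally show ?thesis using True by (simp add: gs_def)
 next
 case False
 thus ?thesis using gauss_pos[of mu y z] by simp
 qed
 have "exp (- 1)*(c*rh^?d) <= exp (- 1)*measure M (Ga Int ball y rh)"
 using c(2)[OF y rh] by simp
 also have "... = (LINT z|M. exp (- 1)*ind (Ga Int ball y rh) z)" using bs by simp
 also have "... <= gms mu y" unfolding gms_def
 by (intro integral_mono gauss_int pt) (use bs in \<open>auto simp: less_top[symmetric]\<close>)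
 finally have "exp (- 1)*(c*rh^?d) * sqrt mu^?d <= gms mu y * sqrt mu^?d"
 using l by simp
 moreover have "exp (- 1)*(c*rh^?d) * sqrt mu^?d = exp (- 1)*c"
 using l by (simp add: rh_def power_divide)
 ultimately show ?thesis by simp
 qed
 thus ?thesis using that[of "exp (- 1)*c"] c(1) by simp
qed

text \<open>Both masses are comparable to the same power of \<open>mu\<close>, uniformly in the
  points. This allows wider Gaussians, and masses at other points, to be traded for the normalising
  mass.\<close>

lemma gmass_ratio:
 obtains C where "1 <= C" "!!mu x y. y:Ga ==> 1 <= mu ==> gms (mu/4) x <= C*gms mu y"
proof -
 let ?d = "CARD('d)"
 obtain A where A: "0 < A" "!!mu x. 0 < mu ==> gms mu x * sqrt mu^?d <= A" by (rule gauss_upper) blast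
 obtain c where c: "0 < c" "!!mu y. y:Ga ==> 1 <= mu ==> c <= gms mu y * sqrt mu^?d" by (rule gmass_lower) blast
 define C where "C = max 1 (A*2^?d/c)"
 have "gms (mu/4) x <= C*gms mu y" if y: "y:Ga" and l: "1 <= mu" for mu x y
 proof -
 have s: "0 < sqrt mu^?d" using l by simp
 have "sqrt mu = sqrt (mu/4)*2" by (simp add: real_sqrt_divide)
 hence "sqrt mu^?d = sqrt (mu/4)^?d*2^?d" by simp
 hence "gms (mu/4) x * sqrt mu^?d = gms (mu/4) x * sqrt (mu/4)^?d*2^?d" by simp
 also have "... <= A*2^?d" using A(2)[of "mu/4" x] l by simp
 also have "... = (A*2^?d/c)*c" using c(1) by simp
 also have "... <= C*(gms mu y * sqrt mu^?d)"
 using c(2)[OF y l] c(1) A(1) by (intro mult_mono) (auto simp: C_def)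
 finally have "gms (mu/4) x * sqrt mu^?d <= (C*gms mu y) * sqrt mu^?d" by simp
 thus ?thesis using s by simp
 qed
 thus ?thesis using that[of C] by (simp add: C_def)
qed

lemma gmass_pos: "1 <= mu ==> y:Ga ==> 0 < gms mu y"
proof -
 assume l: "1 <= mu" and y: "y:Ga"
 obtain c where c: "0 < c" "!!mu y. y:Ga ==> 1 <= mu ==> c <= gms mu y * sqrt mu^CARD('d)" by (rule gmass_lower) blast
 have "0 < gms mu y * sqrt mu^CARD('d)" using c(1) c(2)[OF y l] by simp
 thus ?thesis using l by (simp add: zero_less_mult_iff)
qed

end

section \<open>Integral operators whose kernels have Gaussian bounds\<close>

context submfd
begin

definition gop :: "real => (real^'k => real^'k => real) => (real^'k => real) => 'k fn" where
 "gop mu k f x = (LINT y|M. k x y*f y)/gms mu x"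

text \<open>The bound has the exponent mu/2 instead of \<open>mu\<close>: the lost half pays for the
  polynomial factors that differentiation of the kernel produces.\<close>

definition gbd :: "real => real => (real^'k => real^'k => real) => bool" where
 "gbd mu A k \<longleftrightarrow> (ALL x:Ga. ALL y:Ga. |k x y| <= A*gs (mu/2) x y) &
 (%(x, y). k x y):bmeas (M \<Otimes>\<^sub>M M)"

lemma ident_meas: "(%x. x):M \<rightarrow>\<^sub>M borel"
 by (intro cont_meas continuous_on_id)

lemma gauss_meas [measurable]: "(%(x, y). gs mu x y):bmeas (M \<Otimes>\<^sub>M M)"
proof -
 note [measurable] = ident_meas
 have "(%z. exp (- mu*(dist (fst z) (snd z))^2)):bmeas (M \<Otimes>\<^sub>M M)"
 by simp
 thus ?thesis by (simp add: gs_def)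
qed

lemma sigma_M: "sigma_finite_measure M" ..

lemma gmass_meas [measurable]: "gms mu:bmeas M"
 unfolding gms_def[abs_def]
 by simp

lemma gauss_sqrt: "gs (mu/2) x y = (gs (mu/4) x y)^2"
 unfolding gs_def by (simp add: sq2 exp_add[symmetric])

lemma gauss_mono: "mu <= nu ==> gs nu x y <= gs mu x y"
 unfolding gs_def by (simp add: rmon)

text \<open>The constant of \<open>gmass_ratio\<close>, fixed once so that it can occur in the
  statements of operator bounds.\<close>

definition rt :: real where
 "rt = (SOME C. 1 <= C & (ALL mu x. ALL y:Ga. 1 <= mu --> gms (mu/4) x <= C*gms mu y))"

lemma rt: "1 <= rt" "!!mu x y. y:Ga ==> 1 <= mu ==> gms (mu/4) x <= rt*gms mu y"
 "!!mu x y. y:Ga ==> 1 <= mu ==> gms (mu/2) x <= rt*gms mu y"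
proof -
 obtain C where C: "1 <= C" "!!mu x y. y:Ga ==> 1 <= mu ==> gms (mu/4) x <= C*gms mu y"
 by (rule gmass_ratio) blast
 hence "EX C. 1 <= C & (ALL mu x. ALL y:Ga. 1 <= mu --> gms (mu/4) x <= C*gms mu y)" by blast
 from someI_ex[OF this, folded rt_def]
 show *: "1 <= rt" "!!mu x y. y:Ga ==> 1 <= mu ==> gms (mu/4) x <= rt*gms mu y" by blast+
 fix mu :: real and x y assume y: "y:Ga" and m: "1 <= mu"
 have "gms (mu/2) x <= gms (mu/4) x"
 unfolding gms_def using m by (intro integral_mono gauss_int gauss_mono) auto
 thus "gms (mu/2) x <= rt*gms mu y" using *(2)[OF y m, of x] by simp
qed

text \<open>The column estimate in Schur's test. The mass in the denominator belongs to the
  integration variable \<open>x\<close>, so it is first exchanged for a mass at \<open>y\<close> at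
  the cost of \<open>rt\<close>.\<close>

lemma gauss_average_le:
 assumes mu: "1 <= mu" and y: "y:Ga"
 shows "(NN M (%x. enr (gs (mu/2) x y/gms mu x))) <= enr rt"
proof -
 have gy: "0 < gms (mu/2) y"
 proof -
 have "gms mu y <= gms (mu/2) y"
 unfolding gms_def using mu by (intro integral_mono gauss_int gauss_mono) auto
 thus ?thesis using gmass_pos[OF mu y] by simp
 qed
 have "(NN M (%x. enr (gs (mu/2) x y/gms mu x))) <=
 (NN M (%x. enr (rt/gms (mu/2) y*gs (mu/2) y x)))"
 proof (rule nn_integral_mono, rule ennreal_leI)
 fix x assume "x:space M"
 hence x: "x:Ga" by (simp add: space_M)
 have "1/gms mu x <= rt/gms (mu/2) y"
 using rt(3)[OF x mu, of y] gy gmass_pos[OF mu x] by (simp add: field_simps)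
 from rmon[OF this less_imp_le[OF gauss_pos, of "mu/2" x y]]
 show "gs (mu/2) x y/gms mu x <= rt/gms (mu/2) y*gs (mu/2) y x"
 by (simp add: gauss_commute)
 qed
 also have "... = enr (LINT x|M. rt/gms (mu/2) y*gs (mu/2) y x)"
 using gy rt(1) less_imp_le[OF gauss_pos] by (intro nn_integral_eq_integral integrable_mult_right gauss_int AE_I2) auto
 also have "(LINT x|M. rt/gms (mu/2) y*gs (mu/2) y x) = rt"
 using gy by (simp add: gms_def[symmetric])
 finally show ?thesis .
qed

lemma L2_nn_int: "LL f ==> (NN M (%x. enr ((f x)^2))) = enr ((nm f)^2)"
 for f :: "real^'k => real"
 unfolding L2n_power2 using L2_funD[of M f] by (subst nn_integral_eq_integral[symmetric]) auto

lemma gauss_schur: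
 fixes h :: "real^'k => real"
 assumes mu: "1 <= mu" and h: "LL h"
 shows "(NN M (%x. NN M (%y. enr (gs (mu/2) x y*(h y)^2/gms mu x)))) <= enr (rt*(nm h)^2)"
proof -
 interpret P: pair_sigma_finite M M by (intro pair_sigma_finite.intro sigma_M)
 note [measurable] = L2_funD(1)[OF h]
 have m: "(%(x, y). enr (gs (mu/2) x y*(h y)^2/gms mu x)):bmeas (M \<Otimes>\<^sub>M M)"
 unfolding split_beta by simp
 have "(NN M (%x. NN M (%y. enr (gs (mu/2) x y*(h y)^2/gms mu x)))) =
 (NN M (%y. NN M (%x. enr (gs (mu/2) x y*(h y)^2/gms mu x))))"
 using P.Fubini'[OF m] by simp
 also have "... <= (NN M (%y. enr rt*enr ((h y)^2)))"
 proof (rule nn_integral_mono)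
 fix y assume "y:space M"
 hence y: "y:Ga" by (simp add: space_M)
 have gm: "(%x. gs (mu/2) x y):bmeas M"
 unfolding gauss_commute[of _ _ y] by (rule cont_meas[OF cont_gauss])
 have gm': "(%x. enr (gs (mu/2) x y/gms mu x)):bmeas M"
 by (rule measurable_compose[OF borel_measurable_divide[OF gm gmass_meas] measurable_ennreal])
 have "(NN M (%x. enr (gs (mu/2) x y*(h y)^2/gms mu x))) =
 (NN M (%x. enr (gs (mu/2) x y/gms mu x)*enr ((h y)^2)))"
 by (intro nn_integral_cong) (subst ennreal_mult''[symmetric], simp, simp only: times_divide_eq_left)
 also have "... = (NN M (%x. enr (gs (mu/2) x y/gms mu x)))*enr ((h y)^2)"
 by (rule nn_integral_multc[OF gm'])
 also have "... <= enr rt*enr ((h y)^2)"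
 by (intro rmon gauss_average_le[OF mu y]) simp
 finally show "(NN M (%x. enr (gs (mu/2) x y*(h y)^2/gms mu x))) <= enr rt*enr ((h y)^2)" .
 qed
 also have "... = enr (rt*(nm h)^2)"
 using L2_nn_int[OF h] rt(1) by (simp add: nn_integral_cmult ennreal_mult')
 finally show ?thesis .
qed

lemma gop_slice:
 assumes k: "gbd mu A k" and x: "x:Ga"
 shows "k x:bmeas M" "!!y. y:Ga ==> |k x y| <= A*gs (mu/2) x y"
 "0 <= mu ==> 0 <= A ==> LL (k x)"
proof -
 have "(%(x, y). k x y):bmeas (M \<Otimes>\<^sub>M M)" using k by (simp add: gbd_def)
 hence "(%y. (%(x, y). k x y) (x, y)):bmeas M"
 by (rule measurable_Pair2) (simp add: x space_M)
 thus km: "k x:bmeas M" by simp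
 show le: "|k x y| <= A*gs (mu/2) x y" if "y:Ga" for y using k x that by (simp add: gbd_def)
 assume mu: "0 <= mu" and A: "0 <= A"
 show "LL (k x)"
 proof (rule L2_bounded(1)[OF km AE_I2])
 fix y assume "y:space M"
 hence "|k x y| <= A*gs (mu/2) x y" using le by (simp add: space_M)
 also have "... <= A" using gauss_le1[of "mu/2" x y] mu A by (simp add: mult_left_le)
 finally show "norm (k x y) <= A" by simp
 qed
qed

text \<open>Cauchy-Schwarz after splitting the kernel by the square root \<open>gs (mu/4)\<close> of
  \<open>gs (mu/2)\<close>: one factor gives a mass bounded by \<open>rt\<close>, the other the
  Gaussian average of the square of \<open>h\<close>.\<close>

lemma gop_pointwise:
 fixes h :: "real^'k => real"
 assumes mu: "1 <= mu" and k: "gbd mu A k" and A: "0 <= A" and x: "x:Ga" and h: "LL h"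
 shows "enr ((gop mu k h x)^2) <= enr (A^2*rt)*(NN M (%y. enr (gs (mu/2) x y*(h y)^2/gms mu x)))"
proof -
 have gx: "0 < gms mu x" by (rule gmass_pos[OF mu x])
 let ?g = "gs (mu/4) x"
 have gm: "?g:bmeas M" by (rule cont_meas[OF cont_gauss])
 have g2: "LL ?g" by (rule L2_cont[OF cont_gauss])
 have gh: "LL (%y. ?g y*h y)"
 proof (rule L2_bound[OF h, where C = 1])
 show "(%y. ?g y*h y):bmeas M" using L2_funD(1)[OF h] gm by simp
 show "AE y in M. norm (?g y*h y) <= 1*norm (h y)"
 using gauss_le1[of "mu/4" x] less_imp_le[OF gauss_pos[of "mu/4" x]] mu by (simp add: abs_mult mult_left_le_one_le)
 qed
 have int2: "integrable M (%y. gs (mu/2) x y*(h y)^2)"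
 using L2_funD(2)[OF gh] by (simp add: power_mult_distrib gauss_sqrt)
 note km = gop_slice(1)[OF k x] and kb = gop_slice(2)[OF k x]
 have um: "(%y. k x y/?g y):bmeas M" using km gm by simp
 have ub: "AE y in M. norm (k x y/?g y) <= A*norm (?g y)"
 using kb by (intro AE_I2) (simp add: space_M gauss_sqrt pos_divide_le_eq gauss_pos abs_divide abs_of_pos sq2 mult.assoc)
 have "(LINT y|M. k x y*h y) = (LINT y|M. (k x y/?g y)*(?g y*h y))"
 using less_imp_neq[OF gauss_pos[of "mu/4" x]] by simp
 also have "|...| <= nm (%y. k x y/?g y)*nm (%y. ?g y*h y)"
 by (rule L2_CS_mult[OF L2_bound[OF g2 um ub] gh])
 also have "... <= A*nm ?g*nm (%y. ?g y*h y)"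
 by (rule rmon[OF L2n_bound[OF g2 um ub A] L2n_nonneg])
 finally have "|LINT y|M. k x y*h y|\<^sup>2 <= (A*nm ?g*nm (%y. ?g y*h y))^2"
 by (rule power_mono) simp
 also have "... = A^2*(gms (mu/2) x*(LINT y|M. gs (mu/2) x y*(h y)^2))"
 unfolding power_mult_distrib L2n_power2 gms_def gauss_sqrt by (simp add: power_mult_distrib mult.assoc)
 also have "... <= A^2*((rt*gms mu x)*(LINT y|M. gs (mu/2) x y*(h y)^2))"
 using less_imp_le[OF gauss_pos] by (intro lmon rmon rt(3)[OF x mu] integral_nonneg_AE AE_I2) auto
 finally have "(gop mu k h x)^2 <= A^2*((rt*gms mu x)*(LINT y|M. gs (mu/2) x y*(h y)^2))/(gms mu x)^2"
 unfolding gop_def power_divide by (intro divide_right_mono) auto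
 also have "... = (A^2*rt)*(LINT y|M. gs (mu/2) x y*(h y)^2/gms mu x)"
 by (simp add: sq2 field_simps)
 finally have "enr ((gop mu k h x)^2) <= enr ((A^2*rt)*(LINT y|M. gs (mu/2) x y*(h y)^2/gms mu x))"
 by (rule ennreal_leI)
 also have "... = enr (A^2*rt)*enr (LINT y|M. gs (mu/2) x y*(h y)^2/gms mu x)"
 using rt(1) by (intro ennreal_mult') simp
 also have "enr (LINT y|M. gs (mu/2) x y*(h y)^2/gms mu x) =
 (NN M (%y. enr (gs (mu/2) x y*(h y)^2/gms mu x)))"
 using gx less_imp_le[OF gauss_pos] int2 by (intro nn_integral_eq_integral[symmetric]) auto
 finally show ?thesis .
qed

lemma gop_meas:
 assumes k: "gbd mu A k" and [measurable]: "h:bmeas M"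
 shows "gop mu k h:bmeas M"
proof -
 have [measurable]: "(%z. k (fst z) (snd z)):bmeas (M \<Otimes>\<^sub>M M)"
 using k by (simp add: gbd_def split_beta')
 have "(%(x, y). k x y*h y):bmeas (M \<Otimes>\<^sub>M M)" unfolding split_beta' by simp
 from sigma_finite_measure.borel_measurable_lebesgue_integral[OF sigma_M this]
 have [measurable]: "(%x. LINT y|M. k x y*h y):bmeas M" by simp
 show ?thesis unfolding gop_def[abs_def] by simp
qed

lemma L2_nn:
 fixes f :: "real^'k => real"
 assumes f: "f:bmeas M" and le: "(NN M (%x. enr ((f x)^2))) <= enr (B^2)" and B: "0 <= B"
 shows "LL f" "nm f <= B"
proof -
 have "(NN M (%x. enr (norm ((f x)^2)))) < \<infinity>" using le by (auto simp: less_top[symmetric] top_unique)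
 thus L: "LL f" using f by (auto simp: L2_fun_def integrable_iff_bounded)
 hence "(nm f)^2 <= B^2" using le unfolding L2_nn_int[OF L] by simp
 thus "nm f <= B" using B by (rule power2_le_imp_le)
qed

text \<open>Schur's test: the pointwise bound is integrated in \<open>x\<close> first. The operator
  bound does not depend on \<open>mu\<close>.\<close>

lemma gop_L2:
 assumes mu: "1 <= mu" and k: "gbd mu A k" and A: "0 <= A" and h: "LL h"
 shows "LL (gop mu k h)" "nm (gop mu k h) <= A*rt*nm h"
proof -
 note [measurable] = L2_funD(1)[OF h]
 have im: "(%x. NN M (%y. enr (gs (mu/2) x y*(h y)^2/gms mu x))):bmeas M"
 proof -
 have "(%z. enr (gs (mu/2) (fst z) (snd z)*(h (snd z))^2/gms mu (fst z))):bmeas (M \<Otimes>\<^sub>M M)"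
 by simp
 from sigma_finite_measure.borel_measurable_nn_integral_fst[OF sigma_M this] show ?thesis by simp
 qed
 have "(NN M (%x. enr ((gop mu k h x)^2))) <=
 (NN M (%x. enr (A^2*rt)*(NN M (%y. enr (gs (mu/2) x y*(h y)^2/gms mu x)))))"
 by (intro nn_integral_mono gop_pointwise[OF mu k A _ h]) (simp add: space_M)
 also have "... = enr (A^2*rt)*(NN M (%x. NN M (%y. enr (gs (mu/2) x y*(h y)^2/gms mu x))))"
 by (rule nn_integral_cmult[OF im])
 also have "... <= enr (A^2*rt)*enr (rt*(nm h)^2)"
 by (intro lmon gauss_schur(1)[OF mu h]) simp
 also have "... = enr ((A*rt*nm h)^2)"
 by (subst ennreal_mult'[symmetric]) (use rt(1) in simp, simp add: sq2 mult_ac)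
 finally have le: "(NN M (%x. enr ((gop mu k h x)^2))) <= enr ((A*rt*nm h)^2)" .
 have nn: "0 <= A*rt*nm h" using A rt(1) L2n_nonneg[of M h] by simp
 show "LL (gop mu k h)" "nm (gop mu k h) <= A*rt*nm h"
 using L2_nn[OF gop_meas[OF k L2_funD(1)[OF h]] le nn] by auto
qed

text \<open>The weight \<open>a\<close> serves the points close to \<open>x\<close>, where
  \<open>h\<close> itself is small, and \<open>b\<close> the distant ones, where part of the
  exponent is spent to gain smallness and the wider Gaussian remains.\<close>

lemma gop_le:
 assumes mu: "1 <= mu" and k: "gbd mu A k" and x: "x:Ga" and A: "0 <= A" and h: "LL h"
 and a: "0 <= a" and b: "0 <= b"
 and le: "!!y. y:Ga ==> gs (mu/2) x y * |h y| <= a*gs (mu/2) x y+b*gs (mu/4) x y"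
 shows "|gop mu k h x| <= A*((a+b)*rt)"
proof -
 have gx: "0 < gms mu x" by (rule gmass_pos[OF mu x])
 have kL: "LL (k x)" using gop_slice(3)[OF k x] mu A by simp
 have "|LINT y|M. k x y*h y| <= (LINT y|M. |k x y*h y| )" by simp
 also have "... <= (LINT y|M. A*(a*gs (mu/2) x y+b*gs (mu/4) x y))"
 proof (rule integral_mono)
 show "integrable M (%y. |k x y*h y| )" using L2_int_mult[OF kL h] by simp
 show "integrable M (%y. A*(a*gs (mu/2) x y+b*gs (mu/4) x y))" using gauss_int by simp
 fix y assume "y:space M"
 hence y: "y:Ga" by (simp add: space_M)
 have "|k x y*h y| <= (A*gs (mu/2) x y) * |h y|"
 unfolding abs_mult by (intro rmon gop_slice(2)[OF k x y]) simp
 also have "... <= A*(a*gs (mu/2) x y+b*gs (mu/4) x y)"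
 unfolding mult.assoc by (intro lmon le[OF y] A)
 finally show "|k x y*h y| <= A*(a*gs (mu/2) x y+b*gs (mu/4) x y)" .
 qed
 also have "... = A*(a*gms (mu/2) x+b*gms (mu/4) x)"
 by (simp add: gauss_int gms_def[symmetric])
 also have "... <= A*(a*(rt*gms mu x)+b*(rt*gms mu x))"
 using A a b by (intro lmon add_mono rt(2,3)[OF x mu]) auto
 also have "... = A*((a+b)*rt)*gms mu x" by (simp add: algebra_simps)
 finally show ?thesis unfolding gop_def using gx by (simp add: pos_divide_le_eq)
qed

lemma gop_one_le:
 assumes mu: "1 <= mu" and k: "gbd mu A k" and x: "x:Ga" and A: "0 <= A"
 shows "|gop mu k (%_. 1) x| <= A*rt"
 using gop_le[OF mu k x A, of "%_. 1" 1 0] L2_cont[of "%_. 1 :: real"] by simp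

lemma gop_diff_eq:
 assumes mu: "1 <= mu" and k: "gbd mu A k" and x: "x:Ga" and A: "0 <= A" and f: "LL f" and h: "LL h"
 shows "gop mu k (%y. f y-h y) x = gop mu k f x-gop mu k h x"
 "gop mu k (%y. f y-c) x = gop mu k f x-c*gop mu k (%_. 1) x"
 using L2_int_mult[OF gop_slice(3)[OF k x _ A] f] L2_int_mult[OF gop_slice(3)[OF k x _ A] h] L2_int[OF gop_slice(3)[OF k x _ A]] mu by (simp_all add: gop_def right_diff_distrib diff_divide_distrib)

text \<open>The kernels do not have mass one, and the images of the constant 1 need not converge.
  What tends to 0 is the difference to multiplication by that image: near \<open>x\<close> by
  uniform continuity, far away by the decay of the Gaussian.\<close>

lemma gop_diff_continuous:
 assumes k: "!!n. gbd (real (Suc n)) A (k n)" and A: "0 <= A" and g: "cont Ga g" and e: "0 < e"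
 shows "eventually (%n. ALL x:Ga. |gop (real (Suc n)) (k n) g x-g x*gop (real (Suc n)) (k n) (%_. 1) x| <= e) sequentially"
proof -
 obtain B where B: "0 < B" "!!y. y:Ga ==> |g y| <= B" using cont_bdd[OF g] by auto
 define et where "et = e/(2*((A+1)*rt))"
 have R: "0 < (A+1)*rt" using rt(1) A by simp
 have et: "0 < et" "(A+1)*rt*et = e/2" using e R by (auto simp: et_def field_simps)
 have "uniformly_continuous_on Ga g" by (rule compact_uniformly_continuous[OF g compact])
 then obtain r where r: "0 < r" "!!x y. x:Ga ==> y:Ga ==> dist y x < r ==> dist (g y) (g x) < et"
 unfolding uniformly_continuous_on_def using et(1) by metis
 have "filterlim (%n. exp (- (r^2/4)*real (Suc n))) (nhds 0) sequentially"
 using r(1) by (intro filterlim_compose[OF exp_at_bot] filterlim_tendsto_neg_mult_at_bot[OF tendsto_const]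
 filterlim_compose[OF filterlim_real_sequentially filterlim_Suc]) auto
 hence "eventually (%n. exp (- (r^2/4)*real (Suc n)) < et/(2*B)) sequentially"
 by (rule order_tendstoD) (use et B in simp)
 thus ?thesis
 proof eventually_elim
 case (elim n)
 define mu where "mu = real (Suc n)"
 have mu: "1 <= mu" by (simp add: mu_def)
 have kn: "gbd mu A (k n)" using k[of n] by (simp add: mu_def)
 define E where "E = exp (- (r^2/4)*mu)"
 have E: "0 < E" "E*(2*B) <= et" using elim B(1) by (auto simp: E_def mu_def pos_less_divide_eq)
 have "|gop mu (k n) g x-g x*gop mu (k n) (%_. 1) x| <= e" if x: "x:Ga" for x
 proof -
 have "gs (mu/2) x y * |g y-g x| <= et*gs (mu/2) x y+et*gs (mu/4) x y"
 if y: "y:Ga" for y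
 proof (cases "dist x y < r")
 case True
 have "|g y-g x| <= et" using r(2)[OF x y] True by (simp add: dist_real_def dist_commute)
 hence "gs (mu/2) x y * |g y-g x| <= gs (mu/2) x y*et"
 using less_imp_le[OF gauss_pos] by (intro lmon) auto
 moreover have "0 <= et*gs (mu/4) x y" using et(1) less_imp_le[OF gauss_pos] by simp
 ultimately show ?thesis by (simp add: mult.commute)
 next
 case False
 have 1: "|g y-g x| <= 2*B" using B(2)[OF x] B(2)[OF y] by simp
 have "r^2 <= (dist x y)^2" using False r(1) by simp
 hence "mu*r^2 <= mu*(dist x y)^2" using mu by simp
 hence "- (mu/2)*(dist x y)^2 <= - (r^2/4)*mu + - (mu/4)*(dist x y)^2"
 by (simp add: algebra_simps)
 hence "gs (mu/2) x y <= E*gs (mu/4) x y"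
 unfolding gs_def E_def exp_add[symmetric] by simp
 hence "gs (mu/2) x y * |g y-g x| <= (E*gs (mu/4) x y)*(2*B)"
 using 1 E(1) less_imp_le[OF gauss_pos] by (intro mult_mono) auto
 also have "... = (E*(2*B))*gs (mu/4) x y" by simp
 also have "... <= et*gs (mu/4) x y" using E(2) less_imp_le[OF gauss_pos] by (intro rmon) auto
 also have "... <= et*gs (mu/2) x y+et*gs (mu/4) x y" using et(1) less_imp_le[OF gauss_pos] by simp
 finally show ?thesis .
 qed
 hence "|gop mu (k n) (%y. g y-g x) x| <= A*((et+et)*rt)"
 using et(1) by (intro gop_le[OF mu kn x A]) (auto intro!: L2_diff L2_cont g continuous_on_const continuous_on_diff)
 also have "... <= 2*((A+1)*rt*et)" using et(1) rt(1) by simp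
 also have "... = e" using et(2) by simp
 finally show ?thesis
 using gop_diff_eq(2)[OF mu kn x A L2_cont[OF g] L2_cont[OF g]] by simp
 qed
 thus ?case by (simp add: mu_def)
 qed
qed

text \<open>Both the operator and the multiplication by its image of 1 are bounded on L2 uniformly
  in \<open>n\<close>, so the convergence extends from the dense set of continuous
  functions.\<close>

lemma gop_diff_lim:
 assumes k: "!!n. gbd (real (Suc n)) A (k n)" and A: "0 <= A" and f: "LL f"
 shows "(%n. nm (%x. gop (real (Suc n)) (k n) f x-f x*gop (real (Suc n)) (k n) (%_. 1) x)) ----> 0"
proof (rule LIMSEQ_I)
 fix e :: real assume e: "0 < e"
 define m where "m = sqrt (measure M (space M))"
 have m: "0 <= m" by (simp add: m_def)
 define ep where "ep = e/(4*(A+1)*rt)"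
 have R: "0 < (A+1)*rt" "0 <= A*rt" using rt(1) A by auto
 have ep: "0 < ep" "(A+1)*rt*ep = e/4" using e R by (auto simp: ep_def field_simps)
 obtain g where g: "cont Ga g" "nm (%x. f x-g x) < ep"
 using L2_cont_dense[OF f ep(1)] by blast
 have gL: "LL g" by (rule L2_cont[OF g(1)])
 have fg: "LL (%x. f x-g x)" by (intro L2_diff f gL)
 obtain n0 where n0: "!!n x. n >= n0 ==> x:Ga ==>
 |gop (real (Suc n)) (k n) g x-g x*gop (real (Suc n)) (k n) (%_. 1) x| <= e/(4*(m+1))"
 using gop_diff_continuous[OF k A g(1), of "e/(4*(m+1))"] e m by (auto simp: eventually_sequentially)
 have "nm (%x. gop (real (Suc n)) (k n) f x-f x*gop (real (Suc n)) (k n) (%_. 1) x) < e" if n: "n >= n0" for n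
 proof -
 define mu where "mu = real (Suc n)"
 have mu: "1 <= mu" by (simp add: mu_def)
 have kn: "gbd mu A (k n)" using k[of n] by (simp add: mu_def)
 let ?o = "gop mu (k n) (%_. 1)"
 let ?D = "%f x. gop mu (k n) f x-f x*?o x"
 have om: "?o:bmeas M" by (rule gop_meas[OF kn]) simp
 have F: "LL (%x. h x*?o x)" "nm (%x. h x*?o x) <= A*rt*nm h"
 if h: "LL h" for h :: "'k fn"
 proof -
 have b: "AE x in M. norm (h x*?o x) <= A*rt*norm (h x)"
 using gop_one_le[OF mu kn _ A] by (intro AE_I2) (simp add: abs_mult space_M mult.commute lmon)
 have hm: "(%x. h x*?o x):bmeas M" using L2_funD(1)[OF h] om by simp
 show "LL (%x. h x*?o x)" by (rule L2_bound[OF h hm b])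
 show "nm (%x. h x*?o x) <= A*rt*nm h" by (rule L2n_bound[OF h hm b R(2)])
 qed
 have D: "LL (?D h)" if "LL h" for h by (intro L2_diff gop_L2(1)[OF mu kn A] F that)
 have "nm (?D (%x. f x-g x)) <= A*rt*nm (%x. f x-g x)+A*rt*nm (%x. f x-g x)"
 using L2n_diff[OF gop_L2(1)[OF mu kn A fg] F(1)[OF fg]] gop_L2(2)[OF mu kn A fg] F(2)[OF fg] by simp
 also have "... <= 2*((A+1)*rt*ep)"
 using mult_mono[of "A*rt" "(A+1)*rt" "nm (%x. f x-g x)" ep] g(2) R rt(1) L2n_nonneg[of M "%x. f x-g x"] by simp
 finally have 1: "nm (?D (%x. f x-g x)) <= e/2" using ep(2) by simp
 have "nm (?D g) <= |e/(4*(m+1))|*m"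
 unfolding m_def[symmetric] using n0[OF n] L2_funD(1)[OF D[OF gL]] by (intro L2_bounded(2)[folded m_def] AE_I2) (simp_all add: space_M mu_def)
 also have "... <= e/4" using e m by (simp add: field_simps)
 finally have 2: "nm (?D g) <= e/4" .
 have "nm (?D f) = nm (%x. ?D (%x. f x-g x) x+?D g x)"
 unfolding L2_norm_def using gop_diff_eq(1)[OF mu kn _ A f gL] by (intro arg_cong[of _ _ sqrt] icong) (simp add: space_M algebra_simps)
 also have "... <= e/2+e/4" using L2n_add[OF D[OF fg] D[OF gL]] 1 2 by simp
 finally show ?thesis using e by (simp add: mu_def)
 qed
 thus "EX n0. ALL n>=n0. norm (nm (%x. gop (real (Suc n)) (k n) f x-f x*gop (real (Suc n)) (k n) (%_. 1) x)-0) < e"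
 unfolding diff_0_right real_norm_def abs_of_nonneg[OF L2n_nonneg] by blast
qed

lemma gbounded_gauss: "0 <= mu ==> gbd mu 1 (gs mu)"
 unfolding gbd_def using gauss_meas[of mu] gauss_pos[of mu] gauss_mono[of "mu/2" mu] by (auto simp: abs_of_pos)

lemma gop_gauss_one: "1 <= mu ==> x:Ga ==> gop mu (gs mu) (%_. 1) x = 1"
 using gmass_pos[of mu x] by (simp add: gop_def gms_def[symmetric])

lemma gop_gauss_lim:
 assumes f: "LL f"
 shows "(%n. nm (%x. gop (real (Suc n)) (gs (real (Suc n))) f x-f x)) ----> 0"
proof -
 have "nm (%x. gop (real (Suc n)) (gs (real (Suc n))) f x-f x*gop (real (Suc n)) (gs (real (Suc n))) (%_. 1) x) =
 nm (%x. gop (real (Suc n)) (gs (real (Suc n))) f x-f x)" for n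
 unfolding L2_norm_def by (intro arg_cong[of _ _ sqrt] icong)
 (simp add: gop_gauss_one space_M del: of_nat_Suc)
 thus ?thesis
 using gop_diff_lim[of 1 "%n. gs (real (Suc n))", OF gbounded_gauss _ f] by simp
qed

end

section \<open>Mollification\<close>

lemma L2_nth: "L2_fun M f ==> L2_fun M (%x. f x $ i)" for f :: "'a => real^'k"
 by (rule L2_bound[of M f _ 1]) (simp_all add: component_le_norm_cart meas_vec_nth L2_funD(1))

lemma (in compact_measure) L2_cont_mult:
 fixes v :: "'a => real"
 assumes c: "cont Ga c" and v: "L2_fun M v" shows "L2_fun M (%x. c x * v x)"
proof -
 obtain B where "!!y. y:Ga ==> |c y| <= B" using cont_bdd[OF c] by auto
 thus ?thesis using cont_meas[OF c] L2_funD(1)[OF v] by (intro L2_bound[OF v, where C = B]) (auto simp: abs_mult space_M intro!: rmon AE_I2)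
qed

section \<open>Derivatives of kernels along the diagonal\<close>

context submfd
begin

abbreviation tube2 :: "((real^'k) \<times> (real^'k)) set" where "tube2 \<equiv> tube \<times> tube"

text \<open>The derivative along \<open>fr i\<close> in both variables at once. On a function of x -
  y it brings out the difference of the two frame vectors, so a Gaussian only acquires the factor mu
  |x-y|^2, whereas a derivative in one variable costs mu |x-y|.\<close>

definition lk :: "'k => ((real^'k) \<times> (real^'k) => real) => (real^'k) \<times> (real^'k) => real" where
 "lk i k z = FD k z (fr i (fst z), fr i (snd z))"

definition op :: "((real^'k) \<times> (real^'k) => real) => (real^'k => real) => 'k fn" where
 "op k ph x = (LINT y|M. k (x, y)*ph y)"

lemma open_tube2: "open tube2"
 using op_tube by (rule open_Times[OF _ op_tube])

lemma sm_fst: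
 fixes f :: "real^'k => 'b::euclidean_space"
 assumes "smT f" shows "smooth_on tube2 (%z. f (fst z))" "smooth_on tube2 (%z. f (snd z))"
 by (rule sm_comp[OF open_tube2 op_tube _ assms sm_bl]; force intro: bounded_linear_fst bounded_linear_snd)+

lemma sm_lk:
 assumes k: "smooth_on tube2 k" shows "smooth_on tube2 (lk i k)"
proof -
 have "smooth_on tube2 (%z. (fr i (fst z), 0)+(0, fr i (snd z)))"
 by (intro sm_add open_tube2 sm_fst[OF sm_fr]
 sm_lin_comp[where g = "%w. (w, 0)" and f = "%z. fr i (fst z)"]
 sm_lin_comp[where g = "%w. (0, w)" and f = "%z. fr i (snd z)"]
 bounded_linear_Pair bounded_linear_ident bounded_linear_zero)
 from sm_pdiff_field[OF open_tube2 k this] show ?thesis by (simp add: lk_def[abs_def])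
qed

lemma sm_slice:
 assumes k: "smooth_on tube2 k" and x: "x:tube"
 shows "smT (%y. k (x, y))"
 "!!y. y:tube ==> td i (%y. k (x, y)) y = FD k (x, y) (0, fr i y)"
proof -
 have "smT (%y. (x, 0)+(0, y))"
 by (intro sm_add op_tube sm_const sm_bl bounded_linear_Pair bounded_linear_ident bounded_linear_zero)
 from sm_comp[OF op_tube open_tube2 _ k this] x show "smT (%y. k (x, y))" by auto
 fix y assume y: "y:tube"
 have "((%y. (x, y)) has_derivative (%w. (0, w))) (at y)"
 by (rule has_derivative_Pair[OF has_derivative_const has_derivative_ident])
 from has_derivative_compose[OF this sm_der[OF k]] x y
 have "((%y. k (x, y)) has_derivative (%w. FD k (x, y) (0, w))) (at y)" by simp
 thus "td i (%y. k (x, y)) y = FD k (x, y) (0, fr i y)"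
 unfolding td_def by (rule pdiff_eqI)
qed

lemma sm_op: "smooth_on tube2 k ==> integrable M ph ==> smT (op k ph)"
 unfolding op_def[abs_def] by (rule sm_param_int[OF op_tube op_tube sub_tb])

lemma slice_L2: "smooth_on tube2 k ==> x:tube ==> LL (%y. k (x, y))" for k :: "_ => real"
 by (rule L2_cont[OF smt_cont[OF sm_slice(1)[of k x]]])

lemma op_int: "smooth_on tube2 k ==> x:tube ==> LL v ==> integrable M (%y. k (x, y) * v y)"
 for k :: "_ => real"
 by (rule L2_int_mult[OF slice_L2[of k x]])

lemma op_add:
 assumes "smooth_on tube2 k" "x:tube" "LL v" "LL w"
 shows "op k (%y. v y+w y) x = op k v x + op k w x"
 unfolding op_def using op_int[OF assms(1,2,3)] op_int[OF assms(1,2,4)] by (simp add: distrib_left)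

lemma tder_op_split:
 assumes k: "smooth_on tube2 k" and v: "LL v" and x: "x:tube"
 shows "td i (op k v) x = op (lk i k) v x-(LINT y|M. td i (%y. k (x, y)) y * v y)"
proof -
 have "td i (op k v) x = (LINT y|M. FD k (x, y) (fr i x, 0) * v y)"
 unfolding td_def op_def[abs_def]
 by (rule pdiff_eqI[OF param_int_der[OF op_tube sub_tb k L2_int[OF v] x]])
 also have "... = (LINT y|M. lk i k (x, y) * v y-td i (%y. k (x, y)) y * v y)"
 proof (intro icong)
 fix y assume "y:space M"
 hence y: "y:tube" using sub_tb by (auto simp: space_M)
 have "lk i k (x, y) = FD k (x, y) ((fr i x, 0)+(0, fr i y))" by (simp add: lk_def)
 also have "... = FD k (x, y) (fr i x, 0)+td i (%y. k (x, y)) y"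
 using x y by (subst linear_add[OF sm_lin_der[OF k]]) (auto simp: sm_slice(2)[OF k x])
 finally show "FD k (x, y) (fr i x, 0) * v y = lk i k (x, y) * v y-td i (%y. k (x, y)) y * v y"
 by (simp add: algebra_simps)
 qed
 also have "... = op (lk i k) v x-(LINT y|M. td i (%y. k (x, y)) y * v y)"
 unfolding op_def by (intro Bochner_Integration.integral_diff op_int[OF sm_lk[OF k] x v]
 L2_int_mult[OF _ v] L2_cont smt_cont sm_td sm_slice(1)[OF k x])
 finally show ?thesis .
qed

lemma L2_kap: "LL v ==> LL (%y. kap i y * v y)"
 by (rule L2_cont_mult[OF smt_cont[OF sm_kap]])

text \<open>The derivative in \<open>x\<close> is \<open>lk\<close> minus the derivative in
  \<open>y\<close>, and the latter is moved to \<open>v\<close> by the weak gradient. Hence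
  \<open>lk i k\<close> is the kernel of the commutator, up to the curvature term.\<close>

lemma tder_op:
 assumes k: "smooth_on tube2 k" and v: "LL v" and G: "wg v G" and x: "x:tube"
 shows "td i (op k v) x = op (lk i k) v x + op k (%y. G y $ i+kap i y * v y) x"
proof -
 have GL: "LL (%y. G y $ i)" using G by (intro L2_nth) (simp add: weak_surface_grad_def)
 have I: "integrable M (%y. td i (%y. k (x, y)) y * v y)" "integrable M (%y. k (x, y)*(kap i y * v y))"
 by (intro L2_int_mult L2_kap v L2_cont smt_cont sm_td sm_slice(1)[OF k x])+
 have "(LINT y|M. k (x, y)*(G y $ i)) = - ((LINT y|M. td i (%y. k (x, y)) y * v y)+(LINT y|M. k (x, y)*(kap i y * v y)))"
 using weak_grad_comp[OF G sm_slice(1)[OF k x], of i] I by (simp add: distrib_right mult.assoc)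
 thus ?thesis
 using tder_op_split[OF k v x, of i] op_add[OF k x GL L2_kap[OF v], of i] by (simp add: op_def)
qed

definition gk :: "real => (real^'k) \<times> (real^'k) => real" where
 "gk mu z = gs mu (fst z) (snd z)"

text \<open>Products of two differences. They vanish to second order on the diagonal, and
  \<open>lk\<close> maps them to sums of such products (\<open>lk_dk\<close>), so repeated diagonal
  derivatives keep their form.\<close>

definition dk :: "(real^'k => 'b::euclidean_space) => (real^'k => 'b) => (real^'k) \<times> (real^'k) => real" where
 "dk a b z = (a (fst z)-a (snd z)).*(b (fst z)-b (snd z))"

definition frame2 :: "'k => 'k => real^'k => real^'k" where
 "frame2 i j x = FD (fr i) x (fr j x)"

lemma sm_frame2: "smT (frame2 i j)"
 unfolding frame2_def[abs_def] by (rule sm_pdiff_field[OF op_tube sm_fr sm_fr])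

lemma sm_dk: "smT a ==> smT b ==> smooth_on tube2 (dk a b)"
 unfolding dk_def[abs_def] by (intro sm_inner sm_diff open_tube2 sm_fst)

lemma lk_dk:
 fixes a b :: "real^'k => 'b::euclidean_space"
 assumes a: "smT a" and b: "smT b" and z: "z:tube2"
 and a': "!!x. FD a x (fr i x) = a' x" and b': "!!x. FD b x (fr i x) = b' x"
 shows "lk i (dk a b) z = dk a b' z+dk a' b z"
proof -
 have D: "((%z. f (fst z)-f (snd z)) has_derivative
 (%w. FD f (fst z) (fst w)-frechet_derivative f (at (snd z)) (snd w))) (at z)"
 if f: "smT f" for f :: "real^'k => 'b"
 using z by (intro has_derivative_diff has_derivative_compose[OF has_derivative_fst[OF has_derivative_ident] sm_der[OF f]]
 has_derivative_compose[OF has_derivative_snd[OF has_derivative_ident] sm_der[OF f]]) auto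
 show ?thesis
 unfolding lk_def dk_def[abs_def] by (subst pdiff_eqI[OF has_derivative_inner[OF D[OF a] D[OF b]]]) (simp add: a' b')
qed

lemma gk_eq: "gk mu = (%z. exp (- mu*dk (%x. x) (%x. x) z))"
 by (simp add: fun_eq_iff gk_def gs_def dk_def dist_norm power2_norm_eq_inner)

lemma sm_gk: "smooth_on tube2 (gk mu)"
 unfolding gk_eq
 by (rule sm_comp[OF open_tube2 open_UNIV _ sm_exp], simp)
 (intro sm_mult sm_const open_tube2 sm_dk sm_ident)

lemma lk_mult:
 assumes "smooth_on tube2 f" "smooth_on tube2 g" "z:tube2"
 shows "lk i (%z. f z*g z) z = f z*lk i g z+lk i f z*g z"
 unfolding lk_def by (rule pdiff_eqI[OF has_derivative_mult[OF sm_der[OF assms(1,3)] sm_der[OF assms(2,3)]]])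

lemma lk_cong:
 assumes "!!z. z:tube2 ==> f z = g z" "z:tube2" "smooth_on tube2 f"
 shows "lk i f z = lk i g z"
proof -
 have "(g has_derivative FD f z) (at z)"
 by (rule has_derivative_transform_within_open[OF sm_der[OF assms(3,2)] open_tube2 assms(2,1)])
 thus ?thesis unfolding lk_def by (rule pdiff_eqI[symmetric])
qed

lemma lk_gk:
 assumes z: "z:tube2"
 shows "lk i (gk mu) z = - 2*mu*(dk (%x. x) (fr i) z*gk mu z)"
proof -
 have s: "smooth_on tube2 (dk (%x. x) (%x. x :: real^'k))" by (intro sm_dk sm_ident)
 have "((%z. exp (- mu*dk (%x. x) (%x. x) z)) has_derivative
 (%w. exp (- mu*dk (%x. x) (%x. x) z)*(- mu*frechet_derivative (dk (%x. x) (%x. x)) (at z) w))) (at z)"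
 using has_derivative_exp[OF has_derivative_mult_right[OF sm_der[OF s z], of "- mu"]] by (simp add: mult.commute)
 hence "lk i (gk mu) z = gk mu z*(- mu*lk i (dk (%x. x) (%x. x)) z)"
 unfolding lk_def gk_eq by (rule pdiff_eqI)
 also have "lk i (dk (%x. x) (%x. x)) z = dk (%x. x) (fr i) z+dk (fr i) (%x. x) z"
 by (rule lk_dk[OF sm_ident sm_ident z]) simp_all
 also have "dk (fr i) (%x. x) z = dk (%x. x) (fr i) z" by (simp add: dk_def inner_commute)
 finally show ?thesis by simp
qed

lemma lk_lk_gk:
 assumes z: "z:tube2"
 shows "lk j (lk i (gk mu)) z = 4*((mu*dk (%x. x) (fr i) z)*(mu*dk (%x. x) (fr j) z)*gk mu z)
 - 2*(mu*(dk (%x. x) (frame2 i j) z+dk (fr j) (fr i) z)*gk mu z)"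
proof -
 have s: "smooth_on tube2 (dk (%x. x) (fr i))" by (intro sm_dk sm_ident sm_fr)
 have "lk j (lk i (gk mu)) z = lk j (%z. (- 2*mu)*(dk (%x. x) (fr i) z*gk mu z)) z"
 by (rule lk_cong[OF lk_gk z sm_lk[OF sm_gk]])
 also have "... = (- 2*mu)*lk j (%z. dk (%x. x) (fr i) z*gk mu z) z"
 using lk_mult[OF sm_const[where c = "- 2*mu"] sm_mult[OF open_tube2 s sm_gk] z, of j mu]
 by (simp add: lk_def[of _ "%z. _"] pdiff_eqI[OF has_derivative_const])
 also have "lk j (%z. dk (%x. x) (fr i) z*gk mu z) z =
 dk (%x. x) (fr i) z*lk j (gk mu) z+lk j (dk (%x. x) (fr i)) z*gk mu z"
 by (rule lk_mult[OF s sm_gk z])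
 also have "lk j (dk (%x. x) (fr i)) z = dk (%x. x) (frame2 i j) z+dk (fr j) (fr i) z"
 by (rule lk_dk[OF sm_ident sm_fr z]) (simp_all add: frame2_def)
 finally show ?thesis by (simp add: lk_gk[OF z] algebra_simps)
qed

lemma dk_le:
 assumes a: "smT a" and b: "smT b"
 obtains L where "0 < L" "!!x y. x:Ga ==> y:Ga ==> |dk a b (x, y)| <= L*(dist x y)^2"
proof -
 obtain K L where K: "0 < K" "!!x y. x:Ga ==> y:Ga ==> norm (a x-a y) <= K*dist x y"
 and L: "0 < L" "!!x y. x:Ga ==> y:Ga ==> norm (b x-b y) <= L*dist x y"
 using smooth_lip[OF a] smooth_lip[OF b] by metis
 show ?thesis
 proof (rule that[of "K*L"])
 fix x y assume xy: "x:Ga" "y:Ga"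
 have "|dk a b (x, y)| <= norm (a x-a y)*norm (b x-b y)" by (simp add: dk_def Cauchy_Schwarz_ineq2)
 also have "... <= (K*dist x y)*(L*dist x y)" using K(1) by (intro mult_mono K(2)[OF xy] L(2)[OF xy]) auto
 finally show "|dk a b (x, y)| <= K*L*(dist x y)^2" by (simp add: sq2 mult_ac)
 qed (use K(1) L(1) in simp)
qed

text \<open>With s = mu |x-y|^2 the inequality s/4 <= exp(s/4), squared, gives s^2 <= 16 exp(s/2);
  the same constant suffices for s.\<close>

lemma gauss_absorb:
 assumes "0 <= mu"
 shows "mu*(dist x y)^2*gs mu x y <= 16*gs (mu/2) x y" "(mu*(dist x y)^2)^2*gs mu x y <= 16*gs (mu/2) x y"
proof -
 define s where "s = mu*(dist x y)^2"
 have s: "0 <= s" using assms by (simp add: s_def)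
 have e: "gs mu x y = exp (- s/2)*exp (- s/2)" "gs (mu/2) x y = exp (- s/2)"
 by (simp_all add: gs_def s_def exp_add[symmetric])
 have "s/4 <= exp (s/4)" using exp_ge_add_one_self[of "s/4"] by linarith
 hence "(s/4)^2 <= (exp (s/4))^2" using s by simp
 also have "... = exp (s/2)" by (simp add: sq2 exp_add[symmetric])
 finally have q: "s^2 <= 16*exp (s/2)" by (simp add: power_divide)
 have 1: "s <= 16*exp (s/2)" using exp_ge_add_one_self[of "s/2"] s by linarith
 have "t*gs mu x y <= 16*gs (mu/2) x y" if "t <= 16*exp (s/2)" for t
 proof -
 have "t*exp (- s/2) <= 16*exp (s/2)*exp (- s/2)" using that by simp
 also have "... = 16" by (simp add: exp_add[symmetric])
 finally have "(t*exp (- s/2))*exp (- s/2) <= 16*exp (- s/2)" by simp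
 thus ?thesis unfolding e by simp
 qed
 from this[OF 1] this[OF q] show "mu*(dist x y)^2*gs mu x y <= 16*gs (mu/2) x y"
 "(mu*(dist x y)^2)^2*gs mu x y <= 16*gs (mu/2) x y" by (simp_all add: s_def)
qed

lemma gboundedI:
 assumes k: "smooth_on tube2 k" and le: "!!x y. x:Ga ==> y:Ga ==> |k (x, y)| <= A*gs (mu/2) x y"
 shows "gbd mu A (%x y. k (x, y))"
proof -
 have c: "cont (Ga \<times> Ga) k"
 by (rule continuous_on_subset[OF sm_cont[OF k]]) (use sub_tb in auto)
 have "(%z. (fst z, snd z)):M \<Otimes>\<^sub>M M \<rightarrow>\<^sub>M borel"
 using measurable_compose[OF measurable_fst ident_meas] measurable_compose[OF measurable_snd ident_meas]
 unfolding borel_prod[symmetric] by (rule measurable_Pair)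
 hence "(%z. (fst z, snd z)):M \<Otimes>\<^sub>M M \<rightarrow>\<^sub>M restrict_space borel (Ga \<times> Ga)"
 by (intro measurable_restrict_space2) (auto simp: space_pair_measure space_M)
 from measurable_compose[OF this borel_measurable_continuous_on_restrict[OF c]]
 show ?thesis using le by (simp add: gbd_def split_beta')
qed

lemma kernels:
 obtains A where "0 <= A"
 "!!mu. 0 <= mu ==> gbd mu A (%x y. gk mu (x, y))"
 "!!mu i. 0 <= mu ==> gbd mu A (%x y. lk i (gk mu) (x, y))"
 "!!mu i j. 0 <= mu ==> gbd mu A (%x y. lk j (lk i (gk mu)) (x, y))"
proof -
 have "EX L>0. ALL x:Ga. ALL y:Ga. |dk (%x. x) (fr i) (x, y)| <= L*(dist x y)^2 &
 |dk (%x. x) (frame2 i j) (x, y)+dk (fr j) (fr i) (x, y)| <= L*(dist x y)^2" for i j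
 proof -
 obtain a b c where a: "0 < a" "!!x y. x:Ga ==> y:Ga ==> |dk (%x. x) (fr i) (x, y)| <= a*(dist x y)^2"
 and b: "0 < b" "!!x y. x:Ga ==> y:Ga ==> |dk (%x. x) (frame2 i j) (x, y)| <= b*(dist x y)^2"
 and c: "0 < c" "!!x y. x:Ga ==> y:Ga ==> |dk (fr j) (fr i) (x, y)| <= c*(dist x y)^2"
 using dk_le[OF sm_ident sm_fr] dk_le[OF sm_ident sm_frame2] dk_le[OF sm_fr sm_fr] by metis
 have "r*(dist x y)^2 <= (a+b+c)*(dist x y)^2" if "r <= a+b+c" for r and x y :: "real^'k"
 using that by (rule rmon) simp
 from this[of a] this[of "b+c"] show ?thesis using a b c by (intro exI[of _ "a+b+c"]) (smt (verit, ccfv_SIG) distrib_right)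
 qed
 then obtain L where L: "!!i j. 0 < L i j" and
 D: "!!i j x y. x:Ga ==> y:Ga ==> |dk (%x. x) (fr i) (x, y)| <= L i j*(dist x y)^2"
 "!!i j x y. x:Ga ==> y:Ga ==> |dk (%x. x) (frame2 i j) (x, y)+dk (fr j) (fr i) (x, y)| <= L i j*(dist x y)^2"
 by metis
 define B where "B = (SUM i:UNIV. SUM j:UNIV. L i j)"
 have LB: "L i j <= B" for i j
 proof -
 have "L i j <= (SUM j:UNIV. L i j)" using L by (intro member_le_sum) (auto intro: less_imp_le)
 also have "... <= B" unfolding B_def using L by (intro member_le_sum) (auto intro: less_imp_le sum_nonneg)
 finally show ?thesis .
 qed
 have B: "0 < B" using L LB less_le_trans by blast
 have D': "|mu*dk (%x. x) (fr i) (x, y)| <= B*(mu*(dist x y)^2)"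
 "|mu*(dk (%x. x) (frame2 i j) (x, y)+dk (fr j) (fr i) (x, y))| <= B*(mu*(dist x y)^2)"
 if "x:Ga" "y:Ga" "0 <= mu" for x y mu i j
 proof -
 have "|mu*t| <= B*(mu*(dist x y)^2)" if t: "|t| <= L i j*(dist x y)^2" for t
 proof -
 have "|t| <= B*(dist x y)^2" using t rmon[OF LB[of i j], of "(dist x y)^2"] by simp
 hence "mu * |t| <= mu*(B*(dist x y)^2)" using \<open>0 <= mu\<close> by (rule lmon)
 thus ?thesis using \<open>0 <= mu\<close> by (simp add: abs_mult mult_ac)
 qed
 thus "|mu*dk (%x. x) (fr i) (x, y)| <= B*(mu*(dist x y)^2)"
 "|mu*(dk (%x. x) (frame2 i j) (x, y)+dk (fr j) (fr i) (x, y))| <= B*(mu*(dist x y)^2)"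
 using D that by auto
 qed
 \<comment> \<open>The term \<open>32*B\<close> comes from the coefficient 2 times the 16 of
   \<open>gauss_absorb\<close>, the term \<open>64*B^2\<close> from the coefficient 4 in
   \<open>lk_lk_gk\<close> times 16.\<close>
 define A where "A = 1+32*B+64*B^2"
 have A: "1 <= A" "32*B <= A" using B by (auto simp: A_def)
 have t2: "x:Ga ==> y:Ga ==> (x, y):tube2" for x y using sub_tb by auto
 show ?thesis
 proof (rule that[of A])
 show "0 <= A" using A by simp
 fix mu :: real and i j assume mu: "0 <= mu"
 have AG: "r*gs (mu/2) x y <= A*gs (mu/2) x y" if "r <= A" for r x y
 using that less_imp_le[OF gauss_pos] by (rule rmon)
 show "gbd mu A (%x y. gk mu (x, y))"
 proof (rule gboundedI[OF sm_gk])
 fix x y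
 have "gs mu x y <= gs (mu/2) x y" using mu by (intro gauss_mono) simp
 thus "|gk mu (x, y)| <= A*gs (mu/2) x y"
 using AG[OF A(1), of x y] gauss_pos[of mu x y] unfolding gk_def fst_conv snd_conv by linarith
 qed
 have E: "B*(mu*(dist x y)^2)*gs mu x y <= B*(16*gs (mu/2) x y)" for x y
 using lmon[OF gauss_absorb(1)[OF mu, of x y] less_imp_le[OF B]] by simp
 show "gbd mu A (%x y. lk i (gk mu) (x, y))"
 proof (rule gboundedI[OF sm_lk[OF sm_gk]])
 fix x y assume xy: "x:Ga" "y:Ga"
 have "|lk i (gk mu) (x, y)| = 2*( |mu*dk (%x. x) (fr i) (x, y)|*gs mu x y)"
 using gauss_pos[of mu x y] by (simp add: lk_gk[OF t2[OF xy]] gk_def abs_mult)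
 also have "... <= 2*(B*(mu*(dist x y)^2)*gs mu x y)"
 using D'(1)[OF xy mu] less_imp_le[OF gauss_pos] by (intro lmon rmon) auto
 also have "... <= 32*B*gs (mu/2) x y" using E[of x y] by linarith
 also have "... <= A*gs (mu/2) x y" by (rule AG[OF A(2)])
 finally show "|lk i (gk mu) (x, y)| <= A*gs (mu/2) x y" .
 qed
 show "gbd mu A (%x y. lk j (lk i (gk mu)) (x, y))"
 proof (rule gboundedI[OF sm_lk[OF sm_lk[OF sm_gk]]])
 fix x y assume xy: "x:Ga" "y:Ga"
 let ?q = "%i. mu*dk (%x. x) (fr i) (x, y)" and ?g = "gs mu x y" and ?s = "mu*(dist x y)^2"
 let ?r = "mu*(dk (%x. x) (frame2 i j) (x, y)+dk (fr j) (fr i) (x, y))"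
 have "|lk j (lk i (gk mu)) (x, y)| = |4*(?q i*?q j*?g)-2*(?r*?g)|"
 by (simp only: lk_lk_gk[OF t2[OF xy]]) (simp add: gk_def)
 also have "... <= 4*( |?q i| * |?q j|*?g)+2*( |?r|*?g)"
 using abs_triangle_ineq4[of "4*(?q i*?q j*?g)" "2*(?r*?g)"] gauss_pos[of mu x y] by (simp only: abs_mult) simp
 also have "... <= 4*((B*?s)*(B*?s)*?g)+2*((B*?s)*?g)"
 using D'[OF xy mu] less_imp_le[OF gauss_pos] B mu by (intro add_mono lmon rmon mult_mono) auto
 also have "... = 4*B^2*(?s^2*?g)+2*B*(?s*?g)" by (simp add: sq2 mult_ac)
 also have "... <= 4*B^2*(16*gs (mu/2) x y)+2*B*(16*gs (mu/2) x y)"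
 using gauss_absorb[OF mu, of x y] B by (intro add_mono lmon) auto
 also have "... = (32*B+64*B^2)*gs (mu/2) x y" by (simp add: algebra_simps)
 also have "... <= A*gs (mu/2) x y" by (rule AG) (simp add: A_def)
 finally show "|lk j (lk i (gk mu)) (x, y)| <= A*gs (mu/2) x y" .
 qed
 qed
qed

end

definition L2_null :: "'a measure => (nat => 'a => real) => bool" where
 "L2_null M f \<longleftrightarrow> (ALL n. L2_fun M (f n)) & (%n. L2n M (f n)) ----> 0"

lemma abs_mult_bound: "|b| <= B ==> |a*b| <= B * |a|" for a b B :: real
 using lmon[of "|b|" B "|a|"] by (simp add: abs_mult mult.commute)

lemma L2_nullD: "L2_null M f ==> L2_fun M (f n)" "L2_null M f ==> (%n. L2n M (f n)) ----> 0"
 by (auto simp: L2_null_def)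

lemma L2_null_le:
 assumes g: "L2_null M g" and f: "!!n. f n:bmeas M" and C: "0 <= C"
 and le: "!!n. AE x in M. |f n x| <= C * |g n x|"
 shows "L2_null M f"
 unfolding L2_null_def
proof (intro conjI allI)
 have le': "AE x in M. norm (f n x) <= C*norm (g n x)" for n using le[of n] by simp
 show "L2_fun M (f n)" for n by (rule L2_bound[OF L2_nullD(1)[OF g] f le'])
 show "(%n. L2n M (f n)) ----> 0"
 proof (rule Lim_null_comparison)
 show "\<forall>\<^sub>F n in sequentially. norm (L2n M (f n)) <= C*L2n M (g n)"
 unfolding real_norm_def abs_of_nonneg[OF L2n_nonneg]
 using L2n_bound[OF L2_nullD(1)[OF g] f le' C] by simp
 show "(%n. C*L2n M (g n)) ----> 0"
 using tendsto_mult_left[OF L2_nullD(2)[OF g], of C] by simp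
 qed
qed

lemma L2_null_add:
 assumes f: "L2_null M f" and g: "L2_null M g" shows "L2_null M (%n x. f n x+g n x)"
 unfolding L2_null_def
proof (intro conjI allI)
 show "L2_fun M (%x. f n x+g n x)" for n by (intro L2_add L2_nullD(1) f g)
 show "(%n. L2n M (%x. f n x+g n x)) ----> 0"
 proof (rule Lim_null_comparison)
 show "\<forall>\<^sub>F n in sequentially. norm (L2n M (%x. f n x+g n x)) <= L2n M (f n)+L2n M (g n)"
 unfolding real_norm_def abs_of_nonneg[OF L2n_nonneg]
 by (intro always_eventually allI L2n_add L2_nullD(1) f g)
 show "(%n. L2n M (f n)+L2n M (g n)) ----> 0"
 using tendsto_add[OF L2_nullD(2)[OF f] L2_nullD(2)[OF g]] by simp
 qed
qed

lemma L2_null_diff: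
 assumes f: "L2_null M f" and g: "L2_null M g" shows "L2_null M (%n x. f n x-g n x)"
proof -
 have "L2_null M (%n x. - g n x)"
 by (rule L2_null_le[OF g, where C = 1]) (use L2_funD(1)[OF L2_nullD(1)[OF g]] in auto)
 from L2_null_add[OF f this] show ?thesis by simp
qed

lemma L2n_eq_0:
 assumes f: "L2_fun M f" and 0: "L2n M f = 0" shows "AE x in M. f x = 0"
proof -
 have "(LINT x|M. (norm (f x))^2) = 0" using 0 by (simp add: L2_norm_def)
 hence "AE x in M. (norm (f x))^2 = 0"
 using integral_nonneg_eq_0_iff_AE[OF L2_funD(2)[OF f]] by simp
 thus ?thesis by simp
qed

lemma L2_null_unique:
 assumes f: "!!n. L2_fun M (f n)" and g: "L2_fun M g" and h: "L2_fun M h"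
 and "L2_null M (%n x. f n x-g x)" "L2_null M (%n x. f n x-h x)"
 shows "AE x in M. g x = h x"
proof -
 have "L2_null M (%n x. (f n x-h x)-(f n x-g x))" by (intro L2_null_diff assms)
 hence "L2n M (%x. g x-h x) = 0" by (simp add: L2_null_def LIMSEQ_const_iff)
 from L2n_eq_0[OF L2_diff[OF g h] this] show ?thesis by simp
qed

section \<open>The mollifier and the convergence of its derivatives\<close>

context submfd
begin

lemma gmass_op: "gms mu = op (gk mu) (%_. 1)"
 by (simp add: fun_eq_iff gms_def op_def gk_def)

lemma measure_pos: "0 < measure M Ga"
proof -
 obtain y where y: "y:Ga" using nonempty by blast
 have "gms 1 y <= (LINT y|M. 1)"
 unfolding gms_def by (intro integral_mono gauss_int gauss_le1) auto
 thus ?thesis using gmass_pos[of 1 y] y by (simp add: space_M)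
qed

text \<open>Positivity also off \<open>Ga\<close>, so that the quotient by the mass is smooth on the
  open tube and can be differentiated there.\<close>

lemma gmass_pos': "0 < gms mu x"
proof -
 obtain y0 where y0: "y0:Ga" "!!y. y:Ga ==> gs mu x y0 <= gs mu x y"
 using continuous_attains_inf[OF compact nonempty cont_gauss] by blast
 have "0 < gs mu x y0*measure M Ga" using gauss_pos measure_pos by simp
 also have "... = (LINT y|M. gs mu x y0)" by (simp add: space_M)
 also have "... <= gms mu x" unfolding gms_def using y0(2) by (intro integral_mono gauss_int) (auto simp: space_M)
 finally show ?thesis .
qed

lemma L2_one: "LL (%_. 1 :: real)"
 by (rule L2_cont) (rule continuous_on_const)

lemma sm_gmass: "smT (gms mu)"
 unfolding gmass_op by (rule sm_op[OF sm_gk L2_int[OF L2_one]])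

definition moll :: "nat => (real^'k => real) => 'k fn" where
 "moll n v x = op (gk (real (Suc n))) v x/gms (real (Suc n)) x"

abbreviation gopk :: "nat => ((real^'k) \<times> (real^'k) => real) => (real^'k => real) => 'k fn" where
 "gopk n k \<equiv> gop (real (Suc n)) (%x y. k (x, y))"

abbreviation K0 :: "nat => (real^'k) \<times> (real^'k) => real" where "K0 n \<equiv> gk (real (Suc n))"

lemma gopk_op: "gopk n k f x = op k f x/gms (real (Suc n)) x"
 by (simp add: gop_def op_def)

lemma moll_gop: "moll n v = gopk n (K0 n) v"
 by (simp add: fun_eq_iff moll_def gopk_op del: of_nat_Suc)

lemma sm_moll:
 assumes "LL v" shows "smT (moll n v)"
proof -
 have i: "smT (%x. inverse (gms (real (Suc n)) x))"
 by (rule sm_comp[OF op_tube _ _ sm_inverse sm_gmass])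
 (use less_imp_neq[OF gmass_pos', symmetric] in \<open>auto simp del: of_nat_Suc\<close>)
 have "smT (%x. op (K0 n) v x*inverse (gms (real (Suc n)) x))"
 by (rule sm_mult[OF op_tube sm_op[OF sm_gk L2_int[OF assms]] i])
 thus ?thesis by (simp only: moll_def[abs_def] divide_inverse)
qed

lemma wgrad_const: "wg (%_. c) (%_. 0)"
proof -
 have "tg (%_. c) = (%_. 0)" by (simp add: fun_eq_iff tg_def tder_const vec_eq_iff)
 thus ?thesis using wgrad_smooth[OF sm_const[where c = c]] by simp
qed

text \<open>The logarithmic derivative of the mass. By \<open>gder_eq\<close> it is an expression in
  operators applied to the constant 1 and to \<open>kap i\<close>, hence bounded on
  \<open>Ga\<close> uniformly in \<open>n\<close>.\<close>

definition gder :: "nat => 'k => 'k fn" where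
 "gder n i x = td i (gms (real (Suc n))) x/gms (real (Suc n)) x"

lemma gder_eq: "x:Ga ==> gder n i x = gopk n (lk i (K0 n)) (%_. 1) x+gopk n (K0 n) (kap i) x"
 using tder_op[OF sm_gk L2_one wgrad_const, of x i "real (Suc n)"] sub_tb by (auto simp: gder_def gmass_op[symmetric] gopk_op add_divide_distrib simp del: of_nat_Suc)

lemma tder_moll_mult:
 assumes v: "LL v" and x: "x:tube"
 shows "td i (op (K0 n) v) x = moll n v x*td i (gms (real (Suc n))) x+td i (moll n v) x*gms (real (Suc n)) x"
proof -
 have "op (K0 n) v = (%x. moll n v x*gms (real (Suc n)) x)"
 using gmass_pos' by (simp add: fun_eq_iff moll_def less_imp_neq[symmetric] del: of_nat_Suc)
 thus ?thesis using tder_mult[OF sm_moll[OF v] sm_gmass x] by simp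
qed

lemma tder_moll:
 assumes v: "LL v" and G: "wg v G" and x: "x:Ga"
 shows "td i (moll n v) x = gopk n (lk i (K0 n)) v x+gopk n (K0 n) (%y. G y $ i+kap i y * v y) x-moll n v x*gder n i x"
proof -
 have xt: "x:tube" using x sub_tb by auto
 have "td i (moll n v) x = (td i (op (K0 n) v) x-moll n v x*td i (gms (real (Suc n))) x)/gms (real (Suc n)) x"
 using tder_moll_mult[OF v xt, of i n] gmass_pos'[of "real (Suc n)" x] by simp
 also have "... = (op (lk i (K0 n)) v x + op (K0 n) (%y. G y $ i+kap i y * v y) x)/gms (real (Suc n)) x-moll n v x*gder n i x"
 by (simp only: tder_op[OF sm_gk v G xt] diff_divide_distrib gder_def times_divide_eq_right)
 finally show ?thesis by (simp add: gopk_op add_divide_distrib del: of_nat_Suc)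
qed

lemma cont_kap: "cont Ga (kap i)"
 by (rule smt_cont[OF sm_kap])

lemma mollifier_bounds:
 obtains B where "0 <= B"
 "!!n i x. x:Ga ==> |gder n i x| <= B"
 "!!n h. LL h ==> LL (gopk n (K0 n) h) & nm (gopk n (K0 n) h) <= B*nm h"
 "!!n i h. LL h ==> LL (gopk n (lk i (K0 n)) h) & nm (gopk n (lk i (K0 n)) h) <= B*nm h"
 "!!n i j h. LL h ==> LL (gopk n (lk j (lk i (K0 n))) h) & nm (gopk n (lk j (lk i (K0 n))) h) <= B*nm h"
 "!!n i j x. x:Ga ==> |gopk n (lk j (lk i (K0 n))) (%_. 1) x| <= B"
 "!!n i x h b. x:Ga ==> continuous_on Ga h ==> (!!y. y:Ga ==> |h y| <= b) ==> |gopk n (K0 n) h x| <= B*b"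
 "!!n i x h b. x:Ga ==> continuous_on Ga h ==> (!!y. y:Ga ==> |h y| <= b) ==> |gopk n (lk i (K0 n)) h x| <= B*b"
proof -
 obtain A where A: "0 <= A"
 "!!mu. 0 <= mu ==> gbd mu A (%x y. gk mu (x, y))"
 "!!mu i. 0 <= mu ==> gbd mu A (%x y. lk i (gk mu) (x, y))"
 "!!mu i j. 0 <= mu ==> gbd mu A (%x y. lk j (lk i (gk mu)) (x, y))"
 by (rule kernels) blast
 have one: "1 <= real (Suc n)" "0 <= real (Suc n)" for n by auto
 obtain ka where ka: "0 <= ka" "!!i y. y:Ga ==> |kap i y| <= ka"
 by (rule finite_uniform_bound[where f = kap, OF compact cont_kap, unfolded real_norm_def]) blast
 define R where "R = A*rt"
 have R: "0 <= R" using A(1) rt(1) by (simp add: R_def)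
 define B where "B = R+R*ka"
 have B: "R <= B" using R ka(1) by (simp add: B_def)
 have pt: "|gop (real (Suc n)) k h x| <= R*b"
 if k: "gbd (real (Suc n)) A k" and x: "x:Ga" and h: "cont Ga h" and b: "!!y. y:Ga ==> |h y| <= b" for n k h x b
 proof -
 have b0: "0 <= b" using b[OF x] by simp
 have "|gop (real (Suc n)) k h x| <= A*((b+0)*rt)"
 proof (rule gop_le[OF one(1) k x A(1) L2_cont[OF h] b0])
 show "gs (real (Suc n)/2) x y * |h y| <= b*gs (real (Suc n)/2) x y+0*gs (real (Suc n)/4) x y"
 if "y:Ga" for y
 using rmon[OF b[OF that] less_imp_le[OF gauss_pos]] by (simp add: mult.commute)
 qed simp
 thus ?thesis by (simp add: R_def mult_ac)
 qed
 have pt1: "|gop (real (Suc n)) k (%_. 1) x| <= R" if "gbd (real (Suc n)) A k" "x:Ga" for n k x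
 using pt[OF that, of "%_. 1" 1] by simp
 have l2: "LL (gop (real (Suc n)) k h) & nm (gop (real (Suc n)) k h) <= B*nm h"
 if k: "gbd (real (Suc n)) A k" and h: "LL h" for n k h
 using gop_L2[OF one(1) k A(1) h] rmon[OF B L2n_nonneg[of M h]] by (auto simp: R_def simp del: of_nat_Suc)
 show ?thesis
 proof (rule that[of B])
 show "0 <= B" using R B by simp
 fix n i x assume x: "x:Ga"
 have "|gopk n (K0 n) (kap i) x| <= R*ka" by (rule pt[OF A(2)[OF one(2)] x cont_kap ka(2)])
 thus "|gder n i x| <= B"
 unfolding gder_eq[OF x] using pt1[OF A(3)[OF one(2)] x, of n i] by (simp add: B_def del: of_nat_Suc)
 have Bb: "R*b <= B*b" if "!!y. y:Ga ==> |h y| <= b" for h :: "'k fn" and b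
 using that[OF x] B by (intro rmon) auto
 fix h :: "'k fn" and b assume h: "cont Ga h" "!!y. y:Ga ==> |h y| <= b"
 show "|gopk n (K0 n) h x| <= B*b" using order_trans[OF pt[OF A(2)[OF one(2)] x h(1)] Bb] h(2) by blast
 show "|gopk n (lk i (K0 n)) h x| <= B*b" using order_trans[OF pt[OF A(3)[OF one(2)] x h(1)] Bb] h(2) by blast
 next
 show "|gopk n (lk j (lk i (K0 n))) (%_. 1) x| <= B" if "x:Ga" for n i j x
 using pt1[OF A(4)[OF one(2)] that, of n j i] B by simp
 qed (intro l2 A one; assumption)+
qed

lemma moll_lim:
 assumes v: "LL v" shows "L2_null M (%n x. moll n v x-v x)"
 unfolding L2_null_def
proof (intro conjI allI)
 show "LL (%x. moll n v x-v x)" for n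
 by (intro L2_diff v L2_cont smt_cont sm_moll)
 show "(%n. nm (%x. moll n v x-v x)) ----> 0"
 using gop_gauss_lim[OF v] by (simp add: moll_gop gk_def del: of_nat_Suc)
qed

text \<open>The commutator term of \<open>tder_moll\<close> need not converge, nor does
  \<open>gder\<close>. But \<open>gder\<close> contains the same commutator applied to 1, so the two
  combine to the expression treated in \<open>gop_diff_lim\<close>; the curvature terms cancel in
  the limit likewise.\<close>

lemma tder_moll_lim:
 assumes v: "LL v" and G: "wg v G"
 shows "L2_null M (%n x. td i (moll n v) x-G x $ i)"
proof -
 obtain B where B: "0 <= B" "!!n i x. x:Ga ==> |gder n i x| <= B"
 and b1: "!!n i h. LL h ==> LL (gopk n (lk i (K0 n)) h) & nm (gopk n (lk i (K0 n)) h) <= B*nm h"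
 and b2: "!!n h. LL h ==> LL (gopk n (K0 n) h) & nm (gopk n (K0 n) h) <= B*nm h"
 by (rule mollifier_bounds) blast
 obtain A where A: "0 <= A" "!!mu. 0 <= mu ==> gbd mu A (%x y. gk mu (x, y))"
 "!!mu i. 0 <= mu ==> gbd mu A (%x y. lk i (gk mu) (x, y))"
 by (rule kernels) blast
 have s0: "0 <= real (Suc n)" "1 <= real (Suc n)" for n by auto
 have GL: "LL (%y. G y $ i)" using G by (intro L2_nth) (simp add: weak_surface_grad_def)
 define w where "w = (%y. G y $ i+kap i y * v y)"
 have w: "LL w" unfolding w_def by (intro L2_add GL L2_kap v)
 have om: "gopk n (lk i (K0 n)) (%_. 1):bmeas M" for n using b1[OF L2_one] L2_funD(1) by blast
 have gm: "gder n i:bmeas M" for n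
 unfolding gder_def[abs_def] by (intro borel_measurable_divide cont_meas smt_cont sm_td sm_gmass)
 have km: "gopk n (K0 n) (kap i):bmeas M" for n
 using b2[OF L2_cont[OF cont_kap]] L2_funD(1) by blast
 have vm: "v:bmeas M" "moll n v:bmeas M" for n
 by (auto intro: L2_funD(1)[OF v] cont_meas smt_cont sm_moll v)
 have bo: "|gopk n (lk i (K0 n)) (%_. 1) x| <= A*rt" if "x:Ga" for n x
 by (rule gop_one_le[OF s0(2) A(3)[OF s0(1)] that A(1)])
 have N1: "L2_null M (%n x. gopk n (lk i (K0 n)) v x-v x*gopk n (lk i (K0 n)) (%_. 1) x)"
 unfolding L2_null_def
 proof (intro conjI allI)
 show "LL (%x. gopk n (lk i (K0 n)) v x-v x*gopk n (lk i (K0 n)) (%_. 1) x)" for n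
 proof (intro L2_diff)
 show "LL (gopk n (lk i (K0 n)) v)" using b1[OF v] by blast
 show "LL (%x. v x*gopk n (lk i (K0 n)) (%_. 1) x)"
 by (rule L2_bound[OF v borel_measurable_times[OF vm(1) om], where C = "A*rt"])
 (intro AE_I2, simp only: real_norm_def space_M abs_mult_bound bo)
 qed
 show "(%n. nm (%x. gopk n (lk i (K0 n)) v x-v x*gopk n (lk i (K0 n)) (%_. 1) x)) ----> 0"
 by (rule gop_diff_lim[OF A(3)[OF s0(1)] A(1) v])
 qed
 have N2: "L2_null M (%n x. gopk n (K0 n) w x-w x)"
 using moll_lim[OF w] by (simp only: moll_gop)
 have N3: "L2_null M (%n x. (moll n v x-v x)*gder n i x)"
 by (rule L2_null_le[OF moll_lim[OF v] borel_measurable_times[OF borel_measurable_diff[OF vm(2,1)] gm] B(1)])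
 (intro AE_I2, simp only: space_M abs_mult_bound B(2))
 have N4: "L2_null M (%n x. v x*(gopk n (K0 n) (kap i) x-kap i x))"
 unfolding L2_null_def
 proof (intro conjI allI)
 have m: "(%x. v x*(gopk n (K0 n) (kap i) x-kap i x)):bmeas M" for n
 using vm(1) km cont_meas[OF cont_kap] by simp
 have le: "AE x in M. norm (v x*(gopk n (K0 n) (kap i) x-kap i x)) <= e*norm (v x)"
 if "!!x. x:Ga ==> |gopk n (K0 n) (kap i) x-kap i x| <= e" for n e
 using that by (intro AE_I2) (simp only: real_norm_def space_M abs_mult_bound)
 have unit: "gopk n (K0 n) (%_. 1) x = 1" if "x:Ga" for n x
 using gop_gauss_one[OF s0(2) that, of n] by (simp add: gk_def)
 have ev: "eventually (%n. ALL x:Ga. |gopk n (K0 n) (kap i) x-kap i x| <= e) sequentially" if "0 < e" for e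
 using gop_diff_continuous[OF A(2)[OF s0(1)] A(1) cont_kap[of i] that] by eventually_elim (auto simp: unit simp del: of_nat_Suc)
 show "LL (%x. v x*(gopk n (K0 n) (kap i) x-kap i x))" for n
 unfolding moll_gop[symmetric] mult.commute[of "v _"]
 by (intro L2_cont_mult v continuous_on_diff cont_kap smt_cont sm_moll L2_cont)
 show "(%n. nm (%x. v x*(gopk n (K0 n) (kap i) x-kap i x))) ----> 0"
 proof (rule LIMSEQ_I)
 fix e :: real assume e: "0 < e"
 define e' where "e' = e/(2*(nm v+1))"
 have p: "0 < nm v+1" using L2n_nonneg[of M v] by simp
 have e': "0 < e'" using e p by (simp add: e'_def)
 have "e'*nm v <= e'*(nm v+1)" using e' by simp
 also have "... = e/2" unfolding e'_def using less_imp_neq[OF p] by (simp add: divide_simps)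
 finally have lt: "e'*nm v < e" using e by simp
 from ev[OF e'] obtain N where "!!n x. n >= N ==> x:Ga ==> |gopk n (K0 n) (kap i) x-kap i x| <= e'"
 unfolding eventually_sequentially by blast
 hence "nm (%x. v x*(gopk n (K0 n) (kap i) x-kap i x)) <= e'*nm v" if "n >= N" for n
 using that e' by (intro L2n_bound[OF v m le]) auto
 thus "EX N. ALL n>=N. norm (nm (%x. v x*(gopk n (K0 n) (kap i) x-kap i x))-0) < e"
 unfolding diff_0_right real_norm_def abs_of_nonneg[OF L2n_nonneg] using lt by (meson le_less_trans)
 qed
 qed
 \<comment> \<open>Inserting \<open>gder_eq\<close> for the part v*gder of the last term groups
   everything into the null sequences \<open>N1\<close> to \<open>N4\<close>.\<close>
 have eq: "td i (moll n v) x-G x $ i = gopk n (lk i (K0 n)) v x-v x*gopk n (lk i (K0 n)) (%_. 1) x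
 + (gopk n (K0 n) w x-w x)-(moll n v x-v x)*gder n i x-v x*(gopk n (K0 n) (kap i) x-kap i x)"
 if x: "x:Ga" for n x
 using tder_moll[OF v G x, of i n] gder_eq[OF x, of n i] by (simp only: w_def) (simp add: algebra_simps del: of_nat_Suc)
 show ?thesis
 proof (rule L2_null_le[OF L2_null_diff[OF L2_null_diff[OF L2_null_add[OF N1 N2] N3] N4], where C = 1])
 show "(%x. td i (moll n v) x-G x $ i):bmeas M" for n
 using L2_funD(1)[OF GL] cont_meas[OF smt_cont[OF sm_td[OF sm_moll[OF v]]]] by simp
 show "AE x in M. |td i (moll n v) x-G x $ i| <= 1 * |gopk n (lk i (K0 n)) v x-v x*gopk n (lk i (K0 n)) (%_. 1) x
 + (gopk n (K0 n) w x-w x)-(moll n v x-v x)*gder n i x-v x*(gopk n (K0 n) (kap i) x-kap i x)|" for n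
 by (intro AE_I2) (simp only: eq space_M mult_1)
 qed simp
qed

text \<open>Both fields are L2 limits of the same classical gradients of mollifications. This makes
  integrals of \<open>surface_grad\<close> independent of its choice.\<close>

lemma weak_grad_unique:
 assumes v: "LL v" and G: "wg v G" and H: "wg v H"
 shows "AE x in M. G x = H x"
proof -
 have "AE x in M. G x $ i = H x $ i" for i
 using G H L2_cont[OF smt_cont[OF sm_td[OF sm_moll[OF v]]]] by (intro L2_null_unique[OF _ L2_nth L2_nth tder_moll_lim[OF v G] tder_moll_lim[OF v H]])
 (auto simp: weak_surface_grad_def)
 hence "AE x in M. ALL i. G x $ i = H x $ i" by (simp add: AE_all_countable)
 thus ?thesis by eventually_elim (simp add: vec_eq_iff)
qed

end

lemma L2n_vec:
 fixes f :: "'a => real^'k"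
 assumes f: "L2_fun M f" shows "(L2n M f)^2 = (SUM i:UNIV. (L2n M (%x. f x $ i))^2)"
proof -
 have "(norm v)^2 = (SUM i:UNIV. (norm (v $ i))^2)" for v :: "real^'k"
 by (simp add: norm_vec_def L2_set_def sum_nonneg)
 thus ?thesis
 unfolding L2n_power2 using L2_funD(2)[OF L2_nth[OF f]] by simp
qed

lemma L2n_vec_lim:
 fixes f :: "nat => 'a => real^'k"
 assumes f: "!!n. L2_fun M (f n)" and i: "!!i. L2_null M (%n x. f n x $ i)"
 shows "(%n. L2n M (f n)) ----> 0"
proof -
 have "(%n. sqrt (SUM i:UNIV. (L2n M (%x. f n x $ i))^2)) ----> sqrt (SUM i:(UNIV :: 'k set). 0^2)"
 by (intro tendsto_real_sqrt tendsto_sum) (rule tendsto_power[OF L2_nullD(2)[OF i]])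
 thus ?thesis by (simp add: L2n_vec[OF f, symmetric] abs_of_nonneg[OF L2n_nonneg])
qed

section \<open>Calculus of weak gradients and weak limits\<close>

context submfd
begin

lemma H1I: "LL v ==> wg v G ==> v:HA"
 unfolding H1_def by blast

lemma sgrad_weak: "v:HA ==> wg v (sgr v)"
 unfolding H1_def surface_grad_def using someI_ex[of "wg v"] by blast

lemma H1_L2: "v:HA ==> LL v"
 by (simp add: H1_def)

lemma weak_grad_L2: "wg v G ==> LL G"
 by (simp add: weak_surface_grad_def)

lemma sgrad_AE:
 assumes v: "LL v" and G: "wg v G"
 shows "AE x in M. sgr v x = G x"
 by (rule weak_grad_unique[OF v sgrad_weak[OF H1I[OF v G]] G])

lemma L2n_sgrad:
 assumes v: "LL v" and G: "wg v G"
 shows "nm (sgr v) = nm G"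
 using L2_funD(1)[OF weak_grad_L2[OF sgrad_weak[OF H1I[OF v G]]]] L2_funD(1)[OF weak_grad_L2[OF G]] sgrad_AE[OF v G] by (rule L2n_cong_AE)

lemma dirichlet_form_eq:
 assumes u: "LL u" "wg u G" and v: "LL v" "wg v H"
 shows "Dir u v = (LINT x|M. G x.*H x)"
 unfolding dirichlet_form_def
proof (rule integral_cong_AE)
 note m = L2_funD(1)[OF weak_grad_L2[OF sgrad_weak[OF H1I[OF u]]]] L2_funD(1)[OF weak_grad_L2[OF sgrad_weak[OF H1I[OF v]]]]
 L2_funD(1)[OF weak_grad_L2[OF u(2)]] L2_funD(1)[OF weak_grad_L2[OF v(2)]]
 show "(%q. sgr u q.*sgr v q):bmeas M" "(%x. G x.*H x):bmeas M"
 using m by auto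
 show "AE q in M. sgr u q.*sgr v q = G q.*H q"
 using sgrad_AE[OF u] sgrad_AE[OF v] by auto
qed

lemma wgrad_lincomb:
 assumes u: "LL u" "wg u G" and v: "LL v" "wg v H"
 shows "wg (%x. r*u x+s * v x) (%x. r*.G x+s*.H x)"
 unfolding weak_surface_grad_def
proof (intro conjI allI impI)
 show "LL (%x. r*.G x+s*.H x)" by (rule L2_lincomb[OF weak_grad_L2[OF u(2)] weak_grad_L2[OF v(2)]])
 have "AE q in M. G q:TS q" "AE q in M. H q:TS q"
 using u(2) v(2) unfolding weak_surface_grad_def by blast+
 thus "AE q in M. r*.G q+s*.H q:TS q" using AE_space by eventually_elim (simp add: space_M tsp_iff linear_add[OF lin_dcp] linear_cmul[OF lin_dcp] subsetD[OF sub_tb])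
 fix X assume X: "tf X"
 note XL = L2_cont[OF cont_tfield[OF X]] and dL = L2_cont[OF cont_dv[OF X]]
 have "(LINT q|M. (r*.G q+s*.H q).*X q) = r*(LINT q|M. G q.*X q)+s*(LINT q|M. H q.*X q)"
 using L2_int_inner[OF weak_grad_L2[OF u(2)] XL] L2_int_inner[OF weak_grad_L2[OF v(2)] XL] by (simp add: inner_add_left)
 also have "... = r*- (LINT q|M. u q * dv X q)+s*- (LINT q|M. v q * dv X q)"
 using u(2) v(2) X by (simp add: weak_surface_grad_def)
 also have "... = - (LINT q|M. (r*u q+s * v q) * dv X q)"
 using L2_int_mult[OF u(1) dL] L2_int_mult[OF v(1) dL] by (simp add: distrib_right mult.assoc)
 finally show "(LINT q|M. (r*.G q+s*.H q).*X q) = - (LINT q|M. (r*u q+s * v q) * dv X q)" .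
qed

lemma dcp_norm_le:
 assumes q: "q:Ga" shows "norm (dcp q w) <= norm w"
proof -
 have "(norm (dcp q w))^2 = dcp q w.*w" using dcp_sym[OF q, of "dcp q w" w] dcp_idem[OF q] by (simp add: power2_norm_eq_inner inner_commute)
 also have "... <= norm (dcp q w)*norm w" by (rule norm_cauchy_schwarz)
 finally show ?thesis by (cases "dcp q w = 0") (simp_all add: sq2)
qed

lemma L2_dcp:
 assumes W: "LL W"
 shows "LL (%x. dcp x (W x))" "nm (%x. dcp x (W x)) <= nm W"
proof -
 have "(%x. SUM i:UNIV. (W x $ i)*.fr i x):bmeas M"
 by (intro borel_measurable_sum borel_measurable_scaleR meas_vec_nth L2_funD(1)[OF W]
 cont_meas cont_tfield stf_frame)
 hence m: "(%x. dcp x (W x)):bmeas M"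
 by (rule measurable_cong[THEN iffD1, rotated]) (simp add: space_M dcp_expand subsetD[OF sub_tb])
 have le: "AE x in M. norm (dcp x (W x)) <= 1*norm (W x)" by (intro AE_I2) (simp add: space_M dcp_norm_le)
 show "LL (%x. dcp x (W x))" by (rule L2_bound[OF W m le])
 show "nm (%x. dcp x (W x)) <= nm W" using L2n_bound[OF W m le] by simp
qed

text \<open>Weak compactness: the limit functional on tangent fields is represented by the Riesz theorem.\<close>

lemma weak_grad_limit:
 assumes v: "!!n. LL (v n)" "!!n. wg (v n) (G n)" and b: "!!n. nm (G n) <= C"
 and lim: "L2_null M (%n x. v n x-u x)" and u: "LL u"
 obtains H where "wg u H" "nm H <= C"
proof -
 define S where "S = Collect (tf)"
 have C: "0 <= C" using b[of 0] L2n_nonneg[of M "G 0"] by simp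
 define F where "F X = - (LINT x|M. u x * dv X x)" for X
 note XL = L2_cont[OF cont_tfield] and dL = L2_cont[OF cont_dv]
 have bd: "|F X| <= C*nm X" if X: "tf X" for X
 proof -
 have "(%n. LINT x|M. v n x * dv X x) ----> (LINT x|M. u x * dv X x)"
 using L2_inner_lim[OF v(1) u dL[OF X] L2_nullD(2)[OF lim]] by simp
 hence "(%n. |LINT x|M. v n x * dv X x| ) ----> |F X|"
 unfolding F_def abs_minus_cancel by (rule tendsto_rabs)
 moreover have "|LINT x|M. v n x * dv X x| <= C*nm X" for n
 proof -
 have "(LINT x|M. G n x.*X x) = - (LINT x|M. v n x * dv X x)"
 using v(2)[of n] X by (simp add: weak_surface_grad_def)
 hence "|LINT x|M. v n x * dv X x| = |LINT x|M. G n x.*X x|" by simp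
 also have "... <= nm (G n)*nm X" by (rule L2_CS[OF weak_grad_L2[OF v(2)] XL[OF X]])
 finally show ?thesis using rmon[OF b[of n] L2n_nonneg[of M X]] by simp
 qed
 ultimately show ?thesis by (intro LIMSEQ_le_const2) auto
 qed
 have tan: "X q:TS q" if "X:S" "q:Ga" for X q using that by (auto simp: S_def smooth_tangent_field_def)
 have comb: "(%x. r*.X x+s*.Y x):S & F (%x. r*.X x+s*.Y x) = r*F X+s*F Y" if X: "X:S" and Y: "Y:S" for X Y r s
 proof -
 have tX: "tf X" "tf Y" using X Y by (auto simp: S_def)
 then obtain U where U: "open U" "Ga <= U" and sX: "smooth_on U X" "smooth_on U Y"
 unfolding smooth_tangent_field_def by (meson Int_subset_iff inf.cobounded1 inf.cobounded2 open_Int sm_subset)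
 have sm: "smooth_on U (%x. r*.X x+s*.Y x)"
 by (intro sm_add sm_scaleR sm_const sX U)
 have d: "dv (%x. r*.X x+s*.Y x) q = r * dv X q+s * dv Y q" if q: "q:Ga" for q
 proof -
 have qt: "q:U" using q U by auto
 have "FD (%x. r*.X x+s*.Y x) q w = r*.frechet_derivative X (at q) w+s*.frechet_derivative Y (at q) w" for w
 by (rule pdiff_eqI) (rule has_derivative_add[OF has_derivative_scaleR_right[OF sm_der[OF sX(1) qt]] has_derivative_scaleR_right[OF sm_der[OF sX(2) qt]]])
 thus ?thesis by (simp add: sdiv_eq[OF q] sum.distrib sum_distrib_left)
 qed
 have "F (%x. r*.X x+s*.Y x) = - (LINT x|M. r*(u x * dv X x)+s*(u x * dv Y x))"
 unfolding F_def by (intro arg_cong[of _ _ uminus] icong) (simp add: d space_M algebra_simps)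
 also have "... = r*F X+s*F Y"
 using L2_int_mult[OF u dL[OF tX(1)]] L2_int_mult[OF u dL[OF tX(2)]] by (simp add: F_def)
 finally have "F (%x. r*.X x+s*.Y x) = r*F X+s*F Y" .
 moreover have "r*.X q+s*.Y q:TS q" if "q:Ga" for q
 using tan[OF X that] tan[OF Y that] that by (simp add: tsp_iff linear_add[OF lin_dcp] linear_cmul[OF lin_dcp] subsetD[OF sub_tb])
 ultimately show ?thesis using sm U by (auto simp: S_def smooth_tangent_field_def)
 qed
 have "EX W. LL W & nm W <= |C| & (ALL X:S. F X = (LINT x|M. W x.*X x))"
 proof (rule L2_riesz)
 show "(%x. 0):S"
 using op_tube sub_tb sm_const[of tube "0 :: real^'k"] by (auto simp: S_def smooth_tangent_field_def tsp_iff linear_0[OF lin_dcp] subsetD[OF sub_tb])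
 qed (use comb bd XL in \<open>auto simp: S_def\<close>)
 then obtain W where W: "LL W" "nm W <= C" "!!X. X:S ==> F X = (LINT x|M. W x.*X x)"
 using C by auto
 show ?thesis
 \<comment> \<open>The representer is only an L2 field; its tangential projection has the same
   pairing with tangent fields and no larger norm.\<close>
 proof (rule that[of "%x. dcp x (W x)"])
 show "nm (%x. dcp x (W x)) <= C" using L2_dcp(2)[OF W(1)] W(2) by simp
 show "wg u (%x. dcp x (W x))"
 unfolding weak_surface_grad_def
 proof (intro conjI allI impI)
 show "AE q in M. dcp q (W q):TS q" by (intro AE_I2) (simp add: space_M tsp_iff dcp_idem)
 fix X assume X: "tf X"
 hence XS: "X:S" by (simp add: S_def)
 have "(LINT q|M. dcp q (W q).*X q) = (LINT q|M. W q.*X q)"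
 by (intro icong) (simp add: space_M dcp_sym dcp_tangent tan[OF XS])
 also have "... = - (LINT q|M. u q * dv X q)" using W(3)[OF XS] by (simp add: F_def)
 finally show "(LINT q|M. dcp q (W q).*X q) = - (LINT q|M. u q * dv X q)" .
 qed (rule L2_dcp(1)[OF W(1)])
 qed
qed

lemma tgrad_L2: "smT f ==> LL (tg f)"
 by (rule L2_cont[OF cont_tgrad])

lemma tgrad_moll_lim:
 assumes v: "LL v" and G: "wg v G"
 shows "(%n. nm (%x. tg (moll n v) x-G x)) ----> 0"
 "LL W ==> (%n. LINT x|M. tg (moll n v) x.*W x) ----> (LINT x|M. G x.*W x)"
proof -
 show lim: "(%n. nm (%x. tg (moll n v) x-G x)) ----> 0"
 using tder_moll_lim[OF v G] by (intro L2n_vec_lim L2_diff tgrad_L2 sm_moll v weak_grad_L2[OF G])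
 (simp add: tg_def)
 show "(%n. LINT x|M. tg (moll n v) x.*W x) ----> (LINT x|M. G x.*W x)" if "LL W"
 by (rule L2_inner_lim[OF tgrad_L2[OF sm_moll[OF v]] weak_grad_L2[OF G] that lim])
qed

end

section \<open>The Poincare inequality\<close>

lemma nn_int_shrink:
 fixes h :: "real^'d => ennreal"
 assumes h: "h:bmeas borel" and t: "1/2 <= t"
 shows "(NN lborel (%y. h (z+t*.y))) <= enr (2^CARD('d))*(NN lborel (%y. h y))"
proof -
 note [measurable] = h
 have t0: "t ~= 0" "0 < t" using t by auto
 have "(NN lborel (%y. h y)) = (NN lborel (%y. enr ( |t|^CARD('d))*h (z+t*.y)))"
 by (subst lborel_affine[OF t0(1), of z]) (simp add: nn_integral_density nn_integral_distr)
 also have "... = enr (t^CARD('d))*(NN lborel (%y. h (z+t*.y)))"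
 using t0 by (simp add: nn_integral_cmult)
 finally have "enr (2^CARD('d))*(NN lborel (%y. h y)) = enr ((2*t)^CARD('d))*(NN lborel (%y. h (z+t*.y)))"
 using t0(2) by (simp add: ennreal_mult power_mult_distrib mult.assoc)
 moreover have "1 <= enr ((2*t)^CARD('d))"
 using ennreal_leI[OF one_le_power[of "2*t" "CARD('d)"]] t by simp
 ultimately show ?thesis using rmon[of 1 "enr ((2*t)^CARD('d))" "NN lborel (%y. h (z+t*.y))"] by simp
qed

text \<open>For t >= 1/2 substitute in \<open>y\<close>, at the price of the factor 2^d. Otherwise
  exchange \<open>y\<close> and \<open>z\<close>, which replaces \<open>t\<close> by 1-t.\<close>

lemma nn_int_segments:
 fixes h :: "real^'d => ennreal"
 assumes h[measurable]: "h:bmeas borel" and B[measurable]: "B:sets borel" and t: "0 <= t" "t <= 1"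
 shows "(NN lborel (%z. NN lborel (%y. ind B z*ind B y*h (z+t*.(y-z)))))
 <= enr (2^CARD('d))*em lborel B*(NN lborel (%y. h y))"
proof -
 have *: "(NN lborel (%z. NN lborel (%y. ind B z*ind B y*h (z+s*.(y-z)))))
 <= enr (2^CARD('d))*em lborel B*(NN lborel (%y. h y))" if s: "1/2 <= s" for s
 proof -
 have "(NN lborel (%z. NN lborel (%y. ind B z*ind B y*h (z+s*.(y-z))))) <=
 (NN lborel (%z. (enr (2^CARD('d))*(NN lborel (%y. h y)))*ind B z))"
 proof (rule nn_integral_mono)
 fix z
 have "(NN lborel (%y. ind B z*ind B y*h (z+s*.(y-z)))) <= (NN lborel (%y. ind B z*h ((z-s*.z)+s*.y)))"
 by (intro nn_integral_mono) (auto simp: indicator_def algebra_simps)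
 also have "... <= (enr (2^CARD('d))*(NN lborel (%y. h y)))*ind B z"
 using nn_int_shrink[OF h s, of "z-s*.z"] by (auto simp: indicator_def)
 finally show "(NN lborel (%y. ind B z*ind B y*h (z+s*.(y-z)))) <=
 (enr (2^CARD('d))*(NN lborel (%y. h y)))*ind B z" .
 qed
 also have "... = enr (2^CARD('d))*em lborel B*(NN lborel (%y. h y))"
 by (subst nn_integral_cmult_indicator) (simp_all add: mult_ac)
 finally show ?thesis .
 qed
 show ?thesis
 proof (cases "1/2 <= t")
 case False
 have m: "(%(z, y). ind B z*ind B y*h (z+t*.(y-z))):bmeas (lborel \<Otimes>\<^sub>M lborel)"
 by simp
 have "(NN lborel (%z. NN lborel (%y. ind B z*ind B y*h (z+t*.(y-z))))) =
 (NN lborel (%y. NN lborel (%z. ind B z*ind B y*h (z+t*.(y-z)))))"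
 using lborel_pair.Fubini'[OF m] by simp
 also have "... = (NN lborel (%y. NN lborel (%z. ind B y*ind B z*h (y+(1-t)*.(z-y)))))"
 by (simp add: algebra_simps)
 finally show ?thesis using *[of "1-t"] False by simp
 qed (rule *)
qed

text \<open>A Riemann sum stands in for the integral of the gradient bound along the segment;
  \<open>et\<close> is the oscillation of \<open>H\<close> over one of the \<open>N\<close> steps.
  Cauchy-Schwarz on the sum gives the factor 8.\<close>

lemma increment_le:
 fixes w H :: "real^'d => real"
 assumes D: "!!y. y:cball y0 rh ==> (w has_derivative D y) (at y)"
 and le: "!!y v. y:cball y0 rh ==> |D y v| <= H y*norm v"
 and N: "0 < N" "!!p q. p:cball y0 rh ==> q:cball y0 rh ==> dist p q <= 2*rh/real N ==> H p <= H q+et"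
 and y: "y:cball y0 rh" and z: "z:cball y0 rh"
 shows "(w y-w z)^2 <= (SUM k<N. (8*rh^2/real N)*((H (z+(real k/real N)*.(y-z)))^2+et^2))"
proof -
 let ?p = "%k. z+(real k/real N)*.(y-z)"
 have yz: "norm (y-z) <= 2*rh" using y z dist_triangle3[of y z y0] by (simp add: dist_norm)
 have pin: "z+s*.(y-z):cball y0 rh" if "0 <= s" "s <= 1" for s
 using convexD_alt[OF convex_cball z y that] by (simp add: algebra_simps)
 have step: "|w (?p (Suc k))-w (?p k)| <= (2*rh/real N)*(H (?p k)+et)" if k: "k < N" for k
 proof -
 have in1: "?p k:cball y0 rh" "?p (Suc k):cball y0 rh" using k N(1) by (intro pin; simp del: of_nat_Suc)+
 have eq: "?p (Suc k)-?p k = (1/real N)*.(y-z)" by (simp add: algebra_simps add_divide_distrib)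
 hence nn: "norm (?p (Suc k)-?p k) <= 2*rh/real N" using yz N(1) by (simp add: divide_right_mono)
 have seg: "closed_segment (?p k) (?p (Suc k)) <= cball y0 rh" by (rule closed_segment_subset[OF in1 convex_cball])
 have "norm (w (?p (Suc k))-w (?p k)) <= (H (?p k)+et)*norm (?p (Suc k)-?p k)"
 proof (rule differentiable_bound[where f = w and f' = D and S = "closed_segment (?p k) (?p (Suc k))"])
 fix x assume x: "x:closed_segment (?p k) (?p (Suc k))"
 show "(w has_derivative D x) (at x within closed_segment (?p k) (?p (Suc k)))"
 by (rule has_derivative_at_withinI[OF D]) (use x seg in blast)
 have "dist x (?p k) <= 2*rh/real N"
 using segment_bound(1)[OF x] nn by (simp add: dist_norm)
 hence "H x <= H (?p k)+et" using x seg in1 by (intro N(2)) auto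
 hence "|D x v| <= (H (?p k)+et)*norm v" for v
 using le[of x v] x seg rmon[of "H x" "H (?p k)+et" "norm v"] by auto
 thus "onorm (D x) <= H (?p k)+et" by (intro onorm_le) simp
 qed auto
 also have "... <= (H (?p k)+et)*(2*rh/real N)"
 proof (rule lmon[OF nn])
 have "0 <= H (?p k)*norm (axis undefined 1 :: real^'d)" using le[OF in1(1), of "axis undefined 1"] abs_ge_zero order_trans by blast
 moreover have "0 <= et" using N(2)[OF in1(1) in1(1)] yz norm_ge_zero[of "y-z"] by simp
 ultimately show "0 <= H (?p k)+et" by simp
 qed
 finally show ?thesis by (simp add: mult.commute)
 qed
 have "w y-w z = (SUM k<N. w (?p (Suc k))-w (?p k))"
 using sum_lessThan_telescope[of "%k. w (?p k)" N] N(1) by simp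
 hence "|w y-w z| <= (SUM k<N. (2*rh/real N)*(H (?p k)+et))"
 using order_trans[OF sum_abs sum_mono[of "{..<N}", OF step]] by simp
 hence "|w y-w z|\<^sup>2 <= (SUM k<N. (2*rh/real N)*(H (?p k)+et))^2" by (intro power_mono) auto
 also have "... <= real N*(SUM k<N. ((2*rh/real N)*(H (?p k)+et))^2)"
 using sum_squared_le_sum_of_squares[of "%k. (2*rh/real N)*(H (?p k)+et)" "{..<N}"] by (simp only: card_lessThan mult.commute[of "real N"] finite_lessThan)
 also have "... <= (SUM k<N. (8*rh^2/real N)*((H (?p k))^2+et^2))"
 unfolding sum_distrib_left
 proof (rule sum_mono)
 fix k
 have "(H (?p k)+et)^2 <= 2*((H (?p k))^2+et^2)"
 using sum_squares_bound[of "H (?p k)" et] by (simp add: sq2 algebra_simps)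
 hence "(4*rh^2/real N)*(H (?p k)+et)^2 <= (4*rh^2/real N)*(2*((H (?p k))^2+et^2))"
 by (rule lmon) simp
 thus "real N*((2*rh/real N)*(H (?p k)+et))^2 <= (8*rh^2/real N)*((H (?p k))^2+et^2)"
 using N(1) unfolding power_mult_distrib power_divide by (simp add: sq2[of "real N"] field_simps)
 qed
 finally show ?thesis by simp
qed

text \<open>Squared increments are integrated over all pairs of points, and the segments are removed
  by \<open>nn_int_segments\<close>. The slack \<open>e\<close> absorbs the discretisation error of
  the Riemann sums.\<close>

lemma ball_poincare:
 fixes w H :: "real^'d => real"
 assumes D: "!!y. y:cball y0 rh ==> (w has_derivative D y) (at y)"
 and le: "!!y v. y:cball y0 rh ==> |D y v| <= H y*norm v"
 and H: "cont (cball y0 rh) H" and rh: "0 < rh" and e: "0 < e"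
 obtains c where "(NN lborel (%y. (enr ((w y-c)^2))*ind (ball y0 rh) y)) <=
 enr (16*rh^2*2^CARD('d))*((NN lborel (%y. (enr ((H y)^2))*ind (ball y0 rh) y))+enr e)"
proof -
 define B where "B = ball y0 rh"
 have B[measurable]: "B:sets borel" and Bc: "B <= cball y0 rh" and cB: "convex B" by (auto simp: B_def)
 define V where "V = measure lborel B"
 have V: "0 < V" "em lborel B = enr V"
 using rh content_ball_pos[of rh y0] emeasure_lborel_ball_finite[of y0 rh] by (auto simp: V_def B_def intro!: emeasure_eq_ennreal_measure)
 \<comment> \<open>Chosen so that the constant error \<open>et^2\<close>, integrated over the ball,
   equals \<open>e\<close>.\<close>
 define et where "et = sqrt (e/V)"
 have et: "0 < et" "et^2*V = e" using e V(1) by (auto simp: et_def)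
 have "uniformly_continuous_on (cball y0 rh) H" by (rule compact_uniformly_continuous[OF H compact_cball])
 then obtain r where r: "0 < r" "!!p q. p:cball y0 rh ==> q:cball y0 rh ==> dist p q < r ==> dist (H p) (H q) < et"
 unfolding uniformly_continuous_on_def using et(1) by metis
 obtain N where N: "2*rh/r < real N" using reals_Archimedean2 by blast
 have N0: "0 < N"
 proof (rule ccontr)
 assume "~ 0 < N" thus False using N rh r(1) by (simp add: divide_less_0_iff)
 qed
 have Nr: "2*rh/real N < r" using N r(1) N0 by (simp add: field_simps)
 define h where "h y = enr (ind B y*.((H y)^2+et^2))" for y
 have h[measurable]: "h:bmeas borel"
 unfolding h_def[abs_def] by (intro measurable_compose[OF borel_measurable_continuous_on_indicator measurable_ennreal]
 continuous_intros continuous_on_subset[OF H Bc] B)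
 define I where "I = (NN lborel (%y. (enr ((H y)^2))*ind B y))"
 have hI: "(NN lborel (%y. h y)) = I+enr e"
 proof -
 have "(%y. enr (ind B y*.(H y)^2)):bmeas borel"
 by (intro measurable_compose[OF borel_measurable_continuous_on_indicator measurable_ennreal]
 continuous_intros continuous_on_subset[OF H Bc] B)
 moreover have "(%y. enr (ind B y*.(H y)^2)) = (%y. enr ((H y)^2)*ind B y)"
 by (simp add: indicator_def fun_eq_iff)
 ultimately have m: "(%y. enr ((H y)^2)*ind B y):bmeas lborel"
 by (simp only: measurable_lborel2)
 have "h y = enr ((H y)^2)*ind B y+enr (et^2)*ind B y" for y
 by (simp add: h_def indicator_def ennreal_plus)
 hence "(NN lborel (%y. h y)) = I+(NN lborel (%y. enr (et^2)*ind B y))"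
 unfolding I_def by (simp only:) (rule nn_integral_add[OF m], measurable)
 thus ?thesis using V et by (simp add: nn_integral_cmult_indicator ennreal_mult'[symmetric])
 qed
 let ?c = "8*rh^2/real N"
 define g where "g k z y = ind B z*ind B y*h (z+(real k/real N)*.(y-z))" for k :: nat and z y
 define S where "S z y = (SUM k<N. enr ?c*g k z y)" for z y
 have pt: "enr ((w y-w z)^2)*ind B y*ind B z <= S z y" for y z
 proof (cases "y:B & z:B")
 case True
 have pin: "z+(real k/real N)*.(y-z):B" if "k < N" for k
 using convexD_alt[OF cB, of z y "real k/real N"] True that by (simp add: algebra_simps)
 have "(w y-w z)^2 <= (SUM k<N. ?c*((H (z+(real k/real N)*.(y-z)))^2+et^2))"
 proof (rule increment_le[OF D le N0])
 fix p q assume "p:cball y0 rh" "q:cball y0 rh" "dist p q <= 2*rh/real N"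
 hence "dist (H p) (H q) < et" using Nr by (intro r(2)) auto
 thus "H p <= H q+et" by (simp add: dist_real_def)
 qed (use True Bc in auto)
 hence "enr ((w y-w z)^2) <= (SUM k<N. enr (?c*((H (z+(real k/real N)*.(y-z)))^2+et^2)))"
 by (subst sum_ennreal) (auto intro!: ennreal_leI)
 also have "... = S z y"
 unfolding S_def g_def h_def using True pin by (intro sum.cong refl) (subst ennreal_mult', simp_all)
 finally show ?thesis using True by simp
 qed (auto simp: indicator_def)
 have gm: "(%(z, y). g k z y):bmeas (lborel \<Otimes>\<^sub>M lborel)" for k
 unfolding g_def by simp
 have gm1: "(%z. NN lborel (%y. g k z y)):bmeas lborel" for k
 using lborel.borel_measurable_nn_integral_fst[OF gm] by simp
 have gm2: "g k z:bmeas lborel" for k z unfolding g_def[abs_def] by simp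
 let ?P = "enr (2^CARD('d))"
 have "(NN lborel (%z. NN lborel (%y. S z y))) = (SUM k<N. enr ?c*(NN lborel (%z. NN lborel (%y. g k z y))))"
 proof -
 have "(NN lborel (%y. S z y)) = (SUM k<N. enr ?c*(NN lborel (%y. g k z y)))" for z
 unfolding S_def by (subst nn_integral_sum) (intro borel_measurable_times_ennreal borel_measurable_const gm2, simp only: nn_integral_cmult[OF gm2])
 thus ?thesis
 by (simp only:, subst nn_integral_sum) (intro borel_measurable_times_ennreal borel_measurable_const gm1, simp only: nn_integral_cmult[OF gm1])
 qed
 also have "... <= (SUM k<N. enr ?c*(?P*enr V*(I+enr e)))"
 proof (intro sum_mono lmon)
 show "(NN lborel (%z. NN lborel (%y. g k z y))) <= ?P*enr V*(I+enr e)" if "k:{..<N}" for k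
 using nn_int_segments[OF h B, of "real k/real N"] that by (simp add: g_def hI V(2))
 qed simp
 also have "... = (of_nat N*enr ?c)*(?P*enr V*(I+enr e))" by (simp add: mult.assoc)
 also have "of_nat N*enr ?c = enr (8*rh^2)"
 using N0 by (simp add: ennreal_of_nat_eq_real_of_nat ennreal_mult'[symmetric])
 finally have tot: "(NN lborel (%z. NN lborel (%y. S z y))) <= enr (8*rh^2)*(?P*enr V*(I+enr e))" .
 define Q where "Q = enr (16*rh^2*2^CARD('d))*(I+enr e)"
 have "EX c. (NN lborel (%y. (enr ((w y-c)^2))*ind B y)) <= Q"
 \<comment> \<open>Some value \<open>w z\<close> serves as \<open>c\<close>: if every
   \<open>w z\<close> failed, integrating over \<open>z\<close> would contradict the pair estimate,
   whose constant 8 is half of the claimed 16.\<close>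
 proof (rule ccontr)
 assume no: "~ ?thesis"
 hence gt: "Q <= (NN lborel (%y. (enr ((w y-w z)^2))*ind B y))" for z by (simp add: not_le less_imp_le)
 have "Q ~= top"
 proof
 assume "Q = top" thus False using no by simp
 qed
 hence "Q < top" by (simp add: less_top)
 then obtain q where q: "Q = enr q" "0 <= q" using less_top_ennreal by auto
 have "0 < I+enr e" by (rule less_le_trans[of _ "enr e"]) (use e in auto)
 hence "0 < Q" unfolding Q_def using rh by (simp add: ennreal_zero_less_mult_iff)
 hence q0: "0 < q" using q by simp
 have "Q*enr V = (NN lborel (%z. Q*ind B z))" by (simp add: nn_integral_cmult_indicator V(2))
 also have "... <= (NN lborel (%z. NN lborel (%y. S z y)))"
 proof (rule nn_integral_mono)
 fix z
 have "Q*ind B z <= (NN lborel (%y. (enr ((w y-w z)^2))*ind B y))*ind B z" by (intro rmon gt) simp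
 also have "... <= (NN lborel (%y. S z y))"
 proof (cases "z:B")
 case True
 thus ?thesis using pt[of _ z] by (auto intro!: nn_integral_mono)
 qed simp
 finally show "Q*ind B z <= (NN lborel (%y. S z y))" .
 qed
 also note tot
 also have "enr (8*rh^2)*(?P*enr V*(I+enr e)) = enr (1/2)*(Q*enr V)"
 proof -
 have "enr (8*rh^2)*?P = enr (8*rh^2*2^CARD('d))" by (rule ennreal_mult'[symmetric]) simp
 also have "8*rh^2*2^CARD('d) = 1/2*(16*rh^2*2^CARD('d))" by simp
 also have "enr ... = enr (1/2)*enr (16*rh^2*2^CARD('d))" by (rule ennreal_mult') simp
 finally have *: "enr (8*rh^2)*?P = ..." .
 have "enr (8*rh^2)*(?P*enr V*(I+enr e)) = (enr (8*rh^2)*?P)*((I+enr e)*enr V)"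
 by (simp only: mult_ac)
 thus ?thesis unfolding Q_def * by (simp only: mult_ac)
 qed
 finally have "enr (q*V) <= enr (1/2*(q*V))"
 unfolding q(1) ennreal_mult'[OF q(2), symmetric] by (subst (2) ennreal_mult') auto
 hence "q*V <= 1/2*(q*V)" using q0 V(1) by simp
 moreover have "0 < q*V" using q0 V(1) by simp
 ultimately show False by linarith
 qed
 thus ?thesis using that unfolding Q_def I_def B_def by blast
qed

section \<open>From coordinate balls to the connected manifold\<close>

context submfd
begin

lemma set_int_continuous:
 fixes g :: "real^'k => real"
 assumes "cont Ga g" "S:sets M" shows "integrable M (%x. ind S x*g x)"
 using integrable_mult_indicator[OF assms(2) cont_int[OF assms(1)]] by simp

lemma patch_int:
 assumes p: "patch C ph y0 r" and B: "B:sets borel" "B <= cball y0 r"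
 and g: "cont Ga g" "!!x. x:Ga ==> 0 <= g x"
 shows "enr (LINT x|M. ind (ph ` B) x*g x) <= enr C*(NN lborel (%y. (enr (g (ph y)))*ind B y))"
 "(NN lborel (%y. (enr (g (ph y)))*ind B y)) <= enr C*enr (LINT x|M. ind (ph ` B) x*g x)"
proof -
 obtain V where V: "chart V ph" "cball y0 r <= V" using patch_chart[OF p] by blast
 have BV: "B <= V" using B V by blast
 have S: "ph ` B:sets M" "ph ` B <= Ga" using patch_image_sets[OF p B] by (auto simp: sets_M_iff)
 define G where "G x = enr (ind Ga x*.g x)" for x
 have Gm: "G:bmeas borel"
 unfolding G_def[abs_def] by (intro measurable_compose[OF borel_extension[OF cont_meas[OF g(1)]] measurable_ennreal])
 have "enr (LINT x|M. ind (ph ` B) x*g x) = (NN M (%x. enr (ind (ph ` B) x*g x)))"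
 using g(2) by (intro nn_integral_eq_integral[symmetric] set_int_continuous g(1) S AE_I2) (simp add: space_M)
 also have "... = (NN sg (%x. (enr (ind (ph ` B) x*g x))*ind Ga x))" by (rule nn_integral_restrict_space[OF Ga_sets])
 also have "... = (NN sg (%x. (G x)*ind (ph ` B) x))" by (intro nn_integral_cong) (auto simp: G_def indicator_def)
 also have "... = (NN lborel (%y. (G (ph y)*enr (adens ph y))*ind B y))" by (rule chart_nn_int[OF V(1) B(1) BV Gm])
 also have "... = (NN lborel (%y. (enr (g (ph y))*enr (adens ph y))*ind B y))"
 using chartD(2)[OF V(1)] BV by (intro nn_integral_cong) (auto simp: G_def indicator_def)
 finally have eq: "enr (LINT x|M. ind (ph ` B) x*g x) = (NN lborel (%y. (enr (g (ph y))*enr (adens ph y))*ind B y))" .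
 have cphi: "cont V ph" using immD(2)[OF chartD(1)[OF V(1)]] by (rule sm_cont)
 have "(%y. enr (ind B y*.g (ph y))):bmeas borel"
 using chartD(2)[OF V(1)] BV by (intro measurable_compose[OF borel_measurable_continuous_on_indicator measurable_ennreal]
 continuous_on_compose2[OF g(1) continuous_on_subset[OF cphi BV]] B) auto
 moreover have "(%y. enr (ind B y*.g (ph y))) = (%y. enr (g (ph y))*ind B y)"
 by (simp add: indicator_def fun_eq_iff)
 ultimately have m: "(%y. enr (g (ph y))*ind B y):bmeas lborel" by simp
 have pos: "0 <= g (ph y)" "0 < adens ph y" if "y:B" for y
 using that BV chartD(2)[OF V(1)] g(2) immD(6)[OF chartD(1)[OF V(1)]] by auto
 show "enr (LINT x|M. ind (ph ` B) x*g x) <= enr C*(NN lborel (%y. (enr (g (ph y)))*ind B y))"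
 unfolding eq nn_integral_cmult[OF m, symmetric]
 proof (rule nn_integral_mono)
 fix y
 show "enr (g (ph y))*enr (adens ph y)*ind B y <= enr C*(enr (g (ph y))*ind B y)"
 using patchD(4)[OF p, of y] B(2) by (auto simp: indicator_def mult.commute intro!: rmon ennreal_leI)
 qed
 have m': "(%y. enr (g (ph y))*enr (adens ph y)*ind B y):bmeas lborel"
 proof -
 have "(%y. enr (ind B y*.(g (ph y)*adens ph y))):bmeas borel"
 using chartD(2)[OF V(1)] BV immD(1,2)[OF chartD(1)[OF V(1)]] by (intro measurable_compose[OF borel_measurable_continuous_on_indicator measurable_ennreal]
 continuous_on_mult continuous_on_compose2[OF g(1) continuous_on_subset[OF cphi BV]] B
 continuous_on_subset[OF cont_adens BV]) auto
 moreover have "(%y. enr (ind B y*.(g (ph y)*adens ph y))) = (%y. enr (g (ph y))*enr (adens ph y)*ind B y)"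
 using pos by (auto simp: indicator_def fun_eq_iff ennreal_mult')
 ultimately show ?thesis by simp
 qed
 show "(NN lborel (%y. (enr (g (ph y)))*ind B y)) <= enr C*enr (LINT x|M. ind (ph ` B) x*g x)"
 unfolding eq nn_integral_cmult[OF m', symmetric]
 proof (rule nn_integral_mono)
 fix y
 show "enr (g (ph y))*ind B y <= enr C*(enr (g (ph y))*enr (adens ph y)*ind B y)"
 proof (cases "y:B")
 case True
 have "1 <= C*adens ph y" using patchD(5)[OF p] True B(2) by blast
 hence "g (ph y)*1 <= g (ph y)*(C*adens ph y)" using pos(1)[OF True] by (rule lmon)
 hence "enr (g (ph y)) <= enr (C*(g (ph y)*adens ph y))" by (intro ennreal_leI) (simp add: mult_ac)
 moreover have "0 < C*adens ph y" using \<open>1 <= C * area_density ph y\<close> by simp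
 hence "0 <= C" using pos(2)[OF True] by (simp add: zero_less_mult_iff)
 ultimately show ?thesis using True pos[OF True] by (simp add: ennreal_mult)
 qed simp
 qed
qed

definition energy :: "(real^'k => real) => real" where
 "energy f = (nm (tg f))^2"

text \<open>The energy on the right is that of all of \<open>Ga\<close> even for a small set, so
  that inequalities on overlapping sets can be chained; the constant \<open>c\<close> may depend on
  \<open>f\<close> and on the slack \<open>e\<close>.\<close>

definition poinc :: "(real^'k) set => bool" where
 "poinc S \<longleftrightarrow> S:sets M & (EX C>=0. ALL f e. smT f --> 0 < e -->
 (EX c. (LINT x|M. ind S x*(f x-c)^2) <= C*(energy f+e)))"

lemma poinc_patch:
 assumes C: "1 <= C" and p: "patch C ph y0 r" shows "poinc (ph ` ball y0 (r/2))"
proof -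
 let ?B = "ball y0 (r/2)"
 have r: "0 < r" by (rule patchD(1)[OF p])
 obtain V where V: "chart V ph" "cball y0 r <= V" using patch_chart[OF p] by blast
 have sub: "cball y0 (r/2) <= cball y0 r" "?B <= cball y0 r" using r by auto
 have S: "ph ` ?B:sets M" using patch_image_sets[OF p _ sub(2)] by (simp add: sets_M_iff)
 have inG: "ph y:Ga" if "y:cball y0 r" for y using that chartD(2)[OF V(1)] V(2) by blast
 have sphi: "smooth_on V ph" by (rule immD(2)[OF chartD(1)[OF V(1)]])
 define K where "K = 16*(r/2)^2*2^CARD('d)"
 have K: "0 <= K" by (simp add: K_def)
 have "EX c. (LINT x|M. ind (ph ` ?B) x*(f x-c)^2) <= (C*K*C^3)*(energy f+e)"
 if f: "smT f" and e: "0 < e" for f e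
 proof -
 define T where "T x = (norm (tg f x))^2" for x
 have T: "cont Ga T" unfolding T_def by (intro continuous_intros cont_tgrad f)
 have ET: "(LINT x|M. ind (ph ` ?B) x*T x) <= energy f"
 unfolding energy_def L2n_power2 T_def[symmetric]
 by (intro integral_mono set_int_continuous[OF T S] cont_int[OF T]) (simp add: T_def indicator_def)
 define H where "H y = C*norm (tg f (ph y))" for y
 have cH: "cont (cball y0 (r/2)) H"
 unfolding H_def using inG sub V by (intro continuous_intros continuous_on_compose2[OF cont_tgrad[OF f] continuous_on_subset[OF sm_cont[OF sphi]]]) auto
 have dH: "((%y. f (ph y)) has_derivative (%v. FD f (ph y) (FD ph y v))) (at y)"
 if "y:cball y0 (r/2)" for y
 by (rule has_derivative_compose[OF sm_der[OF sphi] sm_der[OF f]])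
 (use that sub V inG sub_tb in blast)+
 have bH: "|frechet_derivative f (at (ph y)) (FD ph y v)| <= H y*norm v"
 if y: "y:cball y0 (r/2)" for y v
 proof -
 have yV: "y:V" and yr: "y:cball y0 r" using y sub V by auto
 let ?w = "FD ph y v"
 have "?w:TS (ph y)" using range_chart_der[OF V(1) yV] by blast
 hence "FD f (ph y) ?w = tg f (ph y).*?w"
 by (simp add: tgrad_inner[OF f inG[OF yr]] dcp_tangent[OF inG[OF yr]])
 also have "|...| <= norm (tg f (ph y))*norm ?w" by (rule Cauchy_Schwarz_ineq2)
 also have "... <= norm (tg f (ph y))*(C*norm v)" by (intro lmon patchD(6)[OF p yr]) simp
 finally show ?thesis by (simp add: H_def mult_ac)
 qed
 have "0 < r/2" using r by simp
 from ball_poincare[OF dH bH cH this e, folded K_def]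
 obtain c where c: "(NN lborel (%y. (enr ((f (ph y)-c)^2))*ind ?B y)) <= enr K*((NN lborel (%y. (enr ((H y)^2))*ind ?B y))+enr e)"
 by blast
 have "(NN lborel (%y. (enr ((H y)^2))*ind ?B y)) = (NN lborel (%y. (enr ((%x. C^2*T x) (ph y)))*ind ?B y))"
 by (simp add: H_def T_def power_mult_distrib)
 also have "... <= enr C*enr (LINT x|M. ind (ph ` ?B) x*(C^2*T x))"
 by (rule patch_int(2)[OF p _ sub(2)]) (use continuous_on_mult[OF continuous_on_const T] in \<open>simp_all add: T_def\<close>)
 also have "(LINT x|M. ind (ph ` ?B) x*(C^2*T x)) = C^2*(LINT x|M. ind (ph ` ?B) x*T x)"
 by (simp add: mult.left_commute)
 also have "enr C*enr ... <= enr C*enr (C^2*energy f)"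
 by (intro lmon ennreal_leI ET) auto
 also have "... = enr (C^3*energy f)" using C by (simp add: ennreal_mult'[symmetric] sq2 power3_eq_cube mult_ac)
 finally have HE: "(NN lborel (%y. (enr ((H y)^2))*ind ?B y)) <= enr (C^3*energy f)" .
 have E0: "0 <= energy f" by (simp add: energy_def)
 have "enr (LINT x|M. ind (ph ` ?B) x*(f x-c)^2) <= enr C*(NN lborel (%y. (enr ((f (ph y)-c)^2))*ind ?B y))"
 by (rule patch_int(1)[OF p _ sub(2)]) (use continuous_on_power[OF continuous_on_diff[OF smt_cont[OF f] continuous_on_const]] in simp_all)
 also have "... <= enr C*(enr K*(enr (C^3*energy f)+enr e))"
 by (intro lmon order_trans[OF c] add_mono HE) auto
 also have "... = enr (C*(K*(C^3*energy f+e)))"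
 using C K e E0 by (simp add: ennreal_mult ennreal_plus)
 finally have "(LINT x|M. ind (ph ` ?B) x*(f x-c)^2) <= C*(K*(C^3*energy f+e))"
 using C K e E0 by simp
 also have "... <= C*(K*(C^3*energy f+C^3*e))"
 using C K e one_le_power[OF C, of 3] by (intro lmon add_left_mono) auto
 finally show ?thesis by (auto simp: algebra_simps)
 qed
 thus ?thesis unfolding poinc_def using S C K by (intro conjI exI[of _ "C*K*C^3"]) auto
qed

text \<open>The constants belonging to the two sets are both close to \<open>f\<close> on the
  overlap, which has positive measure, so their difference is controlled by the energy.\<close>

lemma poinc_Un:
 assumes S: "poinc S" and T: "poinc T" and pos: "0 < measure M (S Int T)" shows "poinc (S Un T)"
proof -
 have sets: "S:sets M" "T:sets M" using S T by (auto simp: poinc_def)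
 obtain C where C: "0 <= C" "!!f e. smT f ==> 0 < e ==> EX c. (LINT x|M. ind S x*(f x-c)^2) <= C*(energy f+e)"
 using S by (auto simp: poinc_def)
 obtain D where D: "0 <= D" "!!f e. smT f ==> 0 < e ==> EX c. (LINT x|M. ind T x*(f x-c)^2) <= D*(energy f+e)"
 using T by (auto simp: poinc_def)
 define m where "m = measure M (S Int T)"
 define t where "t = measure M T"
 have m: "0 < m" "0 <= t" using pos by (auto simp: m_def t_def)
 define E where "E = C+2*D+2*t*(2*(C+D)/m)"
 have "EX c. (LINT x|M. ind (S Un T) x*(f x-c)^2) <= E*(energy f+e)" if f: "smT f" and e: "0 < e" for f e
 proof -
 define X where "X = energy f+e"
 obtain c d where c: "(LINT x|M. ind S x*(f x-c)^2) <= C*X" and d: "(LINT x|M. ind T x*(f x-d)^2) <= D*X"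
 using C(2)[OF f e] D(2)[OF f e] unfolding X_def by blast
 have I: "integrable M (%x. ind A x*(f x-c)^2)" if "A:sets M" for A c
 by (intro set_int_continuous continuous_intros smt_cont f that)
 have I1: "integrable M (%x. ind A x*c)" "(LINT x|M. ind A x*c) = measure M A*c" if "A:sets M" for A and c :: real
 using set_int_continuous[OF continuous_on_const that] that sets.sets_into_space[OF that] by auto
 have sq: "(a-b)^2 <= 2*(y-a)^2+2*(y-b)^2" for a b y :: real
 using sum_squares_bound[of "y-a" "- (y-b)"] by (simp add: sq2 algebra_simps)
 have "m*(c-d)^2 = (LINT x|M. ind (S Int T) x*(c-d)^2)" using I1(2)[of "S Int T"] sets by (simp add: m_def)
 also have "... <= (LINT x|M. 2*(ind S x*(f x-c)^2)+2*(ind T x*(f x-d)^2))"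
 using sets sq by (intro integral_mono Bochner_Integration.integrable_add integrable_mult_right I I1) (auto simp: indicator_def)
 also have "... <= 2*(C*X)+2*(D*X)" using I sets c d by simp
 finally have cd: "(c-d)^2 <= 2*(C+D)/m*X" using m(1) by (simp add: field_simps)
 have "(LINT x|M. ind (S Un T) x*(f x-c)^2) <=
 (LINT x|M. ind S x*(f x-c)^2+(2*(ind T x*(f x-d)^2)+ind T x*(2*(c-d)^2)))"
 proof (intro integral_mono Bochner_Integration.integrable_add integrable_mult_right I)
 show "integrable M (%x. ind T x*(2*(c-d)^2))" using sets by (intro I1)
 fix x
 have "(f x-c)^2 <= 2*(f x-d)^2+2*(c-d)^2" using sq[of "f x" c d] by (simp add: power2_commute)
 thus "ind (S Un T) x*(f x-c)^2 <= ind S x*(f x-c)^2+(2*(ind T x*(f x-d)^2)+ind T x*(2*(c-d)^2))"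
 by (auto simp: indicator_def)
 qed (use sets in auto)
 also have "... = (LINT x|M. ind S x*(f x-c)^2)+(2*(LINT x|M. ind T x*(f x-d)^2)+t*(2*(c-d)^2))"
 unfolding t_def I1(2)[OF sets(2), symmetric] using I[OF sets(1)] I[OF sets(2)] I1(1)[OF sets(2)] by (simp only: Bochner_Integration.integral_add Bochner_Integration.integrable_add integrable_mult_right integral_mult_right_zero)
 also have "... <= C*X+(2*(D*X)+t*(2*(2*(C+D)/m*X)))"
 using c d cd m(2) by (intro add_mono lmon) auto
 also have "... = E*X" by (simp add: E_def algebra_simps)
 finally show ?thesis unfolding X_def by blast
 qed
 moreover have "0 <= E" using C(1) D(1) m by (simp add: E_def)
 ultimately show ?thesis unfolding poinc_def using sets by blast
qed

lemma openin_measure_pos: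
 assumes "openin (top_of_set Ga) S" "S ~= {}" shows "0 < measure M S"
proof -
 obtain c where c: "0 < c" "!!y rh. y:Ga ==> 0 < rh ==> rh <= 1 ==> c*rh^CARD('d) <= measure M (Ga Int ball y rh)"
 by (rule measure_ball_ge) blast
 obtain y where y: "y:S" using assms by blast
 obtain T where T: "open T" "S = Ga Int T" using assms(1) by (auto simp: openin_open)
 then obtain rh where "0 < rh" "ball y rh <= T" using y open_contains_ball by blast
 hence rh: "0 < min rh 1" "Ga Int ball y (min rh 1) <= S" using T(2) by auto
 have "0 < c*min rh 1^CARD('d)" using c(1) rh(1) by simp
 also have "... <= measure M (Ga Int ball y (min rh 1))" using y T(2) rh(1) by (intro c(2)) auto
 also have "... <= measure M S"
 using T closed by (intro finite_measure_mono[OF rh(2)]) (auto simp: sets_M_iff)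
 finally show ?thesis .
qed

text \<open>A maximal family of patches whose union satisfies the inequality cannot meet a further
  patch, by \<open>poinc_Un\<close>. Its union and that of the others would separate
  \<open>Ga\<close>.\<close>

lemma poinc_Ga: "poinc Ga"
proof -
 obtain C and I :: "((real^'d => real^'k) \<times> (real^'d) \<times> real) set" where A: "1 <= C" "finite I" "!!ph y0 r. (ph, y0, r):I ==> patch C ph y0 r"
 "Ga = (\<Union>(ph, y0, r)\<in>I. ph ` ball y0 (r/2))" by (rule atlas) blast
 define P where "P = (%(ph, y0 :: real^'d, r). ph ` ball y0 (r/2) :: (real^'k) set)"
 have cover: "Ga = (UN i:I. P i)" using A(4) by (simp add: P_def split_beta)
 have one: "poinc (P i) & openin (top_of_set Ga) (P i) & P i ~= {}" if i: "i:I" for i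
 proof -
 obtain ph y0 r where eq: "i = (ph, y0, r)" by (cases i) auto
 have p: "patch C ph y0 r" using A(3) i eq by blast
 obtain V where V: "chart V ph" "cball y0 r <= V" using patch_chart[OF p] by blast
 have "ball y0 (r/2) <= V" using V(2) patchD(1)[OF p] by auto
 hence "openin (top_of_set Ga) (ph ` ball y0 (r/2))" by (intro chartD(6)[OF V(1)]) auto
 thus ?thesis using poinc_patch[OF A(1) p] patchD(1)[OF p] by (simp add: P_def eq)
 qed
 define F where "F = {J. J <= I & J ~= {} & poinc (\<Union>(P ` J))}"
 have "finite F" by (rule finite_subset[of _ "Pow I"]) (use A(2) in \<open>auto simp: F_def\<close>)
 moreover obtain i0 where "i0:I" using cover nonempty by blast
 hence "{i0}:F" using one by (simp add: F_def)
 ultimately obtain J where J: "J:F" "!!J'. J':F ==> J <= J' ==> J' = J"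
 using finite_has_maximal[of F] by auto
 define U where "U = \<Union>(P ` J)"
 define W where "W = \<Union>(P ` (I-J))"
 have JI: "J <= I" "J ~= {}" "poinc U" using J(1) by (auto simp: F_def U_def)
 have oU: "openin (top_of_set Ga) U" "openin (top_of_set Ga) W"
 unfolding U_def W_def using one JI(1) by (auto intro!: openin_Union)
 have "U Int W = {}"
 proof (rule ccontr)
 assume "U Int W ~= {}"
 then obtain i where i: "i:I" "i ~: J" "U Int P i ~= {}" by (auto simp: W_def)
 have "poinc (U Un P i)"
 using one[OF i(1)] i(3) by (intro poinc_Un JI openin_measure_pos openin_Int oU) auto
 hence "insert i J:F" using i(1) JI(1) by (auto simp: F_def U_def Un_commute)
 thus False using J(2) i(2) by blast
 qed
 moreover have "Ga = U Un W" using cover JI(1) by (auto simp: U_def W_def)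
 moreover have "U ~= {}"
 proof -
 obtain j where "j:J" using JI(2) by blast
 thus ?thesis using JI(1) one[of j] by (auto simp: U_def)
 qed
 ultimately have "W = {}" using connected oU unfolding connected_openin by blast
 thus ?thesis using JI(3) \<open>Ga = U Un W\<close> by simp
qed

text \<open>Among all constants the mean is the best, so a mean free function needs none; this is
  seen by expanding the square. The statement passes from smooth functions to weak gradients by
  mollification, keeping the square of the mean on the right because mollifying may change
  it.\<close>

lemma poincare:
 obtains C where "0 < C" "!!v G. LL v ==> wg v G ==> (LINT x|M. v x) = 0 ==> L2_norm M v <= C*nm G"
proof -
 obtain K where K: "0 <= K" "!!f e. smT f ==> 0 < e ==> EX c. (LINT x|M. ind Ga x*(f x-c)^2) <= K*(energy f+e)"
 using poinc_Ga by (auto simp: poinc_def)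
 define m where "m = measure M Ga"
 have m: "0 < m" using measure_pos by (simp add: m_def)
 have main: "(nm f)^2 <= K*energy f+(LINT x|M. f x)^2/m" if f: "smT f" for f
 proof (rule field_le_epsilon)
 fix e :: real assume e: "0 < e"
 \<comment> \<open>Dividing by K+1 lets the slack contribute at most \<open>e\<close>, also when
   \<open>K\<close> is 0.\<close>
 obtain c where c: "(LINT x|M. ind Ga x*(f x-c)^2) <= K*(energy f+e/(K+1))"
 using K(2)[OF f, of "e/(K+1)"] e K(1) by auto
 have i1: "integrable M f" "integrable M (%x. (f x)^2)"
 by (intro cont_int continuous_intros smt_cont f)+
 have "(LINT x|M. ind Ga x*(f x-c)^2) = (LINT x|M. (f x)^2+c^2-2*c*f x)"
 by (intro icong) (simp add: space_M power2_diff mult_ac)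
 also have "... = (nm f)^2+c^2*m-2*c*(LINT x|M. f x)"
 using i1 by (simp add: L2n_power2 space_M m_def mult.commute)
 finally have "(nm f)^2+c^2*m-2*c*(LINT x|M. f x) <= K*energy f+K*(e/(K+1))"
 using c by (simp add: distrib_left)
 moreover have "K*(e/(K+1)) <= e" using K(1) e by (simp add: field_simps)
 moreover have "0 <= (c*m-(LINT x|M. f x))^2/m" using m by simp
 hence "2*c*(LINT x|M. f x)-c^2*m <= (LINT x|M. f x)^2/m"
 using m by (simp add: sq2 field_simps)
 ultimately show "(nm f)^2 <= K*energy f+(LINT x|M. f x)^2/m+e" by simp
 qed
 show ?thesis
 proof (rule that[of "sqrt (K+1)"])
 show "0 < sqrt (K+1)" using K(1) by simp
 fix v G assume v: "LL v" and G: "wg v G" and 0: "(LINT x|M. v x) = 0"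
 note sm = sm_moll[OF v]
 have "(%n. (nm (moll n v))^2) ----> (nm v)^2"
 by (intro tendsto_power L2n_lim L2_cont smt_cont sm v L2_nullD(2)[OF moll_lim[OF v]])
 moreover have "(%n. K*energy (moll n v)+(LINT x|M. moll n v x)^2/m) ----> K*(nm G)^2+0^2/m"
 unfolding energy_def
 proof (intro tendsto_add tendsto_divide tendsto_mult_left tendsto_power tendsto_const)
 show "(%n. nm (tg (moll n v))) ----> nm G"
 by (rule L2n_lim[OF tgrad_L2[OF sm] weak_grad_L2[OF G] tgrad_moll_lim(1)[OF v G]])
 show "(%n. LINT x|M. moll n v x) ----> 0"
 using L2_inner_lim[OF L2_cont[OF smt_cont[OF sm]] v L2_one L2_nullD(2)[OF moll_lim[OF v]]] 0 by simp
 qed (use m in simp)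
 ultimately have "(nm v)^2 <= K*(nm G)^2+0^2/m"
 using main[OF sm] by (intro LIMSEQ_le) auto
 also have "... <= (sqrt (K+1)*nm G)^2" using K(1) by (simp add: power_mult_distrib rmon)
 finally show "nm v <= sqrt (K+1)*nm G"
 by (rule power2_le_imp_le) (use K(1) L2n_nonneg[of M G] in simp)
 qed
qed

end

section \<open>Weak solutions and their regularity\<close>

definition L2_le :: "'a measure => ('a => real) => real => bool" where
 "L2_le M f c \<longleftrightarrow> L2_fun M f & L2n M f <= c"

lemma L2_le_add: "L2_le M f c ==> L2_le M g d ==> L2_le M (%x. f x+g x) (c+d)"
 unfolding L2_le_def by (auto intro: L2_add order_trans[OF L2n_add])

lemma L2_le_diff: "L2_le M f c ==> L2_le M g d ==> L2_le M (%x. f x-g x) (c+d)"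
 unfolding L2_le_def by (auto intro: L2_diff order_trans[OF L2n_diff])

lemma L2_le_sum:
 assumes "!!i. i:I ==> L2_le M (f i) c"
 shows "L2_le M (%x. SUM i:I. f i x) (real (card I)*c)"
 using assms
proof (induction I rule: infinite_finite_induct)
 case (insert i I)
 thus ?case using L2_le_add[of M "f i" c "%x. SUM i:I. f i x" "real (card I)*c"] by (simp add: distrib_right)
qed (simp_all add: L2_le_def L2_zero L2_norm_def)

lemma L2_le_mono: "L2_le M f c ==> c <= d ==> L2_le M f d"
 by (auto simp: L2_le_def)

lemma L2_le_mult:
 assumes f: "L2_le M f c" and b: "b:bmeas M" "!!x. x:space M ==> |b x| <= B" and B: "0 <= B"
 shows "L2_le M (%x. f x*b x) (B*c)"
proof -
 have m: "(%x. f x*b x):bmeas M" using f b(1) by (auto simp: L2_le_def L2_fun_def)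
 have le: "AE x in M. norm (f x*b x) <= B*norm (f x)" by (intro AE_I2) (simp only: real_norm_def abs_mult_bound b(2))
 have fL: "L2_fun M f" "L2n M f <= c" using f by (auto simp: L2_le_def)
 show ?thesis
 unfolding L2_le_def using L2_bound[OF fL(1) m le] order_trans[OF L2n_bound[OF fL(1) m le B] lmon[OF fL(2) B]] by blast
qed

context submfd
begin

definition lap :: "(real^'k => real) => 'k fn" where
 "lap f x = (SUM i:UNIV. td i (td i f) x)"

definition wsol :: "(real^'k => real) => (real^'k => real^'k) => (real^'k => real) => bool" where
 "wsol ph G g \<longleftrightarrow> LL ph & wg ph G & LL g &
 (ALL f. smT f --> (LINT x|M. G x.*tg f x) = (LINT x|M. g x*f x))"

lemma wsol_test:
 assumes w: "wsol ph G g" and v: "LL v" "wg v H"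
 shows "(LINT x|M. G x.*H x) = (LINT x|M. g x * v x)"
proof -
 have G: "LL G" "LL g" using w by (auto simp: wsol_def weak_surface_grad_def)
 have "(%n. LINT x|M. tg (moll n v) x.*G x) ----> (LINT x|M. H x.*G x)" by (rule tgrad_moll_lim(2)[OF v G(1)])
 moreover have "(LINT x|M. tg (moll n v) x.*G x) = (LINT x|M. moll n v x.*g x)" for n
 using w sm_moll[OF v(1), of n] unfolding wsol_def by (simp add: inner_commute mult.commute)
 moreover have "(%n. LINT x|M. moll n v x.*g x) ----> (LINT x|M. v x.*g x)"
 by (rule L2_inner_lim[OF L2_cont[OF smt_cont[OF sm_moll[OF v(1)]]] v(1) G(2) L2_nullD(2)[OF moll_lim[OF v(1)]]])
 ultimately have "(LINT x|M. H x.*G x) = (LINT x|M. v x.*g x)" by (simp add: LIMSEQ_unique)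
 thus ?thesis by (simp add: inner_commute mult.commute)
qed

lemma tgrad_lincomb:
 assumes f: "smT f" and g: "smT g" and q: "q:tube"
 shows "tg (%x. r*f x+s*g x) q = r*.tg f q+s*.tg g q"
proof -
 have "((%x. r*f x+s*g x) has_derivative (%v. r*frechet_derivative f (at q) v+s*frechet_derivative g (at q) v)) (at q)"
 by (rule has_derivative_add[OF has_derivative_mult_right[OF sm_der[OF f q]] has_derivative_mult_right[OF sm_der[OF g q]]])
 thus ?thesis by (simp add: vec_eq_iff tg_def td_def pdiff_eqI)
qed

lemma tgrad_tfield:
 assumes "smT f" shows "tf (tg f)"
proof -
 have "smT (%x. SUM i:UNIV. td i f x*.(axis i 1 :: real^'k))"
 by (intro sm_sum sm_scaleR sm_td sm_const assms op_tube) simp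
 moreover have "(%x. SUM i:UNIV. td i f x*.axis i 1) = tg f"
 by (simp add: fun_eq_iff tg_def vec_eq_iff axis_def if_distrib cong: if_cong)
 ultimately have "smT (tg f)" by simp
 thus ?thesis
 unfolding smooth_tangent_field_def using op_tube sub_tb tgrad_tangent[OF assms] by (auto simp: tsp_iff)
qed

text \<open>The Riesz sequence is taken in smooth functions with the gradient form, whose kernel is
  the constants; \<open>z\<close> subtracts the mean. By the Poincare inequality the mean free parts
  converge in L2, the limit has a weak gradient by weak compactness, and the equation passes to the
  limit after integration by parts.\<close>

lemma wsol_exists:
 assumes g: "LL g" and g0: "(LINT x|M. g x) = 0"
 obtains ph G where "wsol ph G g" "(LINT x|M. ph x) = 0"
proof -
 obtain C where C: "0 < C" "!!v G. LL v ==> wg v G ==> (LINT x|M. v x) = 0 ==> L2_norm M v <= C*nm G"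
 by (rule poincare) blast
 define m where "m = measure M Ga"
 have m: "0 < m" using measure_pos by (simp add: m_def)
 define z where "z f x = f x-(LINT x|M. f x)/m" for f x
 note sL = L2_cont[OF smt_cont]
 have zs: "smT (z f)" "(LINT x|M. z f x) = 0" "!!x. x:tube ==> tg (z f) x = tg f x" if f: "smT f" for f
 proof -
 show "smT (z f)" unfolding z_def[abs_def] by (intro sm_diff op_tube f sm_const)
 show "(LINT x|M. z f x) = 0" unfolding z_def using L2_int[OF sL[OF f]] m by (simp add: space_M m_def[symmetric])
 show "tg (z f) x = tg f x" if "x:tube" for x
 using tgrad_lincomb[OF f sm_const[where c = "(LINT x|M. f x)/m"] that, of 1 "-1"]
 by (simp add: z_def[abs_def] tg_def[of "%_. _"] tder_const zero_vec_def[symmetric])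
 qed
 have zn: "nm (tg (z f)) = nm (tg f)" if f: "smT f" for f
 unfolding L2_norm_def using zs(3)[OF f] sub_tb by (intro arg_cong[of _ _ sqrt] icong) (auto simp: space_M)
 have P: "nm (z f) <= C*nm (tg f)" if f: "smT f" for f
 using C(2)[OF sL[OF zs(1)[OF f]] wgrad_smooth[OF zs(1)[OF f]] zs(2)[OF f]] zn[OF f] by simp
 let ?S = "Collect (smT) :: (real^'k => real) set"
 let ?B = "%v w. LINT x|M. tg v x.*tg w x"
 have sq: "?B v v = (nm (tg v))^2" for v by (simp add: L2n_power2 power2_norm_eq_inner)
 have "EX v. (ALL n. v n : ?S) &
 (ALL e>0. EX N. ALL m>=N. ALL n>=N. ?B (%x. v m x-v n x) (%x. v m x-v n x) < e) &
 (ALL w:?S. (%n. ?B (v n) w) ----> (LINT x|M. g x*w x))"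
 proof (rule riesz_sequence)
 show "?B (%x. r*.v x+s*.w x) y = r*?B v y+s*?B w y" if "v : ?S" "w : ?S" "y : ?S" for v w y r s
 proof -
 have "?B (%x. r*.v x+s*.w x) y = (LINT x|M. r*(tg v x.*tg y x)+s*(tg w x.*tg y x))"
 using that sub_tb by (intro icong) (auto simp: space_M tgrad_lincomb subset_iff inner_add_left)
 thus ?thesis using that by (simp add: L2_int_inner tgrad_L2)
 qed
 show "(LINT x|M. g x*(r*.v x+s*.w x)) = r*(LINT x|M. g x * v x)+s*(LINT x|M. g x*w x)"
 if "v : ?S" "w : ?S" for v w r s
 proof -
 have "(LINT x|M. g x*(r*.v x+s*.w x)) = (LINT x|M. r*(g x * v x)+s*(g x*w x))" by (simp add: algebra_simps)
 thus ?thesis using that by (simp add: L2_int_mult[OF g] sL)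
 qed
 show "|LINT x|M. g x * v x| <= (nm g*C) * sqrt (?B v v)" if "v : ?S" for v
 proof -
 have v: "smT v" using that by simp
 have "(LINT x|M. g x * v x) = (LINT x|M. g x*z v x)"
 unfolding z_def right_diff_distrib using L2_int_mult[OF g sL[OF v]] L2_int[OF g] g0 by simp
 also have "|...| <= nm g*nm (z v)" by (rule L2_CS_mult[OF g sL[OF zs(1)[OF v]]])
 also have "... <= nm g*(C*nm (tg v))" by (intro lmon P v L2n_nonneg)
 finally show ?thesis by (simp add: sq L2n_nonneg mult.assoc)
 qed
 qed (auto simp: inner_commute sm_const intro!: sm_add[OF op_tube] sm_mult[OF op_tube] sm_const)
 then obtain v where v: "!!n. smT (v n)"
 and cau: "!!e. 0 < e ==> EX N. ALL m>=N. ALL n>=N. (nm (tg (%x. v m x-v n x)))^2 < e"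
 and lim: "!!w. smT w ==> (%n. ?B (v n) w) ----> (LINT x|M. g x*w x)"
 unfolding sq by auto
 have vd: "smT (%x. v m x-v n x)" for m n by (intro sm_diff op_tube v)
 have cau': "EX N. ALL m>=N. ALL n>=N. nm (tg (%x. v m x-v n x)) < e" if "0 < e" for e
 using cau[of "e^2"] that power_less_imp_less_base[of _ 2 e] by auto
 have zd: "z (%x. v m x-v n x) = (%x. z (v m) x-z (v n) x)" for m n
 using L2_int[OF sL[OF v]] by (simp add: fun_eq_iff z_def diff_divide_distrib)
 have "EX ph. LL ph & (%n. nm (%x. z (v n) x-ph x)) ----> 0"
 proof (rule L2_complete)
 fix e :: real assume e: "0 < e"
 obtain N where N: "!!m n. m >= N ==> n >= N ==> L2_norm M (tg (%x. v m x-v n x)) < e/C"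
 using cau'[of "e/C"] e C(1) by auto
 have "nm (%x. z (v m) x-z (v n) x) < e" if "m >= N" "n >= N" for m n
 using P[OF vd[of m n]] N[OF that] C(1) unfolding zd by (simp add: pos_less_divide_eq mult.commute)
 thus "EX N. ALL m>=N. ALL n>=N. nm (%x. z (v m) x-z (v n) x) < e" by blast
 qed (intro sL zs v)
 then obtain ph where ph: "LL ph" "(%n. nm (%x. z (v n) x-ph x)) ----> 0" by blast
 obtain N where N: "!!n. n >= N ==> L2_norm M (tg (%x. v n x-v N x)) < 1" using cau'[of 1] by auto
 have bound: "nm (tg (z (v (n+N)))) <= 1+nm (tg (v N))" for n
 proof -
 have "tg (v (n+N)) x = tg (%x. v (n+N) x-v N x) x+tg (v N) x" if "x:Ga" for x
 using tgrad_lincomb[OF v v, of x 1 "n+N" "-1" N] that sub_tb by auto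
 hence "nm (tg (v (n+N))) = nm (%x. tg (%x. v (n+N) x-v N x) x+tg (v N) x)"
 unfolding L2_norm_def by (intro arg_cong[of _ _ sqrt] icong) (simp add: space_M)
 also have "... <= nm (tg (%x. v (n+N) x-v N x))+nm (tg (v N))"
 by (intro L2n_add tgrad_L2 v vd)
 finally show ?thesis using N[of "n+N"] zn[OF v, of "n+N"] by simp
 qed
 have null: "L2_null M (%n x. z (v (n+N)) x-ph x)"
 unfolding L2_null_def using LIMSEQ_ignore_initial_segment[OF ph(2), of N] by (intro conjI allI L2_diff sL zs(1) v ph(1))
 obtain G where G: "wg ph G"
 using weak_grad_limit[OF sL[OF zs(1)[OF v]] wgrad_smooth[OF zs(1)[OF v]] bound null ph(1)] by blast
 show ?thesis
 proof (rule that)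
 have lim0: "(%n. LINT x|M. z (v n) x*h x) ----> (LINT x|M. ph x*h x)" if h: "LL h" for h
 using L2_inner_lim[OF sL[OF zs(1)[OF v]] ph(1) h ph(2)] by simp
 show "(LINT x|M. ph x) = 0" using lim0[OF L2_one] zs(2)[OF v] by (simp add: LIMSEQ_const_iff)
 have "(LINT x|M. G x.*tg f x) = (LINT x|M. g x*f x)" if f: "smT f" for f
 proof -
 note X = tgrad_tfield[OF f]
 have "(LINT x|M. G x.*tg f x) = - (LINT x|M. ph x * dv (tg f) x)"
 using G X by (simp add: weak_surface_grad_def)
 moreover have "(%n. - (LINT x|M. z (v n) x * dv (tg f) x)) ----> - (LINT x|M. ph x * dv (tg f) x)"
 by (intro tendsto_minus lim0 L2_cont cont_dv X)
 moreover have "- (LINT x|M. z (v n) x * dv (tg f) x) = ?B (v n) f" for n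
 proof -
 have "?B (v n) f = (LINT x|M. tg (z (v n)) x.*tg f x)"
 using zs(3)[OF v] sub_tb by (intro icong) (auto simp: space_M)
 thus ?thesis using int_tgrad[OF zs(1)[OF v] X] by simp
 qed
 ultimately show ?thesis using lim[OF f] by (simp add: LIMSEQ_unique)
 qed
 thus "wsol ph G g" using ph(1) G g by (simp add: wsol_def)
 qed
qed

text \<open>Two integrations by parts exchange the indices and turn squared second derivatives into
  the squared Laplacian. The frame derivatives do not commute, but their commutators are first
  order, so the errors are products of the gradient norm and the Hessian norm \<open>S\<close>, and
  \<open>S\<close> is absorbed at the end.\<close>

lemma hessian_bound:
 obtains C where "0 <= C" "!!v. smT v ==>
 (SUM i:UNIV. SUM j:UNIV. (nm (td i (td j v)))^2) <= C*((nm (lap v))^2+(nm (tg v))^2)"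
proof -
 obtain Z where Z: "!!i j q. q:Ga ==> Z i j q:TS q" "!!i j. cont Ga (Z i j)"
 "!!i j f q. smT f ==> q:Ga ==> td i (td j f) q-td j (td i f) q = FD f q (Z i j q)"
 by (rule tder_commutator) blast
 obtain z1 where z1: "0 <= z1" "!!p q. q:Ga ==> norm (Z (fst p) (snd p) q) <= z1"
 by (rule finite_uniform_bound[OF compact, of "%p. Z (fst p) (snd p)"]) (use Z(2) in auto)
 obtain z2 where z2: "0 <= z2" "!!i q. q:Ga ==> norm (kap i q) <= z2" by (rule finite_uniform_bound[where f = kap, OF compact cont_kap]) blast
 define z where "z = z1+z2"
 have z: "0 <= z" "!!i j q. q:Ga ==> norm (Z i j q) <= z" "!!i q. q:Ga ==> |kap i q| <= z"
 using z1 z2 z1(2)[of _ "(_, _)"] by (auto simp: z_def add_increasing add_increasing2)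
 define c where "c = real CARD('k)*(real CARD('k)*(4*z))"
 have c: "0 <= c" using z by (simp add: c_def)
 show ?thesis
 proof (rule that[of "2+c^2"])
 fix v :: "'k fn" assume v: "smT v"
 define N where "N = (SUM i:UNIV. SUM j:UNIV. (nm (td i (td j v)))^2)"
 define S where "S = sqrt N"
 have N: "0 <= N" unfolding N_def by (intro sum_nonneg) simp
 have S: "0 <= S" "S^2 = N" using N by (auto simp: S_def)
 let ?g = "nm (tg v)"
 note sm = sm_td
 note cm = smt_cont[OF sm] and sL = L2_cont[OF smt_cont]
 have hS: "nm (td i (td j v)) <= S" for i j
 proof -
 have "(nm (td i (td j v)))^2 <= (SUM j:UNIV. (nm (td i (td j v)))^2)" by (rule member_le_sum) auto
 also have "... <= N" unfolding N_def by (rule member_le_sum) (auto intro: sum_nonneg)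
 finally show ?thesis unfolding S_def by (rule real_le_rsqrt)
 qed
 have gS: "nm (tg (td j v)) <= S" for j
 proof -
 have "(nm (tg (td j v)))^2 = (SUM i:UNIV. (nm (td i (td j v)))^2)"
 using L2n_vec[OF tgrad_L2[OF sm[OF v]]] by (simp add: tg_def)
 also have "... <= N" unfolding N_def by (intro sum_mono member_le_sum) auto
 finally show ?thesis unfolding S_def by (rule real_le_rsqrt)
 qed
 have dg: "nm (td j v) <= ?g" for j
 proof (rule power2_le_imp_le)
 show "(nm (td j v))^2 <= ?g^2"
 unfolding L2n_vec[OF tgrad_L2[OF v]] by (simp add: tg_def) (rule member_le_sum, auto)
 qed (rule L2n_nonneg)
 define R where "R f i j q = td i (td j f) q-td j (td i f) q" for f i j q
 have cR: "cont Ga (R f i j)" if "smT f" for f i j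
 unfolding R_def by (intro continuous_intros smt_cont sm that)
 have RZ: "nm (R f i j) <= z*nm (tg f)" if f: "smT f" for f i j
 proof (rule L2n_bound[OF tgrad_L2[OF f] cont_meas[OF cR[OF f]] AE_I2 z(1)])
 fix q assume "q:space M"
 hence q: "q:Ga" by (simp add: space_M)
 have "R f i j q = tg f q.*Z i j q"
 unfolding R_def Z(3)[OF f q] using tgrad_inner[OF f q, of "Z i j q"] dcp_tangent[OF q Z(1)[OF q]] by simp
 hence "norm (R f i j q) <= norm (tg f q)*norm (Z i j q)" by (simp add: Cauchy_Schwarz_ineq2)
 also have "... <= z*norm (tg f q)" using lmon[OF z(2)[OF q], of "norm (tg f q)" i j] by (simp add: mult.commute)
 finally show "norm (R f i j q) <= z*norm (tg f q)" .
 qed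
 have kL: "LL (%q. kap i q*f q)" "nm (%q. kap i q*f q) <= z*nm f" if "LL f" for i f
 proof -
 show "LL (%q. kap i q*f q)" by (rule L2_kap[OF that])
 show "nm (%q. kap i q*f q) <= z*nm f"
 by (rule L2n_bound[OF that L2_funD(1)[OF L2_kap[OF that]] AE_I2 z(1)]) (simp add: abs_mult space_M rmon z(3))
 qed
 have CS: "|LINT q|M. f q*h q| <= z*?g*S"
 if "LL f" "LL h" "nm f <= a" "nm h <= b" "a*b = z*?g*S" "0 <= a" for f h a b
 using order_trans[OF L2_CS_mult[OF that(1,2)] mult_mono[OF that(3,4,6) L2n_nonneg]] that(5) by simp
 \<comment> \<open>Four remainders of size \<open>z*?g*S\<close>: the commutator of the two
   derivatives of \<open>v\<close>, the one with \<open>td i v\<close> in place of \<open>v\<close>,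
   and a curvature term from each integration by parts.\<close>
 have est: "(nm (td i (td j v)))^2 <= (LINT q|M. td j (td j v) q*td i (td i v) q)+4*z*?g*S" for i j
 proof -
 let ?a = "td j v" and ?b = "td i v"
 have I: "integrable M (%q. f q*h q)" if "cont Ga f" "cont Ga h" for f h :: "'k fn"
 by (intro cont_int continuous_intros that)
 have 1: "(nm (td i ?a))^2 = (LINT q|M. td i ?a q*td j ?b q+td i ?a q*R v i j q)"
 unfolding L2n_power2 by (intro icong) (simp add: R_def sq2 algebra_simps)
 have 2: "(LINT q|M. td i ?a q*td j ?b q) = - (LINT q|M. ?a q*td i (td j ?b) q+kap i q*?a q*td j ?b q)"
 by (rule int_tder[OF sm[OF v] sm[OF sm[OF v]]])
 have 3: "(LINT q|M. td j ?a q*td i ?b q) = - (LINT q|M. ?a q*td j (td i ?b) q+kap j q*?a q*td i ?b q)"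
 by (rule int_tder[OF sm[OF v] sm[OF sm[OF v]]])
 have 4: "(LINT q|M. ?a q*td i (td j ?b) q+kap i q*?a q*td j ?b q) =
 (LINT q|M. ?a q*td j (td i ?b) q)+(LINT q|M. ?a q*R ?b i j q)+(LINT q|M. (kap i q*?a q)*td j ?b q)"
 proof -
 have "(LINT q|M. ?a q*td i (td j ?b) q+kap i q*?a q*td j ?b q) =
 (LINT q|M. ?a q*td j (td i ?b) q+?a q*R ?b i j q+(kap i q*?a q)*td j ?b q)"
 by (intro icong) (simp add: R_def algebra_simps)
 thus ?thesis by (simp add: I cR sm v smt_cont cont_kap continuous_on_mult)
 qed
 have 5: "(LINT q|M. ?a q*td j (td i ?b) q+kap j q*?a q*td i ?b q) =
 (LINT q|M. ?a q*td j (td i ?b) q)+(LINT q|M. (kap j q*?a q)*td i ?b q)"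
 by (simp add: I sm v smt_cont cont_kap continuous_on_mult)
 have 6: "(LINT q|M. td i ?a q*td j ?b q+td i ?a q*R v i j q) = (LINT q|M. td i ?a q*td j ?b q)+(LINT q|M. td i ?a q*R v i j q)"
 by (simp add: I cR sm v smt_cont)
 have r1: "|LINT q|M. td i ?a q*R v i j q| <= z*?g*S"
 by (rule CS[OF sL[OF sm[OF sm[OF v]]] L2_cont[OF cR[OF v]] hS RZ[OF v]]) (use S in simp_all)
 have r2: "|LINT q|M. ?a q*R ?b i j q| <= z*?g*S"
 by (rule CS[OF sL[OF sm[OF v]] L2_cont[OF cR[OF sm[OF v]]] dg order_trans[OF RZ[OF sm[OF v]] lmon[OF gS z(1)]]])
 (use L2n_nonneg in simp_all)
 have kg: "nm (%q. kap l q*?a q) <= z*?g" for l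
 using order_trans[OF kL(2)[OF sL[OF sm[OF v]]] lmon[OF dg z(1)]] .
 have r3: "|LINT q|M. (kap l q*?a q)*td m ?b q| <= z*?g*S" for l m
 by (rule CS[OF kL(1)[OF sL[OF sm[OF v]]] sL[OF sm[OF sm[OF v]]] kg hS]) (simp_all add: z(1) L2n_nonneg)
 show ?thesis using 1 2 3 4 5 6 r1 r2 r3[of i j] r3[of j i] by linarith
 qed
 have "N <= (SUM i:UNIV. SUM j:UNIV. (LINT q|M. td j (td j v) q*td i (td i v) q)+4*z*?g*S)"
 unfolding N_def by (intro sum_mono est)
 also have "... = (SUM i:UNIV. SUM j:UNIV. LINT q|M. td j (td j v) q*td i (td i v) q)+c*?g*S"
 by (simp add: sum.distrib c_def)
 also have "(SUM i:UNIV. SUM j:UNIV. LINT q|M. td j (td j v) q*td i (td i v) q) = (LINT q|M. (lap v q)^2)"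
 by (subst Bochner_Integration.integral_sum[symmetric], intro integrable_sum cont_int continuous_intros cm sm v,
 subst Bochner_Integration.integral_sum[symmetric]) (auto simp: lap_def sq2 sum_product mult.commute
 intro!: cont_int continuous_on_mult cm sm v Bochner_Integration.integral_cong Bochner_Integration.integrable_sum)
 also have "... = (nm (lap v))^2" by (simp add: L2n_power2)
 finally have "N <= (nm (lap v))^2+c*?g*S" .
 moreover have "2*(c*?g*S) <= (c*?g)^2+N" using sum_squares_bound[of "c*?g" S] S(2) by simp
 ultimately have "N <= 2*(nm (lap v))^2+c^2*?g^2" by (simp add: power_mult_distrib)
 also have "... <= (2+c^2)*((nm (lap v))^2+?g^2)" by (simp add: algebra_simps)
 finally show "(SUM i:UNIV. SUM j:UNIV. (nm (td i (td j v)))^2) <= (2+c^2)*((nm (lap v))^2+?g^2)"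
 by (simp add: N_def)
 qed simp
qed

end

section \<open>The Laplacian of mollified weak solutions and H2 regularity\<close>

context submfd
begin

lemma L2_le_multG:
 assumes "L2_le M f c" "b:bmeas M" "!!x. x:Ga ==> |b x| <= B" "0 <= B"
 shows "L2_le M (%x. f x*b x) (B*c)"
 by (rule L2_le_mult) (use assms in \<open>auto simp: space_M\<close>)

text \<open>The function on which the kernel acts after one derivative has been moved across by
  \<open>tder_op\<close>. Its companion \<open>uu\<close>, with \<open>kap2\<close>, collects the
  lower order rest of a second such step.\<close>

definition ww :: "(real^'k => real) => (real^'k => real^'k) => 'k => 'k fn" where
 "ww ph G i y = G y $ i+kap i y*ph y"

definition kap2 :: "'k => 'k fn" where
 "kap2 i y = td i (kap i) y+kap i y*kap i y"

definition uu :: "(real^'k => real) => (real^'k => real^'k) => 'k => 'k fn" where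
 "uu ph G i y = kap i y*(G y $ i)+kap2 i y*ph y"

lemma sm_kap2: "smT (kap2 i)"
 unfolding kap2_def[abs_def] by (intro sm_add sm_mult sm_td sm_kap op_tube)

lemma wsolD:
 assumes "wsol ph G g"
 shows "LL ph" "wg ph G" "LL g" "LL (%y. G y $ i)" "LL (ww ph G i)" "LL (uu ph G i)"
proof -
 show *: "LL ph" "wg ph G" "LL g" using assms by (auto simp: wsol_def)
 thus G: "LL (%y. G y $ i)" by (intro L2_nth weak_grad_L2)
 show "LL (ww ph G i)" "LL (uu ph G i)" unfolding ww_def[abs_def] uu_def[abs_def]
 by (intro L2_add L2_kap L2_cont_mult[OF smt_cont[OF sm_kap2]] * G)+
qed

text \<open>No second derivative of \<open>ph\<close> is required: the terms with a derivative of
  the kernel paired with \<open>G\<close> sum to the pairing of \<open>G\<close> with the gradient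
  of the slice \<open>k (q, y)\<close> in \<open>y\<close>, which the weak equation replaces by an
  integral of \<open>g\<close>.\<close>

lemma lap_op:
 assumes w: "wsol ph G g" and k: "smooth_on tube2 k" and q: "q:Ga"
 shows "lap (op k ph) q = (SUM i:UNIV. op (lk i (lk i k)) ph q+2 * op (lk i k) (ww ph G i) q + op k (uu ph G i) q)-op k g q"
proof -
 note W = wsolD[OF w]
 have qt: "q:tube" using q sub_tb by auto
 let ?k = "%y. k (q, y)"
 note sk = sm_slice(1)[OF k qt] and so = sm_op[OF _ L2_int]
 have dL: "LL (%y. td i ?k y)" "LL (%y. ?k y*kap i y)" for i
 by (intro L2_cont smt_cont sm_td sm_mult op_tube sm_kap sk)+
 have one: "td i (td i (op k ph)) q = op (lk i (lk i k)) ph q+2 * op (lk i k) (ww ph G i) q + op k (uu ph G i) q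
 - (LINT y|M. td i ?k y*(G y $ i))" for i
 proof -
 have wi: "op k (%y. G y $ i+kap i y*ph y) = op k (ww ph G i)" by (simp add: ww_def[abs_def])
 have "td i (td i (op k ph)) q = td i (%x. op (lk i k) ph x + op k (ww ph G i) x) q"
 using tder_op[OF k W(1,2), of _ i] sub_tb wi q by (intro tder_cong sm_td sm_add op_tube so sm_lk k W) auto
 also have "... = td i (op (lk i k) ph) q+td i (op k (ww ph G i)) q"
 by (intro tder_add so sm_lk k W qt)
 also have "td i (op (lk i k) ph) q = op (lk i (lk i k)) ph q + op (lk i k) (ww ph G i) q"
 using tder_op[OF sm_lk[OF k] W(1,2) qt, of i i] by (simp add: ww_def[abs_def])
 also have "td i (op k (ww ph G i)) q = op (lk i k) (ww ph G i) q-(LINT y|M. td i ?k y*ww ph G i y)"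
 by (rule tder_op_split[OF k W(5) qt])
 also have "(LINT y|M. td i ?k y*ww ph G i y) = (LINT y|M. td i ?k y*(G y $ i))+(LINT y|M. (td i ?k y*kap i y)*ph y)"
 proof -
 have "integrable M (%y. (td i ?k y*kap i y)*ph y)"
 by (intro L2_int_mult W L2_cont smt_cont sm_mult sm_td op_tube sm_kap sk)
 thus ?thesis using L2_int_mult[OF dL(1) W(4)] by (simp add: ww_def distrib_left mult.assoc)
 qed
 also have "(LINT y|M. (td i ?k y*kap i y)*ph y) = - op k (uu ph G i) q"
 proof -
 have sm: "smT (%y. ?k y*kap i y)" by (intro sm_mult sm_kap op_tube sk)
 have "(LINT y|M. (?k y*kap i y)*(G y $ i)) = - (LINT y|M. (td i (%y. ?k y*kap i y) y+(?k y*kap i y)*kap i y)*ph y)"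
 by (rule weak_grad_comp[OF W(2) sm])
 also have "(LINT y|M. (td i (%y. ?k y*kap i y) y+(?k y*kap i y)*kap i y)*ph y) =
 (LINT y|M. (td i ?k y*kap i y)*ph y+?k y*(kap2 i y*ph y))"
 proof (intro icong)
 fix y assume "y:space M"
 hence "y:tube" using sub_tb by (auto simp: space_M)
 thus "(td i (%y. ?k y*kap i y) y+(?k y*kap i y)*kap i y)*ph y = (td i ?k y*kap i y)*ph y+?k y*(kap2 i y*ph y)"
 by (subst tder_mult[OF sk sm_kap]) (simp_all add: kap2_def algebra_simps)
 qed
 also have "... = (LINT y|M. (td i ?k y*kap i y)*ph y)+(LINT y|M. ?k y*(kap2 i y*ph y))"
 by (intro Bochner_Integration.integral_add L2_int_mult W L2_cont_mult[OF smt_cont[OF sm_kap2]]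
 L2_cont smt_cont sm_mult sm_td op_tube sm_kap sk)
 moreover have "op k (uu ph G i) q = (LINT y|M. (?k y*kap i y)*(G y $ i))+(LINT y|M. ?k y*(kap2 i y*ph y))"
 unfolding op_def uu_def distrib_left mult.assoc[symmetric, of "k _" "kap _ _"]
 by (intro Bochner_Integration.integral_add L2_int_mult W dL L2_cont_mult[OF smt_cont[OF sm_kap2]]
 L2_cont smt_cont sk)
 ultimately show ?thesis by simp
 qed
 finally show ?thesis by simp
 qed
 have "(SUM i:UNIV. LINT y|M. td i ?k y*(G y $ i)) = (LINT y|M. G y.*tg ?k y)"
 using L2_int_mult[OF dL(1) W(4)] by (subst Bochner_Integration.integral_sum[symmetric]) (auto simp: inner_vec_def tg_def mult.commute)
 also have "... = op k g q" using w sk unfolding wsol_def op_def by (simp add: mult.commute)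
 finally show ?thesis by (simp add: lap_def one sum_subtractf)
qed

lemma lap_mult:
 assumes f: "smT f" and g: "smT g" and q: "q:Ga"
 shows "lap (%x. f x*g x) q = f q*lap g q+2*(SUM i:UNIV. td i f q*td i g q)+lap f q*g q"
proof -
 have qt: "q:tube" using q sub_tb by auto
 note s = f g sm_td[OF f] sm_td[OF g]
 have "td i (td i (%x. f x*g x)) q = f q*td i (td i g) q+2*(td i f q*td i g q)+td i (td i f) q*g q" for i
 proof -
 have "td i (td i (%x. f x*g x)) q = td i (%x. f x*td i g x+td i f x*g x) q"
 using tder_mult[OF f g] sub_tb q by (intro tder_cong sm_td sm_add sm_mult op_tube s) auto
 also have "... = td i (%x. f x*td i g x) q+td i (%x. td i f x*g x) q"
 by (intro tder_add sm_mult op_tube s qt)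
 finally show ?thesis by (simp add: tder_mult s qt)
 qed
 thus ?thesis by (simp add: lap_def sum.distrib sum_distrib_left sum_distrib_right)
qed

text \<open>The unnormalised average is the mollification times the mass. Its Laplacian is known
  from \<open>lap_op\<close>, and solving the product rule for the Laplacian of the mollification
  leaves only uniformly bounded operators on \<open>ph\<close>, \<open>G\<close> and
  \<open>g\<close>.\<close>

lemma moll_bounds:
 obtains C where "0 <= C" "!!ph G g n. wsol ph G g ==>
 nm (lap (moll n ph)) <= C*(nm ph+nm G+nm g)"
 "!!ph G g n i. wsol ph G g ==> L2_norm M (td i (moll n ph)) <= C*(nm ph+nm G+nm g)"
proof -
 obtain B where B: "0 <= B" "!!n i x. x:Ga ==> |gder n i x| <= B"
 and b0: "!!n h. LL h ==> LL (gopk n (K0 n) h) & nm (gopk n (K0 n) h) <= B*nm h"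
 and b1: "!!n i h. LL h ==> LL (gopk n (lk i (K0 n)) h) & nm (gopk n (lk i (K0 n)) h) <= B*nm h"
 and b2: "!!n i j h. LL h ==> LL (gopk n (lk j (lk i (K0 n))) h) & nm (gopk n (lk j (lk i (K0 n))) h) <= B*nm h"
 and p: "!!n i j x. x:Ga ==> |gopk n (lk j (lk i (K0 n))) (%_. 1) x| <= B"
 "!!n i x h b. x:Ga ==> continuous_on Ga h ==> (!!y. y:Ga ==> |h y| <= b) ==> |gopk n (K0 n) h x| <= B*b"
 "!!n i x h b. x:Ga ==> continuous_on Ga h ==> (!!y. y:Ga ==> |h y| <= b) ==> |gopk n (lk i (K0 n)) h x| <= B*b"
 by (rule mollifier_bounds) blast
 obtain k1 k2 where k12: "0 <= k1" "0 <= k2" "!!i y. y:Ga ==> norm (kap i y) <= k1" "!!i y. y:Ga ==> norm (kap2 i y) <= k2"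
 using finite_uniform_bound[where f = kap, OF compact cont_kap] finite_uniform_bound[where f = kap2, OF compact smt_cont[OF sm_kap2]] by metis
 define ka where "ka = k1+k2"
 have ka: "0 <= ka" "!!i y. y:Ga ==> |kap i y| <= ka" "!!i y. y:Ga ==> |kap2 i y| <= ka"
 using k12 by (auto simp: ka_def add_increasing add_increasing2)
 define k where "k = real CARD('k)"
 define C1 where "C1 = B*(1+ka)+B+B*B"
 define C2 where "C2 = k*(B+(B*(1+ka)+B*(1+ka))+B*(ka+ka))+B"
 define P where "P = k*(B+2*(B*ka)+B*ka)"
 define C where "C = C1+(C2+P*B+2*(k*(B*C1)))"
 have k: "0 <= k" by (simp add: k_def)
 have pos: "0 <= C1" "0 <= C2" "0 <= P" using B(1) ka(1) k by (auto simp: C1_def C2_def P_def)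
 have C: "0 <= C" "C1 <= C" "C2+P*B+2*(k*(B*C1)) <= C" using pos B(1) k by (auto simp: C_def)
 have main: "nm (lap (moll n ph)) <= C*(nm ph+nm G+nm g) &
 nm (td i (moll n ph)) <= C*(nm ph+nm G+nm g)" if w: "wsol ph G g" for ph G g n i
 proof -
 note W = wsolD[OF w]
 define X where "X = nm ph+nm G+nm g"
 have nn: "0 <= nm ph" "0 <= nm G" "0 <= nm g" by (rule L2n_nonneg)+
 have X: "0 <= X" "nm ph <= X" "nm G <= X" "nm g <= X" using nn by (auto simp: X_def)
 have phiX: "L2_le M ph X" "L2_le M g X" using W X by (auto simp: L2_le_def)
 have GX: "L2_le M (%y. G y $ i) X" for i
 proof -
 have "nm (%y. G y $ i) <= 1*nm G"
 by (rule L2n_bound[OF weak_grad_L2[OF W(2)] L2_funD(1)[OF W(4)] AE_I2]) (simp_all add: component_le_norm_cart)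
 thus ?thesis using W(4)[of i] X by (simp add: L2_le_def)
 qed
 have mk: "kap i:bmeas M" "kap2 i:bmeas M" for i
 by (intro cont_meas smt_cont sm_kap sm_kap2)+
 have wX: "L2_le M (ww ph G i) ((1+ka)*X)" for i
 using L2_le_add[OF GX L2_le_multG[OF phiX(1) mk(1) ka(2) ka(1)], of i i] by (simp add: ww_def[abs_def] mult.commute distrib_left)
 have uX: "L2_le M (uu ph G i) (ka*X+ka*X)" for i
 using L2_le_add[OF L2_le_multG[OF GX mk(1) ka(2) ka(1)] L2_le_multG[OF phiX(1) mk(2) ka(3) ka(1)], of i i i] by (simp add: uu_def[abs_def] mult.commute distrib_left)
 have op: "L2_le M (gopk n (K0 n) h) (B*c)" "L2_le M (gopk n (lk i (K0 n)) h) (B*c)" "L2_le M (gopk n (lk j (lk i (K0 n))) h) (B*c)"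
 if "L2_le M h c" for h c i j
 using that b0[of h n] b1[of h n i] b2[of h n j i] B(1) lmon[of "nm h" c B] by (auto simp: L2_le_def)
 have mollX: "L2_le M (moll n ph) (B*X)" unfolding moll_gop by (rule op(1)[OF phiX(1)])
 have gm: "gder n i:bmeas M" for i
 unfolding gder_def[abs_def] by (intro borel_measurable_divide cont_meas smt_cont sm_td sm_gmass)
 have cong: "L2_le M f c" if "L2_le M h c" "!!x. x:Ga ==> f x = h x" for f h c
 proof -
 have "f:bmeas M" using that by (subst measurable_cong[of _ f h]) (auto simp: space_M L2_le_def L2_fun_def)
 moreover have "integrable M (%x. (norm (f x))^2) \<longleftrightarrow> integrable M (%x. (norm (h x))^2)" "(LINT x|M. (norm (f x))^2) = (LINT x|M. (norm (h x))^2)"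
 using that(2) by (auto simp: space_M intro!: Bochner_Integration.integrable_cong Bochner_Integration.integral_cong)
 ultimately show ?thesis using that(1) by (simp add: L2_le_def L2_fun_def L2_norm_def)
 qed
 have t: "L2_le M (td i (moll n ph)) (C1*X)" for i
 proof (rule cong)
 show "L2_le M (%x. gopk n (lk i (K0 n)) ph x+gopk n (K0 n) (ww ph G i) x-moll n ph x*gder n i x) (C1*X)"
 by (rule L2_le_mono[OF L2_le_diff[OF L2_le_add[OF op(2)[OF phiX(1)] op(1)[OF wX]] L2_le_multG[OF mollX gm B(2) B(1)]]])
 (assumption, simp add: C1_def algebra_simps)
 show "td i (moll n ph) x = gopk n (lk i (K0 n)) ph x+gopk n (K0 n) (ww ph G i) x-moll n ph x*gder n i x" if "x:Ga" for x
 using tder_moll[OF W(1,2) that] by (simp only: ww_def[abs_def])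
 qed
 define L1 where "L1 x = (SUM i:UNIV. gopk n (lk i (lk i (K0 n))) ph x+(gopk n (lk i (K0 n)) (ww ph G i) x+gopk n (lk i (K0 n)) (ww ph G i) x)
 + gopk n (K0 n) (uu ph G i) x)-gopk n (K0 n) g x" for x
 define L2 where "L2 x = (SUM i:UNIV. gopk n (lk i (lk i (K0 n))) (%_. 1) x+2*gopk n (lk i (K0 n)) (kap i) x+gopk n (K0 n) (kap2 i) x)" for x
 \<comment> \<open>The constant 1 is a weak solution with right side 0, so \<open>lap_op\<close>
   also yields the Laplacian of the mass.\<close>
 have w1: "wsol (%_. 1) (%_. 0) (%_. 0)" using L2_one wgrad_const by (simp add: wsol_def L2_zero)
 let ?ga = "gms (real (Suc n))"
 have lap1: "lap (op (K0 n) ph) x/?ga x = L1 x" "lap ?ga x/?ga x = L2 x" if x: "x:Ga" for x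
 proof -
 show "lap (op (K0 n) ph) x/?ga x = L1 x"
 unfolding lap_op[OF w sm_gk x] L1_def gopk_op by (simp add: diff_divide_distrib add_divide_distrib sum_divide_distrib del: of_nat_Suc)
 show "lap ?ga x/?ga x = L2 x"
 unfolding L2_def gopk_op using lap_op[OF w1 sm_gk x] by (simp add: gmass_op[symmetric] ww_def[abs_def] uu_def[abs_def] op_def[of _ "%_. 0"] add_divide_distrib sum_divide_distrib del: of_nat_Suc)
 qed
 have L2b: "|L2 x| <= P" if x: "x:Ga" for x
 proof -
 have "|L2 x| <= (SUM i:UNIV. |gopk n (lk i (lk i (K0 n))) (%_. 1) x+2*gopk n (lk i (K0 n)) (kap i) x+gopk n (K0 n) (kap2 i) x| )"
 unfolding L2_def by simp
 also have "... <= (SUM i:(UNIV :: 'k set). B+2*(B*ka)+B*ka)"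
 proof (rule sum_mono)
 fix i
 show "|gopk n (lk i (lk i (K0 n))) (%_. 1) x+2*gopk n (lk i (K0 n)) (kap i) x+gopk n (K0 n) (kap2 i) x| <= B+2*(B*ka)+B*ka"
 using p(1)[OF x, of n i i] p(3)[OF x cont_kap ka(2), of n i i] p(2)[OF x smt_cont[OF sm_kap2] ka(3), of n i] by simp
 qed
 finally show ?thesis by (simp add: P_def k_def)
 qed
 have L2m: "L2:bmeas M"
 proof (subst measurable_cong)
 show "(%x. lap ?ga x/?ga x):bmeas M"
 unfolding lap_def by (intro borel_measurable_divide borel_measurable_sum cont_meas smt_cont sm_td sm_gmass)
 qed (simp add: lap1 space_M del: of_nat_Suc)
 have lap: "L2_le M (lap (moll n ph)) ((C2+P*B+2*(k*(B*C1)))*X)"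
 proof (rule cong)
 have "L2_le M L1 (k*(B*X+(B*((1+ka)*X)+B*((1+ka)*X))+B*(ka*X+ka*X))+B*X)"
 unfolding L1_def[abs_def] k_def by (intro L2_le_diff L2_le_sum L2_le_add op phiX wX uX)
 hence 1: "L2_le M L1 (C2*X)" by (rule L2_le_mono) (simp add: C2_def algebra_simps)
 have 2: "L2_le M (%x. moll n ph x*L2 x) (P*(B*X))" by (rule L2_le_multG[OF mollX L2m L2b pos(3)])
 have 3: "L2_le M (%x. SUM i:UNIV. td i (moll n ph) x*gder n i x) (k*(B*(C1*X)))"
 unfolding k_def by (intro L2_le_sum L2_le_multG t gm B(2) B(1))
 show "L2_le M (%x. L1 x-moll n ph x*L2 x-((SUM i:UNIV. td i (moll n ph) x*gder n i x)+(SUM i:UNIV. td i (moll n ph) x*gder n i x))) ((C2+P*B+2*(k*(B*C1)))*X)"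
 by (rule L2_le_mono[OF L2_le_diff[OF L2_le_diff[OF 1 2] L2_le_add[OF 3 3]]]) (simp add: algebra_simps)
 fix x assume x: "x:Ga"
 have xt: "x:tube" using x sub_tb by auto
 have g0: "?ga x ~= 0" using gmass_pos'[of "real (Suc n)" x] by simp
 have "lap (op (K0 n) ph) x = lap (%x. moll n ph x*?ga x) x"
 proof -
 have "op (K0 n) ph = (%x. moll n ph x*?ga x)"
 using gmass_pos' by (simp add: fun_eq_iff moll_def less_imp_neq[symmetric] del: of_nat_Suc)
 thus ?thesis by simp
 qed
 also have "... = moll n ph x*lap ?ga x+2*(SUM i:UNIV. td i (moll n ph) x*td i ?ga x)+lap (moll n ph) x*?ga x"
 by (rule lap_mult[OF sm_moll[OF W(1)] sm_gmass x])
 finally have "lap (op (K0 n) ph) x/?ga x = moll n ph x*(lap ?ga x/?ga x)+2*((SUM i:UNIV. td i (moll n ph) x*td i ?ga x)/?ga x)+lap (moll n ph) x"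
 using g0 by (simp add: add_divide_distrib del: of_nat_Suc)
 moreover have "(SUM i:UNIV. td i (moll n ph) x*td i ?ga x)/?ga x = (SUM i:UNIV. td i (moll n ph) x*gder n i x)"
 by (simp add: sum_divide_distrib gder_def del: of_nat_Suc)
 ultimately show "lap (moll n ph) x = L1 x-moll n ph x*L2 x-((SUM i:UNIV. td i (moll n ph) x*gder n i x)+(SUM i:UNIV. td i (moll n ph) x*gder n i x))"
 unfolding lap1[OF x] by simp
 qed
 show ?thesis
 using t[of i] lap rmon[OF C(2) X(1)] rmon[OF C(3) X(1)] by (auto simp: L2_le_def X_def[symmetric])
 qed
 show ?thesis by (rule that[of C]) (use C(1) main in blast)+
qed

text \<open>Mollifications have second derivatives bounded by the data, through the Laplacian and
  \<open>hessian_bound\<close>. Their first derivatives converge to the components of the weak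
  gradient, which therefore have weak gradients with the same bound.\<close>

lemma regularity:
 obtains C where "0 < C" "!!ph g. wsol ph (sgr ph) g ==> (LINT x|M. ph x) = 0 ==>
 ph:HB & nB ph <= C*nm g"
proof -
 obtain P where P: "0 < P" "!!v G. LL v ==> wg v G ==> (LINT x|M. v x) = 0 ==> L2_norm M v <= P*nm G"
 by (rule poincare) blast
 obtain H where H: "0 <= H" "!!v. smT v ==>
 (SUM i:UNIV. SUM j:UNIV. (nm (td i (td j v)))^2) <= H*((nm (lap v))^2+(nm (tg v))^2)"
 by (rule hessian_bound) blast
 obtain B where B: "0 <= B" "!!ph G g n. wsol ph G g ==> L2_norm M (lap (moll n ph)) <= B*(nm ph+nm G+nm g)"
 "!!ph G g n i. wsol ph G g ==> L2_norm M (td i (moll n ph)) <= B*(nm ph+nm G+nm g)"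
 by (rule moll_bounds) blast
 define k where "k = real CARD('k)"
 \<comment> \<open>The three summands bound the norms of the solution, of its gradient and of
   \<open>g\<close> by multiples of the norm of \<open>g\<close>.\<close>
 define D where "D = P*P+P+1"
 define E where "E = H*(1+k)*(B*D)^2"
 have D: "0 < D" using P(1) by (simp add: D_def add_pos_pos)
 have E: "0 <= E" using H(1) by (simp add: E_def k_def)
 define C where "C = sqrt (D^2+D^2+k*E)"
 have C: "0 < C" "C^2 = D^2+D^2+k*E" using D E by (auto simp: C_def k_def add_pos_nonneg)
 have "ph:HB & nB ph <= C*nm g" if w: "wsol ph (sgr ph) g" and 0: "(LINT x|M. ph x) = 0" for ph g
 proof -
 let ?G = "sgr ph"
 note W = wsolD[OF w]
 let ?g = "nm g"
 have gn: "nm ?G <= P*?g"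
 proof -
 have "(nm ?G)^2 = (LINT x|M. g x*ph x)" using wsol_test[OF w W(1,2)] by (simp add: L2n_power2 power2_norm_eq_inner)
 also have "... <= ?g*nm ph" using L2_CS_mult[OF W(3,1)] by simp
 also have "... <= ?g*(P*nm ?G)" by (intro lmon P(2) W 0 L2n_nonneg)
 finally have "nm ?G*nm ?G <= (P*?g)*nm ?G" by (simp add: sq2 mult_ac)
 thus ?thesis using L2n_nonneg[of M ?G] L2n_nonneg[of M g] P(1) by (cases "nm ?G = 0") auto
 qed
 have pn: "nm ph <= P*(P*?g)" using P(2)[OF W(1,2) 0] lmon[OF gn, of P] P(1) by linarith
 have X: "nm ph+nm ?G+nm g <= D*?g" using gn pn by (simp add: D_def algebra_simps)
 have b1: "nm (lap (moll n ph)) <= B*D*?g" "nm (td i (moll n ph)) <= B*D*?g" for n i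
 using B(2)[OF w, of n] B(3)[OF w, of i n] lmon[OF X B(1)] by auto
 have hb: "(nm (tg (td j (moll n ph))))^2 <= E*?g^2" for n j
 proof -
 note sm = sm_moll[OF W(1), of n]
 have "(nm (tg (td j (moll n ph))))^2 = (SUM i:UNIV. (nm (td i (td j (moll n ph))))^2)"
 using L2n_vec[OF tgrad_L2[OF sm_td[OF sm]]] by (simp add: tg_def)
 also have "... <= (SUM i:UNIV. SUM j:UNIV. (nm (td i (td j (moll n ph))))^2)"
 by (intro sum_mono member_le_sum) auto
 also have "... <= H*((nm (lap (moll n ph)))^2+(nm (tg (moll n ph)))^2)" by (rule H(2)[OF sm])
 also have "... <= H*((B*D*?g)^2+k*(B*D*?g)^2)"
 proof (intro lmon add_mono H(1))
 show "(nm (lap (moll n ph)))^2 <= (B*D*?g)^2" by (intro power_mono b1 L2n_nonneg)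
 have "(nm (tg (moll n ph)))^2 = (SUM i:UNIV. (nm (td i (moll n ph)))^2)"
 using L2n_vec[OF tgrad_L2[OF sm]] by (simp add: tg_def)
 also have "... <= (SUM i:(UNIV :: 'k set). (B*D*?g)^2)" by (intro sum_mono power_mono b1 L2n_nonneg)
 finally show "(nm (tg (moll n ph)))^2 <= k*(B*D*?g)^2" by (simp add: k_def)
 qed
 also have "... = E*?g^2" by (simp add: E_def algebra_simps)
 finally show ?thesis .
 qed
 have Gj: "EX Hj. wg (%q. ?G q $ j) Hj & nm Hj <= sqrt E*?g" for j
 proof -
 have le: "nm (tg (td j (moll n ph))) <= sqrt E*?g" for n
 using real_le_rsqrt[OF hb[of j n]] L2n_nonneg[of M g] by (simp add: real_sqrt_mult)
 note sm = sm_td[OF sm_moll[OF W(1)]]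
 show ?thesis
 using weak_grad_limit[OF L2_cont[OF smt_cont[OF sm]] wgrad_smooth[OF sm] le tder_moll_lim[OF W(1,2)] W(4)] by blast
 qed
 have phi2: "ph:HB" unfolding H2_def using H1I[OF W(1,2)] H1I[OF W(4)] Gj by blast
 have Hn: "(nm (sgr (%q. ?G q $ j)))^2 <= E*?g^2" for j
 proof -
 obtain Hj where Hj: "wg (%q. ?G q $ j) Hj" "nm Hj <= sqrt E*?g" using Gj by blast
 have "(nm Hj)^2 <= (sqrt E*?g)^2" by (intro power_mono Hj(2) L2n_nonneg)
 thus ?thesis unfolding L2n_sgrad[OF W(4) Hj(1)] using E by (simp add: power_mult_distrib)
 qed
 have "nB ph <= C*?g"
 proof (rule power2_le_imp_le)
 have DD: "nm ph <= D*?g" "nm ?G <= D*?g"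
 using X L2n_nonneg[of M ph] L2n_nonneg[of M ?G] L2n_nonneg[of M g] by auto
 have "(nB ph)^2 = (nm ph)^2+(nm ?G)^2+(SUM j:UNIV. (nm (sgr (%q. ?G q $ j)))^2)"
 unfolding H2_norm_def by (rule real_sqrt_pow2) (simp add: sum_nonneg)
 also have "... <= (D*?g)^2+(D*?g)^2+(SUM j:(UNIV :: 'k set). E*?g^2)"
 by (intro add_mono power_mono sum_mono Hn DD L2n_nonneg)
 also have "... = (C*?g)^2" by (simp add: C(2) k_def algebra_simps)
 finally show "(nB ph)^2 <= (C*?g)^2" .
 show "0 <= C*?g" using C(1) L2n_nonneg[of M g] by simp
 qed
 thus ?thesis using phi2 by blast
 qed
 thus ?thesis using that C(1) by blast
qed

lemma poisson_wsol:
 assumes "poisson_solution sg Ga g u" "LL g" shows "wsol u (sgr u) g"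
proof -
 have u: "u:HA" and t: "!!v. v:HA ==> Dir u v = (LINT q|M. g q * v q)"
 using assms(1) by (auto simp: poisson_solution_def H2_def)
 have "(LINT x|M. sgr u x.*tg f x) = (LINT x|M. g x*f x)" if f: "smT f" for f
 using t[OF smooth_H1[OF f]] dirichlet_form_eq[OF H1_L2[OF u] sgrad_weak[OF u] L2_cont[OF smt_cont[OF f]] wgrad_smooth[OF f]] by simp
 thus ?thesis using H1_L2[OF u] sgrad_weak[OF u] assms(2) by (simp add: wsol_def)
qed

text \<open>Existence is for the dual problem. The estimate holds for every solution, so it also
  bounds the given \<open>u\<close> by \<open>f\<close>.\<close>

lemma poisson_solvable:
 obtains C where "0 < C" "!!g. LL g ==> (LINT x|M. g x) = 0 ==> EX ph. poisson_solution sg Ga g ph"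
 "!!g u. LL g ==> poisson_solution sg Ga g u ==> nB u <= C*nm g"
proof -
 obtain C where C: "0 < C" "!!ph g. wsol ph (sgr ph) g ==> (LINT x|M. ph x) = 0 ==>
 ph:HB & nB ph <= C*nm g" by (rule regularity) blast
 show ?thesis
 proof (rule that[OF C(1)])
 fix g :: "'k fn" assume g: "LL g" and g0: "(LINT x|M. g x) = 0"
 obtain ph G where w: "wsol ph G g" "(LINT x|M. ph x) = 0" using wsol_exists[OF g g0] by blast
 note W = wsolD[OF w(1)]
 have d: "Dir ph v = (LINT q|M. g q * v q)" if v: "v:HA" for v
 using dirichlet_form_eq[OF W(1,2) H1_L2[OF v] sgrad_weak[OF v]] wsol_test[OF w(1) H1_L2[OF v] sgrad_weak[OF v]] by simp
 have "(LINT x|M. sgr ph x.*tg f x) = (LINT x|M. g x*f x)" if f: "smT f" for f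
 using d[OF smooth_H1[OF f]] dirichlet_form_eq[OF W(1) sgrad_weak[OF H1I[OF W(1,2)]] L2_cont[OF smt_cont[OF f]] wgrad_smooth[OF f]] by simp
 hence "wsol ph (sgr ph) g" using W(1) sgrad_weak[OF H1I[OF W(1,2)]] g by (simp add: wsol_def)
 hence "poisson_solution sg Ga g ph" using C(2) w(2) d by (simp add: poisson_solution_def)
 thus "EX ph. poisson_solution sg Ga g ph" by blast
 next
 fix g u :: "'k fn" assume "LL g" "poisson_solution sg Ga g u"
 thus "nB u <= C*nm g" using C(2)[OF poisson_wsol] by (simp add: poisson_solution_def)
 qed
qed

end

section \<open>Lipschitz functions and lifted finite elements\<close>

text \<open>The pieces are arbitrary closed sets, not intervals. From \<open>a\<close> one jumps to
  the last point \<open>t\<close> of a piece containing \<open>a\<close>; what lies beyond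
  \<open>t\<close> is covered by the other pieces, and closedness returns \<open>t\<close> itself to
  them.\<close>

lemma lip_pieces:
 fixes g :: "real => real"
 assumes I: "finite I" and cl: "!!i. i:I ==> closed (F i)" and cov: "{a..b} <= (UN i:I. F i)" and ab: "a <= b"
 and L: "0 <= L" "!!i s t. i:I ==> s:F i ==> t:F i ==> s:{a..b} ==> t:{a..b} ==> |g s-g t| <= L * |s-t|"
 shows "|g a-g b| <= L*(b-a)"
 using assms
proof (induction "card I" arbitrary: I a)
 case 0
 thus ?case by auto
next
 case (Suc n)
 obtain i where i: "i:I" "a:F i" using Suc.prems(3,4) by force
 have c: "compact (F i Int {a..b})" using Suc.prems(2)[OF i(1)] by auto
 have ne: "F i Int {a..b} ~= {}" using i(2) Suc.prems(4) by auto
 obtain t where t: "t:F i" "t:{a..b}" "!!s. s:F i ==> s:{a..b} ==> s <= t"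
 using compact_attains_sup[OF c ne] by blast
 have 1: "|g a-g t| <= L*(t-a)" using Suc.prems(6)[OF i(1,2) t(1)] t(2) by auto
 show ?case
 proof (cases "t = b")
 case True thus ?thesis using 1 by simp
 next
 case False
 hence tb: "t < b" using t(2) by simp
 let ?J = "I - {i}"
 have cJ: "closed (UN j:?J. F j)" using Suc.prems(1,2) by auto
 have "{t<..b} <= (UN j:?J. F j)"
 proof
 fix s assume s: "s:{t<..b}"
 hence "s:{a..b}" using t(2) by auto
 then obtain j where "j:I" "s:F j" using Suc.prems(3) by blast
 thus "s:(UN j:?J. F j)" using t(3)[of s] s \<open>s : {a..b}\<close> by auto
 qed
 hence "closure {t<..b} <= (UN j:?J. F j)" using cJ by (rule closure_minimal)
 hence cov': "{t..b} <= (UN j:?J. F j)" using tb by simp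
 have "|g t-g b| <= L*(b-t)"
 by (rule Suc.hyps(1)[of ?J, OF _ _ _ cov' _ L(1)]) (use Suc.hyps(2) Suc.prems(1,2,6) i(1) tb t(2) in auto)
 thus ?thesis using 1 by (simp add: algebra_simps)
 qed
qed

context submfd
begin

lemma frame_le_1:
 assumes "q:Ga" shows "norm (fr i q) <= 1"
 using dcp_norm_le[OF assms, of "axis i 1"] by (simp add: fr_def norm_axis_1)

text \<open>Derivatives of the mollifications are bounded uniformly, and weak compactness does the
  rest. The one-sided derivative of the kernel, of size mu |x-y|, meets an increment of size L
  |x-y|, and \<open>gauss_absorb\<close> takes care of the product.\<close>

lemma lip_H1:
 assumes L: "0 < L" "!!x y. x:Ga ==> y:Ga ==> |v x-v y| <= L*dist x y"
 shows "v:HA"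
proof -
 have cv: "cont Ga v"
 using L by (intro lipschitz_on_continuous_on[of L] lipschitz_onI) (auto simp: dist_real_def)
 have vL: "LL v" by (rule L2_cont[OF cv])
 obtain B where B: "0 <= B" "!!n i x. x:Ga ==> |gder n i x| <= B"
 "!!n i x h b. x:Ga ==> continuous_on Ga h ==> (!!y. y:Ga ==> |h y| <= b) ==> |gopk n (K0 n) h x| <= B*b"
 "!!n i x h b. x:Ga ==> continuous_on Ga h ==> (!!y. y:Ga ==> |h y| <= b) ==> |gopk n (lk i (K0 n)) h x| <= B*b"
 by (rule mollifier_bounds) blast
 obtain b where b: "!!y. y:Ga ==> |v y| <= b" using cont_bdd[OF cv] by auto
 define C where "C = B*(2*b)+32*L*rt+B*(2*b)*B"
 have der: "|td i (moll n v) x| <= C" if x: "x:Ga" for i n x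
 proof -
 define mu where "mu = real (Suc n)"
 have mu: "1 <= mu" by (simp add: mu_def)
 have xt: "x:tube" using x sub_tb by auto
 have g0: "0 < gms mu x" by (rule gmass_pos')
 \<comment> \<open>With \<open>x\<close> fixed, subtracting \<open>v x\<close> changes the
   mollification by a constant only and makes the integrand small near \<open>x\<close>.\<close>
 define h where "h y = v y-v x" for y
 have ch: "cont Ga h" unfolding h_def by (intro continuous_intros cv)
 have hL: "LL h" by (rule L2_cont[OF ch])
 have hb: "|h y| <= 2*b" if "y:Ga" for y using b[OF that] b[OF x] by (simp add: h_def abs_le_iff)
 have opE: "op (K0 n) h y = op (K0 n) v y-v x*gms mu y" if "y:tube" for y
 using op_int[OF sm_gk that vL, of mu] op_int[OF sm_gk that L2_one, of mu] by (simp add: op_def h_def gmass_op left_diff_distrib right_diff_distrib mu_def[symmetric] mult.commute del: of_nat_Suc)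
 have mh: "moll n h y = moll n v y+(- v x)" if "y:tube" for y
 using opE[OF that] gmass_pos'[of mu y] by (simp add: moll_def mu_def[symmetric] diff_divide_distrib del: of_nat_Suc)
 have "td i (moll n v) x = td i (moll n h) x"
 proof -
 have "td i (moll n h) x = td i (%y. moll n v y+(- v x)) x"
 using mh sub_tb x by (intro tder_cong sm_moll sm_add sm_const op_tube hL vL) auto
 thus ?thesis using tder_add[OF sm_moll[OF vL] sm_const xt, of i n "- v x"] by (simp add: tder_const)
 qed
 also have "... = td i (op (K0 n) h) x/gms mu x-moll n h x*gder n i x"
 using tder_moll_mult[OF hL xt, of i n] g0 by (simp add: gder_def mu_def[symmetric] field_simps del: of_nat_Suc)
 also have "td i (op (K0 n) h) x = op (lk i (K0 n)) h x-(LINT y|M. td i (%y. K0 n (x, y)) y*h y)"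
 by (rule tder_op_split[OF sm_gk hL xt])
 finally have eq: "td i (moll n v) x = gopk n (lk i (K0 n)) h x-(LINT y|M. td i (%y. K0 n (x, y)) y*h y)/gms mu x-moll n h x*gder n i x"
 by (simp only: gopk_op mu_def diff_divide_distrib)
 have "|LINT y|M. td i (%y. K0 n (x, y)) y*h y| <= (LINT y|M. |td i (%y. K0 n (x, y)) y*h y| )" by simp
 also have "... <= (LINT y|M. 32*L*gs (mu/2) x y)"
 proof (rule integral_mono)
 show "integrable M (%y. |td i (%y. K0 n (x, y)) y*h y| )"
 by (intro integrable_abs L2_int_mult hL L2_cont smt_cont sm_td sm_slice(1)[OF sm_gk xt])
 show "integrable M (%y. 32*L*gs (mu/2) x y)" by (intro integrable_mult_right gauss_int)
 fix y assume "y:space M"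
 hence y: "y:Ga" by (simp add: space_M)
 have "((%y. exp (- mu*((x-y).*(x-y)))) has_derivative (%w. exp (- mu*((x-y).*(x-y)))*(2*mu*((x-y).*w)))) (at y)"
 by (auto intro!: derivative_eq_intros simp: inner_commute algebra_simps)
 hence "td i (%y. K0 n (x, y)) y = gs mu x y*(2*mu*((x-y).*fr i y))"
 unfolding td_def gk_def gs_def mu_def[symmetric] by (intro pdiff_eqI) (simp add: dist_norm power2_norm_eq_inner)
 hence "|td i (%y. K0 n (x, y)) y*h y| = gs mu x y*(2*mu*( |(x-y).*fr i y| * |h y| ))"
 using gauss_pos[of mu x y] mu by (simp add: abs_mult)
 also have "... <= gs mu x y*(2*mu*(dist x y*(L*dist x y)))"
 proof (intro lmon mult_mono)
 show "|(x-y).*fr i y| <= dist x y"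
 using Cauchy_Schwarz_ineq2[of "x-y" "fr i y"] lmon[OF frame_le_1[OF y, of i], of "norm (x-y)"] by (simp add: dist_norm)
 show "|h y| <= L*dist x y" using L(2)[OF y x] by (simp add: h_def dist_commute)
 qed (use mu less_imp_le[OF gauss_pos] in auto)
 also have "... = 2*L*(mu*(dist x y)^2*gs mu x y)" by (simp add: sq2)
 also have "... <= 2*L*(16*gs (mu/2) x y)" using L(1) mu by (intro lmon gauss_absorb(1)) auto
 finally show "|td i (%y. K0 n (x, y)) y*h y| <= 32*L*gs (mu/2) x y" by simp
 qed
 also have "... = 32*L*gms (mu/2) x" by (simp add: gms_def)
 also have "... <= 32*L*(rt*gms mu x)" using L(1) by (intro lmon rt(3)[OF x mu]) auto
 finally have "|(LINT y|M. td i (%y. K0 n (x, y)) y*h y)/gms mu x| <= 32*L*rt"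
 using g0 by (simp add: pos_divide_le_eq)
 moreover have "|gopk n (lk i (K0 n)) h x| <= B*(2*b)" by (rule B(4)[OF x ch hb])
 moreover have "|moll n h x*gder n i x| <= B*(2*b)*B"
 unfolding abs_mult moll_gop using B(1) B(2)[OF x] B(3)[OF x ch hb] order_trans[OF abs_ge_zero hb[OF x]] by (intro mult_mono) auto
 ultimately show ?thesis unfolding eq C_def by linarith
 qed
 obtain y0 where "y0:Ga" using nonempty by blast
 from der[OF this] have C: "0 <= C" using abs_ge_zero order_trans by blast
 have bound: "nm (tg (moll n v)) <= |real CARD('k)*C| * sqrt (measure M (space M))" for n
 proof (rule L2_bounded(2)[OF cont_meas[OF cont_tgrad[OF sm_moll[OF vL]]] AE_I2])
 fix x assume "x:space M"
 hence x: "x:Ga" by (simp add: space_M)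
 have "norm (tg (moll n v) x) <= (SUM i:UNIV. |tg (moll n v) x $ i| )" by (rule norm_le_l1_cart)
 also have "... <= (SUM i:(UNIV :: 'k set). C)" using der[OF x] by (intro sum_mono) (simp add: tg_def)
 finally show "norm (tg (moll n v) x) <= real CARD('k)*C" by simp
 qed
 show ?thesis
 using weak_grad_limit[OF L2_cont[OF smt_cont[OF sm_moll[OF vL]]] wgrad_smooth[OF sm_moll[OF vL]]
 bound moll_lim[OF vL] vL] H1I[OF vL] by blast
qed

end

section \<open>Comparison of the discrete and the smooth manifold\<close>

lemma orth_proj_eqI:
 assumes S: "subspace S" and y: "y:S" "!!z. z:S ==> orthogonal (x-y) z" shows "orth_proj S x = y"
 unfolding orth_proj_def
proof (rule the_equality)
 fix y' assume y': "y':S & (ALL z:S. orthogonal (x-y') z)"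
 have "y-y':S" using y(1) y' by (simp add: subspace_diff[OF S])
 hence "orthogonal (x-y) (y-y')" "orthogonal (x-y') (y-y')" using y y' by auto
 hence "(y-y').*(y-y') = 0" by (simp add: orthogonal_def inner_diff_left)
 thus "y' = y" by simp
qed (use y in auto)

lemma lin_orth_proj:
 assumes S: "subspace S" shows "linear (orth_proj S)"
proof -
 have ex: "orth_proj S x:S & (ALL z:S. orthogonal (x-orth_proj S x) z)" for x
 proof -
 obtain y z where yz: "y:span S" "!!w. w:span S ==> orthogonal z w" "x = y+z"
 by (rule orthogonal_subspace_decomp_exists[of S x]) blast
 have "span S = S" using S by simp
 note yz' = yz[unfolded this]
 have y: "y:S" "!!w. w:S ==> orthogonal (x-y) w" using yz'(1,2) by (simp_all add: yz'(3))
 hence "orth_proj S x = y" by (rule orth_proj_eqI[OF S])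
 thus ?thesis using y by simp
 qed
 show ?thesis
 proof (rule linearI)
 fix x y
 show "orth_proj S (x+y) = orth_proj S x + orth_proj S y"
 using ex[of x] ex[of y] by (intro orth_proj_eqI S subspace_add[OF S]) (auto simp: orthogonal_def algebra_simps)
 show "orth_proj S (r*.x) = r*.orth_proj S x" for r
 using ex[of x] by (intro orth_proj_eqI S subspace_scale[OF S]) (auto simp: orthogonal_def simp flip: scaleR_diff_right)
 qed
qed

lemma simplex_parallel:
 fixes K :: "(real^'k) set"
 assumes K: "int CARD('d::finite) simplex K"
 obtains x0 and U :: "real^'d => real^'k" where "subspace (parallel_space K)" "linear U" "!!z. norm (U z) = norm z"
 "range U = parallel_space K" "x0:K" "!!x. x:K ==> EX z. x = x0+U z"
proof -
 have ad: "aff_dim K = int CARD('d)" by (rule aff_dim_simplex[OF K])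
 hence "K ~= {}" by auto
 then obtain x0 where x0: "x0:K" by blast
 have x0h: "x0:affine hull K" using x0 by (rule hull_inc)
 let ?A = "(%x. x-x0) ` (affine hull K)"
 have sA: "subspace ?A" by (rule affine_diffs_subspace_subtract[OF affine_affine_hull x0h])
 have PA: "parallel_space K = ?A"
 proof
 show "parallel_space K <= ?A"
 proof
 fix w assume "w:parallel_space K"
 then obtain x y where xy: "x:affine hull K" "y:affine hull K" "w = x-y" by (auto simp: parallel_space_def)
 thus "w : ?A" using subspace_diff[OF sA, of "x-x0" "y-x0"] by simp
 qed
 qed (use x0h in \<open>auto simp: parallel_space_def\<close>)
 have "dim ?A = CARD('d)" using aff_dim_subspace[OF sA] ad by (simp add: aff_dim_translation_eq_subtract)
 hence "dim (UNIV :: (real^'d) set) = dim ?A" by simp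
 then obtain U :: "real^'d => real^'k" and g :: "real^'k => real^'d" where U: "linear U" "U ` UNIV = ?A" "!!x. x:UNIV ==> norm (U x) = norm x"
 using isometries_subspaces[OF subspace_UNIV sA] by metis
 show ?thesis
 proof (rule that[of U x0])
 fix x assume "x:K"
 hence "x-x0:range U" unfolding U(2) by (simp add: hull_inc)
 then obtain z where "U z = x-x0" by auto
 thus "EX z. x = x0+U z" by (intro exI[of _ z]) simp
 qed (use U PA sA x0 in auto)
qed

context submfd
begin

text \<open>What \<open>discrete_manifold\<close> says about a single simplex. Neither size nor
  shape of \<open>K\<close> enters.\<close>

definition flat :: "real => real => (real^'k) set => bool" where
 "flat C h K \<longleftrightarrow> int CARD('d) simplex K & K <= tube & (ALL x:K. infdist x Ga <= C*h^2) &
 (ALL x:K. onorm (%w. tangent_proj Ga (cp x) w-orth_proj (parallel_space K) w) <= C*h)"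

lemma dcp_lip:
 obtains e L where "0 < e" "0 < L" "!!x w. dist x (cp x) <= e ==> norm (dcp x w-dcp (cp x) w) <= L*dist x (cp x)*norm w"
proof -
 have "EX e L. 0 < e & 0 < L & (ALL q:Ga. cball q e <= tube & (ALL x:cball q e. norm (fr i x-fr i q) <= L*dist x q))" for i
 proof -
 obtain e L where eL: "0 < e" "0 < L" "!!q. q:Ga ==> cball q e <= tube"
 "!!q x y. q:Ga ==> x:cball q e ==> y:cball q e ==> norm (fr i x-fr i y) <= L*dist x y"
 by (rule smooth_lip_local[OF sm_fr[of i]]) blast
 have "norm (fr i x-fr i q) <= L*dist x q" if "q:Ga" "x:cball q e" for q x
 using eL(4)[OF that, of q] eL(1) by simp
 thus ?thesis using eL(1-3) by blast
 qed
 then obtain e L where eL: "!!i. 0 < e i" "!!i. 0 < L i" "!!i q. q:Ga ==> cball q (e i) <= tube"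
 "!!i q x. q:Ga ==> x:cball q (e i) ==> norm (fr i x-fr i q) <= L i*dist x q" by metis
 obtain e0 where e0: "0 < e0" "!!i. e0 <= e i" using positive_lower_bound[of e] eL(1) by metis
 show ?thesis
 proof (rule that[OF e0(1), of "SUM i:UNIV. L i"])
 show "0 < (SUM i:UNIV. L i)" by (intro sum_pos eL(2)) auto
 fix x w assume x: "dist x (cp x) <= e0"
 have xe: "x:cball (cp x) (e i)" for i using x e0(2)[of i] by (simp add: dist_commute)
 have t: "x:tube" "cp x:tube" using xe eL(3)[OF cp_in] cp_in sub_tb by blast+
 have "dcp x w-dcp (cp x) w = (SUM i:UNIV. (w $ i)*.(fr i x-fr i (cp x)))"
 by (simp add: dcp_expand t scaleR_diff_right sum_subtractf)
 also have "norm ... <= (SUM i:UNIV. norm w*(L i*dist x (cp x)))"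
 proof (intro order_trans[OF norm_sum] sum_mono)
 fix i
 show "norm ((w $ i)*.(fr i x-fr i (cp x))) <= norm w*(L i*dist x (cp x))"
 unfolding norm_scaleR using component_le_norm_cart[of w i] eL(4)[OF cp_in xe] by (intro mult_mono) auto
 qed
 finally show "norm (dcp x w-dcp (cp x) w) <= (SUM i:UNIV. L i)*dist x (cp x)*norm w"
 by (simp add: sum_distrib_left sum_distrib_right mult_ac)
 qed
qed

lemma dist_cp: "dist x (cp x) <= infdist x Ga"
 using infdist_attains_inf[OF closed nonempty, of x] cp_le by metis

text \<open>Planes that are O(h) apart distort lengths only to order h^2: at p(x) the derivative of
  p is an orthogonal projection P, and the defect of w.w' is the product of w - P w and w' - P w',
  two factors of order h. Passing from p(x) to x costs another O(h^2), since the distance is of that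
  order.\<close>

lemma flat_der:
 assumes C: "0 < C" and ka: "0 < ka"
 obtains h0 D where "0 < h0" "0 <= D" "!!h K x w. 0 < h ==> h <= h0 ==> flat C h K ==> x:K ==> w:parallel_space K ==> norm (dcp x w-w) <= ka*norm w"
 "!!h K x w w'. 0 < h ==> h <= h0 ==> flat C h K ==> x:K ==> w:parallel_space K ==> w':parallel_space K ==>
 |dcp x w.*dcp x w'-w.*w'| <= D*h^2*(norm w*norm w')"
proof -
 obtain e L where eL: "0 < e" "0 < L" "!!x w. dist x (cp x) <= e ==> norm (dcp x w-dcp (cp x) w) <= L*dist x (cp x)*norm w"
 by (rule dcp_lip) blast
 define h0 where "h0 = min 1 (min (e/C) (ka/(L*C+C)))"
 have LC: "0 < L*C+C" using eL(2) C by (simp add: add_pos_pos)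
 have h0: "0 < h0" using eL(1) C ka LC by (simp add: h0_def)
 define D where "D = C^2+(2*(L*C)+(L*C)^2)"
 have basic: "norm (dcp x w-dcp (cp x) w) <= L*C*h^2*norm w & norm (dcp (cp x) w-w) <= C*h*norm w & h <= 1 & L*C*h^2+C*h <= ka"
 if h: "0 < h" "h <= h0" and K: "flat C h K" and x: "x:K" and w: "w:parallel_space K" for h K x w
 proof -
 have hb: "h <= 1" "h <= e/C" "h <= ka/(L*C+C)" using h(2) by (auto simp: h0_def)
 hence hh: "h^2 <= h" "C*h <= e" "(L*C+C)*h <= ka" using h(1) C LC by (auto simp: sq2 mult_left_le pos_le_divide_eq mult.commute)
 have d: "dist x (cp x) <= C*h^2" using dist_cp[of x] K x by (auto simp: flat_def)
 hence "dist x (cp x) <= e" using hh lmon[OF hh(1), of C] C by linarith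
 hence 1: "norm (dcp x w-dcp (cp x) w) <= L*dist x (cp x)*norm w" by (rule eL(3))
 have "L*dist x (cp x)*norm w <= L*(C*h^2)*norm w" using d eL(2) by (intro rmon lmon) auto
 with 1 have 1: "norm (dcp x w-dcp (cp x) w) <= L*C*h^2*norm w" by simp
 obtain x0 and U :: "real^'d => real^'k" where sP: "subspace (parallel_space K)" using simplex_parallel[where ?'d = 'd, of K] K by (auto simp: flat_def)
 have "linear (%w. tangent_proj Ga (cp x) w-orth_proj (parallel_space K) w)"
 unfolding tangent_proj_eq[OF cp_in] using cp_in sub_tb by (intro linear_compose_sub lin_dcp lin_orth_proj sP) auto
 hence "norm (tangent_proj Ga (cp x) w-orth_proj (parallel_space K) w) <=
 onorm (%w. tangent_proj Ga (cp x) w-orth_proj (parallel_space K) w)*norm w"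
 by (intro onorm linear_conv_bounded_linear[THEN iffD1])
 also have "... <= C*h*norm w" using K x by (intro rmon) (auto simp: flat_def)
 also have "orth_proj (parallel_space K) w = w" by (rule orth_proj_eqI[OF sP w]) (simp add: orthogonal_def)
 finally have 2: "norm (dcp (cp x) w-w) <= C*h*norm w" by (simp add: tangent_proj_eq[OF cp_in])
 have "L*C*h^2+C*h <= ka"
 using hh(3) lmon[OF hh(1), of "L*C"] mult_pos_pos[OF eL(2) C] by (simp add: distrib_right)
 thus ?thesis using 1 2 hb(1) by blast
 qed
 show ?thesis
 proof (rule that[OF h0, of D])
 show "0 <= D" using eL(2) C by (simp add: D_def)
 fix h K x w assume h: "0 < h" "h <= h0" and K: "flat C h K" and x: "x:K" and w: "w:parallel_space K"
 note b = basic[OF h K x w]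
 have "norm (dcp x w-w) <= (L*C*h^2+C*h)*norm w"
 using b norm_triangle_ineq[of "dcp x w-dcp (cp x) w" "dcp (cp x) w-w"] by (simp add: distrib_right)
 also have "... <= ka*norm w" using b by (intro rmon) auto
 finally show "norm (dcp x w-w) <= ka*norm w" .
 fix w' assume w': "w':parallel_space K"
 note b' = basic[OF h K x w']
 have q: "cp x:Ga" by (rule cp_in)
 define p p' r r' where "p = dcp (cp x) w" and "p' = dcp (cp x) w'" and "r = dcp x w-p" and "r' = dcp x w'-p'"
 define a where "a = L*C*h^2"
 have a0: "0 <= a" using eL(2) C by (simp add: a_def)
 have pw: "norm p <= norm w" "norm p' <= norm w'" unfolding p_def p'_def by (rule dcp_norm_le[OF q])+
 have rw: "norm r <= a*norm w" "norm r' <= a*norm w'" using b b' by (auto simp: r_def r'_def p_def p'_def a_def)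
 have "p.*p' = w.*p'" "p.*p' = p.*w'"
 unfolding p_def p'_def using dcp_sym[OF q, of w "dcp (cp x) w'"] dcp_sym[OF q, of "dcp (cp x) w" w'] dcp_idem[OF q] by auto
 hence "dcp x w.*dcp x w'-w.*w' = - ((w-p).*(w'-p'))+(r.*p'+p.*r'+r.*r')"
 by (simp add: r_def r'_def inner_diff algebra_simps)
 also have "|...| <= norm (w-p)*norm (w'-p')+(norm r*norm p'+norm p*norm r'+norm r*norm r')"
 using Cauchy_Schwarz_ineq2[of "w-p" "w'-p'"] Cauchy_Schwarz_ineq2[of r p'] Cauchy_Schwarz_ineq2[of p r'] Cauchy_Schwarz_ineq2[of r r'] by simp
 also have "... <= (C*h*norm w)*(C*h*norm w')+((a*norm w)*norm w'+norm w*(a*norm w')+(a*norm w)*(a*norm w'))"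
 using b b' pw rw a0 C h(1) by (intro add_mono mult_mono) (auto simp: p_def p'_def norm_minus_commute)
 also have "... = (C^2*h^2+(2*a+a^2))*(norm w*norm w')" by (simp add: sq2 algebra_simps)
 also have "... <= D*h^2*(norm w*norm w')"
 proof (rule rmon)
 have "h^2 <= 1" using b h(1) by (simp add: power_le_one)
 hence "h^2*h^2 <= h^2*1" by (intro lmon) auto
 moreover have "a^2 = (L*C)^2*(h^2*h^2)" by (simp add: a_def sq2)
 ultimately have "a^2 <= (L*C)^2*h^2" by (simp only:) (intro lmon; simp)
 thus "C^2*h^2+(2*a+a^2) <= D*h^2" by (simp add: D_def a_def algebra_simps)
 qed simp
 finally show "|dcp x w.*dcp x w'-w.*w'| <= D*h^2*(norm w*norm w')" .
 qed
qed

text \<open>The area formula demands an injective immersion of an open set, so the isometric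
  coordinates of the simplex are thickened to a convex neighbourhood on which p stays close to an
  isometry. The density differs from 1 by O(h^2) because the Gram matrix does.\<close>

lemma flat_geometry:
 assumes C: "0 < C"
 obtains h0 E where "0 < h0" "0 <= E" "E*h0^2 <= 1/2"
 "!!h K x y. 0 < h ==> h <= h0 ==> flat C h K ==> x:K ==> y:K ==> dist x y <= 2*dist (cp x) (cp y)"
 "!!h K A. 0 < h ==> h <= h0 ==> flat C h K ==> A:sets borel ==> A <= K ==>
 enr (1-E*h^2)*em sg A <= em sg (cp ` A) & em sg (cp ` A) <= enr (1+E*h^2)*em sg A & em sg A < \<infinity>"
proof -
 \<comment> \<open>Summed over the d coordinate directions the deviation from an isometry stays
   below 1/2, which gives the factor 2 in the inverse Lipschitz bound.\<close>
 define ka where "ka = 1/(4*real CARD('d))"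
 have ka: "0 < ka" "real CARD('d)*ka < 1/2" by (auto simp: ka_def)
 obtain h1 D where h1: "0 < h1" and D: "0 <= D" and near: "!!h K x w. 0 < h ==> h <= h1 ==> flat C h K ==> x:K ==> w:parallel_space K ==> norm (dcp x w-w) <= ka*norm w"
 "!!h K x w w'. 0 < h ==> h <= h1 ==> flat C h K ==> x:K ==> w:parallel_space K ==> w':parallel_space K ==>
 |dcp x w.*dcp x w'-w.*w'| <= D*h^2*(norm w*norm w')"
 by (rule flat_der[OF C ka(1)]) blast
 obtain c where c: "0 <= c" "!!(N :: real^'d^'d) e. 0 <= e ==> e <= 1 ==> (!!i j. |N $ i $ j| <= e) ==> |det (mat 1+N)-1-trace N| <= c*e^2"
 using det_near_identity[where ?'n = 'd] by metis
 define E where "E = (c+real CARD('d))*D"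
 have E: "0 <= E" using c(1) D by (simp add: E_def)
 define h0 where "h0 = min h1 (1/sqrt (2*(D+E+1)))"
 have h0: "0 < h0" "h0 <= h1" using h1 D E by (auto simp: h0_def)
 have h02: "h^2 <= 1/(2*(D+E+1))" if "0 < h" "h <= h0" for h
 proof -
 have "h^2 <= (1/sqrt (2*(D+E+1)))^2" using that by (intro power_mono) (auto simp: h0_def)
 thus ?thesis using D E by (simp add: power_divide)
 qed
 have Eh: "E*h^2 <= 1/2" "D*h^2 <= 1" if "0 < h" "h <= h0" for h
 proof -
 have p: "0 < 2*(D+E+1)" using D E by simp
 have "E*h^2 <= E*(1/(2*(D+E+1)))" "D*h^2 <= D*(1/(2*(D+E+1)))" by (rule lmon[OF h02[OF that]], fact)+
 moreover have "E*(1/(2*(D+E+1))) <= 1/2" "D*(1/(2*(D+E+1))) <= 1" using p D E by auto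
 ultimately show "E*h^2 <= 1/2" "D*h^2 <= 1" by linarith+
 qed
 have main: "(ALL x:K. ALL y:K. dist x y <= 2*dist (cp x) (cp y)) & (ALL A:sets borel. A <= K -->
 enr (1-E*h^2)*em sg A <= em sg (cp ` A) & em sg (cp ` A) <= enr (1+E*h^2)*em sg A & em sg A < \<infinity>)"
 if h: "0 < h" "h <= h0" and K: "flat C h K" for h K
 proof -
 have hh: "h <= h1" using h h0 by simp
 have sK: "int CARD('d) simplex K" and Kt: "K <= tube" using K by (auto simp: flat_def)
 obtain x0 and U :: "real^'d => real^'k" where U: "subspace (parallel_space K)" "linear U" "!!z. norm (U z) = norm z"
 "range U = parallel_space K" "x0:K" "!!x. x:K ==> EX z. x = x0+U z" by (rule simplex_parallel[OF sK]) blast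
 have blU: "bounded_linear U" using U(2) by (simp add: linear_conv_bounded_linear)
 define al where "al z = x0+U z" for z
 define ps where "ps z = cp (al z)" for z
 have diff: "al z-al z' = U (z-z')" for z z' by (simp add: al_def linear_diff[OF U(2)])
 have iso: "dist (al z) (al z') = dist z z'" for z z' by (simp add: dist_norm diff U(3))
 have sal: "smooth_on UNIV al" unfolding al_def[abs_def] by (intro sm_add sm_const sm_bl blU open_UNIV)
 have cal: "cont S al" for S by (rule continuous_on_subset[OF sm_cont[OF sal]]) simp
 have dal: "(al has_derivative U) (at z)" for z
 unfolding al_def[abs_def] using has_derivative_add[OF has_derivative_const bounded_linear_imp_has_derivative[OF blU]] by simp
 define K' where "K' = al -` K"
 have im: "al ` K' = K" using U(6) by (force simp: K'_def al_def)
 have cK': "compact K'"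
 unfolding compact_eq_bounded_closed
 proof
 show "closed K'" unfolding K'_def
 by (rule continuous_closed_vimage[OF closed_simplex[OF sK]]) (use cal[of UNIV] in \<open>simp add: continuous_on_eq_continuous_at\<close>)
 obtain b where "!!x y. x:K ==> y:K ==> dist x y <= b" using compact_imp_bounded[OF compact_simplex[OF sK]] bounded_two_points by metis
 thus "bounded K'" unfolding bounded_two_points K'_def using iso by (metis vimageE)
 qed
 have vK': "convex K'"
 proof -
 have "K' = U -` ((%x. x-x0) ` K)" by (force simp: K'_def al_def image_iff)
 thus ?thesis using convex_linear_vimage[OF U(2) convex_translation_subtract[OF convex_simplex[OF sK]]] by simp
 qed
 define q where "q z = (SUM l:UNIV. norm (dcp (al z) (U (axis l 1))-U (axis l 1)))" for z
 define W where "W = {z. al z:tube & q z < 1/2}"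
 have oT: "open (al -` tube)" using continuous_on_open_vimage[of UNIV al] cal op_tube by simp
 have cq: "cont (al -` tube) q"
 unfolding q_def
 proof (intro continuous_on_sum continuous_on_norm continuous_on_diff continuous_on_const)
 fix l :: 'd
 have "cont tube (%x. dcp x (U (axis l 1)))"
 unfolding dcp_def by (rule sm_cont[OF sm_pdiff_field[OF op_tube sm_cp sm_const]])
 thus "cont (al -` tube) (%z. dcp (al z) (U (axis l 1)))" by (rule continuous_on_compose2[OF _ cal]) auto
 qed
 have "W = al -` tube Int q -` {..<1/2}" by (auto simp: W_def)
 hence oW: "open W" using continuous_open_preimage[OF cq oT] by simp
 have inP: "U z:parallel_space K" for z using U(4) by blast
 have "K' <= W"
 proof
 fix z assume "z:K'"
 hence z: "al z:K" by (simp add: K'_def)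
 have "q z <= (SUM l:(UNIV :: 'd set). ka)" unfolding q_def
 using near(1)[OF h(1) hh K z inP[of "axis _ 1"]] by (intro sum_mono) (simp add: U(3) norm_axis_1)
 thus "z:W" using z Kt ka(2) by (auto simp: W_def)
 qed
 then obtain et where et: "0 < et" "(UN x:K'. ball x et) <= W" by (rule compact_subset_open_imp_ball_epsilon_subset[OF cK' oW])
 \<comment> \<open>As the sum of the convex set \<open>K'\<close> and a ball, \<open>V\<close> is
   convex, as the mean value inequality demands. The thickness \<open>et\<close> may depend on the
   simplex; no constant in the conclusion does.\<close>
 define V where "V = (UN x:K'. ball x et)"
 have V: "open V" "V <= W" "K' <= V" using et by (auto simp: V_def)
 have "V = (UN x:K'. UN y:ball 0 et. {x+y})"
 proof (intro equalityI subsetI)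
 fix v assume "v:V"
 then obtain x where "x:K'" "dist x v < et" by (auto simp: V_def)
 thus "v:(UN x:K'. UN y:ball 0 et. {x+y})" by (intro UN_I[of x] UN_I[of "v-x"]) (auto simp: dist_norm)
 next
 fix v assume "v:(UN x:K'. UN y:ball 0 et. {x+y})"
 then obtain x y where "x:K'" "norm y < et" "v = x+y" by auto
 thus "v:V" unfolding V_def by (intro UN_I[of x]) (auto simp: dist_norm)
 qed
 hence vV: "convex V" using convex_sums[OF vK' convex_ball] by simp
 have dps: "(ps has_derivative (%w. dcp (al z) (U w))) (at z)" if "z:V" for z
 unfolding ps_def[abs_def] using that V(2) by (intro has_derivative_compose[OF dal cp_der]) (auto simp: W_def)
 have nb: "norm (dcp (al z) (U w)-U w) <= 1/2*norm w" if z: "z:V" for z w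
 proof -
 have "linear (%w. dcp (al z) (U w)-U w)"
 using z V(2) linear_compose[OF U(2) lin_dcp[of "al z"]] by (intro linear_compose_sub U(2)) (auto simp: W_def o_def)
 from lin_norm_le_sum_axis[OF this, of w] have "norm (dcp (al z) (U w)-U w) <= q z*norm w" by (simp add: q_def)
 also have "... <= 1/2*norm w" using z V(2) by (intro rmon) (auto simp: W_def)
 finally show ?thesis .
 qed
 have bil: "norm (z-z') <= 2*norm (ps z-ps z')" if zz: "z:V" "z':V" for z z'
 proof -
 have dd: "((%z. ps z-U z) has_derivative (%w. dcp (al x) (U w)-U w)) (at x within V)" if "x:V" for x
 by (rule has_derivative_at_withinI[OF has_derivative_diff[OF dps[OF that] bounded_linear_imp_has_derivative[OF blU]]])
 have on: "onorm (%w. dcp (al x) (U w)-U w) <= 1/2" if "x:V" for x by (rule onorm_le) (rule nb[OF that])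
 have "norm ((ps z-U z)-(ps z'-U z')) <= 1/2*norm (z-z')"
 by (rule differentiable_bound[OF vV dd on zz])
 moreover have "(ps z-U z)-(ps z'-U z') = (ps z-ps z')-U (z-z')" by (simp add: linear_diff[OF U(2)])
 ultimately show ?thesis using norm_triangle_ineq2[of "U (z-z')" "ps z-ps z'"] by (simp add: U(3) norm_minus_commute)
 qed
 have imm: "injective_immersion V ps"
 unfolding injective_immersion_def
 proof (intro conjI ballI V(1))
 show "smooth_on V ps" unfolding ps_def[abs_def]
 by (rule sm_comp[OF V(1) op_tube _ sm_cp sm_subset[OF sal]]) (use V(2) in \<open>auto simp: W_def\<close>)
 show "inj_on ps V" by (rule inj_onI) (use bil in force)
 fix y assume y: "y:V"
 have fd: "FD ps y = (%w. dcp (al y) (U w))" using frechet_derivative_at[OF dps[OF y]] by simp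
 show "inj (FD ps y)"
 proof (rule linear_injective_0[THEN iffD2, rule_format])
 show "linear (FD ps y)" unfolding fd by (rule has_derivative_linear[OF dps[OF y]])
 show "w = 0" if "FD ps y w = 0" for w
 using nb[OF y, of w] that by (simp add: fd U(3))
 qed
 qed
 have immal: "injective_immersion UNIV al"
 unfolding injective_immersion_def
 proof (intro conjI ballI open_UNIV sal)
 show "inj_on al UNIV" using iso by (metis dist_eq_0_iff inj_onI)
 show "inj (FD al y)" for y
 using frechet_derivative_at[OF dal[of y]] U(2,3) by (simp add: linear_injective_0) (metis norm_eq_zero)
 qed
 have dens: "|adens ps z-1| <= E*h^2" if z: "z:K'" for z
 proof -
 have zV: "z:V" and zK: "al z:K" using z V(3) by (auto simp: K'_def)
 let ?f = "%w. dcp (al z) (U w)"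
 define N :: "real^'d^'d" where "N = transpose (matrix ?f) ** matrix ?f-mat 1"
 have Nb: "|N $ i $ j| <= D*h^2" for i j
 proof -
 have "N $ i $ j = ?f (axis i 1).*?f (axis j 1)-U (axis i 1).*U (axis j 1)"
 unfolding N_def vector_minus_component gram_matrix_nth lin_isom_inner[OF U(2,3)] by (simp add: mat_def inner_axis_axis)
 thus ?thesis using near(2)[OF h(1) hh K zK inP[of "axis i 1"] inP[of "axis j 1"]] by (simp add: U(3) norm_axis_1)
 qed
 have Dh: "0 <= D*h^2" "D*h^2 <= 1" using D Eh[OF h] by auto
 have tr: "|trace N| <= real CARD('d)*(D*h^2)"
 unfolding trace_def using order_trans[OF sum_abs sum_mono[of UNIV "%i. |N $ i $ i|" "%_. D*h^2"]] Nb by simp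
 have "c*(D*h^2)^2 <= c*(D*h^2)" using Dh c(1) by (intro lmon) (auto simp: sq2 mult_left_le)
 hence det: "|det (mat 1+N)-1| <= E*h^2" using c(2)[OF Dh Nb] tr by (simp add: E_def distrib_right mult.assoc)
 have "adens ps z = sqrt (det (mat 1+N))"
 unfolding adens_gram gram_def frechet_derivative_at[OF dps[OF zV], symmetric] N_def by simp
 moreover have "|sqrt t-1| <= |t-1|" if "0 <= t" for t
 proof -
 have "t-1 = (sqrt t-1)*(sqrt t+1)" using that by (simp add: algebra_simps)
 hence "|t-1| = |sqrt t-1|*(sqrt t+1)" using that by (simp add: abs_mult)
 thus ?thesis using that by (simp add: distrib_left)
 qed
 moreover have "0 <= det (mat 1+N)" using det Eh(1)[OF h] by simp
 ultimately show ?thesis using det order_trans by metis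
 qed
 have densal: "adens al z = 1" for z
 unfolding adens_gram frechet_derivative_at[OF dal, symmetric] by (simp add: gram_isom[OF U(2,3)])
 have part1: "dist x y <= 2*dist (cp x) (cp y)" if xy: "x:K" "y:K" for x y
 proof -
 obtain z z' where z: "x = al z" "y = al z'" using U(6) xy by (metis al_def)
 hence "z:V" "z':V" using xy V(3) by (auto simp: K'_def)
 from bil[OF this] show ?thesis using iso[of z z'] by (simp add: z ps_def dist_norm)
 qed
 have part2: "enr (1-E*h^2)*em sg A <= em sg (cp ` A) & em sg (cp ` A) <= enr (1+E*h^2)*em sg A & em sg A < \<infinity>"
 if A: "A:sets borel" "A <= K" for A
 proof -
 define B where "B = al -` A"
 have Bm: "B:sets borel" unfolding B_def
 using measurable_sets[OF borel_measurable_continuous_onI[OF cal] A(1)] by simp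
 have BK: "B <= K'" using A by (auto simp: B_def K'_def)
 have imA: "al ` B = A" using A(2) im by (auto simp: B_def)
 have imC: "cp ` A = ps ` B" unfolding imA[symmetric] ps_def[abs_def] by auto
 have sA: "em sg A = em lborel B"
 using area_formula[OF immal Bm] Bm by (simp add: imA densal)
 have sC: "em sg (cp ` A) = (NN lborel (%y. (enr (adens ps y))*ind B y))"
 unfolding imC using BK V(3) by (intro area_formula[OF imm Bm]) auto
 have db: "1-E*h^2 <= adens ps y" "adens ps y <= 1+E*h^2" if "y:B" for y
 using dens[of y] that BK by auto
 have "enr (1-E*h^2)*em lborel B = (NN lborel (%y. enr (1-E*h^2)*ind B y))"
 using Bm by (simp add: nn_integral_cmult_indicator)
 also have "... <= (NN lborel (%y. (enr (adens ps y))*ind B y))"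
 using db by (intro nn_integral_mono) (auto simp: indicator_def intro!: ennreal_leI)
 finally have 1: "enr (1-E*h^2)*em sg A <= em sg (cp ` A)" unfolding sA sC .
 have "(NN lborel (%y. (enr (adens ps y))*ind B y)) <= (NN lborel (%y. enr (1+E*h^2)*ind B y))"
 using db by (intro nn_integral_mono) (auto simp: indicator_def intro!: ennreal_leI)
 also have "... = enr (1+E*h^2)*em lborel B" using Bm by (simp add: nn_integral_cmult_indicator)
 finally have 2: "em sg (cp ` A) <= enr (1+E*h^2)*em sg A" unfolding sA sC .
 have "em lborel B < \<infinity>" using emeasure_bounded_finite[OF bounded_subset[OF compact_imp_bounded[OF cK'] BK]] by simp
 thus ?thesis using 1 2 sA by simp
 qed
 show ?thesis using part1 part2 by blast
 qed
 show ?thesis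
 proof (rule that[OF h0(1) E])
 show "E*h0^2 <= 1/2" by (rule Eh(1)[OF h0(1) order_refl])
 qed (use main in blast)+
qed

end

lemma nn_int_sandwich:
 assumes s: "sets N = sets R" and f: "f:bmeas R" and r: "0 <= r"
 and le: "!!A. A:sets R ==> emeasure N A <= enr r*em R A"
 shows "(NN N (%x. f x)) <= enr r*(NN R (%x. f x))"
proof -
 have "N <= scale_measure (enr r) R" using s le by (subst le_measure) auto
 hence "(NN N (%x. f x)) <= (NN (scale_measure (enr r) R) (%x. f x))"
 by (intro nn_integral_mono_measure) (simp_all add: s)
 thus ?thesis using f by (simp add: nn_integral_scale_measure)
qed

text \<open>The right side involves \<open>N\<close> alone, because \<open>N\<close> will be the
  measure transported from \<open>Ga\<close>, where the integral of |f| can be estimated. Signed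
  functions are split into their parts.\<close>

lemma int_sandwich:
 fixes f :: "'a => real"
 assumes s: "sets N = sets R" and f: "integrable N f" "integrable R f" and e: "0 <= e" "e <= 1/2"
 and le: "!!A. A:sets R ==> emeasure N A <= enr (1+e)*em R A"
 and ge: "!!A. A:sets R ==> ennreal (1-e)*em R A <= em N A"
 shows "|(LINT x|N. f x)-(LINT x|R. f x)| <= 2*e*(LINT x|N. |f x| )"
proof -
 have ge': "em R A <= enr (1/(1-e))*em N A" if "A:sets R" for A
 proof -
 have "enr (1/(1-e))*(enr (1-e)*em R A) <= enr (1/(1-e))*em N A"
 by (intro lmon ge that) simp
 moreover have "enr (1/(1-e))*enr (1-e) = 1" using e by (subst ennreal_mult'[symmetric]) auto
 ultimately show ?thesis by (simp add: mult.assoc[symmetric])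
 qed
 have pos: "|(LINT x|N. g x)-(LINT x|R. g x)| <= 2*e*(LINT x|N. g x)"
 if g: "integrable N g" "integrable R g" "!!x. 0 <= g x" for g :: "'a => real"
 proof -
 have nn: "(NN N (%x. enr (g x))) = enr (LINT x|N. g x)" "(NN R (%x. enr (g x))) = enr (LINT x|R. g x)"
 using g by (auto intro: nn_integral_eq_integral)
 have i0: "0 <= (LINT x|N. g x)" "0 <= (LINT x|R. g x)" using g(3) by auto
 have m: "(%x. enr (g x)):bmeas R" "(%x. enr (g x)):bmeas N" using g by auto
 have "enr (LINT x|N. g x) <= enr ((1+e)*(LINT x|R. g x))"
 using nn_int_sandwich[OF s m(1) _ le] e by (simp add: nn ennreal_mult')
 hence 1: "(LINT x|N. g x) <= (1+e)*(LINT x|R. g x)" using i0 e by simp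
 have "enr (LINT x|R. g x) <= enr (1/(1-e)*(LINT x|N. g x))"
 using nn_int_sandwich[OF s[symmetric] m(2) _ ge'[unfolded s[symmetric]]] e unfolding nn by (subst ennreal_mult') auto
 hence "(LINT x|R. g x) <= 1/(1-e)*(LINT x|N. g x)" using i0 e by simp
 hence 2: "(1-e)*(LINT x|R. g x) <= (LINT x|N. g x)" using e by (simp add: field_simps)
 have "1/2*(LINT x|R. g x) <= (1-e)*(LINT x|R. g x)" using e i0 by (intro rmon) auto
 hence 3: "(LINT x|R. g x) <= 2*(LINT x|N. g x)" using 2 by simp
 have "e*(LINT x|R. g x) <= e*(2*(LINT x|N. g x))" using 3 e by (intro lmon) auto
 thus ?thesis using 1 2 by (simp add: abs_le_iff algebra_simps)
 qed
 let ?p = "%x. max 0 (f x)" and ?n = "%x. max 0 (- f x)"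
 have I: "integrable N ?p" "integrable R ?p" "integrable N ?n" "integrable R ?n" using f by auto
 have d: "f x = ?p x-?n x" "|f x| = ?p x+?n x" for x by auto
 have "(LINT x|N. f x) = (LINT x|N. ?p x)-(LINT x|N. ?n x)" "(LINT x|R. f x) = (LINT x|R. ?p x)-(LINT x|R. ?n x)"
 "(LINT x|N. |f x| ) = (LINT x|N. ?p x)+(LINT x|N. ?n x)"
 by (subst d, simp only: Bochner_Integration.integral_diff Bochner_Integration.integral_add I)+
 thus ?thesis using pos[OF I(1,2)] pos[OF I(3,4)] by (simp add: distrib_left)
qed

section \<open>From single simplices to the whole discrete manifold\<close>

context submfd
begin

lemma mesh_comparison:
 assumes fin: "finite F" and bij: "bij_betw cp (\<Union>F) Ga"
 and cpt: "!!K. K:F ==> compact K" and tb: "!!K. K:F ==> K <= tube" and e: "0 <= e" "e <= 1/2"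
 and est: "!!K A. K:F ==> A:sets borel ==> A <= K ==> ennreal (1-e)*em sg A <= em sg (cp ` A) &
 em sg (cp ` A) <= enr (1+e)*em sg A & em sg A < \<infinity>"
 shows "em sg (\<Union>F) < \<infinity>" "0 < measure (restrict_space sg (\<Union>F)) (\<Union>F)"
 "cont (\<Union>F) w ==> continuous_on Ga (lift Ga (\<Union>F) w)"
 "cont (\<Union>F) w ==> integrable (restrict_space sg (\<Union>F)) w"
 "cont (\<Union>F) w ==> |(LINT x|M. lift Ga (\<Union>F) w x)-(LINT x|restrict_space sg (\<Union>F). w x)| <= 2*e*(LINT x|M. |lift Ga (\<Union>F) w x| )"
proof -
 define S where "S = \<Union>F"
 have cS: "compact S" unfolding S_def by (rule compact_Union[OF fin cpt])
 have tS: "S <= tube" using tb by (auto simp: S_def)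
 have ccp: "cont S cp" by (rule continuous_on_subset[OF sm_cont[OF sm_cp] tS])
 have inj: "inj_on cp S" and im: "cp ` S = Ga" using bij by (auto simp: bij_betw_def S_def)
 define g where "g = inv_into S cp"
 have hom: "homeomorphism S Ga cp g" unfolding g_def
 by (rule homeomorphismI) (use continuous_on_inv[OF ccp cS, of "inv_into S cp"] in \<open>auto intro!: ccp inv_into_into simp: im inj f_inv_into_f\<close>)
 have cg: "cont Ga g" and gS: "g ` Ga = S" and gcp: "!!x. x:S ==> g (cp x) = x" and cpg: "!!y. y:Ga ==> cp (g y) = y"
 using hom by (auto simp: homeomorphism_def)
 have Sb: "S:sets borel" using cS by (simp add: compact_imp_closed)
 have cpb: "cp ` A:sets borel" if "A:sets borel" "A <= S" for A
 using borel_image_homeo[OF hom _ that] closed by simp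
 \<comment> \<open>Cutting off one simplex at a time makes the pieces disjoint, so common faces,
   which belong to several simplices, are counted once.\<close>
 have all: "enr (1-e)*em sg A <= em sg (cp ` A) & em sg (cp ` A) <= enr (1+e)*em sg A & em sg A < \<infinity>"
 if A: "A:sets borel" "A <= \<Union>G" and G: "G <= F" for A G
 proof -
 have "finite G" using fin G finite_subset by blast
 thus ?thesis using A G
 proof (induction G arbitrary: A rule: finite_induct)
 case (insert K G)
 have Kb: "K:sets borel" using cpt insert.prems(3) by (simp add: compact_imp_closed)
 define X Y where "X = A Int K" and "Y = A-K"
 have XY: "X:sets borel" "Y:sets borel" "X <= K" "Y <= \<Union>G" "A = X Un Y" "X Int Y = {}" "X <= S" "Y <= S"
 using insert.prems Kb by (auto simp: X_def Y_def S_def)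
 note x = est[OF _ XY(1,3)] and y = insert.IH[OF XY(2,4)]
 have "cp ` X Int cp ` Y = {}" using inj XY(6-8) by (auto simp: inj_on_def) (metis IntI empty_iff subsetD)
 hence sum: "em sg (cp ` A) = em sg (cp ` X)+em sg (cp ` Y)" "em sg A = em sg X+em sg Y"
 using cpb XY by (auto simp: image_Un plus_emeasure sets_sg)
 show ?case unfolding sum distrib_left using x y insert.prems(3) by (auto intro!: add_mono)
 qed simp
 qed
 note tot = all[OF _ _ order_refl, folded S_def]
 have fS: "em sg S < \<infinity>" using tot[OF Sb] by simp
 thus "em sg (\<Union>F) < \<infinity>" by (simp add: S_def)
 let ?R = "restrict_space sg S"
 have spR: "space ?R = S" by (simp add: space_restrict_space space_sg)
 have sR: "A:sets ?R \<longleftrightarrow> A:sets borel & A <= S" for A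
 using Sb by (auto simp: sets_restrict_space_iff sets_sg space_sg)
 have eR: "em ?R A = em sg A" if "A <= S" for A
 using Sb that by (intro emeasure_restrict_space) (auto simp: sets_sg space_sg)
 interpret R: finite_measure ?R by (rule finite_measureI) (use fS in \<open>simp add: spR eR\<close>)
 have "0 < em sg S"
 proof (rule ccontr)
 assume "~ ?thesis"
 hence "em sg Ga = 0" using tot[OF Sb order_refl] im by simp
 thus False using measure_pos by (simp add: measure_def emeasure_M)
 qed
 thus "0 < measure (restrict_space sg (\<Union>F)) (\<Union>F)"
 unfolding S_def[symmetric] using R.emeasure_eq_measure[of S] eR[of S] by simp
 have pre: "g -` A Int space M = cp ` A" if "A <= S" for A
 proof (intro equalityI subsetI)
 fix x assume "x:g -` A Int space M"
 thus "x:cp ` A" using cpg[of x] by (auto simp: space_M intro: rev_image_eqI)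
 qed (use that gcp im in \<open>auto simp: space_M\<close>)
 have gm: "g:M \<rightarrow>\<^sub>M ?R"
 proof (rule measurableI)
 fix A assume "A:sets ?R"
 hence A: "A:sets borel" "A <= S" by (auto simp: sR)
 thus "g -` A Int space M:sets M" unfolding pre[OF A(2)] using cpb[OF A] A(2) im by (auto simp: sets_M_iff)
 qed (use gS in \<open>auto simp: spR space_M\<close>)
 \<comment> \<open>The area of \<open>Ga\<close> transported to the discrete manifold by the inverse
   of p; integrals of \<open>w\<close> against it are integrals of the lift.\<close>
 define N where "N = distr M ?R g"
 have sN: "sets N = sets ?R" by (simp add: N_def)
 have eN: "em N A = em sg (cp ` A)" if "A:sets ?R" for A
 proof -
 have A: "A:sets borel" "A <= S" using that by (auto simp: sR)
 thus ?thesis using im by (auto simp: N_def emeasure_distr[OF gm that] pre intro!: emeasure_M)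
 qed
 fix w :: "'k fn" assume "cont (\<Union>F) w"
 hence w: "cont S w" by (simp add: S_def)
 have l: "lift Ga S w = (%x. w (g x))" by (simp add: fun_eq_iff lift_def g_def)
 have cl: "cont Ga (%x. w (g x))" by (rule continuous_on_compose2[OF w cg]) (simp add: gS)
 thus "cont Ga (lift Ga (\<Union>F) w)" by (simp add: l S_def[symmetric])
 have wm: "w:bmeas ?R"
 using borel_measurable_continuous_on_restrict[OF w] measurable_cong_sets[OF sets_restrict_space_cong[OF sets_sg] refl] by blast
 obtain b where "!!x. x:S ==> norm (w x) <= b" using cpt_bound[OF cS w] by blast
 hence iR: "integrable ?R w" by (intro R.integrable_const_bound[of _ b] wm AE_I2) (simp add: spR)
 thus "integrable (restrict_space sg (\<Union>F)) w" by (simp add: S_def)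
 have iN: "integrable N w" unfolding N_def using cont_int[OF cl] by (subst integrable_distr_eq[OF gm wm])
 have "|(LINT x|N. w x)-(LINT x|?R. w x)| <= 2*e*(LINT x|N. |w x| )"
 by (rule int_sandwich[OF sN iN iR e]) (use tot in \<open>auto simp: eN eR sR\<close>)
 also have "(LINT x|N. w x) = (LINT x|M. w (g x))" unfolding N_def by (rule integral_distr[OF gm wm])
 also have "(LINT x|N. |w x| ) = (LINT x|M. |w (g x)| )" unfolding N_def by (rule integral_distr[OF gm borel_measurable_abs[OF wm]])
 finally show "|(LINT x|M. lift Ga (\<Union>F) w x)-(LINT x|restrict_space sg (\<Union>F). w x)| <= 2*e*(LINT x|M. |lift Ga (\<Union>F) w x| )"
 unfolding S_def[symmetric] l .
qed

text \<open>The lift is Lipschitz. Close points of \<open>Ga\<close> are joined by the projection of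
  a segment; the times at which it runs in the image of one simplex within one background element
  form closed sets, on each of which \<open>v\<close> is affine and the inverse of p is 2-Lipschitz,
  and \<open>lip_pieces\<close> joins them. The constant may depend on the mesh, as only membership
  is concluded.\<close>

lemma lift_H1:
 assumes fin: "finite F" "finite Tr" and bij: "bij_betw cp (\<Union>F) Ga"
 and cpt: "!!K. K:F ==> compact K" "!!T. T:Tr ==> compact T"
 and bil: "!!K x y. K:F ==> x:K ==> y:K ==> dist x y <= 2*dist (cp x) (cp y)"
 and v: "!!T. T:Tr ==> EX c b. ALL x:T. v x = c.*x+b" and cov: "\<Union>F <= \<Union>Tr"
 and tb: "!!K. K:F ==> K <= tube" and cl: "cont Ga (lift Ga (\<Union>F) v)"
 shows "lift Ga (\<Union>F) v:HA"
proof -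
 let ?v = "lift Ga (\<Union>F) v"
 have inj: "inj_on cp (\<Union>F)" and im: "cp ` (\<Union>F) = Ga" using bij by (auto simp: bij_betw_def)
 have vl: "?v (cp x) = v x" if "x:\<Union>F" for x using that inj by (simp add: lift_def inv_into_f_f)
 obtain c b where cb: "!!T x. T:Tr ==> x:T ==> v x = c T.*x+b T" using v by metis
 define B where "B = (SUM T:Tr. norm (c T))+1"
 have B: "0 < B" "!!T. T:Tr ==> norm (c T) <= B"
 using member_le_sum[OF _ _ fin(2), of _ "%T. norm (c T)"] sum_nonneg[of Tr "%T. norm (c T)"] by (force simp: B_def)+
 obtain e L where eL: "0 < e" "0 < L" "!!q. q:Ga ==> cball q e <= tube"
 "!!q x y. q:Ga ==> x:cball q e ==> y:cball q e ==> norm (cp x-cp y) <= L*dist x y"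
 by (rule smooth_lip_local[OF sm_cp]) blast
 have loc: "norm (?v q-?v q') <= (2*B*L)*dist q q'" if q: "q:Ga" "q':Ga" and d: "dist q q' <= e" for q q'
 proof -
 define p where "p t = q+t*.(q'-q)" for t :: real
 have pb: "p t:cball q e" if "t:{0..1}" for t
 proof -
 have "norm (t*.(q'-q)) <= 1*norm (q'-q)" unfolding norm_scaleR using that by (intro rmon) auto
 thus ?thesis using d by (simp add: p_def dist_norm norm_minus_commute)
 qed
 define P where "P i = {t:{0..1}. cp (p t):cp ` (fst i Int snd i)}" for i
 have cpp: "cont {0..1} (%t. cp (p t))"
 by (rule continuous_on_compose2[OF sm_cont[OF sm_cp]]) (use pb eL(3)[OF q(1)] in \<open>auto simp: p_def intro!: continuous_intros\<close>)
 have "|?v (cp (p 0))-?v (cp (p 1))| <= (2*B*L*dist q q')*(1-0)"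
 proof (rule lip_pieces[of "F \<times> Tr" P 0 1 "2*B*L*dist q q'" "%t. ?v (cp (p t))"])
 show "finite (F \<times> Tr)" using fin by simp
 show "closed (P i)" if "i:F \<times> Tr" for i
 proof -
 have "compact (fst i Int snd i)" using that cpt by auto
 moreover have "cont (fst i Int snd i) cp"
 by (rule continuous_on_subset[OF sm_cont[OF sm_cp]]) (use that tb[of "fst i"] in auto)
 ultimately have "closed (cp ` (fst i Int snd i))" by (intro compact_imp_closed compact_continuous_image)
 hence "closed ({0..1} Int (%t. cp (p t)) -` (cp ` (fst i Int snd i)))" by (intro continuous_closed_preimage[OF cpp]) auto
 moreover have "P i = {0..1} Int (%t. cp (p t)) -` (cp ` (fst i Int snd i))" by (auto simp: P_def)
 ultimately show ?thesis by simp
 qed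
 show "{0..1} <= (UN i:F \<times> Tr. P i)"
 proof
 fix t :: real assume t: "t:{0..1}"
 obtain x where x: "x:\<Union>F" "cp x = cp (p t)" using im cp_in by (metis imageE)
 then obtain K T where "K:F" "T:Tr" "x:K Int T" using cov by blast
 thus "t:(UN i:F \<times> Tr. P i)" using t x(2)[symmetric] by (intro UN_I[of "(K, T)"]) (auto simp: P_def)
 qed
 show "|?v (cp (p s))-?v (cp (p t))| <= 2*B*L*dist q q' * |s-t|"
 if i: "i:F \<times> Tr" and st: "s:P i" "t:P i" "s:{0..1}" "t:{0..1}" for i s t
 proof -
 obtain K T where KT: "i = (K, T)" "K:F" "T:Tr" using i by auto
 obtain x y where xy: "x:K" "x:T" "cp (p s) = cp x" "y:K" "y:T" "cp (p t) = cp y" using st(1,2) by (auto simp: P_def KT)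
 have "?v (cp (p s))-?v (cp (p t)) = c T.*(x-y)"
 using vl[OF UnionI[OF KT(2) xy(1)]] vl[OF UnionI[OF KT(2) xy(4)]] xy cb[OF KT(3)] by (simp add: inner_diff_right)
 hence "|?v (cp (p s))-?v (cp (p t))| <= norm (c T)*dist x y" by (simp add: Cauchy_Schwarz_ineq2 dist_norm)
 also have "... <= B*(2*dist (cp x) (cp y))" using B bil[OF KT(2) xy(1,4)] KT(3) by (intro mult_mono) auto
 also have "dist (cp x) (cp y) <= L*dist (p s) (p t)"
 using eL(4)[OF q(1) pb[OF st(3)] pb[OF st(4)]] xy by (simp add: dist_norm)
 also have "dist (p s) (p t) = |s-t|*dist q q'"
 by (simp add: p_def dist_norm norm_minus_commute flip: scaleR_diff_left)
 finally show ?thesis using B(1) by (simp add: mult_ac)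
 qed
 qed (use B eL(2) in auto)
 thus ?thesis by (simp add: p_def cp_self q)
 qed
 obtain b where b: "!!x. x:Ga ==> norm (?v x) <= b" using cpt_bound[OF compact cl] by blast
 obtain L' where "0 < L'" "!!x y. x:Ga ==> y:Ga ==> norm (?v x-?v y) <= L'*dist x y"
 by (rule lip_from_local[where S = Ga and f = ?v and e = e and B = "2*B*L" and F = b]) (use eL(1,2) B(1) b loc in auto)
 thus ?thesis by (intro lip_H1) auto
qed

lemma discrete_facts:
 assumes C: "0 < C"
 obtains h0 E where "0 < h0" "0 <= E" "!!h Ks Tr S V. 0 < h ==> h <= h0 ==> discrete_manifold TYPE('d) Ga de C h Ks ==> background_mesh Ga de C h Tr ==>
 S = \<Union>Ks ==> V = fe_space (active_mesh Tr S) ==>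
 cp ` S = Ga & 0 < measure (restrict_space sg S) S & (ALL v:V. integrable (restrict_space sg S) v & lift Ga S v:HA &
 |(LINT x|M. lift Ga S v x)-(LINT x|restrict_space sg S. v x)| <= E*h^2*(LINT x|M. |lift Ga S v x| ))"
proof -
 obtain h0 E where h0: "0 < h0" and E: "0 <= E" "E*h0^2 <= 1/2"
 and bil: "!!h K x y. 0 < h ==> h <= h0 ==> flat C h K ==> x:K ==> y:K ==> dist x y <= 2*dist (cp x) (cp y)"
 and est: "!!h K A. 0 < h ==> h <= h0 ==> flat C h K ==> A:sets borel ==> A <= K ==>
 enr (1-E*h^2)*em sg A <= em sg (cp ` A) & em sg (cp ` A) <= enr (1+E*h^2)*em sg A & em sg A < \<infinity>"
 by (rule flat_geometry[OF C]) blast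
 show ?thesis
 proof (rule that[OF h0, of "2*E"])
 fix h and Ks Tr :: "(real^'k) set set" and S V assume h: "0 < h" "h <= h0" and K: "discrete_manifold TYPE('d) Ga de C h Ks" and T: "background_mesh Ga de C h Tr"
 and S: "S = \<Union>Ks" and V: "V = fe_space (active_mesh Tr S)"
 have fin: "finite Ks" "finite (active_mesh Tr S)" using K T by (auto simp: discrete_manifold_def background_mesh_def triangulation_def active_mesh_def)
 have fl: "flat C h k" if "k:Ks" for k using K that by (auto simp: discrete_manifold_def flat_def)
 have bij: "bij_betw cp (\<Union>Ks) Ga" and tbK: "\<Union>Ks <= tube" using K by (auto simp: discrete_manifold_def)
 have cpt: "compact k" if "k:Ks" for k using fl[OF that] by (auto simp: flat_def intro: compact_simplex)
 have cptT: "compact t" if "t:active_mesh Tr S" for t using that T by (auto simp: active_mesh_def background_mesh_def intro: compact_simplex)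
 have tb: "k <= tube" if "k:Ks" for k using that tbK by blast
 have cov: "\<Union>Ks <= \<Union>(active_mesh Tr S)"
 proof
 fix x assume x: "x:\<Union>Ks"
 obtain Om where "tube <= Om" "Om <= \<Union>Tr" using T unfolding background_mesh_def by blast
 hence "x:\<Union>Tr" using tbK x by blast
 then obtain t where "t:Tr" "x:t" by blast
 thus "x:\<Union>(active_mesh Tr S)" using x by (auto simp: active_mesh_def S)
 qed
 have e: "0 <= E*h^2" "E*h^2 <= 1/2"
 using E h order_trans[OF lmon[OF power_mono[of h h0 2] E(1)] E(2)] by auto
 have "integrable (restrict_space sg S) v & lift Ga S v:HA &
 |(LINT x|M. lift Ga S v x)-(LINT x|restrict_space sg S. v x)| <= 2*E*h^2*(LINT x|M. |lift Ga S v x| )" if v: "v:V" for v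
 proof -
 have va: "!!t. t:active_mesh Tr S ==> EX c b. ALL x:t. v x = c.*x+b" and "cont (\<Union>(active_mesh Tr S)) v"
 using v by (auto simp: V fe_space_def)
 hence cv: "cont (\<Union>Ks) v" using cov continuous_on_subset by blast
 have "cont Ga (lift Ga (\<Union>Ks) v)" by (rule mesh_comparison(3)[OF fin(1) bij cpt tb e est[OF h fl] cv])
 hence "lift Ga (\<Union>Ks) v:HA" by (intro lift_H1[OF fin bij cpt cptT bil[OF h fl] va cov tb])
 moreover have "integrable (restrict_space sg (\<Union>Ks)) v" by (rule mesh_comparison(4)[OF fin(1) bij cpt tb e est[OF h fl] cv])
 moreover have "|(LINT x|M. lift Ga (\<Union>Ks) v x)-(LINT x|restrict_space sg (\<Union>Ks). v x)| <= 2*(E*h^2)*(LINT x|M. |lift Ga (\<Union>Ks) v x| )"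
 by (rule mesh_comparison(5)[OF fin(1) bij cpt tb e est[OF h fl] cv])
 ultimately show ?thesis by (simp add: S)
 qed
 moreover have "0 < measure (restrict_space sg (\<Union>Ks)) (\<Union>Ks)" by (rule mesh_comparison(2)[OF fin(1) bij cpt tb e est[OF h fl]])
 ultimately show "cp ` S = Ga & 0 < measure (restrict_space sg S) S & (ALL v:V. integrable (restrict_space sg S) v & lift Ga S v:HA &
 |(LINT x|M. lift Ga S v x)-(LINT x|restrict_space sg S. v x)| <= 2*E*h^2*(LINT x|M. |lift Ga S v x| ))"
 using bij by (auto simp: S bij_betw_def)
 qed (use E in simp)
qed

end

section \<open>Error estimates\<close>

definition lincomb_closed :: "('a => real) set => bool" where
 "lincomb_closed W \<longleftrightarrow> (ALL v:W. ALL w:W. ALL r s. (%x. r * v x+s*w x):W)"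

lemma psd_form:
 assumes B: "psd_form_on W B" and lc: "lincomb_closed W" and vw: "v:W" "w:W"
 shows psd_sym: "B v w = B w v" and psd_lincomb: "z:W ==> B z (%x. r * v x+s*w x) = r*B z v+s*B z w"
 and psd_lincomb_left: "z:W ==> B (%x. r * v x+s*w x) z = r*B v z+s*B w z"
 and psd_power2: "(form_norm B v)^2 = B v v" and psd_nonneg: "0 <= form_norm B v"
 and psd_Cauchy_Schwarz: "|B v w| <= form_norm B v * form_norm B w"
 and psd_triangle: "form_norm B (%x. r * v x+s*w x) <= |r|*form_norm B v+|s|*form_norm B w"
proof -
 have W: "(%x. r * v x+s*w x):W" if "v:W" "w:W" for v w r s
 using lc that by (simp add: lincomb_closed_def)
 have sym: "B v w = B w v" if "v:W" "w:W" for v w using B that by (simp add: psd_form_on_def)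
 have lin: "B z (%x. r * v x+s*w x) = r*B z v+s*B z w" if "v:W" "w:W" "z:W" for v w z r s
 using B that by (simp add: psd_form_on_def linear_form_on_def)
 have lin': "B (%x. r * v x+s*w x) z = r*B v z+s*B w z" if "v:W" "w:W" "z:W" for v w z r s
 using lin[OF that, of r s] sym[OF W[OF that(1,2)] that(3)] sym[OF that(1,3)] sym[OF that(2,3)] by simp
 have pos: "0 <= B v v" if "v:W" for v using B that by (simp add: psd_form_on_def)
 have p2: "(form_norm B v)^2 = B v v" if "v:W" for v using pos[OF that] by (simp add: form_norm_def)
 have nn: "0 <= form_norm B v" if "v:W" for v using pos[OF that] by (simp add: form_norm_def)
 have exp: "B (%x. r * v x+s*w x) (%x. r * v x+s*w x) = r^2*B v v+2*r * s*B v w+s^2*B w w" for r s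
 by (simp add: lin[OF vw W[OF vw]] lin'[OF vw vw(1)] lin'[OF vw vw(2)] sym[OF vw(2,1)] sq2 algebra_simps)
 have "(B v w)^2 <= B v v * B w w"
 proof (rule discriminant)
 show "0 <= B v v+2*t*B v w+t^2*B w w" for t using pos[OF W[OF vw, of 1 t]] exp[of 1 t] by simp
 qed (rule pos[OF vw(2)])
 thus CS: "|B v w| <= form_norm B v * form_norm B w"
 by (simp add: form_norm_def real_sqrt_mult[symmetric] real_le_rsqrt)
 have "(form_norm B (%x. r * v x+s*w x))^2 = r^2*(form_norm B v)^2+2*(r * s*B v w)+s^2*(form_norm B w)^2"
 by (simp add: p2 vw W exp)
 also have "... <= r^2*(form_norm B v)^2+2*( |r| * |s|*(form_norm B v * form_norm B w))+s^2*(form_norm B w)^2"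
 using lmon[OF CS, of "|r| * |s|"] abs_ge_self[of "r * s*B v w"] by (simp add: abs_mult)
 also have "... = ( |r|*form_norm B v+|s|*form_norm B w)^2" by (simp add: power2_sum power_mult_distrib)
 finally show "form_norm B (%x. r * v x+s*w x) <= |r|*form_norm B v+|s|*form_norm B w"
 by (rule power2_le_imp_le) (simp add: nn vw)
 show "B v w = B w v" "(form_norm B v)^2 = B v v" "0 <= form_norm B v" by (rule sym p2 nn vw)+
 show "B z (%x. r * v x+s*w x) = r*B z v+s*B z w" "B (%x. r * v x+s*w x) z = r*B v z+s*B w z" if "z:W"
 by (rule lin[OF vw that] lin'[OF vw that])+
qed

lemma fe_space_lincomb:
 fixes v w :: "real^'k => real" and Tr :: "(real^'k) set set"
 assumes "v:fe_space Tr" "w:fe_space Tr" shows "(%x. r * v x+s*w x):fe_space Tr"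
proof -
 have "EX c b. ALL x:T. r * v x+s*w x = c.*x+b" if T: "T:Tr" for T
 proof -
 obtain c b where "ALL x:T. v x = c.*x+b" using assms(1) T unfolding fe_space_def by blast
 moreover obtain c' b' where "ALL x:T. w x = c'.*x+b'" using assms(2) T unfolding fe_space_def by blast
 ultimately    show ?thesis by (intro exI[of _ "r*.c+s*.c'"] exI[of _ "r*b+s*b'"]) (simp add: inner_add_left algebra_simps)
 qed
 thus ?thesis using assms by (auto simp: fe_space_def intro!: continuous_intros)
qed

lemma fe_space_const: fixes Tr :: "(real^'k) set set" shows "(%x. c):fe_space Tr"
proof -
 have "EX a b. ALL x:T. c = (a::real^'k).*x+b" for T :: "(real^'k) set" by (intro exI[of _ 0] exI[of _ c]) simp
 thus ?thesis by (simp add: fe_space_def)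
qed

context submfd
begin

lemma H1_lincomb:
 assumes "u:HA" "v:HA" shows "(%x. r*u x+s * v x):HA"
 using wgrad_lincomb[OF H1_L2[OF assms(1)] sgrad_weak[OF assms(1)] H1_L2[OF assms(2)] sgrad_weak[OF assms(2)]] L2_lincomb[OF H1_L2[OF assms(1)] H1_L2[OF assms(2)], of r s] by (intro H1I) simp_all

lemma dirichlet_psd: "psd_form_on (HA) (Dir)"
proof -
 have sym: "Dir v w = Dir w v" for v w
 by (simp add: dirichlet_form_def inner_commute)
 have lin: "Dir z (%x. r * v x+s*w x) = r*Dir z v+s*Dir z w"
 if H: "v:HA" "w:HA" "z:HA" for v w z r s
 proof -
 note W = sgrad_weak[OF H(1)] sgrad_weak[OF H(2)] sgrad_weak[OF H(3)] and L = H1_L2[OF H(1)] H1_L2[OF H(2)] H1_L2[OF H(3)]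
 have "Dir z (%x. r * v x+s*w x) = (LINT x|M. sgr z x.*(r*.surface_grad sg Ga v x+s*.surface_grad sg Ga w x))"
 by (rule dirichlet_form_eq[OF L(3) W(3) _ wgrad_lincomb[OF L(1) W(1) L(2) W(2)]])
 (use L2_lincomb[OF L(1,2)] in simp)
 thus ?thesis
 using L2_int_inner[OF weak_grad_L2[OF W(3)] weak_grad_L2[OF W(1)]] L2_int_inner[OF weak_grad_L2[OF W(3)] weak_grad_L2[OF W(2)]] by (simp add: inner_add_right dirichlet_form_def)
 qed
 thus ?thesis using sym by (auto simp: psd_form_on_def linear_form_on_def dirichlet_form_def intro!: integral_nonneg_AE)
qed

lemma dirichlet_form_cong:
 assumes "!!x. x:Ga ==> v x = w x" shows "form_norm (Dir) v = form_norm (Dir) w"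
 using wgrad_cong[OF assms sets_sg] by (simp add: form_norm_def dirichlet_form_def surface_grad_def)

end

text \<open>One mesh with its forms and data, together with the constants \<open>K\<close> and
  \<open>E\<close> obtained beforehand. Every bound proved inside contains only \<open>C\<close>,
  \<open>ta\<close>, \<open>K\<close> and \<open>E\<close>, which is the uniformity in h and in the
  position of the mesh.\<close>

locale discrete_problem = submfd Ga de sg d
 for Ga :: "(real^'k) set" and de :: real and sg :: "(real^'k) measure" and d :: "'d::finite itself" +
 fixes C ta K E h :: real and S :: "(real^'k) set" and Tr a s l \<pi> and f u w :: "real^'k => real"
 assumes C: "0 < C" and ta: "0 < ta" and K: "0 < K" and E: "0 <= E" and h: "0 < h" "h <= 1" "E*h^2 <= 1/2"
 and solvable: "!!g. L2_fun M g ==> (LINT x|M. g x) = 0 ==> EX ph. poisson_solution sg Ga g ph"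
 and regular: "!!g u. L2_fun M g ==> poisson_solution sg Ga g u ==> H2_norm sg Ga u <= K*L2n M g"
 and cpS: "cp ` S = Ga" and S_pos: "0 < measure (restrict_space sg S) S"
 and fe: "!!v. v:fe_space Tr ==> integrable (restrict_space sg S) v" "!!v. v:fe_space Tr ==> lift Ga S v:H1 sg Ga"
 "!!v. v:fe_space Tr ==> |(LINT x|M. lift Ga S v x)-(LINT x|restrict_space sg S. v x)| <= E*h^2*(LINT x|M. |lift Ga S v x| )"
 and forms: "discrete_forms sg Ga S (fe_space Tr) C ta a s" and l: "linear_form_on (fe_space Tr) l"
 and f: "L2_fun M f" "(LINT x|M. f x) = 0" and u: "poisson_solution sg Ga f u" and w: "w:fe_space0 sg S Tr"
 and galerkin0: "!!v. v:fe_space0 sg S Tr ==> a w v+ta * s w v = l v"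
 and interpolation: "!!v. v:H2 sg Ga ==> \<pi> (extension Ga v):fe_space Tr &
 L2n (restrict_space sg S) (%x. extension Ga v x-\<pi> (extension Ga v) x)
 + h*form_norm (%v w. a v w+ta * s v w) (%x. extension Ga v x-\<pi> (extension Ga v) x) <= C*h^2*H2_norm sg Ga v"
 and quadrature: "!!v. v:fe_space Tr ==>
 |l v-(LINT q|M. f q*lift Ga S v q)| <= C*h*L2n M f*form_norm (%v w. a v w+ta * s v w) v"
 "!!v. v:fe_space Tr ==> |dirichlet_form sg Ga u (lift Ga S v)-a (extension Ga u) v|
 <= C*h*H2_norm sg Ga u*form_norm (%v w. a v w+ta * s v w) v"
 and quadrature2: "!!ph. ph:H2 sg Ga ==> |l (\<pi> (extension Ga ph))-(LINT q|M. f q*lift Ga S (\<pi> (extension Ga ph)) q)|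
 <= C*h^2*L2n M f*H2_norm sg Ga ph"
 "!!ph. ph:H2 sg Ga ==> |dirichlet_form sg Ga (lift Ga S w) (lift Ga S (\<pi> (extension Ga ph)))-a w (\<pi> (extension Ga ph))|
 <= C*h^2*H2_norm sg Ga u*H2_norm sg Ga ph"
 and consistency: "!!v. v:H2 sg Ga ==> form_norm s (extension Ga v) <= C*h*H2_norm sg Ga v"
begin

abbreviation "V \<equiv> fe_space Tr"
abbreviation "A \<equiv> %v w. a v w+ta * s v w"
abbreviation "ext \<equiv> extension Ga"
abbreviation "lft \<equiv> lift Ga S"
abbreviation "D \<equiv> Dir"
abbreviation "W \<equiv> sum_space (ext ` HA) V"
abbreviation "F \<equiv> nm f"
abbreviation "nA \<equiv> form_norm A"
abbreviation "nS \<equiv> form_norm s"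
abbreviation "N2 \<equiv> nB"

lemma forms':
 shows psd_a: "psd_form_on W a" and psd_s: "psd_form_on W s" and A_one: "!!v. v:W ==> A (%x. 1) v = 0"
 and D_lift: "!!v. v:W ==> form_norm D (lft v) <= C*nA v"
 using forms by (auto simp: discrete_forms_def Let_def)

lemma W_lincomb: "lincomb_closed W"
 unfolding lincomb_closed_def
proof (intro ballI allI)
 fix v z r t assume "v:W" "z:W"
 then obtain v1 v2 z1 z2 where v: "v = (%x. ext v1 x+v2 x)" "v1:HA" "v2:V" and z: "z = (%x. ext z1 x+z2 x)" "z1:HA" "z2:V"
 by (auto simp: sum_space_def)
 have "(%x. r * v x+t*z x) = (%x. ext (%x. r * v1 x+t*z1 x) x+(r * v2 x+t*z2 x))"
 by (simp add: fun_eq_iff v(1) z(1) extension_def algebra_simps)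
 thus "(%x. r * v x+t*z x):W" unfolding sum_space_def using H1_lincomb[OF v(2) z(2), of r t] fe_space_lincomb[OF v(3) z(3), of r t] by (intro CollectI exI[of _ "ext (%x. r * v1 x+t*z1 x)"] exI[of _ "%x. r * v2 x+t*z2 x"]) (intro conjI imageI; assumption)
qed

lemma V_W: "v:V ==> v:W"
proof -
 assume v: "v:V"
 have "(%x. 0):HA" by (rule smooth_H1) (rule sm_const)
 moreover have "v = (%x. ext (%x. 0) x+v x)" by (simp add: fun_eq_iff extension_def)
 ultimately show ?thesis unfolding sum_space_def using v by blast
qed

lemma ext_W: "v:HA ==> ext v:W"
 unfolding sum_space_def using fe_space_const[of 0 Tr] by force

lemma psd_A: "psd_form_on W A"
 using psd_a psd_s ta by (auto simp: psd_form_on_def linear_form_on_def algebra_simps)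

lemmas A_facts = psd_form[OF psd_A W_lincomb]
lemmas s_facts = psd_form[OF psd_s W_lincomb]

lemma nS_le: assumes v: "v:W" shows "nS v <= nA v/sqrt ta"
proof -
 have "0 <= a v v" using psd_a v by (simp add: psd_form_on_def)
 hence "s v v <= A v v/ta" using ta by (simp add: field_simps)
 hence "sqrt (s v v) <= sqrt (A v v/ta)" by simp
 thus ?thesis by (simp add: form_norm_def real_sqrt_divide)
qed

lemma diff_W: "v:W ==> z:W ==> (%x. v x-z x):W"
 using W_lincomb[unfolded lincomb_closed_def, rule_format, of v z 1 "-1"] by simp

lemma wV: "w:V" "(LINT x|restrict_space sg S. w x) = 0"
 using w by (auto simp: fe_space0_def)

lemma lift_one: "x:Ga ==> lft (ext v) x = v x" "lft (%x. v x-z x) x = lft v x-lft z x" "lft (%x. c) x = c"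
 using cpS by (simp_all add: lift_def extension_def f_inv_into_f)

text \<open>Constants are in the kernel of \<open>A\<close>, and the quadrature bound forces \<open>l 1 = 0\<close>, so the discrete
 equation holds for test functions of arbitrary mean.\<close>

lemma galerkin: assumes v: "v:V" shows "A w v = l v"
proof -
 define c where "c = (LINT x|restrict_space sg S. v x)/measure (restrict_space sg S) S"
 have one: "(%x. 1):V" by (rule fe_space_const)
 have "nA (%x. 1) = 0" using A_one[OF V_W[OF one]] by (simp add: form_norm_def)
 hence l1: "l (%x. 1) = 0" using quadrature(1)[OF one] f(2) by (simp add: lift_one(3)[abs_def])
 have vc: "(%x. 1 * v x+(- c)*1):V" by (rule fe_space_lincomb[OF v one])
 have sp: "space (restrict_space sg S) = S" by (simp add: space_restrict_space space_sg)
 have "(LINT x|restrict_space sg S. 1 * v x+(- c)*1) = (LINT x|restrict_space sg S. v x)-c*measure (restrict_space sg S) S"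
 using fe(1)[OF v] fe(1)[OF fe_space_const[of c]] by (simp add: sp mult.commute)
 hence "(%x. 1 * v x+(- c)*1):fe_space0 sg S Tr" using vc S_pos by (simp add: fe_space0_def c_def)
 hence "A w (%x. 1 * v x+(- c)*1) = l (%x. 1 * v x+(- c)*1)" by (rule galerkin0)
 moreover have "A w (%x. 1 * v x+(- c)*1) = 1*A w v+(- c)*A w (%x. 1)"
 by (rule A_facts(2)[OF V_W[OF v] V_W[OF one] V_W[OF wV(1)]])
 moreover have "A w (%x. 1) = 0" using A_one[OF V_W[OF wV(1)]] A_facts(1)[OF V_W[OF wV(1)] V_W[OF one]] by simp
 moreover have "l (%x. 1 * v x+(- c)*1) = 1*l v+(- c)*l (%x. 1)" using l[unfolded linear_form_on_def, rule_format, OF v one, of 1 "-c"] .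
 ultimately show ?thesis using l1 by simp
qed

lemma interp: assumes "v:HB" shows "\<pi> (ext v):V" "nA (%x. ext v x-\<pi> (ext v) x) <= C*h*N2 v"
proof -
 show "\<pi> (ext v):V" using interpolation[OF assms] by simp
 have "h*nA (%x. ext v x-\<pi> (ext v) x) <= C*h^2*N2 v"
 using interpolation[OF assms] L2n_nonneg[of "restrict_space sg S" "%x. ext v x-\<pi> (ext v) x"] by simp
 hence "h*nA (%x. ext v x-\<pi> (ext v) x) <= h*(C*h*N2 v)" by (simp add: sq2 mult_ac)
 thus "nA (%x. ext v x-\<pi> (ext v) x) <= C*h*N2 v" using h(1) by simp
qed

lemma u_facts: "u:HB" "u:HA" "(LINT x|M. u x) = 0" "!!v. v:HA ==> D u v = (LINT q|M. f q * v q)" "N2 u <= K*F"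
 using u regular[OF f(1) u] by (auto simp: poisson_solution_def H2_def)

text \<open>In \<open>3*K\<close> two parts come from interpolation and one from the quadrature of
  a; 1 comes from the quadrature of l, and the last summand from the stabilisation of the extended
  solution.\<close>

definition C1 :: real where "C1 = C*(3*K+1+sqrt ta*K)"

text \<open>The error equation is tested with the difference \<open>v\<close> of interpolant and
  discrete solution. Galerkin orthogonality fails by the quadrature errors and by the stabilisation
  of the extended solution, each of order \<open>h\<close> times \<open>nA v\<close>, so one factor
  \<open>nA v\<close> can be divided out.\<close>

lemma energy_error: "nA (%x. ext u x-w x) <= C1*h*F"
proof -
 let ?I = "\<pi> (ext u)"
 define et where "et x = ext u x-?I x" for x
 define v where "v x = ?I x-w x" for x
 note I = interp[OF u_facts(1)]
 have uW: "ext u:W" by (rule ext_W[OF u_facts(2)])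
 have IW: "?I:W" "w:W" using I(1) wV(1) V_W by auto
 have etW: "et:W" unfolding et_def[abs_def] by (rule diff_W[OF uW IW(1)])
 have vV: "v:V" unfolding v_def[abs_def] using fe_space_lincomb[OF I(1) wV(1), of 1 "-1"] by simp
 have vW: "v:W" by (rule V_W[OF vV])
 have n0: "0 <= nA v" "0 <= F" "0 <= N2 u" using A_facts(5)[OF vW vW] L2n_nonneg by (auto simp: H2_norm_def intro!: sum_nonneg add_nonneg_nonneg)
 have etn: "nA et <= C*h*N2 u" using I(2) by (simp add: et_def[abs_def])
 have "A v v = A ?I v-A w v"
 using A_facts(3)[OF IW vW, of 1 "-1"] by (simp add: v_def[abs_def])
 also have "A ?I v = A (ext u) v-A et v"
 using A_facts(3)[OF uW etW vW, of 1 "-1"] by (simp add: et_def)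
 finally have eq: "A v v = a (ext u) v+ta * s (ext u) v-A et v-l v" by (simp add: galerkin[OF vV])
 have q1: "l v >= D u (lft v)-C*h*F*nA v" using quadrature(1)[OF vV] u_facts(4)[OF fe(2)[OF vV]] by simp
 have q2: "a (ext u) v <= D u (lft v)+C*h*N2 u*nA v" using quadrature(2)[OF vV] by simp
 have "s (ext u) v <= nS (ext u)*nS v" using s_facts(6)[OF uW vW] by simp
 also have "... <= (C*h*N2 u)*(nA v/sqrt ta)"
 using C h n0 by (intro mult_mono consistency[OF u_facts(1)] nS_le vW s_facts(5)[OF vW vW]) auto
 finally have "ta * s (ext u) v <= ta*((C*h*N2 u)*(nA v/sqrt ta))" using ta by (intro lmon) auto
 \<comment> \<open>Of the factor \<open>ta\<close> one root is consumed by \<open>nS_le\<close>, the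
   other stays in \<open>C1\<close>.\<close>
 also have "... = sqrt ta*(C*h*N2 u)*nA v"
 using ta real_sqrt_mult_self[of ta] by (simp add: field_simps)
 finally have q3: "ta * s (ext u) v <= sqrt ta*(C*h*N2 u)*nA v" .
 have "- A et v <= nA et*nA v" using A_facts(6)[OF etW vW] by simp
 also have "... <= (C*h*N2 u)*nA v" using etn n0 by (intro rmon) auto
 finally have q4: "- A et v <= (C*h*N2 u)*nA v" .
 have "nA v * nA v <= (C*h*(2*N2 u+F+sqrt ta*N2 u))*nA v"
 using eq q1 q2 q3 q4 A_facts(4)[OF vW vW] by (simp add: sq2 algebra_simps)
 hence "nA v <= C*h*(2*N2 u+F+sqrt ta*N2 u)"
 using n0 C h ta by (cases "nA v = 0") auto
 moreover have "nA (%x. ext u x-w x) <= nA et+nA v"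
 using A_facts(7)[OF etW vW, of 1 1] by (simp add: et_def v_def)
 ultimately have "nA (%x. ext u x-w x) <= C*h*(3*N2 u+F+sqrt ta*N2 u)" using etn by (simp add: algebra_simps)
 also have "... <= C*h*(3*(K*F)+F+sqrt ta*(K*F))"
 using u_facts(5) C h ta by (intro lmon add_mono) auto
 also have "... = C1*h*F" by (simp add: C1_def algebra_simps)
 finally show ?thesis .
qed

text \<open>The summands are the coefficients of \<open>h^2*F*N2 ph\<close> in the estimates
  \<open>b1\<close> to \<open>b4\<close> of the duality argument: two energy errors, quadrature of
  l, stabilisation, quadrature of a.\<close>

definition C2 :: real where
 "C2 = C1*C^3+C+ta*((C*K+C1/sqrt ta)*(C+C/sqrt ta))+C*K"

lemma C12: "0 <= C1" "0 <= C2"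
 using C K ta by (auto simp: C1_def C2_def)

lemma L2_error: "nm (%q. u q-lft w q) <= (C2*K+2*E*(K+C2*K))*h^2*F"
proof -
 define e where "e x = ext u x-w x" for x
 define r where "r q = u q-lft w q" for q
 have F0: "0 <= F" by (rule L2n_nonneg)
 have uW: "ext u:W" by (rule ext_W[OF u_facts(2)])
 have wW: "w:W" by (rule V_W[OF wV(1)])
 have eW: "e:W" unfolding e_def[abs_def] by (rule diff_W[OF uW wW])
 have en: "nA e <= C1*h*F" using energy_error by (simp add: e_def[abs_def])
 have rH: "r:HA" unfolding r_def[abs_def] using H1_lincomb[OF u_facts(2) fe(2)[OF wV(1)], of 1 "-1"] by simp
 have rL: "LL r" by (rule H1_L2[OF rH])
 have "lincomb_closed (HA)" by (simp add: lincomb_closed_def H1_lincomb)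
 note D_facts = psd_form[OF dirichlet_psd this]
 have "form_norm D r = form_norm D (lft e)"
 by (rule dirichlet_form_cong) (simp add: r_def e_def[abs_def] lift_one)
 hence rD: "form_norm D r <= C*(C1*h*F)" using D_lift[OF eW] lmon[OF en, of C] C by linarith
 define mu where "mu = measure M Ga"
 have mu: "0 < mu" using measure_pos by (simp add: mu_def)
 define m where "m = (LINT x|M. r x)/mu"
 define g where "g q = r q-m" for q
 have cL: "LL (%_. c)" for c :: real by (rule L2_cont) (rule continuous_on_const)
 have gL: "LL g" unfolding g_def[abs_def] by (intro L2_diff rL cL)
 have g0: "(LINT x|M. g x) = 0"
 unfolding g_def m_def using L2_int[OF rL] mu by (simp add: space_M mu_def[symmetric])
 obtain ph where ph: "poisson_solution sg Ga g ph" using solvable[OF gL g0] by blast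
 have ph2: "ph:HB" "ph:HA" and pht: "!!v. v:HA ==> D ph v = (LINT q|M. g q * v q)"
 using ph by (auto simp: poisson_solution_def H2_def)
 have phn: "N2 ph <= K*nm g" by (rule regular[OF gL ph])
 have N0: "0 <= N2 v" for v by (auto simp: H2_norm_def intro!: sum_nonneg add_nonneg_nonneg)
 let ?I = "\<pi> (ext ph)"
 note I = interp[OF ph2(1)]
 have IW: "?I:W" "ext ph:W" using I(1) V_W ext_W ph2 by auto
 note lI = fe(2)[OF I(1)]
 define rh where "rh q = ph q-lft ?I q" for q
 have rhH: "rh:HA" unfolding rh_def[abs_def] using H1_lincomb[OF ph2(2) lI, of 1 "-1"] by simp
 have "form_norm D rh = form_norm D (lft (%x. ext ph x-?I x))"
 by (rule dirichlet_form_cong) (simp add: rh_def lift_one)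
 hence rhD: "form_norm D rh <= C*(C*h*N2 ph)" using D_lift[OF diff_W[OF IW(2,1)]] lmon[OF I(2), of C] C by linarith
 have "(nm g)^2 = (LINT q|M. g q*r q-m*g q)"
 unfolding L2n_power2 by (intro icong) (simp add: g_def sq2 algebra_simps)
 also have "... = (LINT q|M. g q*r q)" using L2_int_mult[OF gL rL] L2_int[OF gL] g0 by simp
 also have "... = D r ph" using pht[OF rH] D_facts(1)[OF rH ph2(2)] by simp
 also have "... = D r rh+D r (lft ?I)"
 using D_facts(2)[OF rhH lI rH, of 1 1] by (simp add: rh_def)
 also have "D r (lft ?I) = (LINT q|M. f q*lft ?I q)-D (lft w) (lft ?I)"
 using D_facts(3)[OF u_facts(2) fe(2)[OF wV(1)] lI, of 1 "-1"] u_facts(4)[OF lI] by (simp add: r_def[abs_def])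
 \<comment> \<open>Quadrature is compared only on the interpolant of the dual solution, where it is
   of order \<open>h^2\<close>. The first term is a product of two energy errors, and in the
   stabilisation both arguments are of order \<open>h\<close>.\<close>
 finally have eq: "(nm g)^2 = D r rh+((LINT q|M. f q*lft ?I q)-l ?I)+ta * s w ?I+(a w ?I-D (lft w) (lft ?I))"
 using galerkin[OF I(1)] by simp
 have b1: "D r rh <= C1*C^3*(h^2*F*N2 ph)"
 proof -
 have "D r rh <= form_norm D r*form_norm D rh" using D_facts(6)[OF rH rhH] by simp
 also have "... <= (C*(C1*h*F))*(C*(C*h*N2 ph))"
 using C C12 h F0 by (intro mult_mono rD rhD D_facts(5)[OF rhH rhH]) auto
 finally show ?thesis by (simp add: sq2 power3_eq_cube mult_ac)
 qed
 have b2: "(LINT q|M. f q*lft ?I q)-l ?I <= C*(h^2*F*N2 ph)" using quadrature2(1)[OF ph2(1)] by simp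
 have b3: "ta * s w ?I <= ta*((C*K+C1/sqrt ta)*(C+C/sqrt ta))*(h^2*F*N2 ph)"
 proof -
 have "nS w <= nS (ext u)+nS e" using s_facts(7)[OF uW eW, of 1 "-1"] by (simp add: e_def)
 also have "... <= C*h*(K*F)+(C1*h*F)/sqrt ta"
 proof -
 have "C*h*N2 u <= C*h*(K*F)" using u_facts(5) C h by simp
 moreover have "nA e/sqrt ta <= (C1*h*F)/sqrt ta" using en ta by (intro divide_right_mono) auto
 ultimately show ?thesis using consistency[OF u_facts(1)] nS_le[OF eW] by simp
 qed
 finally have w1: "nS w <= (C*K+C1/sqrt ta)*(h*F)" by (simp add: algebra_simps)
 have "nS ?I <= nS (ext ph)+nS (%x. ext ph x-?I x)" using s_facts(7)[OF IW(2) diff_W[OF IW(2,1)], of 1 "-1"] by simp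
 also have "... <= C*h*N2 ph+(C*h*N2 ph)/sqrt ta"
 using consistency[OF ph2(1)] nS_le[OF diff_W[OF IW(2,1)]] divide_right_mono[OF I(2), of "sqrt ta"] ta by auto
 finally have I1: "nS ?I <= (C+C/sqrt ta)*(h*N2 ph)" by (simp add: algebra_simps)
 have "s w ?I <= nS w*nS ?I" using s_facts(6)[OF wW IW(1)] by simp
 also have "... <= ((C*K+C1/sqrt ta)*(h*F))*((C+C/sqrt ta)*(h*N2 ph))"
 using C K C12 ta h F0 by (intro mult_mono w1 I1 s_facts(5)[OF IW(1) IW(1)]) auto
 finally have "ta * s w ?I <= ta*(((C*K+C1/sqrt ta)*(h*F))*((C+C/sqrt ta)*(h*N2 ph)))" using ta by simp
 thus ?thesis by (simp add: sq2 mult_ac)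
 qed
 have b4: "a w ?I-D (lft w) (lft ?I) <= C*K*(h^2*F*N2 ph)"
 proof -
 have "a w ?I-D (lft w) (lft ?I) <= C*h^2*N2 u*N2 ph" using quadrature2(2)[OF ph2(1)] by simp
 also have "... <= C*h^2*(K*F)*N2 ph" using u_facts(5) C N0 by (intro rmon lmon) auto
 finally show ?thesis by (simp add: mult_ac)
 qed
 have "(nm g)^2 <= C2*(h^2*F*N2 ph)"
 using eq b1 b2 b3 b4 by (simp only: C2_def distrib_right)
 also have "... <= C2*(h^2*F*(K*nm g))" using phn C12 F0 by (intro lmon) auto
 finally have "nm g*nm g <= (C2*K*h^2*F)*nm g" by (simp add: sq2 mult_ac)
 hence gn: "nm g <= C2*K*h^2*F"
 using L2n_nonneg[of M g] C12 K F0 by (cases "nm g = 0") auto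
 \<comment> \<open>The mean of \<open>u\<close> vanishes, so \<open>m\<close> is minus the mean of
   \<open>lft w\<close>, and this is a pure area defect since \<open>w\<close> has mean zero on
   \<open>S\<close>. The bound by the L1 norm of \<open>lft w\<close> reproduces \<open>m\<close>,
   which is absorbed because \<open>E*h^2 <= 1/2\<close>.\<close>
 have mb: "|m| * sqrt mu <= 2*E*h^2*((K+C2*K)*F)"
 proof -
 note lw = fe(2)[OF wV(1)]
 have "m*mu = (LINT x|M. r x)" using mu by (simp add: m_def)
 also have "... = - (LINT x|M. lft w x)"
 unfolding r_def using L2_int[OF H1_L2[OF u_facts(2)]] L2_int[OF H1_L2[OF lw]] u_facts(3) by simp
 finally have "|m|*mu = |LINT x|M. lft w x|" using mu by (metis abs_minus_cancel abs_mult abs_of_pos)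
 also have "... <= E*h^2*(LINT x|M. |lft w x| )" using fe(3)[OF wV(1)] wV(2) by simp
 finally have 1: "|m|*mu <= E*h^2*(LINT x|M. |lft w x| )" .
 \<comment> \<open>The function \<open>u - g\<close> is \<open>lft w\<close> shifted by the constant
   \<open>m\<close>, so this bounds the L1 norm of the lift without a separate stability estimate
   for \<open>w\<close>.\<close>
 have ug: "LL (%x. u x-g x)" by (intro L2_diff H1_L2 u_facts gL)
 have "(LINT x|M. |lft w x| ) <= (LINT x|M. |u x-g x| + |m| )"
 using L2_int[OF H1_L2[OF lw]] L2_int[OF ug] by (intro integral_mono) (auto simp: g_def r_def)
 also have "... = (LINT x|M. |u x-g x| )+|m|*mu" using L2_int[OF ug] by (simp add: space_M mu_def)
 also have "(LINT x|M. |u x-g x| ) <= nm (%x. u x-g x) * sqrt mu"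
 using L1_le_L2[OF ug] by (simp add: space_M mu_def)
 also have "nm (%x. u x-g x) <= (K+C2*K)*F"
 proof -
 have "nm u <= N2 u" unfolding H2_norm_def by (rule real_le_rsqrt) (simp add: sum_nonneg)
 moreover have "nm g <= C2*K*F"
 proof (rule order_trans[OF gn])
 have "h^2 <= 1" using h by (simp add: power_le_one)
 hence "C2*K*F*h^2 <= C2*K*F*1" using C12 K F0 by (intro lmon) auto
 thus "C2*K*h^2*F <= C2*K*F" by (simp add: mult_ac)
 qed
 ultimately show ?thesis using L2n_diff[OF H1_L2[OF u_facts(2)] gL] u_facts(5) by (simp add: distrib_right)
 qed
 finally have 2: "(LINT x|M. |lft w x| ) <= (K+C2*K)*F * sqrt mu+|m|*mu" using mu by simp
 have "|m|*mu <= E*h^2*((K+C2*K)*F * sqrt mu)+E*h^2*( |m|*mu)"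
 using order_trans[OF 1 lmon[OF 2]] E by (simp add: distrib_left)
 also have "E*h^2*( |m|*mu) <= 1/2*( |m|*mu)" using h(3) mu by (intro rmon) auto
 finally have "|m|*mu <= 2*E*h^2*((K+C2*K)*F) * sqrt mu" by simp
 moreover have "|m|*mu = ( |m| * sqrt mu) * sqrt mu" using mu by simp
 ultimately show ?thesis using mu by simp
 qed
 have "nm r <= nm g+nm (%_. m)" using L2n_add[OF gL cL, of m] by (simp add: g_def)
 also have "nm (%_. m) = |m| * sqrt mu" by (simp add: L2_norm_def space_M mu_def real_sqrt_mult mult.commute)
 finally show ?thesis using gn mb by (simp add: r_def[abs_def] algebra_simps)
qed

end

theorem theorem6p3:
  fixes \<Gamma> :: "(real^'k) set" and \<sigma> :: "(real^'k) measure" and \<delta>\<^sub>0 \<tau> C :: real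
  assumes "CARD('d::finite) < CARD('k)"
    and "area_measure TYPE('d) \<sigma>"
    and "embedded_submanifold TYPE('d) \<Gamma>" "compact \<Gamma>" "connected \<Gamma>" "\<Gamma> \<noteq> {}"
    and "0 < \<delta>\<^sub>0" "smooth_closest_point \<Gamma> \<delta>\<^sub>0"
    and "0 < \<tau>" "0 < C"
  shows "\<exists>h\<^sub>0>0. \<exists>C'>0.
    \<forall>(h::real) (\<K> :: (real^'k) set set) (\<T> :: (real^'k) set set) a\<^sub>h s\<^sub>h l\<^sub>h
      (\<pi>\<^sub>h :: (real^'k \<Rightarrow> real) \<Rightarrow> real^'k \<Rightarrow> real)
      (f :: real^'k \<Rightarrow> real) (u :: real^'k \<Rightarrow> real) (u\<^sub>h :: real^'k \<Rightarrow> real).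
    let \<Gamma>\<^sub>h = \<Union>\<K>;
        \<T>\<^sub>h = active_mesh \<T> \<Gamma>\<^sub>h;
        N\<^sub>h = \<Union>\<T>\<^sub>h;
        V\<^sub>h = fe_space \<T>\<^sub>h;
        V\<^sub>0 = fe_space0 \<sigma> \<Gamma>\<^sub>h \<T>\<^sub>h;
        A\<^sub>h = (\<lambda>v w. a\<^sub>h v w + \<tau> * s\<^sub>h v w);
        a = dirichlet_form \<sigma> \<Gamma>;
        l = (\<lambda>v. \<integral>q. f q * v q \<partial>restrict_space \<sigma> \<Gamma>);
        ext = extension \<Gamma>;
        lft = lift \<Gamma> \<Gamma>\<^sub>h;
        normf = L2_norm (restrict_space \<sigma> \<Gamma>) f
    in 0 < h \<longrightarrow> h \<le> h\<^sub>0 \<longrightarrow>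
       discrete_manifold TYPE('d) \<Gamma> \<delta>\<^sub>0 C h \<K> \<longrightarrow>
       background_mesh \<Gamma> \<delta>\<^sub>0 C h \<T> \<longrightarrow>
       discrete_forms \<sigma> \<Gamma> \<Gamma>\<^sub>h V\<^sub>h C \<tau> a\<^sub>h s\<^sub>h \<longrightarrow>
       linear_form_on V\<^sub>h l\<^sub>h \<longrightarrow>
       L2_fun (restrict_space \<sigma> \<Gamma>) f \<longrightarrow>
       (\<integral>q. f q \<partial>restrict_space \<sigma> \<Gamma>) = 0 \<longrightarrow>
       poisson_solution \<sigma> \<Gamma> f u \<longrightarrow>
       u\<^sub>h \<in> V\<^sub>0 \<longrightarrow>
       (\<forall>v\<in>V\<^sub>0. A\<^sub>h u\<^sub>h v = l\<^sub>h v) \<longrightarrow>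
       (\<forall>v\<in>V\<^sub>0. 1 / h ^ (CARD('k) - CARD('d)) * (L2_norm (restrict_space lborel N\<^sub>h) v)\<^sup>2
                  \<le> C * (form_norm A\<^sub>h v)\<^sup>2) \<longrightarrow>
       (\<forall>v\<in>H2 \<sigma> \<Gamma>. \<pi>\<^sub>h (ext v) \<in> V\<^sub>h \<and>
          L2_norm (restrict_space \<sigma> \<Gamma>\<^sub>h) (\<lambda>x. ext v x - \<pi>\<^sub>h (ext v) x)
          + h * form_norm A\<^sub>h (\<lambda>x. ext v x - \<pi>\<^sub>h (ext v) x) \<le> C * h\<^sup>2 * H2_norm \<sigma> \<Gamma> v) \<longrightarrow>
       (\<forall>v\<in>V\<^sub>h. \<bar>l\<^sub>h v - l (lft v)\<bar> \<le> C * h * normf * form_norm A\<^sub>h v \<and>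
                 \<bar>a u (lft v) - a\<^sub>h (ext u) v\<bar> \<le> C * h * H2_norm \<sigma> \<Gamma> u * form_norm A\<^sub>h v) \<longrightarrow>
       (\<forall>\<phi>\<in>H2 \<sigma> \<Gamma>. let \<phi>\<^sub>h = \<pi>\<^sub>h (ext \<phi>) in
          \<bar>l\<^sub>h \<phi>\<^sub>h - l (lft \<phi>\<^sub>h)\<bar> \<le> C * h\<^sup>2 * normf * H2_norm \<sigma> \<Gamma> \<phi> \<and>
          \<bar>a (lft u\<^sub>h) (lft \<phi>\<^sub>h) - a\<^sub>h u\<^sub>h \<phi>\<^sub>h\<bar>
            \<le> C * h\<^sup>2 * H2_norm \<sigma> \<Gamma> u * H2_norm \<sigma> \<Gamma> \<phi>) \<longrightarrow>
       (\<forall>v\<in>H2 \<sigma> \<Gamma>. form_norm s\<^sub>h (ext v) \<le> C * h * H2_norm \<sigma> \<Gamma> v) \<longrightarrow>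
       form_norm A\<^sub>h (\<lambda>x. ext u x - u\<^sub>h x) \<le> C' * h * normf \<and>
       L2_norm (restrict_space \<sigma> \<Gamma>) (\<lambda>q. u q - lft u\<^sub>h q) \<le> C' * h\<^sup>2 * normf"
proof -
 interpret submfd \<Gamma> \<delta>\<^sub>0 \<sigma> "TYPE('d)"
 by unfold_locales (use assms in auto)
 obtain K where K: "0 < K" "!!g. L2_fun M g ==> (LINT x|M. g x) = 0 ==> EX \<phi>. poisson_solution \<sigma> \<Gamma> g \<phi>"
 "!!g u. L2_fun M g ==> poisson_solution \<sigma> \<Gamma> g u ==> H2_norm \<sigma> \<Gamma> u <= K*L2n M g"
 by (rule poisson_solvable) blast
 obtain h1 E where h1: "0 < h1" and E: "0 <= E" and df: "!!h \<K> \<T> S V. 0 < h ==> h <= h1 ==> discrete_manifold TYPE('d) \<Gamma> \<delta>\<^sub>0 C h \<K> ==> background_mesh \<Gamma> \<delta>\<^sub>0 C h \<T> ==>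
 S = \<Union>\<K> ==> V = fe_space (active_mesh \<T> S) ==>
 closest_point \<Gamma> ` S = \<Gamma> & 0 < measure (restrict_space \<sigma> S) S & (ALL v:V. integrable (restrict_space \<sigma> S) v & lift \<Gamma> S v:H1 \<sigma> \<Gamma> &
 |(LINT x|M. lift \<Gamma> S v x)-(LINT x|restrict_space \<sigma> S. v x)| <= E*h^2*(LINT x|M. |lift \<Gamma> S v x| ))"
 by (rule discrete_facts[OF assms(10)]) blast
 \<comment> \<open>The second bound gives both \<open>h <= 1\<close> and
   \<open>E*h^2 <= 1/2\<close>, the two smallness conditions of \<open>discrete_problem\<close>
   beyond the geometric \<open>h <= h1\<close>.\<close>
 define h0 where "h0 = min h1 (1/sqrt (2*(E+1)))"
 have h0: "0 < h0" using h1 E by (simp add: h0_def)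
 have hb: "h <= h1" "h <= 1" "E*h^2 <= 1/2" if h: "0 < h" "h <= h0" for h
 proof -
 have p: "0 < 2*(E+1)" using E by simp
 show "h <= h1" using h by (simp add: h0_def)
 have "h^2 <= (1/sqrt (2*(E+1)))^2" using h by (intro power_mono) (auto simp: h0_def)
 hence h2: "h^2 <= 1/(2*(E+1))" using p by (simp add: power_divide)
 also have "... <= 1" using E by simp
 finally show "h <= 1" using power2_le_imp_le[of h 1] by simp
 have "E*h^2 <= E*(1/(2*(E+1)))" by (rule lmon[OF h2 E])
 also have "... <= 1/2" using E by simp
 finally show "E*h^2 <= 1/2" .
 qed
 \<comment> \<open>Copies of \<open>C1\<close>, \<open>C2\<close> and the constant of
   \<open>L2_error\<close>: the final constant has to be named before a mesh is fixed and the locale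
   can be entered.\<close>
 define D1 where "D1 = C*(3*K+1+sqrt \<tau>*K)"
 define D2 where "D2 = D1*C^3+C+\<tau>*((C*K+D1/sqrt \<tau>)*(C+C/sqrt \<tau>))+C*K"
 define D3 where "D3 = D2*K+2*E*(K+D2*K)"
 have D: "0 < D1" "0 <= D3" using K(1) E assms(9,10) by (auto simp: D1_def D2_def D3_def add_pos_pos)
 show ?thesis
 unfolding Let_def
 proof (rule exI[of _ h0], rule conjI[OF h0], rule exI[of _ "D1+D3"], intro conjI allI impI)
 fix h :: real and \<K> \<T> :: "(real^'k) set set" and a s l and \<pi> :: "(real^'k => real) => 'k fn" and f u w :: "'k fn"
 assume h: "0 < h" "h <= h0" and dm: "discrete_manifold TYPE('d) \<Gamma> \<delta>\<^sub>0 C h \<K>" and bm: "background_mesh \<Gamma> \<delta>\<^sub>0 C h \<T>"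
 note facts = df[OF h(1) hb(1)[OF h] dm bm refl refl]
 note fe = facts[THEN conjunct1] facts[THEN conjunct2, THEN conjunct1] facts[THEN conjunct2, THEN conjunct2, THEN bspec, THEN conjunct1]
 facts[THEN conjunct2, THEN conjunct2, THEN bspec, THEN conjunct2, THEN conjunct1] facts[THEN conjunct2, THEN conjunct2, THEN bspec, THEN conjunct2, THEN conjunct2]
 assume A: "discrete_forms \<sigma> \<Gamma> (\<Union>\<K>) (fe_space (active_mesh \<T> (\<Union>\<K>))) C \<tau> a s"
 "linear_form_on (fe_space (active_mesh \<T> (\<Union>\<K>))) l" "L2_fun M f" "(LINT q|M. f q) = 0" "poisson_solution \<sigma> \<Gamma> f u"
 "w:fe_space0 \<sigma> (\<Union>\<K>) (active_mesh \<T> (\<Union>\<K>))"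
 "ALL v:fe_space0 \<sigma> (\<Union>\<K>) (active_mesh \<T> (\<Union>\<K>)). a w v+\<tau> * s w v = l v"
 assume B: "ALL v:H2 \<sigma> \<Gamma>. \<pi> (extension \<Gamma> v):fe_space (active_mesh \<T> (\<Union>\<K>)) &
 L2n (restrict_space \<sigma> (\<Union>\<K>)) (%x. extension \<Gamma> v x-\<pi> (extension \<Gamma> v) x)
 + h*form_norm (%v w. a v w+\<tau> * s v w) (%x. extension \<Gamma> v x-\<pi> (extension \<Gamma> v) x) <= C*h^2*H2_norm \<sigma> \<Gamma> v"
 "ALL v:fe_space (active_mesh \<T> (\<Union>\<K>)). |l v-(LINT q|M. f q*lift \<Gamma> (\<Union>\<K>) v q)| <= C*h*L2n M f*form_norm (%v w. a v w+\<tau> * s v w) v &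
 |dirichlet_form \<sigma> \<Gamma> u (lift \<Gamma> (\<Union>\<K>) v)-a (extension \<Gamma> u) v| <= C*h*H2_norm \<sigma> \<Gamma> u*form_norm (%v w. a v w+\<tau> * s v w) v"
 "ALL \<phi>:H2 \<sigma> \<Gamma>. |l (\<pi> (extension \<Gamma> \<phi>))-(LINT q|M. f q*lift \<Gamma> (\<Union>\<K>) (\<pi> (extension \<Gamma> \<phi>)) q)| <= C*h^2*L2n M f*H2_norm \<sigma> \<Gamma> \<phi> &
 |dirichlet_form \<sigma> \<Gamma> (lift \<Gamma> (\<Union>\<K>) w) (lift \<Gamma> (\<Union>\<K>) (\<pi> (extension \<Gamma> \<phi>)))-a w (\<pi> (extension \<Gamma> \<phi>))| <= C*h^2*H2_norm \<sigma> \<Gamma> u*H2_norm \<sigma> \<Gamma> \<phi>"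
 "ALL v:H2 \<sigma> \<Gamma>. form_norm s (extension \<Gamma> v) <= C*h*H2_norm \<sigma> \<Gamma> v"
 interpret discrete_problem \<Gamma> \<delta>\<^sub>0 \<sigma> "TYPE('d)" C \<tau> K E h "\<Union>\<K>" "active_mesh \<T> (\<Union>\<K>)" a s l \<pi> f u w
 by (intro discrete_problem.intro discrete_problem_axioms.intro submfd_axioms)
 (rule assms(10,9) K E h(1) hb(2,3)[OF h] fe A(1-6) A(7)[THEN bspec] B(1)[THEN bspec] B(2)[THEN bspec, THEN conjunct1]
 B(2)[THEN bspec, THEN conjunct2] B(3)[THEN bspec, THEN conjunct1] B(3)[THEN bspec, THEN conjunct2] B(4)[THEN bspec]; assumption)+
 have F0: "0 <= h*L2n M f" "0 <= h^2*L2n M f" using h L2n_nonneg[of M f] by auto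
 have "D1*(h*L2n M f) <= (D1+D3)*(h*L2n M f)" using D F0 by (intro rmon) auto
 thus "form_norm (%v w. a v w+\<tau> * s v w) (%x. extension \<Gamma> u x-w x) <= (D1+D3)*h*L2n M f"
 using energy_error by (simp add: C1_def D1_def[symmetric] mult.assoc)
 have "D3*(h^2*L2n M f) <= (D1+D3)*(h^2*L2n M f)" using D F0 by (intro rmon) auto
 thus "L2n M (%q. u q-lift \<Gamma> (\<Union>\<K>) w q) <= (D1+D3)*h^2*L2n M f"
 using L2_error unfolding C2_def C1_def D1_def[symmetric] D2_def[symmetric] D3_def[symmetric] by simp
 qed (use D in auto)
qed

end
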